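(* Let $H$ be a Hilbert space, let $X=(X_{ij})$ be an $n\times n$ magic decomposition of $H$ which is non-degenerate, in the sense that $X_{ij}\neq 0$ for all $i,j$, and let $A$ be the quantum permutation algebra associated to $X$. The following are equivalent: (1) $A$ is cocommutative; (2) $X=X^E$ for an abelian magic partition $E$, that is, there exist a finite orthogonal decomposition $H=\bigoplus_{k=1}^NX_k$ and an abelian magic partition $E=(E_{ij})$ of $\{1,\dots,N\}$ such that $X_{ij}=\bigoplus_{k\in E_{ij}}X_k$ for all $i,j$.
   Context: A magic decomposition of $H$ is a square matrix $(X_{ij})$ of closed subspaces of $H$ such that each row and each column is an orthogonal decomposition of $H$. A magic partition of $\{1,\dots,N\}$ is a square $n\times n$ matrix $(E_{ij})$ of subsets such that each row and each column is a partition of $\{1,\dots,N\}$. For $k\in\{1,\dots,N\}$ let $\sigma_k\in S_n$ be the permutation given by $\sigma_k(j)=i$ when $k\in E_{ij}$. The group associated to $E$ is the subgroup $G\subset S_n$ generated by $\sigma_1,\dots,\sigma_N$, and $E$ is called abelian if $G$ is abelian. C*-algebras and morphisms are unital. A magic unitary over a C*-algebra $A$ is a matrix $u\in M_n(A)$ of projections such that on each row and each column the entries are pairwise orthogonal and sum to $1$. $A_s(n)$ is the universal C*-algebra generated by $n^2$ elements $u_{ij}$ with the relations making $(u_{ij})$ a magic unitary. A quantum permutation algebra is a C*-algebra $A$ with a magic unitary $u\in M_n(A)$ whose entries generate $A$, and such that $\Delta(u_{ij})=\sum_k u_{ik}\otimes u_{kj}$, $\varepsilon(u_{ij})=\delta_{ij}$,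 $S(u_{ij})=u_{ji}$ define morphisms $\Delta:A\to A\otimes A$, $\varepsilon:A\to\mathbb C$, $S:A\to A^{op}$. All quantum permutation algebras are taken full: $A$ is the enveloping C*-algebra of the $*$-algebra generated by the $u_{ij}$. Cocommutative means that $\Delta$ is invariant under the flip of $A\otimes A$. Given a representation $\pi:A_s(n)\to B(H)$, its Hopf image is the smallest quantum permutation algebra $A$ (with $n\times n$ magic unitary) realizing a factorization $A_s(n)\to A\to B(H)$ of $\pi$, the first map sending generators to generators; smallest means that any other algebra realizing such a factorization maps onto $A$, generators being sent to generators. The quantum permutation algebra associated to a magic decomposition $X$ is the Hopf image of $\pi:A_s(n)\to B(H)$, $\pi(u_{ij})=P_{ij}$, where $P_{ij}$ is the orthogonal projection onto $X_{ij}$. *)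

theory Defs
  imports
    "HOL-Analysis.Operator_Norm"
    "HOL-Algebra.Module"
    "HOL-Algebra.Bij"
    "HOL-Algebra.Generated_Groups"
    "HOL-Library.Disjoint_Sets"
begin

section \<open>Complex Hilbert spaces and magic decompositions\<close>

class chilbert_space = banach +
  fixes scaleC :: "complex \<Rightarrow> 'a \<Rightarrow> 'a"
    and cinner :: "'a \<Rightarrow> 'a \<Rightarrow> complex"
  assumes scaleC_add_right: "scaleC c (x + y) = scaleC c x + scaleC c y"
    and scaleC_add_left: "scaleC (c + d) x = scaleC c x + scaleC d x"
    and scaleC_scaleC: "scaleC c (scaleC d x) = scaleC (c * d) x"
    and scaleR_scaleC: "scaleR r x = scaleC (complex_of_real r) x"
    and cinner_commute: "cinner x y = cnj (cinner y x)"
    and cinner_add_left: "cinner (x + y) z = cinner x z + cinner y z"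
    and cinner_scaleC_left: "cinner (scaleC c x) y = c * cinner x y"
    and cinner_self: "cinner x x = complex_of_real ((norm x)\<^sup>2)"

definition closed_csubspace :: "'h::chilbert_space set \<Rightarrow> bool" where
  "closed_csubspace X \<longleftrightarrow>
     closed X \<and> 0 \<in> X \<and> (\<forall>x\<in>X. \<forall>y\<in>X. x + y \<in> X) \<and> (\<forall>c. \<forall>x\<in>X. scaleC c x \<in> X)"

definition orthogonal_family :: "'k set \<Rightarrow> ('k \<Rightarrow> 'h::chilbert_space set) \<Rightarrow> bool" where
  "orthogonal_family I Y \<longleftrightarrow>
     (\<forall>k\<in>I. closed_csubspace (Y k)) \<and>
     (\<forall>k\<in>I. \<forall>l\<in>I. k \<noteq> l \<longrightarrow> (\<forall>x\<in>Y k. \<forall>y\<in>Y l. cinner x y = 0))"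

definition sum_subspaces :: "'k set \<Rightarrow> ('k \<Rightarrow> 'h::chilbert_space set) \<Rightarrow> 'h set" where
  "sum_subspaces I Y = {\<Sum>k\<in>I. f k | f. \<forall>k\<in>I. f k \<in> Y k}"

text \<open>Only used for finite index sets. Zero summands are allowed.\<close>

definition orthogonal_decomposition :: "'k set \<Rightarrow> ('k \<Rightarrow> 'h::chilbert_space set) \<Rightarrow> bool" where
  "orthogonal_decomposition I Y \<longleftrightarrow> orthogonal_family I Y \<and> sum_subspaces I Y = UNIV"

text \<open>The size of a square matrix is the cardinality of a finite type \<open>'n\<close>.\<close>

definition magic_decomposition :: "('n::finite \<Rightarrow> 'n \<Rightarrow> 'h::chilbert_space set) \<Rightarrow> bool" where
  "magic_decomposition X \<longleftrightarrow>
     (\<forall>i. orthogonal_decomposition UNIV (\<lambda>j. X i j)) \<and>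
     (\<forall>j. orthogonal_decomposition UNIV (\<lambda>i. X i j))"

definition orth_proj :: "'h::chilbert_space set \<Rightarrow> 'h \<Rightarrow> 'h" where
  "orth_proj X h = (THE y. y \<in> X \<and> (\<forall>z\<in>X. cinner (h - y) z = 0))"

section \<open>Magic partitions\<close>

text \<open>As with zero subspaces above, parts of a partition are allowed to be empty.\<close>

definition set_partition :: "'k set \<Rightarrow> ('n \<Rightarrow> 'k set) \<Rightarrow> bool" where
  "set_partition S F \<longleftrightarrow> disjoint_family F \<and> (\<Union>j. F j) = S"

definition magic_partition :: "nat \<Rightarrow> ('n::finite \<Rightarrow> 'n \<Rightarrow> nat set) \<Rightarrow> bool" where
  "magic_partition N E \<longleftrightarrow>
     (\<forall>i. set_partition {1..N} (\<lambda>j. E i j)) \<and> (\<forall>j. set_partition {1..N} (\<lambda>i. E i j))"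

definition partition_perm :: "('n::finite \<Rightarrow> 'n \<Rightarrow> nat set) \<Rightarrow> nat \<Rightarrow> 'n \<Rightarrow> 'n" where
  "partition_perm E k j = (THE i. k \<in> E i j)"

definition partition_group :: "nat \<Rightarrow> ('n::finite \<Rightarrow> 'n \<Rightarrow> nat set) \<Rightarrow> ('n \<Rightarrow> 'n) monoid" where
  "partition_group N E =
     subgroup_generated (BijGroup (UNIV :: 'n set)) (partition_perm E ` {1..N})"

definition abelian_magic_partition :: "nat \<Rightarrow> ('n::finite \<Rightarrow> 'n \<Rightarrow> nat set) \<Rightarrow> bool" where
  "abelian_magic_partition N E \<longleftrightarrow> magic_partition N E \<and> comm_group (partition_group N E)"

section \<open>C*-algebras\<close>

record 'a star_algebra = "(complex, 'a) module" +
  star :: "'a \<Rightarrow> 'a"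

record 'a cstar = "'a star_algebra" +
  cnorm :: "'a \<Rightarrow> real"

locale star_algebra = ring A for A :: "('a, 'm) star_algebra_scheme" (structure) +
  assumes smult_closed: "x \<in> carrier A \<Longrightarrow> c \<odot> x \<in> carrier A"
    and smult_add_left: "x \<in> carrier A \<Longrightarrow> (c + d) \<odot> x = c \<odot> x \<oplus> d \<odot> x"
    and smult_add_right:
      "\<lbrakk>x \<in> carrier A; y \<in> carrier A\<rbrakk> \<Longrightarrow> c \<odot> (x \<oplus> y) = c \<odot> x \<oplus> c \<odot> y"
    and smult_smult: "x \<in> carrier A \<Longrightarrow> c \<odot> (d \<odot> x) = (c * d) \<odot> x"
    and smult_1: "x \<in> carrier A \<Longrightarrow> 1 \<odot> x = x"
    and smult_mult_left:
      "\<lbrakk>x \<in> carrier A; y \<in> carrier A\<rbrakk> \<Longrightarrow> (c \<odot> x) \<otimes> y = c \<odot> (x \<otimes> y)"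
    and smult_mult_right:
      "\<lbrakk>x \<in> carrier A; y \<in> carrier A\<rbrakk> \<Longrightarrow> x \<otimes> (c \<odot> y) = c \<odot> (x \<otimes> y)"
    and star_closed: "x \<in> carrier A \<Longrightarrow> star A x \<in> carrier A"
    and star_star: "x \<in> carrier A \<Longrightarrow> star A (star A x) = x"
    and star_add:
      "\<lbrakk>x \<in> carrier A; y \<in> carrier A\<rbrakk> \<Longrightarrow> star A (x \<oplus> y) = star A x \<oplus> star A y"
    and star_smult: "x \<in> carrier A \<Longrightarrow> star A (c \<odot> x) = cnj c \<odot> star A x"
    and star_mult:
      "\<lbrakk>x \<in> carrier A; y \<in> carrier A\<rbrakk> \<Longrightarrow> star A (x \<otimes> y) = star A y \<otimes> star A x"

definition cstar_seminorm :: "('a, 'm) star_algebra_scheme \<Rightarrow> ('a \<Rightarrow> real) \<Rightarrow> bool" where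
  "cstar_seminorm A p \<longleftrightarrow>
     (\<forall>x\<in>carrier A. 0 \<le> p x) \<and>
     (\<forall>x\<in>carrier A. \<forall>c. p (c \<odot>\<^bsub>A\<^esub> x) = cmod c * p x) \<and>
     (\<forall>x\<in>carrier A. \<forall>y\<in>carrier A. p (x \<oplus>\<^bsub>A\<^esub> y) \<le> p x + p y) \<and>
     (\<forall>x\<in>carrier A. \<forall>y\<in>carrier A. p (x \<otimes>\<^bsub>A\<^esub> y) \<le> p x * p y) \<and>
     (\<forall>x\<in>carrier A. p (star A x \<otimes>\<^bsub>A\<^esub> x) = (p x)\<^sup>2)"

definition cauchy_seqs :: "('a, 'm) star_algebra_scheme \<Rightarrow> ('a \<Rightarrow> real) \<Rightarrow> (nat \<Rightarrow> 'a) set" where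
  "cauchy_seqs A p =
     {X. (\<forall>n. X n \<in> carrier A) \<and>
         (\<forall>e>0. \<exists>M. \<forall>m\<ge>M. \<forall>n\<ge>M. p (X m \<ominus>\<^bsub>A\<^esub> X n) < e)}"

locale cstar_algebra = star_algebra A for A :: "('a, 'm) cstar_scheme" (structure) +
  assumes cnorm_seminorm: "cstar_seminorm A (cnorm A)"
    and cnorm_eq_0: "\<lbrakk>x \<in> carrier A; cnorm A x = 0\<rbrakk> \<Longrightarrow> x = \<zero>"
    and cnorm_complete:
      "X \<in> cauchy_seqs A (cnorm A) \<Longrightarrow>
         \<exists>l\<in>carrier A. (\<lambda>n. cnorm A (X n \<ominus> l)) \<longlonglongrightarrow> 0"

text \<open>Unital *-homomorphisms (\<^const>\<open>ring_hom\<close> preserves the unit).\<close>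

definition star_hom ::
  "('a, 'm) star_algebra_scheme \<Rightarrow> ('b, 'l) star_algebra_scheme \<Rightarrow> ('a \<Rightarrow> 'b) set" where
  "star_hom A B =
     {f \<in> ring_hom A B.
        (\<forall>x\<in>carrier A. (\<forall>c. f (c \<odot>\<^bsub>A\<^esub> x) = c \<odot>\<^bsub>B\<^esub> f x) \<and> f (star A x) = star B (f x))}"

inductive_set star_generate :: "('a, 'm) star_algebra_scheme \<Rightarrow> 'a set \<Rightarrow> 'a set"
  for A and U where
  incl: "x \<in> U \<Longrightarrow> x \<in> star_generate A U"
| one: "\<one>\<^bsub>A\<^esub> \<in> star_generate A U"
| add: "\<lbrakk>x \<in> star_generate A U; y \<in> star_generate A U\<rbrakk> \<Longrightarrow> x \<oplus>\<^bsub>A\<^esub> y \<in> star_generate A U"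
| mult: "\<lbrakk>x \<in> star_generate A U; y \<in> star_generate A U\<rbrakk> \<Longrightarrow> x \<otimes>\<^bsub>A\<^esub> y \<in> star_generate A U"
| smult: "x \<in> star_generate A U \<Longrightarrow> c \<odot>\<^bsub>A\<^esub> x \<in> star_generate A U"
| star: "x \<in> star_generate A U \<Longrightarrow> star A x \<in> star_generate A U"

definition cstar_generated_by :: "('a, 'm) cstar_scheme \<Rightarrow> 'a set \<Rightarrow> bool" where
  "cstar_generated_by A U \<longleftrightarrow>
     U \<subseteq> carrier A \<and>
     (\<forall>a\<in>carrier A. \<forall>e>0. \<exists>b\<in>star_generate A U. cnorm A (a \<ominus>\<^bsub>A\<^esub> b) < e)"

text \<open>The norm of the enveloping C*-algebra of a *-algebra is the largest C*-seminorm on it.\<close>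

definition enveloping_of :: "('a, 'm) cstar_scheme \<Rightarrow> 'a set \<Rightarrow> bool" where
  "enveloping_of A U \<longleftrightarrow>
     cstar_generated_by A U \<and>
     (\<forall>p. cstar_seminorm (A\<lparr>carrier := star_generate A U\<rparr>) p \<longrightarrow>
          (\<forall>a\<in>star_generate A U. p a \<le> cnorm A a))"

definition complex_cstar :: "complex cstar" where
  "complex_cstar =
     \<lparr>carrier = UNIV, mult = (*), one = 1, zero = 0, add = (+), smult = (*),
      star = cnj, cnorm = cmod\<rparr>"

definition opposite :: "'a cstar \<Rightarrow> 'a cstar" where
  "opposite A = A\<lparr>mult := (\<lambda>x y. y \<otimes>\<^bsub>A\<^esub> x)\<rparr>"

definition bounded_operators :: "('h::chilbert_space \<Rightarrow> 'h) cstar" where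
  "bounded_operators =
     \<lparr>carrier = {T. bounded_linear T \<and> (\<forall>c x. T (scaleC c x) = scaleC c (T x))},
      mult = (\<circ>), one = id, zero = (\<lambda>x. 0), add = (\<lambda>S T x. S x + T x),
      smult = (\<lambda>c T x. scaleC c (T x)),
      star = (\<lambda>T. THE S. \<forall>x y. cinner (S x) y = cinner x (T y)),
      cnorm = onorm\<rparr>"

section \<open>Universal C*-algebras\<close>

text \<open>
  The free unital *-algebra on the set \<open>G\<close>: the words on the letters \<open>(g, False)\<close>, standing for
  \<open>g\<close>, and \<open>(g, True)\<close>, standing for the adjoint of \<open>g\<close>, form a basis.
\<close>

definition free_star_algebra :: "'g set \<Rightarrow> (('g \<times> bool) list \<Rightarrow> complex) star_algebra" where
  "free_star_algebra G =
     \<lparr>carrier = {f. finite {w. f w \<noteq> 0} \<and> (\<forall>w. f w \<noteq> 0 \<longrightarrow> fst ` set w \<subseteq> G)},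
      mult = (\<lambda>f g w. \<Sum>k\<le>length w. f (take k w) * g (drop k w)),
      one = (\<lambda>w. if w = [] then 1 else 0),
      zero = (\<lambda>w. 0), add = (\<lambda>f g w. f w + g w), smult = (\<lambda>c f w. c * f w),
      star = (\<lambda>f w. cnj (f (rev (map (\<lambda>(g, b). (g, \<not> b)) w))))\<rparr>"

definition free_gen :: "'g \<Rightarrow> ('g \<times> bool) list \<Rightarrow> complex" where
  "free_gen g w = (if w = [(g, False)] then 1 else 0)"

text \<open>
  The Hausdorff completion of a *-algebra with respect to a C*-seminorm: Cauchy sequences modulo
  null sequences.
\<close>

definition completion_rel ::
  "('a, 'm) star_algebra_scheme \<Rightarrow> ('a \<Rightarrow> real) \<Rightarrow> ((nat \<Rightarrow> 'a) \<times> (nat \<Rightarrow> 'a)) set" where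
  "completion_rel A p =
     {(X, Y). X \<in> cauchy_seqs A p \<and> Y \<in> cauchy_seqs A p \<and> (\<lambda>n. p (X n \<ominus>\<^bsub>A\<^esub> Y n)) \<longlonglongrightarrow> 0}"

definition completion_class ::
  "('a, 'm) star_algebra_scheme \<Rightarrow> ('a \<Rightarrow> real) \<Rightarrow> (nat \<Rightarrow> 'a) \<Rightarrow> (nat \<Rightarrow> 'a) set" where
  "completion_class A p X = completion_rel A p `` {X}"

definition cstar_completion ::
  "('a, 'm) star_algebra_scheme \<Rightarrow> ('a \<Rightarrow> real) \<Rightarrow> (nat \<Rightarrow> 'a) set cstar" where
  "cstar_completion A p =
     \<lparr>carrier = cauchy_seqs A p // completion_rel A p,
      mult = (\<lambda>C D. \<Union>X\<in>C. \<Union>Y\<in>D. completion_class A p (\<lambda>n. X n \<otimes>\<^bsub>A\<^esub> Y n)),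
      one = completion_class A p (\<lambda>n. \<one>\<^bsub>A\<^esub>),
      zero = completion_class A p (\<lambda>n. \<zero>\<^bsub>A\<^esub>),
      add = (\<lambda>C D. \<Union>X\<in>C. \<Union>Y\<in>D. completion_class A p (\<lambda>n. X n \<oplus>\<^bsub>A\<^esub> Y n)),
      smult = (\<lambda>c C. \<Union>X\<in>C. completion_class A p (\<lambda>n. c \<odot>\<^bsub>A\<^esub> X n)),
      star = (\<lambda>C. \<Union>X\<in>C. completion_class A p (\<lambda>n. star A (X n))),
      cnorm = (\<lambda>C. THE r. \<exists>X\<in>C. (\<lambda>n. p (X n)) \<longlonglongrightarrow> r)\<rparr>"

text \<open>
  The universal C*-algebra generated by \<open>G\<close> subject to the relations \<open>l = r\<close>, \<open>(l, r) \<in> R\<close>.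
  The supremum is finite in the two cases below: a C*-seminorm takes values at most \<open>1\<close>
  on projections, and every C*-seminorm on a C*-algebra is dominated by the norm.
\<close>

definition universal_seminorm ::
  "'g set \<Rightarrow> ((('g \<times> bool) list \<Rightarrow> complex) \<times> (('g \<times> bool) list \<Rightarrow> complex)) set \<Rightarrow>
   (('g \<times> bool) list \<Rightarrow> complex) \<Rightarrow> real" where
  "universal_seminorm G R x =
     Sup {p x | p. cstar_seminorm (free_star_algebra G) p \<and>
                   (\<forall>(l, r)\<in>R. p (l \<ominus>\<^bsub>free_star_algebra G\<^esub> r) = 0)}"

definition universal_cstar ::
  "'g set \<Rightarrow> ((('g \<times> bool) list \<Rightarrow> complex) \<times> (('g \<times> bool) list \<Rightarrow> complex)) set \<Rightarrow>
   (nat \<Rightarrow> ('g \<times> bool) list \<Rightarrow> complex) set cstar" where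
  "universal_cstar G R = cstar_completion (free_star_algebra G) (universal_seminorm G R)"

definition universal_gen ::
  "'g set \<Rightarrow> ((('g \<times> bool) list \<Rightarrow> complex) \<times> (('g \<times> bool) list \<Rightarrow> complex)) set \<Rightarrow>
   'g \<Rightarrow> (nat \<Rightarrow> ('g \<times> bool) list \<Rightarrow> complex) set" where
  "universal_gen G R g =
     completion_class (free_star_algebra G) (universal_seminorm G R) (\<lambda>n. free_gen g)"

section \<open>Tensor products\<close>

text \<open>
  The (maximal) C*-tensor product, that is, the enveloping C*-algebra of the algebraic tensor
  product, presented by the symbols \<open>x \<otimes> y\<close>.
\<close>

definition tensor_relations ::
  "('a, 'm) star_algebra_scheme \<Rightarrow> ('b, 'l) star_algebra_scheme \<Rightarrow>
   (((('a \<times> 'b) \<times> bool) list \<Rightarrow> complex) \<times> ((('a \<times> 'b) \<times> bool) list \<Rightarrow> complex)) set" where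
  "tensor_relations A B =
     (let F = free_star_algebra (carrier A \<times> carrier B) in
       {(free_gen (x \<oplus>\<^bsub>A\<^esub> x', y), free_gen (x, y) \<oplus>\<^bsub>F\<^esub> free_gen (x', y)) | x x' y.
          x \<in> carrier A \<and> x' \<in> carrier A \<and> y \<in> carrier B} \<union>
       {(free_gen (x, y \<oplus>\<^bsub>B\<^esub> y'), free_gen (x, y) \<oplus>\<^bsub>F\<^esub> free_gen (x, y')) | x y y'.
          x \<in> carrier A \<and> y \<in> carrier B \<and> y' \<in> carrier B} \<union>
       {(free_gen (c \<odot>\<^bsub>A\<^esub> x, y), c \<odot>\<^bsub>F\<^esub> free_gen (x, y)) | c x y.
          x \<in> carrier A \<and> y \<in> carrier B} \<union>
       {(free_gen (x, c \<odot>\<^bsub>B\<^esub> y), c \<odot>\<^bsub>F\<^esub> free_gen (x, y)) | c x y.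
          x \<in> carrier A \<and> y \<in> carrier B} \<union>
       {(free_gen (x \<otimes>\<^bsub>A\<^esub> x', y \<otimes>\<^bsub>B\<^esub> y'), free_gen (x, y) \<otimes>\<^bsub>F\<^esub> free_gen (x', y')) | x x' y y'.
          x \<in> carrier A \<and> x' \<in> carrier A \<and> y \<in> carrier B \<and> y' \<in> carrier B} \<union>
       {(free_gen (star A x, star B y), star F (free_gen (x, y))) | x y.
          x \<in> carrier A \<and> y \<in> carrier B} \<union>
       {(free_gen (\<one>\<^bsub>A\<^esub>, \<one>\<^bsub>B\<^esub>), \<one>\<^bsub>F\<^esub>)})"

definition tensor ::
  "('a, 'm) star_algebra_scheme \<Rightarrow> ('b, 'l) star_algebra_scheme \<Rightarrow>
   (nat \<Rightarrow> (('a \<times> 'b) \<times> bool) list \<Rightarrow> complex) set cstar" where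
  "tensor A B = universal_cstar (carrier A \<times> carrier B) (tensor_relations A B)"

definition elem_tensor ::
  "('a, 'm) star_algebra_scheme \<Rightarrow> ('b, 'l) star_algebra_scheme \<Rightarrow> 'a \<Rightarrow> 'b \<Rightarrow>
   (nat \<Rightarrow> (('a \<times> 'b) \<times> bool) list \<Rightarrow> complex) set" where
  "elem_tensor A B x y = universal_gen (carrier A \<times> carrier B) (tensor_relations A B) (x, y)"

section \<open>Quantum permutation algebras\<close>

definition projection :: "('a, 'm) star_algebra_scheme \<Rightarrow> 'a \<Rightarrow> bool" where
  "projection A p \<longleftrightarrow> p \<in> carrier A \<and> star A p = p \<and> p \<otimes>\<^bsub>A\<^esub> p = p"

definition magic_unitary :: "('a, 'm) star_algebra_scheme \<Rightarrow> ('n::finite \<Rightarrow> 'n \<Rightarrow> 'a) \<Rightarrow> bool" where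
  "magic_unitary A u \<longleftrightarrow>
     (\<forall>i j. projection A (u i j)) \<and>
     (\<forall>i j k. j \<noteq> k \<longrightarrow> u i j \<otimes>\<^bsub>A\<^esub> u i k = \<zero>\<^bsub>A\<^esub>) \<and>
     (\<forall>i j k. i \<noteq> k \<longrightarrow> u i j \<otimes>\<^bsub>A\<^esub> u k j = \<zero>\<^bsub>A\<^esub>) \<and>
     (\<forall>i. (\<Oplus>\<^bsub>A\<^esub>j\<in>UNIV. u i j) = \<one>\<^bsub>A\<^esub>) \<and>
     (\<forall>j. (\<Oplus>\<^bsub>A\<^esub>i\<in>UNIV. u i j) = \<one>\<^bsub>A\<^esub>)"

definition magic_relations ::
  "(((('n::finite \<times> 'n) \<times> bool) list \<Rightarrow> complex) \<times> ((('n \<times> 'n) \<times> bool) list \<Rightarrow> complex)) set" where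
  "magic_relations =
     (let F = free_star_algebra UNIV; w = (\<lambda>i j. free_gen (i, j)) in
       {(star F (w i j), w i j) | i j. True} \<union>
       {(w i j \<otimes>\<^bsub>F\<^esub> w i j, w i j) | i j. True} \<union>
       {(w i j \<otimes>\<^bsub>F\<^esub> w i k, \<zero>\<^bsub>F\<^esub>) | i j k. j \<noteq> k} \<union>
       {(w i j \<otimes>\<^bsub>F\<^esub> w k j, \<zero>\<^bsub>F\<^esub>) | i j k. i \<noteq> k} \<union>
       {(\<Oplus>\<^bsub>F\<^esub>j\<in>UNIV. w i j, \<one>\<^bsub>F\<^esub>) | i. True} \<union>
       {(\<Oplus>\<^bsub>F\<^esub>i\<in>UNIV. w i j, \<one>\<^bsub>F\<^esub>) | j. True})"

definition A\<^sub>s :: "(nat \<Rightarrow> (('n::finite \<times> 'n) \<times> bool) list \<Rightarrow> complex) set cstar" where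
  "A\<^sub>s = universal_cstar UNIV magic_relations"

definition A\<^sub>s_gen :: "'n::finite \<Rightarrow> 'n \<Rightarrow> (nat \<Rightarrow> (('n \<times> 'n) \<times> bool) list \<Rightarrow> complex) set" where
  "A\<^sub>s_gen i j = universal_gen UNIV magic_relations (i, j)"

text \<open>
  The maps \<open>\<Delta>\<close>, \<open>\<epsilon>\<close> and \<open>S\<close>, and the flip below, are determined by their values on
  generators, so they are unique when they exist.
\<close>

definition comultiplication ::
  "'a cstar \<Rightarrow> ('n::finite \<Rightarrow> 'n \<Rightarrow> 'a) \<Rightarrow>
   ('a \<Rightarrow> (nat \<Rightarrow> (('a \<times> 'a) \<times> bool) list \<Rightarrow> complex) set) \<Rightarrow> bool" where
  "comultiplication A u \<Delta> \<longleftrightarrow>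
     \<Delta> \<in> star_hom A (tensor A A) \<and>
     (\<forall>i j. \<Delta> (u i j) = (\<Oplus>\<^bsub>tensor A A\<^esub>k\<in>UNIV. elem_tensor A A (u i k) (u k j)))"

definition counit :: "'a cstar \<Rightarrow> ('n::finite \<Rightarrow> 'n \<Rightarrow> 'a) \<Rightarrow> ('a \<Rightarrow> complex) \<Rightarrow> bool" where
  "counit A u \<epsilon> \<longleftrightarrow>
     \<epsilon> \<in> star_hom A complex_cstar \<and> (\<forall>i j. \<epsilon> (u i j) = (if i = j then 1 else 0))"

definition antipode :: "'a cstar \<Rightarrow> ('n::finite \<Rightarrow> 'n \<Rightarrow> 'a) \<Rightarrow> ('a \<Rightarrow> 'a) \<Rightarrow> bool" where
  "antipode A u S \<longleftrightarrow> S \<in> star_hom A (opposite A) \<and> (\<forall>i j. S (u i j) = u j i)"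

definition quantum_permutation_algebra :: "'a cstar \<Rightarrow> ('n::finite \<Rightarrow> 'n \<Rightarrow> 'a) \<Rightarrow> bool" where
  "quantum_permutation_algebra A u \<longleftrightarrow>
     cstar_algebra A \<and> magic_unitary A u \<and>
     cstar_generated_by A {u i j | i j. True} \<and>
     enveloping_of A {u i j | i j. True} \<and>
     (\<exists>\<Delta>. comultiplication A u \<Delta>) \<and> (\<exists>\<epsilon>. counit A u \<epsilon>) \<and> (\<exists>S. antipode A u S)"

definition tensor_flip ::
  "'a cstar \<Rightarrow>
   ((nat \<Rightarrow> (('a \<times> 'a) \<times> bool) list \<Rightarrow> complex) set \<Rightarrow>
    (nat \<Rightarrow> (('a \<times> 'a) \<times> bool) list \<Rightarrow> complex) set) \<Rightarrow> bool" where
  "tensor_flip A \<tau> \<longleftrightarrow>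
     \<tau> \<in> star_hom (tensor A A) (tensor A A) \<and>
     (\<forall>x\<in>carrier A. \<forall>y\<in>carrier A. \<tau> (elem_tensor A A x y) = elem_tensor A A y x)"

definition cocommutative :: "'a cstar \<Rightarrow> ('n::finite \<Rightarrow> 'n \<Rightarrow> 'a) \<Rightarrow> bool" where
  "cocommutative A u \<longleftrightarrow>
     (\<exists>\<Delta> \<tau>. comultiplication A u \<Delta> \<and> tensor_flip A \<tau> \<and> (\<forall>a\<in>carrier A. \<tau> (\<Delta> a) = \<Delta> a))"

section \<open>Hopf images\<close>

definition realizes_factorization ::
  "((nat \<Rightarrow> (('n::finite \<times> 'n) \<times> bool) list \<Rightarrow> complex) set \<Rightarrow> 'h \<Rightarrow> 'h::chilbert_space) \<Rightarrow>
   'a cstar \<Rightarrow> ('n \<Rightarrow> 'n \<Rightarrow> 'a) \<Rightarrow> bool" where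
  "realizes_factorization \<pi> A u \<longleftrightarrow>
     (\<exists>\<phi> \<psi>. \<phi> \<in> star_hom A\<^sub>s A \<and> (\<forall>i j. \<phi> (A\<^sub>s_gen i j) = u i j) \<and>
            \<psi> \<in> star_hom A bounded_operators \<and> (\<forall>x\<in>carrier A\<^sub>s. \<psi> (\<phi> x) = \<pi> x))"

text \<open>
  The competitors \<open>B\<close> have their carrier in the same type \<open>'a\<close> as \<open>A\<close>. This is no restriction:
  a quantum permutation algebra \<open>B\<close> is separable, hence of cardinality at most that of
  the continuum, and \<open>'a\<close> contains a copy of the complex numbers since \<open>A\<close> has a counit and is
  therefore nonzero. So each \<open>B\<close> is isomorphic to one whose carrier is a subset of \<open>'a\<close>.
\<close>

definition hopf_image ::
  "((nat \<Rightarrow> (('n::finite \<times> 'n) \<times> bool) list \<Rightarrow> complex) set \<Rightarrow> 'h \<Rightarrow> 'h::chilbert_space) \<Rightarrow>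
   'a cstar \<Rightarrow> ('n \<Rightarrow> 'n \<Rightarrow> 'a) \<Rightarrow> bool" where
  "hopf_image \<pi> A u \<longleftrightarrow>
     quantum_permutation_algebra A u \<and> realizes_factorization \<pi> A u \<and>
     (\<forall>(B :: 'a cstar) w. quantum_permutation_algebra B w \<and> realizes_factorization \<pi> B w \<longrightarrow>
        (\<exists>\<rho>\<in>star_hom B A. \<rho> ` carrier B = carrier A \<and> (\<forall>i j. \<rho> (w i j) = u i j)))"

definition associated_algebra ::
  "('n::finite \<Rightarrow> 'n \<Rightarrow> 'h::chilbert_space set) \<Rightarrow> 'a cstar \<Rightarrow> ('n \<Rightarrow> 'n \<Rightarrow> 'a) \<Rightarrow> bool" where
  "associated_algebra X A u \<longleftrightarrow>
     (\<exists>\<pi>\<in>star_hom A\<^sub>s bounded_operators.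
        (\<forall>i j. \<pi> (A\<^sub>s_gen i j) = orth_proj (X i j)) \<and> hopf_image \<pi> A u)"

end

theory Submission
  imports Defs "HOL-Analysis.Elementary_Normed_Spaces" "HOL-Analysis.Abstract_Topology_2"
begin

text \<open>
  If \<open>A\<close> is cocommutative, then \<open>\<Sum>\<^sub>k u\<^sub>i\<^sub>k \<otimes> u\<^sub>k\<^sub>j = \<Sum>\<^sub>k u\<^sub>k\<^sub>j \<otimes> u\<^sub>i\<^sub>k\<close>, and multiplication by
  \<open>u\<^sub>i\<^sub>l \<otimes> 1\<close> and \<open>u\<^sub>a\<^sub>j \<otimes> 1\<close> from the two sides gives \<open>u\<^sub>i\<^sub>l u\<^sub>a\<^sub>j \<otimes> (u\<^sub>l\<^sub>j - u\<^sub>i\<^sub>a) = 0\<close>. Products of vector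
  states are positive on the tensor product by the Schur product theorem, so elementary tensors of
  nonzero operators do not vanish, and \<open>P\<^sub>i\<^sub>l P\<^sub>a\<^sub>j = 0\<close> or \<open>P\<^sub>l\<^sub>j = P\<^sub>i\<^sub>a\<close>. By non-degeneracy any two of
  the projections are then equal or orthogonal. So they form a Latin square whose symbols are the
  projections of one row, and the alternative says that the associated permutations commute.

  Conversely, if \<open>X = X\<^sup>E\<close> with an abelian group \<open>G\<close>, the representation factors through \<open>C(G)\<close>, so by
  minimality \<open>A\<close> is a quotient of \<open>C(G)\<close>, and \<open>\<Delta> u\<^sub>i\<^sub>j\<close> is the image of the sum of \<open>\<delta>\<^sub>g \<otimes> \<delta>\<^sub>h\<close> over
  \<open>g h j = i\<close>, which the flip fixes because \<open>g h = h g\<close>.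

  Both directions compute in universal C*-algebras, whose seminorms are finite because every
  C*-seminorm on a C*-algebra is dominated by its norm.
\<close>

section \<open>Hilbert spaces and bounded operators\<close>

text \<open>Equations in a universal algebra come for free from its relations; the hard point is to
  see that something there is nonzero. For the symbol of an elementary tensor this takes one
  C*-seminorm on the free *-algebra that kills all tensor relations but not the symbol. Instead of a
  Hilbert space tensor product, a kernel on words is used: the Gram kernel of a would-be vector h
  \<otimes> k moved around by the letters. The operator seminorm of left multiplication in the
  resulting semi-inner product, taken before any quotient or completion, is the required one, and
  the Schur product theorem supplies both its positivity and its boundedness.

  In the converse the obstacle is size: minimality of the Hopf image speaks only of algebras whose
  elements have the type \<open>'a\<close>. Functions on G are therefore coded by complex numbers
  and then by scalar multiples of the unit of A, which the counit separates. Since functions on a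
  finite set form a product of copies of the complex numbers, the map from \<open>A\<^sub>s\<close>
  to them is assembled from one character for each permutation in G.\<close>

lemma cinner_add_right: "cinner x (y + z) = cinner x y + cinner x z"
  by (metis cinner_commute cinner_add_left complex_cnj_add)

lemma cinner_scaleC_right: "cinner x (scaleC c y) = cnj c * cinner x y"
  by (metis cinner_commute cinner_scaleC_left complex_cnj_mult)

lemma cinner_zero_left [simp]: "cinner 0 y = 0"
  using cinner_add_left[of 0 0 y] by simp

lemma cinner_zero_right [simp]: "cinner x 0 = 0"
  using cinner_add_right[of x 0 0] by simp

lemma cinner_minus_left [simp]: "cinner (- x) y = - cinner x y"
  using cinner_add_left[of x "- x" y] by (simp add: add_eq_0_iff)

lemma cinner_minus_right [simp]: "cinner x (- y) = - cinner x y"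
  using cinner_add_right[of x y "- y"] by (simp add: add_eq_0_iff)

lemma cinner_diff_left: "cinner (x - y) z = cinner x z - cinner y z"
  using cinner_add_left[of x "- y" z] by simp

lemma cinner_sum_left: "cinner (\<Sum>i\<in>I. f i) y = (\<Sum>i\<in>I. cinner (f i) y)"
  by (induction I rule: infinite_finite_induct) (auto simp: cinner_add_left)

lemma cinner_sum_right: "cinner x (\<Sum>i\<in>I. f i) = (\<Sum>i\<in>I. cinner x (f i))"
  by (induction I rule: infinite_finite_induct) (auto simp: cinner_add_right)

lemma Re_cinner_self [simp]: "Re (cinner x x) = (norm x)\<^sup>2"
  by (simp add: cinner_self)

lemma cinner_self_eq_0_iff [simp]: "cinner x x = 0 \<longleftrightarrow> x = 0"
  by (simp add: cinner_self)

lemma cinner_all_eq_0: "(\<And>y. cinner x y = 0) \<Longrightarrow> x = 0"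
  using cinner_self_eq_0_iff by blast

text \<open>Linearity of adjoints and of orthogonal projections, and the uniqueness of adjoints, are
  all read off by this test.\<close>

lemma cinner_ext: "(\<And>y. cinner x y = cinner x' y) \<Longrightarrow> x = x'"
  using cinner_all_eq_0[of "x - x'"] by (simp add: cinner_diff_left)

lemma norm_scaleC: "norm (scaleC c x) = cmod c * norm x"
proof -
  have "complex_of_real ((norm (scaleC c x))\<^sup>2) = cnj c * (c * complex_of_real ((norm x)\<^sup>2))"
    by (simp only: cinner_self[symmetric] cinner_scaleC_left cinner_scaleC_right)
  also have "\<dots> = (c * cnj c) * complex_of_real ((norm x)\<^sup>2)"
    by (simp only: mult_ac)
  also have "\<dots> = complex_of_real ((cmod c)\<^sup>2) * complex_of_real ((norm x)\<^sup>2)"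
    by (simp only: complex_norm_square)
  also have "\<dots> = complex_of_real ((cmod c * norm x)\<^sup>2)"
    by (simp only: of_real_mult[symmetric] power_mult_distrib)
  finally show ?thesis
    by (simp only: of_real_eq_iff) (simp add: power2_eq_iff_nonneg)
qed

lemma scaleC_zero_right [simp]: "scaleC c 0 = 0"
  using norm_scaleC[of c 0] by simp

lemma scaleC_zero_left [simp]: "scaleC 0 x = 0"
  using norm_scaleC[of 0 x] by simp

lemma scaleC_one [simp]: "scaleC 1 x = x"
  using scaleR_scaleC[of 1 x] by simp

lemma scaleC_minus_one: "scaleC (- 1) x = - x"
  using scaleR_scaleC[of "-1" x] by simp

lemma Re_cinner_commute: "Re (cinner x y) = Re (cinner y x)"
  by (metis cinner_commute complex_cnj(1) complex.sel(1) complex_surj)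

lemma norm_add_square: "(norm (x + y))\<^sup>2 = (norm x)\<^sup>2 + 2 * Re (cinner x y) + (norm y)\<^sup>2"
  using Re_cinner_self[of "x + y"] Re_cinner_commute[of x y]
  by (simp add: cinner_add_left cinner_add_right)

lemma cmod_cinner_le: "cmod (cinner x y) \<le> norm x * norm y"
proof (cases "y = 0")
  case False
  define r where "r = (norm y)\<^sup>2"
  have r: "r > 0" using False by (simp add: r_def)
  \<comment> \<open>\<open>scaleC c y\<close> is the component of \<open>x\<close> along
    \<open>y\<close>; the inequality is the non-negativity of the squared norm of what
    remains.\<close>
  define c where "c = cinner x y / complex_of_real r"
  have "(norm x)\<^sup>2 + 2 * Re (cinner x (scaleC (- c) y)) + (norm (scaleC (- c) y))\<^sup>2 \<ge> 0"
    by (metis norm_add_square zero_le_power2)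
  moreover have "Re (cinner x (scaleC (- c) y)) = - ((cmod (cinner x y))\<^sup>2 / r)"
  proof -
    have "cinner x (scaleC (- c) y) = - (cinner x y * cnj (cinner x y) / complex_of_real r)"
      by (simp add: cinner_scaleC_right c_def)
    also have "\<dots> = complex_of_real (- ((cmod (cinner x y))\<^sup>2 / r))"
      using complex_norm_square[of "cinner x y"] by simp
    finally show ?thesis by (metis Re_complex_of_real)
  qed
  moreover have "(norm (scaleC (- c) y))\<^sup>2 = (cmod (cinner x y))\<^sup>2 / r"
    using r by (simp add: norm_scaleC c_def norm_divide power_mult_distrib power_divide flip: r_def)
      (simp add: power2_eq_square)
  ultimately have "(cmod (cinner x y))\<^sup>2 \<le> (norm x)\<^sup>2 * r"
    using r by (simp add: field_simps)
  then show ?thesis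
    by (metis r_def abs_le_square_iff abs_norm_cancel abs_mult power_mult_distrib
        abs_ge_self order_trans)
qed simp

lemma parallelogram:
  fixes x y :: "'h::chilbert_space"
  shows "(norm (x + y))\<^sup>2 + (norm (x - y))\<^sup>2 = 2 * (norm x)\<^sup>2 + 2 * (norm y)\<^sup>2"
  using norm_add_square[of x y] norm_add_square[of x "- y"] by simp

text \<open>The representing vector minimises \<open>\<parallel>x\<parallel>\<^sup>2 - 2 Re (f x)\<close>.\<close>

lemma riesz_representation:
  fixes f :: "'h::chilbert_space \<Rightarrow> complex"
  assumes add: "\<And>x y. f (x + y) = f x + f y"
    and scale: "\<And>c x. f (scaleC c x) = c * f x"
    and bound: "\<And>x. cmod (f x) \<le> K * norm x"
  shows "\<exists>y. \<forall>x. f x = cinner x y"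
proof -
  define J where "J x = (norm x)\<^sup>2 - 2 * Re (f x)" for x
  have Re_le: "\<bar>Re (f x)\<bar> \<le> K * norm x" for x
    using bound[of x] abs_Re_le_cmod[of "f x"] by linarith
  have lower: "- (K\<^sup>2) \<le> J x" for x
  proof -
    have "0 \<le> (norm x - K)\<^sup>2" by simp
    then show ?thesis
      using Re_le[of x] by (simp add: J_def power2_eq_square algebra_simps)
  qed
  have scaleR: "f (r *\<^sub>R x) = r * f x" for r x
    by (simp add: scaleR_scaleC scale)
  have diff: "f (x - y) = f x - f y" for x y
    using add[of x "(-1) *\<^sub>R y"] scaleR[of "-1" y] by simp
  define m where "m = Inf (range J)"
  have bdd: "bdd_below (range J)"
    using lower by (auto intro!: bdd_belowI)
  have m_le: "m \<le> J x" for x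
    unfolding m_def using bdd by (auto intro: cInf_lower)
  have "\<exists>x. J x < m + e" if "e > 0" for e
    using cInf_lessD[of "range J" "m + e"] that by (auto simp: m_def)
  then have "\<forall>n. \<exists>x. J x < m + inverse (real (Suc n))"
    by simp
  then obtain X where X: "\<And>n. J (X n) < m + inverse (real (Suc n))"
    by metis
  \<comment> \<open>The midpoint of \<open>x\<close> and \<open>y\<close> cannot go below
    \<open>m\<close>, so by the parallelogram law two near-minimisers are close to each other. This
    makes the minimising sequence Cauchy.\<close>
  have par: "(norm (x - y))\<^sup>2 \<le> 2 * (J x - m) + 2 * (J y - m)" for x y
  proof -
    have "J ((1/2) *\<^sub>R (x + y)) = (norm (x + y))\<^sup>2 / 4 - (Re (f x) + Re (f y))"
      unfolding J_def scaleR norm_scaleR power_mult_distrib by (simp add: add power_divide) (simp add: add_divide_distrib)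
    then show ?thesis
      using m_le[of "(1/2) *\<^sub>R (x + y)"] parallelogram[of x y] by (simp add: J_def field_simps)
  qed
  have "Cauchy X"
  proof (rule CauchyI)
    fix e :: real assume "e > 0"
    then obtain M where M: "inverse (real (Suc M)) < e\<^sup>2 / 4"
      using reals_Archimedean[of "e\<^sup>2 / 4"] by auto
    have "norm (X a - X b) < e" if "a \<ge> M" "b \<ge> M" for a b
    proof -
      have "inverse (real (Suc a)) \<le> inverse (real (Suc M))"
        "inverse (real (Suc b)) \<le> inverse (real (Suc M))"
        using that by (auto intro!: le_imp_inverse_le)
      moreover have "s < t" if "s \<le> 2 * (p - m) + 2 * (q - m)" "p < m + a" "q < m + b"
        "a \<le> c" "b \<le> c" "c < t / 4" for s t p q a b c :: real
        using that by (simp add: field_simps)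
      ultimately have "(norm (X a - X b))\<^sup>2 < e\<^sup>2"
        using par[of "X a" "X b"] X[of a] X[of b] M by blast
      then show ?thesis using \<open>e > 0\<close> by (simp add: power2_less_imp_less)
    qed
    then show "\<exists>M. \<forall>a\<ge>M. \<forall>b\<ge>M. norm (X a - X b) < e" by blast
  qed
  then obtain z where z: "X \<longlonglongrightarrow> z"
    using Cauchy_convergent_iff convergent_def by blast
  have Re_lim: "(\<lambda>n. Re (f (X n))) \<longlonglongrightarrow> Re (f z)"
  proof (rule Lim_transform2[OF tendsto_const, of "Re (f z)"])
    have "(\<lambda>n. K * norm (z - X n)) \<longlonglongrightarrow> K * norm (z - z)"
      by (intro tendsto_intros z)
    then have "(\<lambda>n. K * norm (z - X n)) \<longlonglongrightarrow> 0" by simp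
    then show "(\<lambda>n. Re (f z) - Re (f (X n))) \<longlonglongrightarrow> 0"
      by (rule Lim_null_comparison[rotated]) (use Re_le[of "z - X _"] in \<open>auto simp: diff\<close>)
  qed
  have "(\<lambda>n. J (X n)) \<longlonglongrightarrow> J z"
    unfolding J_def
    by (intro tendsto_diff tendsto_power tendsto_norm tendsto_mult tendsto_const z Re_lim)
  moreover have "(\<lambda>n. m + inverse (real (Suc n))) \<longlonglongrightarrow> m + 0"
    by (intro tendsto_intros LIMSEQ_inverse_real_of_nat)
  ultimately have "J z \<le> m + 0"
    by (rule LIMSEQ_le) (use X less_imp_le in blast)
  then have min: "J z \<le> J x" for x
    using m_le[of x] by simp
  \<comment> \<open>First variation of \<open>J\<close> at its minimiser in the direction
    \<open>h\<close>: the real quadratic in \<open>t\<close> below can stay non-negative only if its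
    linear coefficient vanishes.\<close>
  have Re_eq: "Re (f h) = Re (cinner h z)" for h
  proof (rule ccontr)
    define d where "d = Re (f h) - Re (cinner h z)"
    assume "Re (f h) \<noteq> Re (cinner h z)"
    then have d: "d \<noteq> 0" by (simp add: d_def)
    have q: "2 * t * d \<le> t\<^sup>2 * (norm h)\<^sup>2" for t
      using min[of "z + t *\<^sub>R h"] Re_cinner_commute[of z h]
      by (simp add: J_def norm_add_square add scale scaleR_scaleC cinner_scaleC_right
          norm_scaleC power_mult_distrib d_def algebra_simps)
    \<comment> \<open>Up to the added 1 this is the optimal \<open>t\<close>; the 1 keeps the
      denominator positive for \<open>h = 0\<close> and still leaves a contradiction unless
      \<open>d = 0\<close>.\<close>
    define t where "t = d / ((norm h)\<^sup>2 + 1)"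
    have pos: "(norm h)\<^sup>2 + 1 > 0" by (simp add: add_nonneg_pos)
    have "2 * t * d * ((norm h)\<^sup>2 + 1) = 2 * d\<^sup>2"
      using pos by (simp add: t_def power2_eq_square)
    moreover have "t\<^sup>2 * (norm h)\<^sup>2 * ((norm h)\<^sup>2 + 1) \<le> d\<^sup>2"
    proof -
      have "t\<^sup>2 * (norm h)\<^sup>2 * ((norm h)\<^sup>2 + 1) \<le> t\<^sup>2 * ((norm h)\<^sup>2 + 1) * ((norm h)\<^sup>2 + 1)"
        using pos by (intro mult_right_mono mult_left_mono) auto
      also have "\<dots> = d\<^sup>2" using pos by (simp add: t_def power2_eq_square)
      finally show ?thesis .
    qed
    moreover have "2 * t * d * ((norm h)\<^sup>2 + 1) \<le> t\<^sup>2 * (norm h)\<^sup>2 * ((norm h)\<^sup>2 + 1)"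
      using q[of t] pos by (intro mult_right_mono) auto
    ultimately have "2 * d\<^sup>2 \<le> d\<^sup>2" by linarith
    then show False using d by simp
  qed
  \<comment> \<open>Both sides are complex linear in \<open>h\<close>, so comparing real parts at
    \<open>scaleC \<i> h\<close> compares imaginary parts at \<open>h\<close>.\<close>
  have "f h = cinner h z" for h
    using Re_eq[of h] Re_eq[of "scaleC \<i> h"]
    by (simp add: scale cinner_scaleC_left complex_eq_iff)
  then show ?thesis by blast
qed

section \<open>Adjoints and the *-algebra of bounded operators\<close>

abbreviation op_carrier :: "('h::chilbert_space \<Rightarrow> 'h) set" where
  "op_carrier \<equiv> {T. bounded_linear T \<and> (\<forall>c x. T (scaleC c x) = scaleC c (T x))}"

text \<open>Riesz applied to the functionals \<open>cinner (T x) y\<close> in \<open>x\<close>. The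
  bound for \<open>S\<close> comes from writing the square of \<open>norm (S x)\<close> as
  \<open>cinner x (T (S x))\<close> and cancelling one factor.\<close>

lemma adjoint_ex:
  fixes T :: "'h::chilbert_space \<Rightarrow> 'h"
  assumes "T \<in> op_carrier"
  obtains S where "S \<in> op_carrier" "\<And>x y. cinner (S x) y = cinner x (T y)"
proof -
  from assms have T: "bounded_linear T" and Ts: "\<And>c x. T (scaleC c x) = scaleC c (T x)"
    by auto
  interpret T: bounded_linear T by (fact T)
  obtain K where K: "K > 0" "\<And>x. norm (T x) \<le> norm x * K"
    using T.pos_bounded by blast
  have "\<exists>z. \<forall>x. cinner (T x) y = cinner x z" for y
  proof (rule riesz_representation)
    show "cmod (cinner (T x) y) \<le> (K * norm y) * norm x" for x
      using cmod_cinner_le[of "T x" y] mult_right_mono[OF K(2)[of x], of "norm y"]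
      by (simp add: algebra_simps)
  qed (simp_all add: T.add Ts cinner_add_left cinner_scaleC_left)
  then obtain S where "\<And>x y. cinner (T x) y = cinner x (S y)" by metis
  then have S: "cinner (S y) x = cinner y (T x)" for x y
    by (metis cinner_commute)
  have add: "S (x + y) = S x + S y" for x y
    by (rule cinner_ext) (simp add: S cinner_add_left)
  have sc: "S (scaleC c x) = scaleC c (S x)" for c x
    by (rule cinner_ext) (simp add: S cinner_scaleC_left)
  have "bounded_linear S"
  proof (rule bounded_linear_intro[where K = K])
    show "norm (S x) \<le> norm x * K" for x
    proof (cases "norm (S x) = 0")
      case False
      have "(norm (S x))\<^sup>2 = Re (cinner x (T (S x)))"
        by (metis S Re_cinner_self)
      also have "\<dots> \<le> norm x * norm (T (S x))"
        using cmod_cinner_le complex_Re_le_cmod order_trans by blast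
      also have "\<dots> \<le> norm x * (norm (S x) * K)"
        by (intro mult_left_mono K) auto
      finally have "norm (S x) * norm (S x) \<le> norm (S x) * (norm x * K)"
        by (simp add: power2_eq_square algebra_simps)
      then show ?thesis
        using False by (simp add: mult_le_cancel_left)
    qed (use K in simp)
  qed (simp_all add: add sc scaleR_scaleC)
  with sc S that show thesis by blast
qed

text \<open>The star of an operator is a definite description, so it carries information only once
  existence and uniqueness of the adjoint are combined as here.\<close>

lemma star_bounded_operators:
  fixes T :: "'h::chilbert_space \<Rightarrow> 'h"
  assumes "T \<in> op_carrier"
  shows "star bounded_operators T \<in> op_carrier"
    and "cinner (star bounded_operators T x) y = cinner x (T y)"
proof -
  obtain S where S: "S \<in> op_carrier" "\<And>x y. cinner (S x) y = cinner x (T y)"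
    using adjoint_ex[OF assms] by blast
  have "star bounded_operators T = S"
    unfolding bounded_operators_def star_algebra.simps cstar.simps
    using S(2) by (intro the_equality allI) (auto intro!: ext intro: cinner_ext)
  with S show "star bounded_operators T \<in> op_carrier"
    "cinner (star bounded_operators T x) y = cinner x (T y)"
    by auto
qed

lemma bounded_operators_simps [simp]:
  "mult bounded_operators = (\<circ>)"
  "one bounded_operators = id"
  "zero bounded_operators = (\<lambda>x. 0)"
  "add bounded_operators = (\<lambda>S T x. S x + T x)"
  "smult bounded_operators = (\<lambda>c T x. scaleC c (T x))"
  "cnorm bounded_operators = onorm"
  by (simp_all add: bounded_operators_def)

lemma carrier_bounded_operators: "carrier bounded_operators = op_carrier"
  by (simp add: bounded_operators_def)

lemma scaleC_bounded_linear: "bounded_linear (\<lambda>x::'h::chilbert_space. scaleC c x)"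
  by (rule bounded_linear_intro[where K = "cmod c"])
     (auto simp: scaleC_add_right scaleR_scaleC scaleC_scaleC norm_scaleC mult.commute)

lemma bounded_operators_closed:
  fixes S T :: "'h::chilbert_space \<Rightarrow> 'h"
  assumes "T \<in> carrier bounded_operators"
  shows "S \<in> carrier bounded_operators \<Longrightarrow> S \<circ> T \<in> carrier bounded_operators"
    and "S \<in> carrier bounded_operators \<Longrightarrow> (\<lambda>x. S x + T x) \<in> carrier bounded_operators"
    and "(\<lambda>x. scaleC c (T x)) \<in> carrier bounded_operators"
    and "star bounded_operators T \<in> carrier bounded_operators"
proof -
  have T: "bounded_linear T" using assms by (simp add: carrier_bounded_operators)
  show "S \<in> carrier bounded_operators \<Longrightarrow> S \<circ> T \<in> carrier bounded_operators"
    using assms bounded_linear_compose[of S T] by (simp add: carrier_bounded_operators o_def)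
  show "S \<in> carrier bounded_operators \<Longrightarrow> (\<lambda>x. S x + T x) \<in> carrier bounded_operators"
    using assms by (simp add: carrier_bounded_operators bounded_linear_add scaleC_add_right)
  show "(\<lambda>x. scaleC c (T x)) \<in> carrier bounded_operators"
    using assms bounded_linear_compose[OF scaleC_bounded_linear T, of c]
    by (simp add: carrier_bounded_operators scaleC_scaleC mult.commute)
  show "star bounded_operators T \<in> carrier bounded_operators"
    using assms star_bounded_operators(1)[of T] by (simp only: carrier_bounded_operators)
qed

lemma operator_linear:
  assumes "T \<in> carrier bounded_operators"
  shows "T (x + y) = T x + T y" "T (scaleC c x) = scaleC c (T x)"
  using assms by (auto simp: carrier_bounded_operators linear_add bounded_linear.linear)

lemma cinner_star_operator:
  assumes "T \<in> carrier bounded_operators"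
  shows "cinner (star bounded_operators T x) y = cinner x (T y)"
    and "cinner y (star bounded_operators T x) = cinner (T y) x"
proof -
  show *: "cinner (star bounded_operators T x) y = cinner x (T y)" for x y
    using star_bounded_operators(2)[of T x y] assms by (simp only: carrier_bounded_operators)
  show "cinner y (star bounded_operators T x) = cinner (T y) x"
    by (metis * cinner_commute)
qed

lemma star_bounded_operators_unique:
  assumes "T \<in> carrier bounded_operators" "\<And>x y. cinner (S x) y = cinner x (T y)"
  shows "star bounded_operators T = S"
  by (rule ext, rule cinner_ext) (simp only: cinner_star_operator[OF assms(1)] assms(2))

lemma bounded_operators_star_algebra:
  "star_algebra (bounded_operators :: ('h::chilbert_space \<Rightarrow> 'h) cstar)"
proof -
  let ?B = "bounded_operators :: ('h \<Rightarrow> 'h) cstar"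
  note cl = bounded_operators_closed
  have zero: "(\<lambda>x. 0) \<in> carrier ?B" and one: "id \<in> carrier ?B"
    by (auto simp: carrier_bounded_operators id_def)
  have minus: "\<exists>S\<in>carrier ?B. (\<lambda>x. S x + T x) = (\<lambda>x. 0)" if "T \<in> carrier ?B" for T
    by (rule bexI[of _ "\<lambda>x. scaleC (-1) (T x)"]) (simp_all add: scaleC_minus_one that cl(3)[OF that, of "-1", simplified scaleC_minus_one])
  interpret abelian_group ?B
    by (rule abelian_groupI) (use minus in \<open>auto simp: ac_simps cl zero\<close>)
  interpret monoid ?B
    by (rule monoidI) (auto simp: cl one)
  interpret ring ?B
    by (rule ringI) (auto simp: abelian_group_axioms monoid_axioms fun_eq_iff operator_linear)
  show ?thesis
  proof
    fix x y :: "'h \<Rightarrow> 'h" and c d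
    assume x: "x \<in> carrier ?B"
    show "c \<odot>\<^bsub>?B\<^esub> x \<in> carrier ?B" "star ?B x \<in> carrier ?B"
      using x by (simp_all add: cl)
    show "star ?B (star ?B x) = x"
      by (rule star_bounded_operators_unique) (simp_all add: cl x cinner_star_operator)
    show "star ?B (c \<odot>\<^bsub>?B\<^esub> x) = cnj c \<odot>\<^bsub>?B\<^esub> star ?B x"
      by (rule star_bounded_operators_unique)
         (simp_all add: cl x cinner_star_operator cinner_scaleC_left cinner_scaleC_right)
    assume y: "y \<in> carrier ?B"
    show "star ?B (x \<oplus>\<^bsub>?B\<^esub> y) = star ?B x \<oplus>\<^bsub>?B\<^esub> star ?B y"
      by (rule star_bounded_operators_unique)
         (simp_all add: cl x y cinner_star_operator cinner_add_left cinner_add_right)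
    show "star ?B (x \<otimes>\<^bsub>?B\<^esub> y) = star ?B y \<otimes>\<^bsub>?B\<^esub> star ?B x"
      by (rule star_bounded_operators_unique) (simp_all add: cl x y cinner_star_operator)
  qed (auto simp: scaleC_add_left scaleC_add_right scaleC_scaleC operator_linear)
qed

text \<open>One half of the C*-identity is Cauchy-Schwarz applied to
  \<open>cinner (star bounded_operators x (x z)) z\<close>, which is the square of
  \<open>norm (x z)\<close>; the other half needs only that taking adjoints does not increase the
  norm.\<close>

lemma bounded_operators_cstar_seminorm:
  "cstar_seminorm (bounded_operators :: ('h::chilbert_space \<Rightarrow> 'h) cstar) onorm"
  unfolding cstar_seminorm_def
proof (intro conjI ballI allI)
  fix x y :: "'h \<Rightarrow> 'h" and c
  assume x: "x \<in> carrier bounded_operators"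
  then have xl: "bounded_linear x" and xc: "x \<in> op_carrier" by (auto simp: carrier_bounded_operators)
  show "0 \<le> onorm x" by (rule onorm_pos_le[OF xl])
  have le: "onorm (\<lambda>z. scaleC c (w z)) \<le> cmod c * onorm w" if "bounded_linear w" for w :: "'h \<Rightarrow> 'h" and c
    by (rule onorm_bound)
       (auto simp: norm_scaleC mult.assoc that onorm_pos_le intro!: mult_left_mono onorm)
  show "onorm (c \<odot>\<^bsub>bounded_operators\<^esub> x) = cmod c * onorm x"
  proof (cases "c = 0")
    case False
    have "onorm x = onorm (\<lambda>z. scaleC (inverse c) (scaleC c (x z)))"
      using False by (simp add: scaleC_scaleC)
    also have "\<dots> \<le> cmod (inverse c) * onorm (\<lambda>z. scaleC c (x z))"
      by (rule le) (rule bounded_linear_compose[OF scaleC_bounded_linear xl])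
    finally have "cmod c * onorm x \<le> onorm (\<lambda>z. scaleC c (x z))"
      using False by (simp add: norm_inverse norm_divide field_simps)
    then show ?thesis using le[OF xl, of c] by simp
  qed (use onorm_zero in simp)
  have CS: "(onorm x)\<^sup>2 \<le> onorm (star bounded_operators x \<circ> x)"
  proof -
    let ?y = "star bounded_operators x \<circ> x"
    have yl: "bounded_linear ?y"
      using star_bounded_operators(1)[OF xc] xl
      by (auto simp: o_def intro: bounded_linear_compose)
    have "norm (x z) \<le> sqrt (onorm ?y) * norm z" for z
    proof -
      have "(norm (x z))\<^sup>2 = Re (cinner (?y z) z)"
        using star_bounded_operators(2)[OF xc, of "x z" z] by simp
      also have "\<dots> \<le> norm (?y z) * norm z"
        using cmod_cinner_le complex_Re_le_cmod order_trans by blast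
      also have "\<dots> \<le> (onorm ?y * norm z) * norm z"
        by (intro mult_right_mono onorm[OF yl]) auto
      also have "\<dots> = (sqrt (onorm ?y) * norm z)\<^sup>2"
        by (simp add: power_mult_distrib onorm_pos_le[OF yl]) (simp add: power2_eq_square)
      finally show ?thesis
        by (rule power2_le_imp_le) (simp add: onorm_pos_le[OF yl])
    qed
    then have "onorm x \<le> sqrt (onorm ?y)"
      by (intro onorm_bound) (auto simp: onorm_pos_le[OF yl])
    then show ?thesis
      using onorm_pos_le[OF xl] onorm_pos_le[OF yl] real_sqrt_pow2 power_mono by metis
  qed
  have sub: "onorm (v \<circ> w) \<le> onorm v * onorm w" if "bounded_linear v" "bounded_linear w" for v w :: "'h \<Rightarrow> 'h"
    using onorm_compose[OF that] .
  have adj_le: "onorm (star bounded_operators x) \<le> onorm x" 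
  proof (rule onorm_bound)
    fix z
    let ?s = "star bounded_operators x z"
    have "(norm ?s)\<^sup>2 = Re (cinner z (x ?s))"
      using star_bounded_operators(2)[OF xc, of z ?s] by (metis Re_cinner_self)
    also have "\<dots> \<le> norm z * norm (x ?s)"
      using cmod_cinner_le complex_Re_le_cmod order_trans by blast
    also have "\<dots> \<le> norm z * (onorm x * norm ?s)"
      by (intro mult_left_mono onorm[OF xl]) auto
    finally have "norm ?s * norm ?s \<le> norm ?s * (onorm x * norm z)"
      by (simp add: power2_eq_square algebra_simps)
    then show "norm ?s \<le> onorm x * norm z"
      by (cases "norm ?s = 0") (auto simp: mult_le_cancel_left onorm_pos_le[OF xl])
  qed (rule onorm_pos_le[OF xl])
  have "onorm (star bounded_operators x \<circ> x) \<le> (onorm x)\<^sup>2"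
    using sub[of "star bounded_operators x" x] star_bounded_operators(1)[OF xc] xl
      mult_right_mono[OF adj_le onorm_pos_le[OF xl]]
    by (simp add: power2_eq_square)
  with CS show "onorm (star bounded_operators x \<otimes>\<^bsub>bounded_operators\<^esub> x) = (onorm x)\<^sup>2"
    by simp
  assume y: "y \<in> carrier bounded_operators"
  show "onorm (x \<oplus>\<^bsub>bounded_operators\<^esub> y) \<le> onorm x + onorm y"
    using xl y by (simp add: onorm_triangle carrier_bounded_operators)
  show "onorm (x \<otimes>\<^bsub>bounded_operators\<^esub> y) \<le> onorm x * onorm y"
    using xl y sub by (simp add: carrier_bounded_operators)
qed

section \<open>C*-seminorms\<close>

context star_algebra
begin

lemma smult_zero_left [simp]: "x \<in> carrier A \<Longrightarrow> 0 \<odot> x = \<zero>"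
  using smult_add_left[of x 0 0] smult_closed[of x 0]
  by (metis add.l_cancel_one' add_0)

lemma smult_zero_right [simp]: "c \<odot> \<zero> = \<zero>"
  using smult_add_right[of \<zero> \<zero> c] smult_closed[of \<zero> c]
  by (metis add.l_cancel_one' r_zero zero_closed)

text \<open>The axioms of seminorms and homomorphisms mention scalars but not negation; this
  identity carries them over to differences.\<close>

lemma smult_minus_one: "x \<in> carrier A \<Longrightarrow> (- 1) \<odot> x = \<ominus> x"
proof -
  assume x: "x \<in> carrier A"
  have "(- 1) \<odot> x \<oplus> x = \<zero>"
    using smult_add_left[OF x, of "-1" 1] by (simp add: smult_1 x)
  then show ?thesis by (metis minus_equality smult_closed x)
qed

lemma star_zero [simp]: "star A \<zero> = \<zero>"
  by (metis complex_cnj_zero smult_zero_left star_closed star_smult zero_closed)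

lemma star_one [simp]: "star A \<one> = \<one>"
  by (metis l_one one_closed r_one star_closed star_mult star_star)

lemma star_minus: "x \<in> carrier A \<Longrightarrow> star A (\<ominus> x) = \<ominus> star A x"
  by (metis complex_cnj_minus complex_cnj_one smult_minus_one star_closed star_smult)

lemma star_diff: "x \<in> carrier A \<Longrightarrow> y \<in> carrier A \<Longrightarrow> star A (x \<ominus> y) = star A x \<ominus> star A y"
  by (simp add: minus_eq star_add star_minus star_closed)

lemma smult_diff_right:
  "x \<in> carrier A \<Longrightarrow> y \<in> carrier A \<Longrightarrow> c \<odot> (x \<ominus> y) = c \<odot> x \<ominus> c \<odot> y"
  by (simp add: minus_eq smult_add_right smult_closed flip: smult_minus_one)
     (simp add: smult_smult mult.commute)

lemma minus_eq_zero_iff: "x \<in> carrier A \<Longrightarrow> y \<in> carrier A \<Longrightarrow> x \<ominus> y = \<zero> \<longleftrightarrow> x = y"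
  by (metis minus_closed minus_eq minus_equality minus_minus r_neg add.inv_closed)

end

text \<open>The seminorm is a parameter and not the \<open>cnorm\<close> of the record: a free
  *-algebra has no norm of its own and is studied with many C*-seminorms at once.\<close>

locale seminormed_star_algebra = star_algebra A for A :: "('a, 'm) star_algebra_scheme" (structure) +
  fixes p :: "'a \<Rightarrow> real"
  assumes seminorm: "cstar_seminorm A p"
begin

lemma nonneg: "x \<in> carrier A \<Longrightarrow> 0 \<le> p x"
  and p_smult: "x \<in> carrier A \<Longrightarrow> p (c \<odot> x) = cmod c * p x"
  and triangle: "x \<in> carrier A \<Longrightarrow> y \<in> carrier A \<Longrightarrow> p (x \<oplus> y) \<le> p x + p y"
  and p_mult: "x \<in> carrier A \<Longrightarrow> y \<in> carrier A \<Longrightarrow> p (x \<otimes> y) \<le> p x * p y"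
  and cstar: "x \<in> carrier A \<Longrightarrow> p (star A x \<otimes> x) = (p x)\<^sup>2"
  using seminorm by (auto simp: cstar_seminorm_def)

lemma p_zero [simp]: "p \<zero> = 0"
  using p_smult[of \<zero> 0] by simp

lemma p_uminus: "x \<in> carrier A \<Longrightarrow> p (\<ominus> x) = p x"
  using p_smult[of x "-1"] by (simp add: smult_minus_one)

lemma p_diff_commute: "x \<in> carrier A \<Longrightarrow> y \<in> carrier A \<Longrightarrow> p (x \<ominus> y) = p (y \<ominus> x)"
  using p_uminus[of "x \<ominus> y"] by (simp add: minus_eq minus_add a_comm)

lemma p_diff_triangle:
  assumes "x \<in> carrier A" "y \<in> carrier A" "z \<in> carrier A"
  shows "p (x \<ominus> z) \<le> p (x \<ominus> y) + p (y \<ominus> z)"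
proof -
  have "x \<ominus> z = (x \<ominus> y) \<oplus> (y \<ominus> z)" using assms by algebra
  then show ?thesis using triangle[of "x \<ominus> y" "y \<ominus> z"] assms by simp
qed

text \<open>The C*-identity and submultiplicativity give
  \<open>(p x)\<^sup>2 \<le> p (star A x) * p x\<close>; cancel \<open>p x\<close>.\<close>

lemma p_star_le: "x \<in> carrier A \<Longrightarrow> p x \<le> p (star A x)"
  using p_mult[of "star A x" x] cstar[of x] nonneg[of x] nonneg[of "star A x"]
  by (cases "p x = 0") (auto simp: star_closed power2_eq_square mult_le_cancel_right)

lemma p_star: "x \<in> carrier A \<Longrightarrow> p (star A x) = p x"
  using p_star_le[of x] p_star_le[of "star A x"] by (simp add: star_closed star_star)

text \<open>The C*-identity at the unit says that \<open>p \<one>\<close> equals its own square, so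
  it is 0 or 1. The value 0 does occur, for the zero seminorm.\<close>

lemma p_one_le: "p \<one> \<le> 1"
  using p_mult[of \<one> \<one>] cstar[of \<one>] nonneg[of \<one>]
  by (cases "p \<one> = 0") (auto simp: power2_eq_square)

lemma p_reverse_triangle:
  assumes "x \<in> carrier A" "y \<in> carrier A"
  shows "\<bar>p x - p y\<bar> \<le> p (x \<ominus> y)"
proof -
  have "x = (x \<ominus> y) \<oplus> y" "y = (y \<ominus> x) \<oplus> x" using assms by algebra+
  then show ?thesis
    using triangle[of "x \<ominus> y" y] triangle[of "y \<ominus> x" x] p_diff_commute[OF assms] assms
    by (simp add: abs_le_iff)
qed

lemma p_add_diff_le:
  assumes "x \<in> carrier A" "y \<in> carrier A" "x' \<in> carrier A" "y' \<in> carrier A"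
  shows "p ((x \<oplus> y) \<ominus> (x' \<oplus> y')) \<le> p (x \<ominus> x') + p (y \<ominus> y')"
proof -
  have "(x \<oplus> y) \<ominus> (x' \<oplus> y') = (x \<ominus> x') \<oplus> (y \<ominus> y')" using assms by algebra
  then show ?thesis using triangle[of "x \<ominus> x'" "y \<ominus> y'"] assms by simp
qed

lemma p_mult_diff_le:
  assumes "x \<in> carrier A" "y \<in> carrier A" "x' \<in> carrier A" "y' \<in> carrier A"
  shows "p ((x \<otimes> y) \<ominus> (x' \<otimes> y')) \<le> p x * p (y \<ominus> y') + p (x \<ominus> x') * p y'"
proof -
  have "(x \<otimes> y) \<ominus> (x' \<otimes> y') = (x \<otimes> (y \<ominus> y')) \<oplus> ((x \<ominus> x') \<otimes> y')" using assms by algebra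
  then show ?thesis
    using triangle[of "x \<otimes> (y \<ominus> y')" "(x \<ominus> x') \<otimes> y'"] p_mult[of x "y \<ominus> y'"]
      p_mult[of "x \<ominus> x'" y'] assms by simp
qed

lemma p_star_diff:
  "x \<in> carrier A \<Longrightarrow> y \<in> carrier A \<Longrightarrow> p (star A x \<ominus> star A y) = p (x \<ominus> y)"
  by (metis star_diff p_star minus_closed)

lemma p_smult_diff:
  "x \<in> carrier A \<Longrightarrow> y \<in> carrier A \<Longrightarrow> p (c \<odot> x \<ominus> c \<odot> y) = cmod c * p (x \<ominus> y)"
  by (metis smult_diff_right p_smult minus_closed)

lemma p_limit_bounded:
  assumes X: "\<And>n. X n \<in> carrier A" and l: "l \<in> carrier A"
    and lim: "(\<lambda>n. p (X n \<ominus> l)) \<longlonglongrightarrow> 0"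
  shows "(\<lambda>n. p (X n)) \<longlonglongrightarrow> p l"
proof (rule Lim_transform2[OF tendsto_const])
  show "(\<lambda>n. p l - p (X n)) \<longlonglongrightarrow> 0"
  proof (rule tendsto_rabs_zero_cancel, rule tendsto_sandwich[OF _ _ tendsto_const lim])
    show "\<forall>\<^sub>F n in sequentially. 0 \<le> \<bar>p l - p (X n)\<bar>" by simp
    show "\<forall>\<^sub>F n in sequentially. \<bar>p l - p (X n)\<bar> \<le> p (X n \<ominus> l)"
      using p_reverse_triangle[OF X l] by (simp add: abs_minus_commute)
  qed
qed

lemma null_sandwich:
  "(\<And>n. X n \<in> carrier A) \<Longrightarrow> (\<And>n. p (X n) \<le> f n) \<Longrightarrow> f \<longlonglongrightarrow> 0 \<Longrightarrow> (\<lambda>n. p (X n)) \<longlonglongrightarrow> 0"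
  by (rule tendsto_sandwich[OF _ _ tendsto_const]) (auto intro!: always_eventually nonneg)

lemma limit_add:
  assumes "\<And>n. X n \<in> carrier A" "\<And>n. Y n \<in> carrier A" "l \<in> carrier A" "m \<in> carrier A"
    and "(\<lambda>n. p (X n \<ominus> l)) \<longlonglongrightarrow> 0" "(\<lambda>n. p (Y n \<ominus> m)) \<longlonglongrightarrow> 0"
  shows "(\<lambda>n. p ((X n \<oplus> Y n) \<ominus> (l \<oplus> m))) \<longlonglongrightarrow> 0"
  by (rule null_sandwich[OF _ p_add_diff_le])
     (use assms tendsto_add[OF assms(5,6)] in auto)

lemma limit_mult:
  assumes "\<And>n. X n \<in> carrier A" "\<And>n. Y n \<in> carrier A" "l \<in> carrier A" "m \<in> carrier A"
    and "(\<lambda>n. p (X n \<ominus> l)) \<longlonglongrightarrow> 0" "(\<lambda>n. p (Y n \<ominus> m)) \<longlonglongrightarrow> 0"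
  shows "(\<lambda>n. p ((X n \<otimes> Y n) \<ominus> (l \<otimes> m))) \<longlonglongrightarrow> 0"
proof (rule null_sandwich[OF _ p_mult_diff_le])
  have "(\<lambda>n. p (X n) * p (Y n \<ominus> m) + p (X n \<ominus> l) * p m) \<longlonglongrightarrow> p l * 0 + 0 * p m"
    by (intro tendsto_intros assms p_limit_bounded)
  then show "(\<lambda>n. p (X n) * p (Y n \<ominus> m) + p (X n \<ominus> l) * p m) \<longlonglongrightarrow> 0" by simp
qed (use assms in auto)

end

lemma (in cstar_algebra) seminormed: "seminormed_star_algebra A (cnorm A)"
  by unfold_locales (rule cnorm_seminorm)

sublocale cstar_algebra \<subseteq> N: seminormed_star_algebra A "cnorm A"
  by (rule seminormed)

section \<open>Limits, square roots and the domination of C*-seminorms\<close>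

context cstar_algebra
begin

lemma limit_unique:
  assumes "\<And>n. X n \<in> carrier A" "l \<in> carrier A" "m \<in> carrier A"
    and "(\<lambda>n. cnorm A (X n \<ominus> l)) \<longlonglongrightarrow> 0" "(\<lambda>n. cnorm A (X n \<ominus> m)) \<longlonglongrightarrow> 0"
  shows "l = m"
proof -
  have "(\<lambda>n. cnorm A (l \<ominus> m)) \<longlonglongrightarrow> 0"
  proof (rule N.null_sandwich)
    show "cnorm A (l \<ominus> m) \<le> cnorm A (X n \<ominus> l) + cnorm A (X n \<ominus> m)" for n
      using N.p_diff_triangle[of l "X n" m] N.p_diff_commute[of l "X n"] assms by simp
    show "(\<lambda>n. cnorm A (X n \<ominus> l) + cnorm A (X n \<ominus> m)) \<longlonglongrightarrow> 0"
      using tendsto_add[OF assms(4,5)] by simp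
  qed (use assms in auto)
  then have "cnorm A (l \<ominus> m) = 0" by (simp add: LIMSEQ_const_iff)
  then show ?thesis using cnorm_eq_0[of "l \<ominus> m"] minus_eq_zero_iff assms by simp
qed

text \<open>The form of completeness needed for a fixed point iteration: telescoping against a
  geometric series makes the sequence Cauchy.\<close>

lemma geometric_limit:
  assumes X: "\<And>n. X n \<in> carrier A" and r: "0 \<le> r" "r < 1"
    and step: "\<And>n. cnorm A (X (Suc n) \<ominus> X n) \<le> K * r ^ n"
  shows "\<exists>l\<in>carrier A. (\<lambda>n. cnorm A (X n \<ominus> l)) \<longlonglongrightarrow> 0"
proof (rule cnorm_complete)
  have K: "K \<ge> 0" using step[of 0] N.nonneg[of "X 1 \<ominus> X 0"] X by simp
  have gap: "cnorm A (X (n + d) \<ominus> X n) \<le> K * r ^ n / (1 - r)" for n d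
  proof -
    have "cnorm A (X (n + d) \<ominus> X n) \<le> (\<Sum>i<d. K * r ^ (n + i))"
    proof (induction d)
      case 0
      then show ?case using X[of n] by (simp add: minus_eq r_neg)
    next
      case (Suc d)
      then show ?case
        using N.p_diff_triangle[of "X (Suc (n + d))" "X (n + d)" "X n"] step[of "n + d"] X by simp
    qed
    also have "\<dots> = K * r ^ n * (\<Sum>i<d. r ^ i)"
      by (simp add: power_add sum_distrib_left algebra_simps)
    also have "\<dots> \<le> K * r ^ n * (1 / (1 - r))"
      using r K by (intro mult_left_mono) (auto simp: sum_gp_strict divide_right_mono)
    finally show ?thesis by simp
  qed
  have "(\<lambda>n. K * r ^ n / (1 - r)) \<longlonglongrightarrow> K * 0 / (1 - r)"
    using r by (intro tendsto_intros LIMSEQ_realpow_zero) auto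
  then have lim: "(\<lambda>n. K * r ^ n / (1 - r)) \<longlonglongrightarrow> 0" by simp
  show "X \<in> cauchy_seqs A (cnorm A)"
    unfolding cauchy_seqs_def
  proof (intro CollectI conjI allI impI)
    fix e :: real assume "e > 0"
    then have "\<forall>\<^sub>F n in sequentially. K * r ^ n / (1 - r) < e"
      using lim by (rule order_tendstoD(2)[rotated])
    then obtain M where M: "K * r ^ M / (1 - r) < e / 2 "
      using order_tendstoD(2)[OF lim, of "e / 2"] \<open>e > 0\<close> by (auto simp: eventually_sequentially)
    have "cnorm A (X m \<ominus> X n) < e" if "m \<ge> M" "n \<ge> M" for m n
    proof -
      have "cnorm A (X m \<ominus> X M) < e / 2" "cnorm A (X n \<ominus> X M) < e / 2"
        using gap[of M "m - M"] gap[of M "n - M"] M that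
        by (metis le_add_diff_inverse order_le_less_trans)+
      then show ?thesis
        using N.p_diff_triangle[of "X m" "X M" "X n"] N.p_diff_commute[of "X M" "X n"] X by simp
    qed
    then show "\<exists>M. \<forall>m\<ge>M. \<forall>n\<ge>M. cnorm A (X m \<ominus> X n) < e" by blast
  qed (rule X)
qed

text \<open>
  Write \<open>b = 1 - y\<close>, where \<open>y\<close> is the fixed point of \<open>y \<mapsto> (c + y\<^sup>2) / 2\<close>. Since
  \<open>r = 1 - sqrt (1 - \<parallel>c\<parallel>)\<close> solves the scalar equation \<open>r = (\<parallel>c\<parallel> + r\<^sup>2) / 2\<close>, this map is a contraction
  of the ball of radius \<open>r < 1\<close> with constant \<open>r\<close>.
\<close>

lemma square_root_one_minus:
  assumes c: "c \<in> carrier A" and sa: "star A c = c" and norm: "cnorm A c < 1"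
  obtains b where "b \<in> carrier A" "star A b = b" "b \<otimes> b = \<one> \<ominus> c"
    "\<And>d. d \<in> carrier A \<Longrightarrow> d \<otimes> c = c \<otimes> d \<Longrightarrow> d \<otimes> b = b \<otimes> d"
proof -
  define f where "f y = (1/2) \<odot> (c \<oplus> y \<otimes> y)" for y
  define Y where "Y n = (f ^^ n) \<zero>" for n
  have Y0: "Y 0 = \<zero>" and YS: "Y (Suc n) = f (Y n)" for n by (simp_all add: Y_def)
  have f_closed: "y \<in> carrier A \<Longrightarrow> f y \<in> carrier A" for y
    unfolding f_def using c by (intro smult_closed a_closed m_closed)
  have Y: "Y n \<in> carrier A" for n
    by (induction n) (simp_all add: Y0 YS f_closed)
  define \<rho> where "\<rho> = cnorm A c"
  have \<rho>: "0 \<le> \<rho>" "\<rho> < 1" using N.nonneg[OF c] norm by (auto simp: \<rho>_def)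
  define r where "r = 1 - sqrt (1 - \<rho>)"
  have r: "0 \<le> r" "r < 1" using \<rho> by (auto simp: r_def)
  have rr: "\<rho> + r * r = 2 * r" using \<rho> by (simp add: r_def algebra_simps)
  have bound: "cnorm A (Y n) \<le> r" for n
  proof (induction n)
    case 0
    then show ?case using r by (simp add: Y0)
  next
    case (Suc n)
    have "cnorm A (Y (Suc n)) = cnorm A (c \<oplus> Y n \<otimes> Y n) / 2"
      using Y c by (simp add: YS f_def N.p_smult)
    also have "cnorm A (c \<oplus> Y n \<otimes> Y n) \<le> \<rho> + r * r"
      using N.triangle[of c "Y n \<otimes> Y n"] N.p_mult[of "Y n" "Y n"] Y c
        mult_mono[OF Suc Suc] r(1) N.nonneg[OF Y[of n]] by (simp add: \<rho>_def)
    finally show ?case using rr by simp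
  qed
  have step: "cnorm A (Y (Suc n) \<ominus> Y n) \<le> r * r ^ n" for n
  proof (induction n)
    case 0
    then show ?case using bound[of 1] Y[of 1] by (simp add: Y0 minus_eq)
  next
    case (Suc n)
    have "f (Y (Suc n)) \<ominus> f (Y n) = (1/2) \<odot> ((Y (Suc n) \<otimes> Y (Suc n)) \<ominus> (Y n \<otimes> Y n))"
    proof -
      have "(c \<oplus> y) \<ominus> (c \<oplus> z) = y \<ominus> z" if "y \<in> carrier A" "z \<in> carrier A" for y z
        using that c by algebra
      then show ?thesis
        using Y c by (simp add: f_def smult_diff_right[symmetric] del: One_nat_def)
    qed
    then have "cnorm A (Y (Suc (Suc n)) \<ominus> Y (Suc n)) =
        cnorm A ((Y (Suc n) \<otimes> Y (Suc n)) \<ominus> (Y n \<otimes> Y n)) / 2"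
      using Y by (simp add: YS[symmetric] N.p_smult)
    also have "\<dots> \<le> (cnorm A (Y (Suc n)) * cnorm A (Y (Suc n) \<ominus> Y n)
        + cnorm A (Y (Suc n) \<ominus> Y n) * cnorm A (Y n)) / 2"
      using N.p_mult_diff_le[of "Y (Suc n)" "Y (Suc n)" "Y n" "Y n"] Y by simp
    also have "\<dots> \<le> (r * (r * r ^ n) + (r * r ^ n) * r) / 2"
      using r bound Suc N.nonneg Y by (intro divide_right_mono add_mono mult_mono) auto
    finally show ?case by (simp add: mult.commute)
  qed
  obtain y where y: "y \<in> carrier A" and lim: "(\<lambda>n. cnorm A (Y n \<ominus> y)) \<longlonglongrightarrow> 0"
    using geometric_limit[OF Y r step] by blast
  have "(\<lambda>n. cnorm A (f (Y n) \<ominus> f y)) \<longlonglongrightarrow> cmod (1/2) * 0"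
    unfolding f_def using Y y c
    by (simp only: N.p_smult_diff a_closed m_closed)
       (intro tendsto_intros N.limit_add N.limit_mult lim; simp add: minus_eq r_neg)
  then have "(\<lambda>n. cnorm A (Y (Suc n) \<ominus> f y)) \<longlonglongrightarrow> 0" by (simp add: YS)
  then have fixpoint: "y = f y"
    using limit_unique[of "\<lambda>n. Y (Suc n)" y "f y"] Y y f_closed LIMSEQ_Suc[OF lim] by simp
  have Ysa: "star A (Y n) = Y n" for n
    by (induction n) (simp_all add: Y0 YS f_def star_smult star_add star_mult Y c sa)
  have ysa: "star A y = y"
    using limit_unique[of Y "star A y" y] lim N.p_star_diff[OF Y y] Ysa Y y star_closed by simp
  \<comment> \<open>The iterates are polynomials in \<open>c\<close>, so they commute with whatever
    commutes with \<open>c\<close>, and the relation passes to the limit.\<close>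
  have ycomm: "d \<otimes> y = y \<otimes> d" if d: "d \<in> carrier A" "d \<otimes> c = c \<otimes> d" for d
  proof -
    have Yc: "d \<otimes> Y n = Y n \<otimes> d" for n
    proof (induction n)
      case (Suc n)
      have "d \<otimes> (c \<oplus> Y n \<otimes> Y n) = (c \<oplus> Y n \<otimes> Y n) \<otimes> d"
        using Suc d Y[of n] c by (simp add: l_distr r_distr) (metis m_assoc)
      then show ?case
        using d Y[of n] c by (simp add: YS f_def smult_mult_right smult_mult_left)
    qed (simp add: Y0 d)
    have dd: "(\<lambda>n. cnorm A (d \<ominus> d)) \<longlonglongrightarrow> 0" using d by (simp add: minus_eq r_neg)
    show ?thesis
    proof (rule limit_unique)
      show "(\<lambda>n. cnorm A (d \<otimes> Y n \<ominus> d \<otimes> y)) \<longlonglongrightarrow> 0"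
        by (rule N.limit_mult[OF _ _ _ _ dd lim]) (use d Y y in auto)
      show "(\<lambda>n. cnorm A (d \<otimes> Y n \<ominus> y \<otimes> d)) \<longlonglongrightarrow> 0"
        unfolding Yc by (rule N.limit_mult[OF _ _ _ _ lim dd]) (use d Y y in auto)
    qed (use d Y y in auto)
  qed
  have two: "y \<oplus> y = c \<oplus> y \<otimes> y"
  proof -
    have "y \<oplus> y = 2 \<odot> y" using smult_add_left[OF y, of 1 1] y by (simp add: smult_1)
    also have "\<dots> = 2 \<odot> f y" using fixpoint by simp
    also have "\<dots> = c \<oplus> y \<otimes> y" using y c by (simp add: f_def smult_smult smult_1)
    finally show ?thesis .
  qed
  show thesis
  proof
    show "\<one> \<ominus> y \<in> carrier A" using y by simp
    show "star A (\<one> \<ominus> y) = \<one> \<ominus> y" using y ysa by (simp add: star_diff)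
    have "(\<one> \<ominus> y) \<otimes> (\<one> \<ominus> y) = \<one> \<ominus> (y \<oplus> y) \<oplus> y \<otimes> y"
      using y by (simp add: minus_eq l_distr r_distr l_minus r_minus minus_add a_assoc)
    also have "\<dots> = \<one> \<ominus> c" unfolding two using y c by algebra
    finally show "(\<one> \<ominus> y) \<otimes> (\<one> \<ominus> y) = \<one> \<ominus> c" .
    fix d assume d: "d \<in> carrier A" "d \<otimes> c = c \<otimes> d"
    then show "d \<otimes> (\<one> \<ominus> y) = (\<one> \<ominus> y) \<otimes> d"
      using ycomm[OF d] y by (simp add: minus_eq r_distr l_distr r_minus l_minus)
  qed
qed

text \<open>
  A self-adjoint \<open>a\<close> with \<open>\<parallel>a\<parallel> < 1\<close> is the real part of the unitary \<open>a + i b\<close>, where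
  \<open>b\<^sup>2 = 1 - a\<^sup>2\<close>, and every C*-seminorm is at most \<open>1\<close> on unitaries.
\<close>

theorem cstar_seminorm_le_norm:
  assumes q: "cstar_seminorm A q" and x: "x \<in> carrier A"
  shows "q x \<le> cnorm A x"
proof -
  interpret Q: seminormed_star_algebra A q by unfold_locales (rule q)
  have unit: "q a \<le> 1" if a: "a \<in> carrier A" "star A a = a" "cnorm A a < 1" for a
  proof -
    have "cnorm A (a \<otimes> a) < 1"
      using N.cstar[OF a(1)] a N.nonneg[OF a(1)] by (simp add: power_less_one_iff)
    \<comment> \<open>As \<open>a\<close> commutes with its square, it commutes with the root
      \<open>b\<close>. The cross terms in the product of \<open>star A v\<close> and
      \<open>v\<close> then cancel and leave the sum of the squares of \<open>a\<close> and
      \<open>b\<close>.\<close>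
    then obtain b where b: "b \<in> carrier A" "star A b = b" "b \<otimes> b = \<one> \<ominus> a \<otimes> a"
      and comm: "a \<otimes> b = b \<otimes> a"
      using square_root_one_minus[of "a \<otimes> a"] a by (metis m_assoc m_closed star_mult)
    define v where "v = a \<oplus> \<i> \<odot> b"
    have v: "v \<in> carrier A" using a b by (simp add: v_def smult_closed)
    have sv: "star A v = a \<oplus> (- \<i>) \<odot> b"
      using a b by (simp add: v_def star_add star_smult smult_closed)
    have "star A v \<otimes> v = (a \<oplus> (- \<i>) \<odot> b) \<otimes> (a \<oplus> \<i> \<odot> b)"
      by (subst sv) (simp add: v_def)
    also have "\<dots> = a \<otimes> a \<oplus> \<i> \<odot> (a \<otimes> b) \<oplus> ((- \<i>) \<odot> (a \<otimes> b) \<oplus> b \<otimes> b)"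
      using a(1) b(1,2) comm
      by (simp add: l_distr r_distr smult_add_right smult_mult_left smult_mult_right smult_closed
          smult_smult smult_1 a_ac)
    also have "\<i> \<odot> (a \<otimes> b) \<oplus> ((- \<i>) \<odot> (a \<otimes> b) \<oplus> b \<otimes> b) = b \<otimes> b"
      using a b smult_add_left[of "a \<otimes> b" \<i> "- \<i>"] by (simp add: smult_closed flip: a_assoc)
    then have "a \<otimes> a \<oplus> \<i> \<odot> (a \<otimes> b) \<oplus> ((- \<i>) \<odot> (a \<otimes> b) \<oplus> b \<otimes> b) = a \<otimes> a \<oplus> b \<otimes> b"
      using a b by (simp add: a_assoc smult_closed)
    also have "\<dots> = \<one>" unfolding b(3) using a by algebra
    finally have "(q v)\<^sup>2 = q \<one>" using Q.cstar[OF v] by simp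
    then have "(q v)\<^sup>2 \<le> 1\<^sup>2" using Q.p_one_le by simp
    then have qv: "q v \<le> 1" by (rule power2_le_imp_le) simp
    have "v \<oplus> star A v = (a \<oplus> a) \<oplus> (\<i> \<odot> b \<oplus> (- \<i>) \<odot> b)"
      unfolding sv unfolding v_def using a b by (simp add: a_ac smult_closed)
    also have "\<i> \<odot> b \<oplus> (- \<i>) \<odot> b = \<zero>"
      using smult_add_left[OF b(1), of \<i> "- \<i>"] b by simp
    also have "(a \<oplus> a) \<oplus> \<zero> = 2 \<odot> a"
      using smult_add_left[OF a(1), of 1 1] a by (simp add: smult_1)
    finally have "2 * q a \<le> q v + q (star A v)"
      using Q.triangle[OF v star_closed[OF v]] a by (simp add: Q.p_smult)
    then show ?thesis using qv Q.p_star[OF v] by simp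
  qed
  have sa: "q a \<le> cnorm A a" if a: "a \<in> carrier A" "star A a = a" for a
  proof (rule field_le_epsilon)
    fix e :: real assume e: "e > 0"
    \<comment> \<open>The square root requires norm strictly below 1, so \<open>a\<close> is divided
      by a number slightly larger than its norm.\<close>
    define t where "t = cnorm A a + e"
    have t: "t > 0" "cnorm A a < t" using e N.nonneg[OF a(1)] by (auto simp: t_def)
    define a' where "a' = complex_of_real (inverse t) \<odot> a"
    have "q a' \<le> 1"
      by (rule unit) (use a t in \<open>auto simp: a'_def smult_closed star_smult N.p_smult norm_inverse norm_divide field_simps\<close>)
    moreover have "q a' = q a / t"
      using t a by (simp add: a'_def Q.p_smult norm_inverse norm_divide divide_inverse mult.commute)
    ultimately have "q a \<le> t" using t by (simp add: pos_divide_le_eq)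
    then show "q a \<le> cnorm A a + e" by (simp add: t_def)
  qed
  \<comment> \<open>The C*-identity for both seminorms reduces a general \<open>x\<close> to the
    self-adjoint product of \<open>star A x\<close> and \<open>x\<close>.\<close>
  have "(q x)\<^sup>2 \<le> (cnorm A x)\<^sup>2"
    using sa[of "star A x \<otimes> x"] x by (simp add: star_mult star_star star_closed Q.cstar N.cstar)
  then show ?thesis by (rule power2_le_imp_le) (rule N.nonneg[OF x])
qed

end

section \<open>Unital *-homomorphisms\<close>

lemma star_homI:
  assumes "\<And>x. x \<in> carrier A \<Longrightarrow> f x \<in> carrier B"
    and "\<And>x y. x \<in> carrier A \<Longrightarrow> y \<in> carrier A \<Longrightarrow> f (x \<otimes>\<^bsub>A\<^esub> y) = f x \<otimes>\<^bsub>B\<^esub> f y"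
    and "\<And>x y. x \<in> carrier A \<Longrightarrow> y \<in> carrier A \<Longrightarrow> f (x \<oplus>\<^bsub>A\<^esub> y) = f x \<oplus>\<^bsub>B\<^esub> f y"
    and "f \<one>\<^bsub>A\<^esub> = \<one>\<^bsub>B\<^esub>"
    and "\<And>c x. x \<in> carrier A \<Longrightarrow> f (c \<odot>\<^bsub>A\<^esub> x) = c \<odot>\<^bsub>B\<^esub> f x"
    and "\<And>x. x \<in> carrier A \<Longrightarrow> f (star A x) = star B (f x)"
  shows "f \<in> star_hom A B"
  using assms by (simp add: star_hom_def ring_hom_def)

lemma star_homD:
  assumes "f \<in> star_hom A B"
  shows "x \<in> carrier A \<Longrightarrow> f x \<in> carrier B"
    and "x \<in> carrier A \<Longrightarrow> y \<in> carrier A \<Longrightarrow> f (x \<otimes>\<^bsub>A\<^esub> y) = f x \<otimes>\<^bsub>B\<^esub> f y"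
    and "x \<in> carrier A \<Longrightarrow> y \<in> carrier A \<Longrightarrow> f (x \<oplus>\<^bsub>A\<^esub> y) = f x \<oplus>\<^bsub>B\<^esub> f y"
    and "f \<one>\<^bsub>A\<^esub> = \<one>\<^bsub>B\<^esub>"
    and "x \<in> carrier A \<Longrightarrow> f (c \<odot>\<^bsub>A\<^esub> x) = c \<odot>\<^bsub>B\<^esub> f x"
    and "x \<in> carrier A \<Longrightarrow> f (star A x) = star B (f x)"
  using assms by (auto simp: star_hom_def ring_hom_def)

lemma star_hom_comp:
  "f \<in> star_hom A B \<Longrightarrow> g \<in> star_hom B C \<Longrightarrow> g \<circ> f \<in> star_hom A C"
  by (rule star_homI) (simp_all add: star_homD)

lemma star_hom_diff:
  assumes "star_algebra A" "star_algebra B" "f \<in> star_hom A B" "x \<in> carrier A" "y \<in> carrier A"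
  shows "f (x \<ominus>\<^bsub>A\<^esub> y) = f x \<ominus>\<^bsub>B\<^esub> f y"
proof -
  interpret A: star_algebra A by fact
  interpret B: star_algebra B by fact
  show ?thesis
    using assms(3-5) star_homD(5)[OF assms(3,5), of "-1"]
    by (simp add: A.minus_eq B.minus_eq star_homD A.smult_minus_one B.smult_minus_one)
qed

lemma star_hom_zero:
  assumes "star_algebra A" "star_algebra B" "f \<in> star_hom A B"
  shows "f \<zero>\<^bsub>A\<^esub> = \<zero>\<^bsub>B\<^esub>"
proof -
  interpret A: star_algebra A by fact
  interpret B: star_algebra B by fact
  show ?thesis
    using star_homD(5)[OF assms(3) A.zero_closed, of 0] star_homD(1)[OF assms(3) A.zero_closed] by simp
qed

lemma star_hom_finsum:
  assumes A: "star_algebra A" and B: "star_algebra B" and f: "f \<in> star_hom A B"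
    and "finite I" "\<And>i. i \<in> I \<Longrightarrow> x i \<in> carrier A"
  shows "f (\<Oplus>\<^bsub>A\<^esub>i\<in>I. x i) = (\<Oplus>\<^bsub>B\<^esub>i\<in>I. f (x i))"
proof -
  interpret A: star_algebra A by fact
  interpret B: star_algebra B by fact
  from assms(4,5) show ?thesis
  proof (induction I rule: finite_induct)
    case empty
    then show ?case by (simp add: star_hom_zero[OF A B f])
  next
    case (insert i I)
    then have "x \<in> I \<rightarrow> carrier A" "(\<lambda>i. f (x i)) \<in> I \<rightarrow> carrier B"
      by (auto simp: star_homD(1)[OF f])
    with insert show ?case
      by (simp add: A.finsum_insert B.finsum_insert star_homD[OF f] A.finsum_closed)
  qed
qed

section \<open>Completions\<close>

context seminormed_star_algebra
begin

abbreviation "cs \<equiv> cauchy_seqs A p"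
abbreviation "cls \<equiv> completion_class A p"
abbreviation "C \<equiv> cstar_completion A p"

lemma csI:
  "(\<And>n. X n \<in> carrier A) \<Longrightarrow> (\<And>e. e > 0 \<Longrightarrow> \<exists>M. \<forall>m\<ge>M. \<forall>n\<ge>M. p (X m \<ominus> X n) < e) \<Longrightarrow> X \<in> cs"
  by (simp add: cauchy_seqs_def)

lemma cs_closed: "X \<in> cs \<Longrightarrow> X n \<in> carrier A"
  by (simp add: cauchy_seqs_def)

lemma csD: "X \<in> cs \<Longrightarrow> e > 0 \<Longrightarrow> \<exists>M. \<forall>m\<ge>M. \<forall>n\<ge>M. p (X m \<ominus> X n) < e"
  by (simp add: cauchy_seqs_def)

lemma cs_const: "x \<in> carrier A \<Longrightarrow> (\<lambda>n. x) \<in> cs"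
  by (rule csI) (auto simp: minus_eq r_neg)

lemma cs_lipschitz:
  assumes X: "X \<in> cs" and Z: "\<And>n. Z n \<in> carrier A"
    and le: "\<And>m n. p (Z m \<ominus> Z n) \<le> K * p (X m \<ominus> X n)" and K: "K \<ge> 0"
  shows "Z \<in> cs"
proof (rule csI[OF Z])
  fix e :: real assume e: "e > 0"
  \<comment> \<open>The 1 is added because the Lipschitz constant may be 0.\<close>
  then have "e / (K + 1) > 0" using K by simp
  then obtain M where M: "\<And>m n. m \<ge> M \<Longrightarrow> n \<ge> M \<Longrightarrow> p (X m \<ominus> X n) < e / (K + 1)"
    using csD[OF X] by blast
  have "p (Z m \<ominus> Z n) < e" if "m \<ge> M" "n \<ge> M" for m n
  proof -
    have "p (X m \<ominus> X n) * (K + 1) < e"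
      using M[OF that] K by (simp add: pos_less_divide_eq)
    then show ?thesis
      using le[of m n] nonneg[of "X m \<ominus> X n"] cs_closed[OF X] by (simp add: algebra_simps)
  qed
  then show "\<exists>M. \<forall>m\<ge>M. \<forall>n\<ge>M. p (Z m \<ominus> Z n) < e" by blast
qed

lemma cs_smult: "X \<in> cs \<Longrightarrow> (\<lambda>n. c \<odot> X n) \<in> cs"
  by (rule cs_lipschitz[where K = "cmod c"]) (auto simp: smult_closed cs_closed p_smult_diff)

lemma cs_uminus: "X \<in> cs \<Longrightarrow> (\<lambda>n. \<ominus> X n) \<in> cs"
  using cs_smult[of X "-1"] by (simp add: smult_minus_one cs_closed)

lemma cs_star: "X \<in> cs \<Longrightarrow> (\<lambda>n. star A (X n)) \<in> cs"
  by (rule cs_lipschitz[where K = 1]) (auto simp: star_closed cs_closed p_star_diff)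

lemma cs_Cauchy_norm: "X \<in> cs \<Longrightarrow> Cauchy (\<lambda>n. p (X n))"
proof (rule CauchyI)
  fix e :: real assume X: "X \<in> cs" and "e > 0"
  then obtain M where M: "\<And>m n. m \<ge> M \<Longrightarrow> n \<ge> M \<Longrightarrow> p (X m \<ominus> X n) < e"
    using csD[OF X] by blast
  then show "\<exists>M. \<forall>m\<ge>M. \<forall>n\<ge>M. norm (p (X m) - p (X n)) < e"
    using p_reverse_triangle[OF cs_closed[OF X] cs_closed[OF X]]
    by (metis order_le_less_trans real_norm_def)
qed

lemma cs_norm_convergent: "X \<in> cs \<Longrightarrow> convergent (\<lambda>n. p (X n))"
  using cs_Cauchy_norm Cauchy_convergent_iff by blast

lemma cs_bounded:
  assumes "X \<in> cs" shows "\<exists>K>0. \<forall>n. p (X n) \<le> K"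
proof -
  have "Bseq (\<lambda>n. p (X n))"
    using cs_Cauchy_norm[OF assms] by (rule Cauchy_Bseq)
  then obtain K where "K > 0" "\<forall>n. norm (p (X n)) \<le> K" by (rule BseqE)
  then show ?thesis by (metis abs_ge_self order_trans real_norm_def)
qed

lemma cs_add:
  assumes X: "X \<in> cs" and Y: "Y \<in> cs" shows "(\<lambda>n. X n \<oplus> Y n) \<in> cs"
proof (rule csI)
  fix e :: real assume e: "e > 0"
  then obtain M M' where
    M: "\<And>m n. m \<ge> M \<Longrightarrow> n \<ge> M \<Longrightarrow> p (X m \<ominus> X n) < e / 2" and
    M': "\<And>m n. m \<ge> M' \<Longrightarrow> n \<ge> M' \<Longrightarrow> p (Y m \<ominus> Y n) < e / 2"
    using csD[OF X, of "e / 2"] csD[OF Y, of "e / 2"] by (metis half_gt_zero)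
  have "p ((X m \<oplus> Y m) \<ominus> (X n \<oplus> Y n)) < e" if "m \<ge> max M M'" "n \<ge> max M M'" for m n
    using p_add_diff_le[of "X m" "Y m" "X n" "Y n"] M[of m n] M'[of m n] that cs_closed X Y
    by fastforce
  then show "\<exists>M. \<forall>m\<ge>M. \<forall>n\<ge>M. p ((X m \<oplus> Y m) \<ominus> (X n \<oplus> Y n)) < e" by blast
qed (use X Y cs_closed in auto)

lemma cs_mult:
  assumes X: "X \<in> cs" and Y: "Y \<in> cs" shows "(\<lambda>n. X n \<otimes> Y n) \<in> cs"
proof (rule csI)
  fix e :: real assume e: "e > 0"
  obtain K where K: "K > 0" "\<And>n. p (X n) \<le> K" using cs_bounded[OF X] by blast
  obtain L where L: "L > 0" "\<And>n. p (Y n) \<le> L" using cs_bounded[OF Y] by blast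
  have "e / (2 * L) > 0" "e / (2 * K) > 0" using e K L by auto
  then obtain M M' where
    M: "\<And>m n. m \<ge> M \<Longrightarrow> n \<ge> M \<Longrightarrow> p (X m \<ominus> X n) < e / (2 * L)" and
    M': "\<And>m n. m \<ge> M' \<Longrightarrow> n \<ge> M' \<Longrightarrow> p (Y m \<ominus> Y n) < e / (2 * K)"
    using csD[OF X, of "e / (2 * L)"] csD[OF Y, of "e / (2 * K)"] by metis
  have "p ((X m \<otimes> Y m) \<ominus> (X n \<otimes> Y n)) < e" if mn: "m \<ge> max M M'" "n \<ge> max M M'" for m n
  proof -
    note cl = cs_closed[OF X] cs_closed[OF Y]
    have "p (X m) * p (Y m \<ominus> Y n) \<le> K * p (Y m \<ominus> Y n)"
      using K cl nonneg by (intro mult_right_mono) auto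
    also have "\<dots> < K * (e / (2 * K))"
      using K M'[of m n] mn by (intro mult_strict_left_mono) auto
    finally have 1: "p (X m) * p (Y m \<ominus> Y n) < e / 2" using K by simp
    have "p (X m \<ominus> X n) * p (Y n) \<le> p (X m \<ominus> X n) * L"
      using L cl nonneg by (intro mult_left_mono) auto
    also have "\<dots> < (e / (2 * L)) * L"
      using L M[of m n] mn by (intro mult_strict_right_mono) auto
    finally have 2: "p (X m \<ominus> X n) * p (Y n) < e / 2" using L by simp
    show ?thesis
      using p_mult_diff_le[of "X m" "Y m" "X n" "Y n"] 1 2 cl by simp
  qed
  then show "\<exists>M. \<forall>m\<ge>M. \<forall>n\<ge>M. p ((X m \<otimes> Y m) \<ominus> (X n \<otimes> Y n)) < e" by blast
qed (use X Y cs_closed in auto)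

lemma equiv_completion_rel: "equiv cs (completion_rel A p)"
proof (rule equivI)
  show "completion_rel A p \<subseteq> cs \<times> cs" by (auto simp: completion_rel_def)
  show "refl_on cs (completion_rel A p)"
    by (auto simp: refl_on_def completion_rel_def cs_closed minus_eq r_neg)
  show "sym (completion_rel A p)"
    by (auto simp: sym_def completion_rel_def p_diff_commute cs_closed)
  show "trans (completion_rel A p)"
  proof (rule transI)
    fix X Y Z assume "(X, Y) \<in> completion_rel A p" "(Y, Z) \<in> completion_rel A p"
    then have X: "X \<in> cs" and Y: "Y \<in> cs" and Z: "Z \<in> cs"
      and l: "(\<lambda>n. p (X n \<ominus> Y n)) \<longlonglongrightarrow> 0" "(\<lambda>n. p (Y n \<ominus> Z n)) \<longlonglongrightarrow> 0"
      by (auto simp: completion_rel_def)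
    have "(\<lambda>n. p (X n \<ominus> Z n)) \<longlonglongrightarrow> 0"
      by (rule null_sandwich[OF _ p_diff_triangle])
         (use tendsto_add[OF l] X Y Z cs_closed in auto)
    then show "(X, Z) \<in> completion_rel A p" using X Z by (simp add: completion_rel_def)
  qed
qed

lemma cls_eq_iff: "X \<in> cs \<Longrightarrow> Y \<in> cs \<Longrightarrow> cls X = cls Y \<longleftrightarrow> (\<lambda>n. p (X n \<ominus> Y n)) \<longlonglongrightarrow> 0"
  using eq_equiv_class_iff[OF equiv_completion_rel, of X Y]
  by (simp add: completion_class_def completion_rel_def)

lemma carrier_C: "carrier C = cls ` cs"
  by (auto simp: cstar_completion_def completion_class_def quotient_def)

lemma C_cases:
  assumes "z \<in> carrier C" obtains X where "X \<in> cs" "z = cls X"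
  using assms by (auto simp: carrier_C)

lemma cls_closed [simp]: "X \<in> cs \<Longrightarrow> cls X \<in> carrier C"
  by (simp add: carrier_C)

lemma rel_iff: "(X, Y) \<in> completion_rel A p \<longleftrightarrow> X \<in> cs \<and> Y \<in> cs \<and> (\<lambda>n. p (X n \<ominus> Y n)) \<longlonglongrightarrow> 0"
  by (simp add: completion_rel_def)

text \<open>Operations of the completion are unions over all representatives. Once the class of the
  result is independent of the representatives, the union collapses to a single class; the same
  scheme serves the other operations.\<close>

lemma add_C [simp]:
  assumes "X \<in> cs" "Y \<in> cs" shows "cls X \<oplus>\<^bsub>C\<^esub> cls Y = cls (\<lambda>n. X n \<oplus> Y n)"
proof -
  have "congruent2 (completion_rel A p) (completion_rel A p) (\<lambda>X Y. cls (\<lambda>n. X n \<oplus> Y n))"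
  proof (rule congruent2I')
    fix X X' Y Y' assume r: "(X, X') \<in> completion_rel A p" "(Y, Y') \<in> completion_rel A p"
    have "(\<lambda>n. p ((X n \<oplus> Y n) \<ominus> (X' n \<oplus> Y' n))) \<longlonglongrightarrow> 0"
      by (rule null_sandwich[OF _ p_add_diff_le])
         (use r tendsto_add[of "\<lambda>n. p (X n \<ominus> X' n)" 0 _ "\<lambda>n. p (Y n \<ominus> Y' n)" 0] in
           \<open>auto simp: rel_iff cs_closed\<close>)
    then show "cls (\<lambda>n. X n \<oplus> Y n) = cls (\<lambda>n. X' n \<oplus> Y' n)"
      using r by (simp add: cls_eq_iff cs_add rel_iff)
  qed
  from UN_equiv_class2[OF equiv_completion_rel equiv_completion_rel this assms]
  show ?thesis by (simp add: cstar_completion_def completion_class_def)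
qed

lemma mult_C [simp]:
  assumes "X \<in> cs" "Y \<in> cs" shows "cls X \<otimes>\<^bsub>C\<^esub> cls Y = cls (\<lambda>n. X n \<otimes> Y n)"
proof -
  have "congruent2 (completion_rel A p) (completion_rel A p) (\<lambda>X Y. cls (\<lambda>n. X n \<otimes> Y n))"
  proof (rule congruent2I')
    fix X X' Y Y' assume r: "(X, X') \<in> completion_rel A p" "(Y, Y') \<in> completion_rel A p"
    then have X: "X \<in> cs" and X': "X' \<in> cs" and Y: "Y \<in> cs" and Y': "Y' \<in> cs"
      and lX: "(\<lambda>n. p (X n \<ominus> X' n)) \<longlonglongrightarrow> 0" and lY: "(\<lambda>n. p (Y n \<ominus> Y' n)) \<longlonglongrightarrow> 0"
      by (auto simp: rel_iff)
    obtain K where K: "K > 0" "\<And>n. p (X n) \<le> K" using cs_bounded[OF X] by blast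
    obtain L where L: "L > 0" "\<And>n. p (Y' n) \<le> L" using cs_bounded[OF Y'] by blast
    note cl = cs_closed[OF X] cs_closed[OF Y] cs_closed[OF X'] cs_closed[OF Y']
    have "(\<lambda>n. p ((X n \<otimes> Y n) \<ominus> (X' n \<otimes> Y' n))) \<longlonglongrightarrow> 0"
    proof (rule null_sandwich)
      show "p ((X n \<otimes> Y n) \<ominus> (X' n \<otimes> Y' n)) \<le> K * p (Y n \<ominus> Y' n) + p (X n \<ominus> X' n) * L" for n
        using p_mult_diff_le[of "X n" "Y n" "X' n" "Y' n"] cl nonneg
          mult_right_mono[OF K(2)[of n], of "p (Y n \<ominus> Y' n)"]
          mult_left_mono[OF L(2)[of n], of "p (X n \<ominus> X' n)"] by (smt (verit) minus_closed)
      show "(\<lambda>n. K * p (Y n \<ominus> Y' n) + p (X n \<ominus> X' n) * L) \<longlonglongrightarrow> 0"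
        using tendsto_add[OF tendsto_mult[OF tendsto_const lY, of K] tendsto_mult[OF lX tendsto_const, of L]]
        by simp
    qed (use cl in auto)
    then show "cls (\<lambda>n. X n \<otimes> Y n) = cls (\<lambda>n. X' n \<otimes> Y' n)"
      using X X' Y Y' by (simp add: cls_eq_iff cs_mult)
  qed
  from UN_equiv_class2[OF equiv_completion_rel equiv_completion_rel this assms]
  show ?thesis by (simp add: cstar_completion_def completion_class_def)
qed

lemma smult_C [simp]:
  assumes "X \<in> cs" shows "c \<odot>\<^bsub>C\<^esub> cls X = cls (\<lambda>n. c \<odot> X n)"
proof -
  have "congruent (completion_rel A p) (\<lambda>X. cls (\<lambda>n. c \<odot> X n))"
  proof (rule congruentI)
    fix X X' assume r: "(X, X') \<in> completion_rel A p"
    have "(\<lambda>n. cmod c * p (X n \<ominus> X' n)) \<longlonglongrightarrow> cmod c * 0"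
      by (intro tendsto_intros) (use r in \<open>simp add: rel_iff\<close>)
    then show "cls (\<lambda>n. c \<odot> X n) = cls (\<lambda>n. c \<odot> X' n)"
      using r by (simp add: cls_eq_iff cs_smult rel_iff p_smult_diff cs_closed)
  qed
  from UN_equiv_class[OF equiv_completion_rel this assms]
  show ?thesis by (simp add: cstar_completion_def completion_class_def)
qed

lemma star_C [simp]:
  assumes "X \<in> cs" shows "star C (cls X) = cls (\<lambda>n. star A (X n))"
proof -
  have "congruent (completion_rel A p) (\<lambda>X. cls (\<lambda>n. star A (X n)))"
    by (rule congruentI) (simp add: cls_eq_iff cs_star rel_iff p_star_diff cs_closed)
  from UN_equiv_class[OF equiv_completion_rel this assms]
  show ?thesis by (simp add: cstar_completion_def completion_class_def)
qed

lemma zero_C: "\<zero>\<^bsub>C\<^esub> = cls (\<lambda>n. \<zero>)"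
  and one_C: "\<one>\<^bsub>C\<^esub> = cls (\<lambda>n. \<one>)"
  by (simp_all add: cstar_completion_def)

text \<open>Equivalent Cauchy sequences have the same limit of seminorms, by the reverse triangle
  inequality; this makes the definite description in \<open>cnorm\<close> well determined.\<close>

lemma cnorm_C:
  assumes X: "X \<in> cs" and r: "(\<lambda>n. p (X n)) \<longlonglongrightarrow> r"
  shows "cnorm C (cls X) = r"
proof -
  have lim: "(\<lambda>n. p (Y n)) \<longlonglongrightarrow> r" if "Y \<in> cls X" for Y
  proof (rule Lim_transform2[OF r])
    from that have Y: "Y \<in> cs" and l: "(\<lambda>n. p (X n \<ominus> Y n)) \<longlonglongrightarrow> 0"
      by (auto simp: completion_class_def rel_iff)
    show "(\<lambda>n. p (X n) - p (Y n)) \<longlonglongrightarrow> 0"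
      by (rule tendsto_rabs_zero_cancel, rule tendsto_sandwich[OF _ _ tendsto_const l])
         (use p_reverse_triangle cs_closed X Y in auto)
  qed
  have "X \<in> cls X"
    using equiv_class_self[OF equiv_completion_rel X] by (simp add: completion_class_def)
  then show ?thesis
    unfolding cstar_completion_def cstar.simps
    by (intro the_equality) (use lim LIMSEQ_unique in blast)+
qed

lemma cnorm_C_lim: "X \<in> cs \<Longrightarrow> (\<lambda>n. p (X n)) \<longlonglongrightarrow> cnorm C (cls X)"
  using cnorm_C cs_norm_convergent by (metis convergent_def)

lemma cnorm_C_const: "x \<in> carrier A \<Longrightarrow> cnorm C (cls (\<lambda>n. x)) = p x"
  by (rule cnorm_C) (auto simp: cs_const)

lemma star_algebra_C: "star_algebra C"
proof -
  note ops = cs_add cs_mult cs_smult cs_star cs_const cs_closed zero_C one_C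
  interpret C: abelian_group C
  proof (rule abelian_groupI)
    fix x assume "x \<in> carrier C"
    then obtain X where X: "X \<in> cs" "x = cls X" by (rule C_cases)
    show "\<exists>y\<in>carrier C. y \<oplus>\<^bsub>C\<^esub> x = \<zero>\<^bsub>C\<^esub>"
      by (rule bexI[of _ "cls (\<lambda>n. \<ominus> X n)"])
         (use X in \<open>simp_all add: ops cs_uminus l_neg\<close>)
  qed (((erule C_cases)+)?, simp add: ops a_ac)+
  interpret C: monoid C
    by (rule monoidI; ((erule C_cases)+)?; simp add: ops m_assoc)
  interpret C: ring C
    by (rule ringI; ((erule C_cases)+)?;
        simp add: ops l_distr r_distr C.abelian_group_axioms C.monoid_axioms)
  show ?thesis
    by unfold_locales
       (((erule C_cases)+)?, simp add: ops smult_add_left smult_add_right smult_smult smult_1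
         smult_mult_left smult_mult_right star_star star_add star_smult star_mult)+
qed

lemma diff_C:
  assumes "X \<in> cs" "Y \<in> cs" shows "cls X \<ominus>\<^bsub>C\<^esub> cls Y = cls (\<lambda>n. X n \<ominus> Y n)"
proof -
  interpret C: star_algebra C by (rule star_algebra_C)
  have "cls X \<ominus>\<^bsub>C\<^esub> cls Y = cls X \<oplus>\<^bsub>C\<^esub> ((-1) \<odot>\<^bsub>C\<^esub> cls Y)"
    using assms by (simp only: C.minus_eq C.smult_minus_one[OF cls_closed])
  then show ?thesis
    using assms by (simp add: cs_smult cs_uminus minus_eq smult_minus_one cs_closed)
qed

lemma cs_diff: "X \<in> cs \<Longrightarrow> Y \<in> cs \<Longrightarrow> (\<lambda>n. X n \<ominus> Y n) \<in> cs"
  using cs_add[of X "\<lambda>n. (-1) \<odot> Y n"] cs_smult[of Y "-1"]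
  by (simp add: minus_eq smult_minus_one cs_closed)

lemma cstar_seminorm_C: "cstar_seminorm C (cnorm C)"
  unfolding cstar_seminorm_def
proof (intro conjI ballI allI)
  fix x y c assume "x \<in> carrier C"
  then obtain X where X: "X \<in> cs" and x: "x = cls X" by (rule C_cases)
  note lX = cnorm_C_lim[OF X]
  show "0 \<le> cnorm C x"
    unfolding x by (rule LIMSEQ_le_const[OF lX]) (use nonneg cs_closed[OF X] in blast)
  show "cnorm C (c \<odot>\<^bsub>C\<^esub> x) = cmod c * cnorm C x"
    unfolding x smult_C[OF X]
    by (rule cnorm_C[OF cs_smult[OF X]])
       (use tendsto_mult[OF tendsto_const lX] cs_closed[OF X] in \<open>simp add: p_smult\<close>)
  show "cnorm C (star C x \<otimes>\<^bsub>C\<^esub> x) = (cnorm C x)\<^sup>2"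
    unfolding x star_C[OF X] mult_C[OF cs_star[OF X] X]
    by (rule cnorm_C[OF cs_mult[OF cs_star[OF X] X]])
       (use tendsto_power[OF lX] cs_closed[OF X] in \<open>simp add: cstar\<close>)
  assume "y \<in> carrier C"
  then obtain Y where Y: "Y \<in> cs" and y: "y = cls Y" by (rule C_cases)
  note lY = cnorm_C_lim[OF Y]
  show "cnorm C (x \<oplus>\<^bsub>C\<^esub> y) \<le> cnorm C x + cnorm C y"
    unfolding x y add_C[OF X Y]
    by (rule LIMSEQ_le[OF cnorm_C_lim[OF cs_add[OF X Y]] tendsto_add[OF lX lY]])
       (use triangle cs_closed X Y in blast)
  show "cnorm C (x \<otimes>\<^bsub>C\<^esub> y) \<le> cnorm C x * cnorm C y"
    unfolding x y mult_C[OF X Y]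
    by (rule LIMSEQ_le[OF cnorm_C_lim[OF cs_mult[OF X Y]] tendsto_mult[OF lX lY]])
       (use p_mult cs_closed X Y in blast)
qed

text \<open>The distance from a constant class to \<open>cls W\<close> is the limit over
  \<open>i\<close> of \<open>p (W m \<ominus> W i)\<close>, which the Cauchy property controls. It
  serves both the completeness of the completion and the uniqueness of homomorphisms on it.\<close>

lemma const_classes_dense:
  assumes Wcs: "W \<in> cs"
  shows "(\<lambda>m. cnorm C (cls (\<lambda>n. W m) \<ominus>\<^bsub>C\<^esub> cls W)) \<longlonglongrightarrow> 0"
proof (rule LIMSEQ_I)
  interpret C: star_algebra C by (rule star_algebra_C)
  interpret S: seminormed_star_algebra C "cnorm C"
    by unfold_locales (rule cstar_seminorm_C)
  note W = cs_closed[OF Wcs]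
  fix e :: real assume e: "e > 0"
  then obtain K where K: "\<And>m n. m \<ge> K \<Longrightarrow> n \<ge> K \<Longrightarrow> p (W m \<ominus> W n) < e / 2"
    using csD[OF Wcs, of "e / 2"] by auto
  have "cnorm C (cls (\<lambda>n. W m) \<ominus>\<^bsub>C\<^esub> cls W) \<le> e / 2" if "m \<ge> K" for m
  proof (rule LIMSEQ_le_const2)
    show "(\<lambda>i. p (W m \<ominus> W i)) \<longlonglongrightarrow> cnorm C (cls (\<lambda>n. W m) \<ominus>\<^bsub>C\<^esub> cls W)"
      using cnorm_C_lim[OF cs_diff[OF cs_const[OF W[of m]] Wcs]]
      by (simp add: diff_C Wcs cs_const W)
    show "\<exists>N. \<forall>i\<ge>N. p (W m \<ominus> W i) \<le> e / 2"
      using K[OF that] less_imp_le by blast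
  qed
  moreover have "0 \<le> cnorm C (cls (\<lambda>n. W m) \<ominus>\<^bsub>C\<^esub> cls W)" for m
    by (rule S.nonneg) (simp add: cs_const W Wcs)
  ultimately have "norm (cnorm C (cls (\<lambda>n. W m) \<ominus>\<^bsub>C\<^esub> cls W) - 0) < e" if "m \<ge> K" for m
    using that e by fastforce
  then show "\<exists>no. \<forall>m\<ge>no. norm (cnorm C (cls (\<lambda>n. W m) \<ominus>\<^bsub>C\<^esub> cls W) - 0) < e" by blast
qed

theorem cstar_algebra_completion: "cstar_algebra C"
proof -
  interpret C: star_algebra C by (rule star_algebra_C)
  show ?thesis
  proof
    show "cstar_seminorm C (cnorm C)" by (rule cstar_seminorm_C)
    fix x assume "x \<in> carrier C" and x0: "cnorm C x = 0"
    then obtain X where X: "X \<in> cs" and x: "x = cls X" by (auto elim: C_cases)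
    have "(\<lambda>n. p (X n)) \<longlonglongrightarrow> 0" using cnorm_C_lim[OF X] x0 x by simp
    then show "x = \<zero>\<^bsub>C\<^esub>"
      using X by (simp add: x zero_C cls_eq_iff cs_const minus_eq cs_closed)
  next
    fix Z assume "Z \<in> cauchy_seqs C (cnorm C)"
    then have Z: "\<And>n. Z n \<in> carrier C"
      and Zc: "\<And>e. e > 0 \<Longrightarrow> \<exists>M. \<forall>m\<ge>M. \<forall>n\<ge>M. cnorm C (Z m \<ominus>\<^bsub>C\<^esub> Z n) < e"
      by (auto simp: cauchy_seqs_def)
    have "\<forall>n. \<exists>X. X \<in> cs \<and> Z n = cls X" using Z by (meson C_cases)
    then obtain X where X: "\<And>n. X n \<in> cs" and ZX: "\<And>n. Z n = cls (X n)" by metis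
    note Xc = cs_closed[OF X]
    have "\<exists>M. \<forall>i\<ge>M. p (X m i \<ominus> X m M) < inverse (real (Suc m))" for m
      using csD[OF X, of "inverse (real (Suc m))" m] by auto
    then obtain M where M: "\<And>m i. i \<ge> M m \<Longrightarrow> p (X m i \<ominus> X m (M m)) < inverse (real (Suc m))"
      by metis
    \<comment> \<open>Diagonal argument: \<open>W m\<close> is a single term of a representative of
      \<open>Z m\<close>, chosen so late that its constant class lies within
      \<open>1 / (m + 1)\<close> of \<open>Z m\<close>. Then \<open>W\<close> is itself Cauchy and
      its class is the limit.\<close>
    define W where "W m = X m (M m)" for m
    have W: "W m \<in> carrier A" for m by (simp add: W_def Xc)
    have near: "cnorm C (cls (X m) \<ominus>\<^bsub>C\<^esub> cls (\<lambda>n. W m)) \<le> inverse (real (Suc m))" for m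
    proof (rule LIMSEQ_le_const2)
      show "(\<lambda>i. p (X m i \<ominus> W m)) \<longlonglongrightarrow> cnorm C (cls (X m) \<ominus>\<^bsub>C\<^esub> cls (\<lambda>n. W m))"
        using cnorm_C_lim[OF cs_diff[OF X[of m] cs_const[OF W[of m]]]]
        by (simp add: diff_C X cs_const W)
      show "\<exists>N. \<forall>i\<ge>N. p (X m i \<ominus> W m) \<le> inverse (real (Suc m))"
        using M[of m] less_imp_le unfolding W_def by blast
    qed
    interpret S: seminormed_star_algebra C "cnorm C"
      by unfold_locales (rule cstar_seminorm_C)
    have Wcs: "W \<in> cs"
    proof (rule csI[OF W])
      fix e :: real assume e: "e > 0"
      then obtain M1 where M1: "\<And>m n. m \<ge> M1 \<Longrightarrow> n \<ge> M1 \<Longrightarrow> cnorm C (Z m \<ominus>\<^bsub>C\<^esub> Z n) < e / 3"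
        using Zc[of "e / 3"] by auto
      obtain M2 where M2: "inverse (real (Suc M2)) < e / 3"
        using reals_Archimedean[of "e / 3"] e by auto
      have inv: "inverse (real (Suc m)) < e / 3" if "m \<ge> M2" for m
        using that by (intro order_le_less_trans[OF _ M2] le_imp_inverse_le) auto
      have "p (W m \<ominus> W n) < e" if "m \<ge> max M1 M2" "n \<ge> max M1 M2" for m n
      proof -
        let ?w = "\<lambda>m. cls (\<lambda>n. W m)"
        have wc: "?w k \<in> carrier C" for k by (simp add: cs_const W)
        have "p (W m \<ominus> W n) = cnorm C (?w m \<ominus>\<^bsub>C\<^esub> ?w n)"
          using cnorm_C_const[of "W m \<ominus> W n"] W by (simp add: diff_C cs_const)
        also have "\<dots> \<le> cnorm C (?w m \<ominus>\<^bsub>C\<^esub> Z m) + cnorm C (Z m \<ominus>\<^bsub>C\<^esub> ?w n)"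
          by (rule S.p_diff_triangle) (simp_all add: wc Z)
        also have "cnorm C (Z m \<ominus>\<^bsub>C\<^esub> ?w n) \<le> cnorm C (Z m \<ominus>\<^bsub>C\<^esub> Z n) + cnorm C (Z n \<ominus>\<^bsub>C\<^esub> ?w n)"
          by (rule S.p_diff_triangle) (simp_all add: wc Z)
        also have "cnorm C (?w m \<ominus>\<^bsub>C\<^esub> Z m) = cnorm C (Z m \<ominus>\<^bsub>C\<^esub> ?w m)"
          by (rule S.p_diff_commute) (simp_all add: wc Z)
        finally show ?thesis
          using near[of m] near[of n] inv[of m] inv[of n] M1[of m n] that by (simp add: ZX)
      qed
      then show "\<exists>M. \<forall>m\<ge>M. \<forall>n\<ge>M. p (W m \<ominus> W n) < e" by blast
    qed
    note const_lim = const_classes_dense[OF Wcs]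
    show "\<exists>l\<in>carrier C. (\<lambda>n. cnorm C (Z n \<ominus>\<^bsub>C\<^esub> l)) \<longlonglongrightarrow> 0"
    proof (rule bexI[of _ "cls W"])
      show "(\<lambda>n. cnorm C (Z n \<ominus>\<^bsub>C\<^esub> cls W)) \<longlonglongrightarrow> 0"
      proof (rule S.null_sandwich)
        show "cnorm C (Z n \<ominus>\<^bsub>C\<^esub> cls W)
            \<le> inverse (real (Suc n)) + cnorm C (cls (\<lambda>k. W n) \<ominus>\<^bsub>C\<^esub> cls W)" for n
          using S.p_diff_triangle[of "Z n" "cls (\<lambda>k. W n)" "cls W"] near[of n] Z
          by (simp add: ZX cs_const W Wcs)
        show "(\<lambda>n. inverse (real (Suc n)) + cnorm C (cls (\<lambda>k. W n) \<ominus>\<^bsub>C\<^esub> cls W)) \<longlonglongrightarrow> 0"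
          using tendsto_add[OF LIMSEQ_inverse_real_of_nat const_lim] by simp
      qed (use Z Wcs in auto)
    qed (use Wcs in simp)
  qed
qed

lemma const_star_hom: "(\<lambda>x. cls (\<lambda>n. x)) \<in> star_hom A C"
  by (simp add: star_hom_def ring_hom_def cs_const one_C)

text \<open>The estimate \<open>q (f x) \<le> p x\<close> sends Cauchy sequences to Cauchy sequences
  and null sequences to null sequences, so applying \<open>f\<close> termwise descends to
  classes.\<close>

lemma extend_star_hom:
  assumes "seminormed_star_algebra B q" and f: "f \<in> star_hom A B"
    and le: "\<And>x. x \<in> carrier A \<Longrightarrow> q (f x) \<le> p x"
  shows "\<exists>h\<in>star_hom C (cstar_completion B q).
    \<forall>X\<in>cs. h (cls X) = completion_class B q (\<lambda>n. f (X n))"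
proof -
  interpret B: seminormed_star_algebra B q by fact
  from f have fc: "\<And>x. x \<in> carrier A \<Longrightarrow> f x \<in> carrier B"
    and fm: "\<And>x y. x \<in> carrier A \<Longrightarrow> y \<in> carrier A \<Longrightarrow> f (x \<otimes> y) = f x \<otimes>\<^bsub>B\<^esub> f y"
    and fa: "\<And>x y. x \<in> carrier A \<Longrightarrow> y \<in> carrier A \<Longrightarrow> f (x \<oplus> y) = f x \<oplus>\<^bsub>B\<^esub> f y"
    and f1: "f \<one> = \<one>\<^bsub>B\<^esub>"
    and fs: "\<And>x c. x \<in> carrier A \<Longrightarrow> f (c \<odot> x) = c \<odot>\<^bsub>B\<^esub> f x"
    and fst: "\<And>x. x \<in> carrier A \<Longrightarrow> f (star A x) = star B (f x)"
    by (auto simp: star_hom_def ring_hom_def)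
  have fd: "f (x \<ominus> y) = f x \<ominus>\<^bsub>B\<^esub> f y" if "x \<in> carrier A" "y \<in> carrier A" for x y
    using that fs[of y "-1"] by (simp add: minus_eq B.minus_eq fa smult_minus_one B.smult_minus_one fc)
  have fX: "(\<lambda>n. f (X n)) \<in> B.cs" if X: "X \<in> cs" for X
  proof (rule B.csI)
    show "f (X n) \<in> carrier B" for n using X by (simp add: fc cs_closed)
    fix e :: real assume "e > 0"
    then obtain M where M: "\<And>m n. m \<ge> M \<Longrightarrow> n \<ge> M \<Longrightarrow> p (X m \<ominus> X n) < e"
      using csD[OF X] by blast
    moreover have "q (f (X m) \<ominus>\<^bsub>B\<^esub> f (X n)) \<le> p (X m \<ominus> X n)" for m n
      using le[of "X m \<ominus> X n"] cs_closed[OF X] by (simp add: fd)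
    ultimately show "\<exists>M. \<forall>m\<ge>M. \<forall>n\<ge>M. q (f (X m) \<ominus>\<^bsub>B\<^esub> f (X n)) < e"
      by (meson order_le_less_trans)
  qed
  \<comment> \<open>A representative is chosen arbitrarily; that any other one gives the same class
    is the next claim, and all algebraic properties of \<open>h\<close> are read off from
    it.\<close>
  define h where "h z = B.cls (\<lambda>n. f ((SOME X. X \<in> cs \<and> z = cls X) n))" for z
  have h: "h (cls X) = B.cls (\<lambda>n. f (X n))" if X: "X \<in> cs" for X
  proof -
    define Y where "Y = (SOME Y. Y \<in> cs \<and> cls X = cls Y)"
    have Y: "Y \<in> cs" "cls X = cls Y"
      using someI[of "\<lambda>Y. Y \<in> cs \<and> cls X = cls Y" X] X by (auto simp: Y_def)
    have "(\<lambda>n. p (Y n \<ominus> X n)) \<longlonglongrightarrow> 0"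
      using cls_eq_iff[OF Y(1) X] Y by simp
    moreover have "q (f (Y n) \<ominus>\<^bsub>B\<^esub> f (X n)) \<le> p (Y n \<ominus> X n)" for n
      using le[of "Y n \<ominus> X n"] cs_closed[OF X] cs_closed[OF Y(1)] by (simp add: fd)
    ultimately have "(\<lambda>n. q (f (Y n) \<ominus>\<^bsub>B\<^esub> f (X n))) \<longlonglongrightarrow> 0"
      using B.null_sandwich[of "\<lambda>n. f (Y n) \<ominus>\<^bsub>B\<^esub> f (X n)" "\<lambda>n. p (Y n \<ominus> X n)"]
        cs_closed[OF X] cs_closed[OF Y(1)] fc by simp
    then show ?thesis
      using B.cls_eq_iff[OF fX[OF Y(1)] fX[OF X]] by (simp add: h_def Y_def)
  qed
  note ops = cs_add cs_mult cs_smult cs_star cs_const cs_closed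
  have "h \<in> star_hom C B.C"
    by (rule star_homI; ((erule C_cases)+)?; simp add: h fX ops fm fa fs fst one_C f1 B.one_C)
  then show ?thesis using h by blast
qed

end

text \<open>Pulling back a norm is what makes *-homomorphisms contractive: on a C*-algebra the
  pulled back C*-seminorm is dominated by the norm. It is also how admissible seminorms are
  produced.\<close>

lemma star_hom_seminorm:
  assumes "star_algebra A" "star_algebra B" "cstar_seminorm B q" "f \<in> star_hom A B"
  shows "cstar_seminorm A (\<lambda>x. q (f x))"
proof -
  interpret A: star_algebra A by fact
  interpret B: seminormed_star_algebra B q
    using assms(2,3) by (simp add: seminormed_star_algebra_def seminormed_star_algebra_axioms_def)
  show ?thesis
    using assms(4)
    by (auto simp: cstar_seminorm_def star_hom_def ring_hom_def A.star_closed B.nonneg B.p_smult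
        B.triangle B.p_mult B.cstar Pi_iff)
qed

lemma complex_cstar_simps [simp]:
  "carrier complex_cstar = UNIV" "mult complex_cstar = (*)" "one complex_cstar = 1"
  "zero complex_cstar = 0" "add complex_cstar = (+)" "smult complex_cstar = (*)"
  "star complex_cstar = cnj" "cnorm complex_cstar = cmod"
  by (simp_all add: complex_cstar_def)

lemma complex_star_algebra: "star_algebra complex_cstar"
proof -
  have inverse: "\<exists>y\<in>carrier complex_cstar. y \<oplus>\<^bsub>complex_cstar\<^esub> x = \<zero>\<^bsub>complex_cstar\<^esub>" for x
    by (rule bexI[of _ "- x"]) auto
  interpret abelian_group complex_cstar
    by (rule abelian_groupI) (use inverse in \<open>auto simp: ac_simps\<close>)
  interpret monoid complex_cstar
    by (rule monoidI) (auto simp: ac_simps)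
  interpret ring complex_cstar
    by (rule ringI) (auto simp: abelian_group_axioms monoid_axioms algebra_simps)
  show ?thesis
    by unfold_locales (auto simp: algebra_simps)
qed

text \<open>Stated separately because the values should lie in the complex numbers themselves and
  not in a completion of them; limits exist there already.\<close>

lemma (in seminormed_star_algebra) extend_character:
  assumes f: "f \<in> star_hom A complex_cstar"
    and le: "\<And>x. x \<in> carrier A \<Longrightarrow> cmod (f x) \<le> p x"
  shows "\<exists>h\<in>star_hom C complex_cstar. \<forall>x\<in>carrier A. h (cls (\<lambda>n. x)) = f x"
proof -
  from f have fm: "\<And>x y. x \<in> carrier A \<Longrightarrow> y \<in> carrier A \<Longrightarrow> f (x \<otimes> y) = f x * f y"
    and fa: "\<And>x y. x \<in> carrier A \<Longrightarrow> y \<in> carrier A \<Longrightarrow> f (x \<oplus> y) = f x + f y"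
    and f1: "f \<one> = 1"
    and fs: "\<And>x c. x \<in> carrier A \<Longrightarrow> f (c \<odot> x) = c * f x"
    and fst: "\<And>x. x \<in> carrier A \<Longrightarrow> f (star A x) = cnj (f x)"
    by (auto simp: star_hom_def ring_hom_def)
  have fd: "f (x \<ominus> y) = f x - f y" if "x \<in> carrier A" "y \<in> carrier A" for x y
    using that fs[of y "-1"] by (simp add: minus_eq fa smult_minus_one)
  have conv: "convergent (\<lambda>n. f (X n))" if X: "X \<in> cs" for X
  proof (rule Cauchy_convergent, rule CauchyI)
    fix e :: real assume "e > 0"
    then obtain M where M: "\<And>m n. m \<ge> M \<Longrightarrow> n \<ge> M \<Longrightarrow> p (X m \<ominus> X n) < e"
      using csD[OF X] by blast
    moreover have "cmod (f (X m) - f (X n)) \<le> p (X m \<ominus> X n)" for m n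
      using le[of "X m \<ominus> X n"] cs_closed[OF X] by (simp add: fd)
    ultimately show "\<exists>M. \<forall>m\<ge>M. \<forall>n\<ge>M. cmod (f (X m) - f (X n)) < e"
      by (meson order_le_less_trans)
  qed
  define h where "h z = lim (\<lambda>n. f ((SOME X. X \<in> cs \<and> z = cls X) n))" for z
  have h: "(\<lambda>n. f (X n)) \<longlonglongrightarrow> h (cls X)" if X: "X \<in> cs" for X
  proof -
    define Y where "Y = (SOME Y. Y \<in> cs \<and> cls X = cls Y)"
    have Y: "Y \<in> cs" "cls X = cls Y"
      using someI[of "\<lambda>Y. Y \<in> cs \<and> cls X = cls Y" X] X by (auto simp: Y_def)
    have "(\<lambda>n. f (Y n)) \<longlonglongrightarrow> h (cls X)"
      using conv[OF Y(1)] unfolding h_def Y_def[symmetric] by (simp add: convergent_LIMSEQ_iff)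
    moreover have "(\<lambda>n. f (Y n) - f (X n)) \<longlonglongrightarrow> 0"
    proof (rule tendsto_norm_zero_cancel, rule tendsto_sandwich[OF _ _ tendsto_const])
      show "(\<lambda>n. p (Y n \<ominus> X n)) \<longlonglongrightarrow> 0" using cls_eq_iff[OF Y(1) X] Y by simp
      show "\<forall>\<^sub>F n in sequentially. cmod (f (Y n) - f (X n)) \<le> p (Y n \<ominus> X n)"
        using le[of "Y n \<ominus> X n" for n] cs_closed[OF X] cs_closed[OF Y(1)] by (simp add: fd)
    qed simp
    ultimately show ?thesis by (rule Lim_transform2)
  qed
  have hI: "h (cls X) = l" if "X \<in> cs" "(\<lambda>n. f (X n)) \<longlonglongrightarrow> l" for X l
    using h that LIMSEQ_unique by blast
  note ops = cs_add cs_mult cs_smult cs_star cs_const cs_closed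
  have h_ops: "h (cls X \<oplus>\<^bsub>C\<^esub> cls Y) = h (cls X) + h (cls Y)"
    "h (cls X \<otimes>\<^bsub>C\<^esub> cls Y) = h (cls X) * h (cls Y)"
    "h (c \<odot>\<^bsub>C\<^esub> cls X) = c * h (cls X)" "h (star C (cls X)) = cnj (h (cls X))"
    if "X \<in> cs" "Y \<in> cs" for X Y c
    using that tendsto_add[OF h h, of X Y] tendsto_mult[OF h h, of X Y]
      tendsto_mult[OF tendsto_const h, of X c] tendsto_cnj[OF h, of X]
    by (auto intro!: hI simp: ops fa fm fs fst)
  have const: "h (cls (\<lambda>n. x)) = f x" if "x \<in> carrier A" for x
    by (rule hI) (use that in \<open>auto simp: ops\<close>)
  have "h \<in> star_hom C complex_cstar"
    by (rule star_homI; ((erule C_cases)+)?; simp only: h_ops complex_cstar_simps UNIV_I)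
       (simp add: one_C const f1)
  then show ?thesis using const by blast
qed

section \<open>Free star algebras and universal C*-algebras\<close>

abbreviation letter_star :: "'g \<times> bool \<Rightarrow> 'g \<times> bool" where
  "letter_star \<equiv> \<lambda>(g, b). (g, \<not> b)"

definition word_star :: "('g \<times> bool) list \<Rightarrow> ('g \<times> bool) list" where
  "word_star w = rev (map letter_star w)"

lemma word_star_simps [simp]:
  "word_star [] = []" "word_star (w @ v) = word_star v @ word_star w"
  "word_star (word_star w) = w" "length (word_star w) = length w"
  "fst ` set (word_star w) = fst ` set w"
  by (auto simp: word_star_def rev_map image_image case_prod_unfold o_def)

lemma word_star_eq_iff: "word_star w = v \<longleftrightarrow> w = word_star v"
  by (metis word_star_simps(3))

text \<open>The basis vector of the free *-algebra that belongs to the word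
  \<open>w\<close>.\<close>

definition word_coeff :: "('g \<times> bool) list \<Rightarrow> ('g \<times> bool) list \<Rightarrow> complex" where
  "word_coeff w v = (if v = w then 1 else 0)"

text \<open>The linear extension to the free *-algebra of a function \<theta> on the basis
  words.\<close>

definition word_lin :: "(('g \<times> bool) list \<Rightarrow> complex) \<Rightarrow> (('g \<times> bool) list \<Rightarrow> complex) \<Rightarrow> complex" where
  "word_lin \<theta> f = (\<Sum>w | f w \<noteq> 0. f w * \<theta> w)"

locale free_alg =
  fixes G :: "'g set"
begin

abbreviation "F \<equiv> free_star_algebra G"

lemma F_simps [simp]:
  "mult F = (\<lambda>f g w. \<Sum>k\<le>length w. f (take k w) * g (drop k w))"
  "one F = (\<lambda>w. if w = [] then 1 else 0)"
  "zero F = (\<lambda>w. 0)" "add F = (\<lambda>f g w. f w + g w)" "smult F = (\<lambda>c f w. c * f w)"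
  "star F = (\<lambda>f w. cnj (f (word_star w)))"
  by (simp_all add: free_star_algebra_def word_star_def)

lemma carrier_F: "f \<in> carrier F \<longleftrightarrow> finite {w. f w \<noteq> 0} \<and> (\<forall>w. f w \<noteq> 0 \<longrightarrow> fst ` set w \<subseteq> G)"
  by (simp add: free_star_algebra_def)

lemma finite_support: "f \<in> carrier F \<Longrightarrow> finite {w. f w \<noteq> 0}"
  by (simp add: carrier_F)

lemma mult_support:
  "(\<Sum>k\<le>length w. f (take k w) * g (drop k w)) \<noteq> 0 \<Longrightarrow> \<exists>u v. w = u @ v \<and> f u \<noteq> 0 \<and> g v \<noteq> (0::complex)"
  by (metis (no_types, lifting) append_take_drop_id mult_not_zero sum.not_neutral_contains_not_neutral)

lemma F_closed:
  assumes f: "f \<in> carrier F" and g: "g \<in> carrier F"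
  shows "(\<lambda>w. f w + g w) \<in> carrier F" "(\<lambda>w. c * f w) \<in> carrier F"
    "(\<lambda>w. \<Sum>k\<le>length w. f (take k w) * g (drop k w)) \<in> carrier F"
    "(\<lambda>w. cnj (f (word_star w))) \<in> carrier F"
proof -
  have *: "{w. f w + g w \<noteq> 0} \<subseteq> {w. f w \<noteq> 0} \<union> {w. g w \<noteq> 0}" by auto
  have "fst ` set w \<subseteq> G" if "f w + g w \<noteq> 0" for w
    using that f g unfolding carrier_F by (cases "f w = 0") auto
  then show "(\<lambda>w. f w + g w) \<in> carrier F"
    using f g finite_subset[OF *] by (simp add: carrier_F)
  have *: "{w. c * f w \<noteq> 0} \<subseteq> {w. f w \<noteq> 0}" by auto
  show "(\<lambda>w. c * f w) \<in> carrier F"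
    using f finite_subset[OF *] by (auto simp: carrier_F)
  have *: "{w. (\<Sum>k\<le>length w. f (take k w) * g (drop k w)) \<noteq> 0}
      \<subseteq> (\<lambda>(u, v). u @ v) ` ({w. f w \<noteq> 0} \<times> {w. g w \<noteq> 0})"
    using mult_support[where f = f and g = g] by fast
  have "fst ` set w \<subseteq> G" if "(\<Sum>k\<le>length w. f (take k w) * g (drop k w)) \<noteq> 0" for w
    using mult_support[OF that] f g unfolding carrier_F by (metis image_Un le_sup_iff set_append)
  then show "(\<lambda>w. \<Sum>k\<le>length w. f (take k w) * g (drop k w)) \<in> carrier F"
    using f g finite_subset[OF *] unfolding carrier_F by simp
  have *: "{w. cnj (f (word_star w)) \<noteq> 0} \<subseteq> word_star ` {w. f w \<noteq> 0}"
    by (auto simp: image_iff) (metis word_star_simps(3))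
  have "fst ` set w \<subseteq> G" if "f (word_star w) \<noteq> 0" for w
    using that f unfolding carrier_F by (metis word_star_simps(5))
  then show "(\<lambda>w. cnj (f (word_star w))) \<in> carrier F"
    using f finite_subset[OF *] unfolding carrier_F by simp
qed

text \<open>Both sides run over the ways to cut \<open>w\<close> into three pieces. On the left the
  second cut is counted from the start of \<open>w\<close>, on the right from the first cut, hence
  the substitution \<open>k = i + j\<close>.\<close>

lemma convolution_assoc:
  fixes f g h :: "('g \<times> bool) list \<Rightarrow> complex"
  shows "(\<Sum>k\<le>length w. (\<Sum>j\<le>length (take k w). f (take j (take k w)) * g (drop j (take k w))) * h (drop k w))
    = (\<Sum>j\<le>length w. f (take j w) * (\<Sum>i\<le>length (drop j w). g (take i (drop j w)) * h (drop i (drop j w))))"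
proof -
  let ?n = "length w"
  let ?t = "\<lambda>j k. f (take j w) * g (drop j (take k w)) * h (drop k w)"
  have "(\<Sum>k\<le>?n. (\<Sum>j\<le>length (take k w). f (take j (take k w)) * g (drop j (take k w))) * h (drop k w))
      = (\<Sum>k\<le>?n. \<Sum>j\<le>k. ?t j k)"
    by (rule sum.cong) (auto simp: sum_distrib_right min_def intro!: sum.cong)
  also have "\<dots> = (\<Sum>(k, j)\<in>(SIGMA k:{..?n}. {..k}). ?t j k)"
    by (simp add: sum.Sigma)
  also have "\<dots> = (\<Sum>(j, i)\<in>(SIGMA j:{..?n}. {..?n - j}). ?t j (i + j))"
    by (rule sum.reindex_bij_witness[of _ "\<lambda>(j, i). (i + j, j)" "\<lambda>(k, j). (j, k - j)"]) auto
  also have "\<dots> = (\<Sum>j\<le>?n. \<Sum>i\<le>?n - j. ?t j (i + j))"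
    by (simp add: sum.Sigma)
  also have "\<dots> = (\<Sum>j\<le>?n. f (take j w) * (\<Sum>i\<le>length (drop j w). g (take i (drop j w)) * h (drop i (drop j w))))"
    by (simp add: sum_distrib_left take_drop mult.assoc)
  finally show ?thesis .
qed

text \<open>Cutting the reversed word after \<open>k\<close> letters is cutting \<open>w\<close>
  after \<open>length w - k\<close> letters, with the two pieces exchanged.\<close>

lemma convolution_star:
  "(\<Sum>k\<le>length w. f (take k (word_star w)) * g (drop k (word_star w)))
    = (\<Sum>k\<le>length w. g (word_star (take k w)) * f (word_star (drop k w)) :: complex)"
proof (rule sum.reindex_bij_witness[of _ "\<lambda>k. length w - k" "\<lambda>k. length w - k"])
  fix k assume k: "k \<in> {..length w}"
  have "word_star w = word_star (drop (length w - k) w) @ word_star (take (length w - k) w)"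
    by (metis append_take_drop_id word_star_simps(2))
  moreover have "length (word_star (drop (length w - k) w)) = k"
    using k by simp
  ultimately have "take k (word_star w) = word_star (drop (length w - k) w)"
    "drop k (word_star w) = word_star (take (length w - k) w)"
    by (metis append_eq_conv_conj)+
  then show "g (word_star (take (length w - k) w)) * f (word_star (drop (length w - k) w))
      = f (take k (word_star w)) * g (drop k (word_star w))"
    by simp
qed auto

lemma one_mult_word: "(\<Sum>k\<le>length w. (if take k w = [] then 1 else 0) * f (drop k w)) = (f w :: complex)"
proof -
  have "(\<Sum>k\<le>length w. (if take k w = [] then 1 else 0) * f (drop k w))
      = (\<Sum>k\<le>length w. if k = 0 then f w else 0)"
    by (rule sum.cong) auto
  then show ?thesis by simp
qed

lemma mult_one_word: "(\<Sum>k\<le>length w. f (take k w) * (if drop k w = [] then 1 else 0)) = (f w :: complex)"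
proof -
  have "(\<Sum>k\<le>length w. f (take k w) * (if drop k w = [] then 1 else 0))
      = (\<Sum>k\<le>length w. if k = length w then f w else 0)"
    by (rule sum.cong) auto
  then show ?thesis by simp
qed

lemma F_one_zero: "(\<lambda>w. if w = [] then 1 else 0) \<in> carrier F" "(\<lambda>w. 0) \<in> carrier F"
  by (auto simp: carrier_F)

lemma star_algebra_F: "star_algebra F"
proof -
  note cl = F_closed F_one_zero
  have neg: "\<exists>g\<in>carrier F. g \<oplus>\<^bsub>F\<^esub> f = \<zero>\<^bsub>F\<^esub>" if "f \<in> carrier F" for f
    by (rule bexI[of _ "\<lambda>w. (-1) * f w"]) (use F_closed(2)[OF that that, of "-1"] in auto)
  interpret abelian_group F
    by (rule abelian_groupI) (use neg in \<open>auto simp: cl ac_simps\<close>)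
  interpret monoid F
    by (rule monoidI)
       (simp add: cl, simp add: cl, simp only: F_simps convolution_assoc,
         simp only: F_simps one_mult_word, simp only: F_simps mult_one_word)
  interpret ring F
    by (rule ringI)
       (simp_all add: abelian_group_axioms monoid_axioms distrib_left distrib_right sum.distrib)
  show ?thesis
  proof
    fix f g assume "f \<in> carrier F" "g \<in> carrier F"
    show "star F (f \<otimes>\<^bsub>F\<^esub> g) = star F g \<otimes>\<^bsub>F\<^esub> star F f"
      by (simp add: convolution_star)
  qed (simp_all add: cl distrib_left distrib_right mult.assoc sum_distrib_left mult.left_commute)
qed

sublocale F: star_algebra F
  by (rule star_algebra_F)

lemma free_gen_closed [simp]: "g \<in> G \<Longrightarrow> free_gen g \<in> carrier F"
  by (auto simp: carrier_F free_gen_def)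

lemma gens_subset: "free_gen ` G \<subseteq> carrier F"
  by auto

text \<open>Among all cuts of a word only the one after the first letter contributes, so left
  multiplication by a generator is a shift. This reduces statements about products to statements
  about single letters.\<close>

lemma free_gen_mult:
  "free_gen g \<otimes>\<^bsub>F\<^esub> f = (\<lambda>w. case w of [] \<Rightarrow> 0 | l # v \<Rightarrow> if l = (g, False) then f v else 0)"
proof
  fix w
  show "(free_gen g \<otimes>\<^bsub>F\<^esub> f) w = (case w of [] \<Rightarrow> 0 | l # v \<Rightarrow> if l = (g, False) then f v else 0)"
  proof (cases w)
    case (Cons l v)
    have "(\<Sum>k\<le>length w. free_gen g (take k w) * f (drop k w))
        = (\<Sum>k\<le>length w. if k = 1 then free_gen g [l] * f v else 0)"
    proof (rule sum.cong)
      fix k assume "k \<in> {..length w}"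
      then show "free_gen g (take k w) * f (drop k w) = (if k = 1 then free_gen g [l] * f v else 0)"
        using Cons by (cases k; cases "k - 1"; cases v) (auto simp: free_gen_def)
    qed simp
    also have "\<dots> = free_gen g [l] * f v"
      by (subst sum.delta) (auto simp: Cons)
    finally show ?thesis using Cons by (simp add: free_gen_def)
  qed (simp add: free_gen_def)
qed

lemma star_free_gen_mult:
  "star F (free_gen g) \<otimes>\<^bsub>F\<^esub> f = (\<lambda>w. case w of [] \<Rightarrow> 0 | l # v \<Rightarrow> if l = (g, True) then f v else 0)"
proof
  fix w
  have star: "star F (free_gen g) = word_coeff [(g, True)]"
    by (auto simp: free_gen_def word_coeff_def fun_eq_iff word_star_eq_iff) (auto simp: word_star_def)
  show "(star F (free_gen g) \<otimes>\<^bsub>F\<^esub> f) w = (case w of [] \<Rightarrow> 0 | l # v \<Rightarrow> if l = (g, True) then f v else 0)"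
  proof (cases w)
    case (Cons l v)
    have "(\<Sum>k\<le>length w. word_coeff [(g, True)] (take k w) * f (drop k w))
        = (\<Sum>k\<le>length w. if k = 1 then word_coeff [(g, True)] [l] * f v else 0)"
    proof (rule sum.cong)
      fix k assume "k \<in> {..length w}"
      then show "word_coeff [(g, True)] (take k w) * f (drop k w)
          = (if k = 1 then word_coeff [(g, True)] [l] * f v else 0)"
        using Cons by (cases k; cases "k - 1"; cases v) (auto simp: word_coeff_def)
    qed simp
    also have "\<dots> = word_coeff [(g, True)] [l] * f v"
      by (subst sum.delta) (auto simp: Cons)
    finally show ?thesis using Cons unfolding star by (simp add: word_coeff_def)
  qed (unfold star, simp add: word_coeff_def)
qed

lemma word_coeff_generated:
  assumes "fst ` set w \<subseteq> G"
  shows "word_coeff w \<in> star_generate F (free_gen ` G)"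
  using assms
proof (induction w)
  case Nil
  then show ?case
    using star_generate.one[of F "free_gen ` G"] by (simp add: word_coeff_def[abs_def])
next
  case (Cons l w)
  obtain g b where l: "l = (g, b)" by (cases l)
  have g: "free_gen g \<in> star_generate F (free_gen ` G)"
    using Cons.prems l by (auto intro: star_generate.incl)
  have w: "word_coeff w \<in> star_generate F (free_gen ` G)" using Cons by simp
  show ?case
  proof (cases b)
    case True
    have "word_coeff (l # w) = star F (free_gen g) \<otimes>\<^bsub>F\<^esub> word_coeff w"
      unfolding star_free_gen_mult by (auto simp: word_coeff_def l True fun_eq_iff split: list.splits)
    then show ?thesis
      using star_generate.mult[OF star_generate.star[OF g] w] by simp
  next
    case False
    have "word_coeff (l # w) = free_gen g \<otimes>\<^bsub>F\<^esub> word_coeff w"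
      unfolding free_gen_mult by (auto simp: word_coeff_def l False fun_eq_iff split: list.splits)
    then show ?thesis
      using star_generate.mult[OF g w] by simp
  qed
qed

text \<open>Removing one word at a time from the support writes any element in terms of generators.
  This turns rule induction over \<open>star_generate\<close> into an induction principle for the
  free *-algebra.\<close>

lemma carrier_F_generated:
  assumes "f \<in> carrier F" shows "f \<in> star_generate F (free_gen ` G)"
  using assms
proof (induction "card {w. f w \<noteq> 0}" arbitrary: f)
  case 0
  then have "f = (\<lambda>w. 0 * (if w = [] then 1 else 0))"
    by (auto simp: carrier_F)
  then show ?case
    using star_generate.smult[OF star_generate.one[of F "free_gen ` G"], where c = 0] by simp
next
  case (Suc n)
  then obtain v where v: "f v \<noteq> 0" by fastforce
  define h where "h = f(v := 0)"
  have supp: "{w. h w \<noteq> 0} = {w. f w \<noteq> 0} - {v}" by (auto simp: h_def)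
  have h: "h \<in> carrier F" using Suc.prems supp unfolding carrier_F by (auto simp: h_def)
  have "card {w. h w \<noteq> 0} = n"
    using Suc.hyps(2) v finite_support[OF Suc.prems] unfolding supp by simp
  then have h': "h \<in> star_generate F (free_gen ` G)" using Suc.hyps(1) h by blast
  have "word_coeff v \<in> star_generate F (free_gen ` G)"
    using Suc.prems v unfolding carrier_F by (intro word_coeff_generated) blast
  from star_generate.add[OF h' star_generate.smult[OF this, of "f v"]]
  have "(\<lambda>w. h w + f v * word_coeff v w) \<in> star_generate F (free_gen ` G)" by simp
  also have "(\<lambda>w. h w + f v * word_coeff v w) = f"
    by (auto simp: h_def word_coeff_def)
  finally show ?case .
qed

lemma word_lin_superset:
  assumes "finite S" "{w. f w \<noteq> 0} \<subseteq> S"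
  shows "word_lin \<theta> f = (\<Sum>w\<in>S. f w * \<theta> w)"
  unfolding word_lin_def by (rule sum.mono_neutral_left) (use assms in auto)

lemma word_lin_add:
  assumes "f \<in> carrier F" "g \<in> carrier F"
  shows "word_lin \<theta> (\<lambda>w. f w + g w) = word_lin \<theta> f + word_lin \<theta> g"
proof -
  let ?S = "{w. f w \<noteq> 0} \<union> {w. g w \<noteq> 0}"
  have S: "finite ?S" using assms finite_support by blast
  have "word_lin \<theta> f = (\<Sum>w\<in>?S. f w * \<theta> w)" "word_lin \<theta> g = (\<Sum>w\<in>?S. g w * \<theta> w)"
    "word_lin \<theta> (\<lambda>w. f w + g w) = (\<Sum>w\<in>?S. (f w + g w) * \<theta> w)"
    by (rule word_lin_superset[OF S]; auto)+
  then show ?thesis by (simp add: sum.distrib distrib_right)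
qed

lemma word_lin_smult: "word_lin \<theta> (\<lambda>w. c * f w) = c * word_lin \<theta> f"
  by (cases "c = 0") (simp_all add: word_lin_def sum_distrib_left mult.assoc)

lemma word_lin_add_fun: "word_lin (\<lambda>w. \<theta> w + \<theta>' w) f = word_lin \<theta> f + word_lin \<theta>' f"
  by (simp add: word_lin_def distrib_left sum.distrib)

lemma word_lin_smult_fun: "word_lin (\<lambda>w. c * \<theta> w) f = c * word_lin \<theta> f"
  by (simp add: word_lin_def sum_distrib_left mult.left_commute)

lemma word_lin_one: "word_lin \<theta> \<one>\<^bsub>F\<^esub> = \<theta> []"
  by (simp add: word_lin_def)

lemma word_lin_free_gen: "word_lin \<theta> (free_gen g) = \<theta> [(g, False)]"
  by (simp add: word_lin_def free_gen_def)

lemma word_lin_shift: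
  assumes f: "f \<in> carrier F"
    and h: "h = (\<lambda>w. case w of [] \<Rightarrow> 0 | l' # v \<Rightarrow> if l' = l then f v else 0)"
  shows "word_lin \<theta> h = word_lin (\<lambda>w. \<theta> (l # w)) f"
proof -
  have "h w \<noteq> 0 \<longleftrightarrow> (\<exists>v. w = l # v \<and> f v \<noteq> 0)" for w
    by (cases w) (auto simp: h)
  then have "{w. h w \<noteq> 0} = Cons l ` {w. f w \<noteq> 0}" by auto
  then have "word_lin \<theta> h = (\<Sum>w\<in>Cons l ` {w. f w \<noteq> 0}. h w * \<theta> w)"
    by (simp add: word_lin_def)
  also have "\<dots> = word_lin (\<lambda>w. \<theta> (l # w)) f"
    by (subst sum.reindex) (auto simp: h word_lin_def)
  finally show ?thesis .
qed

lemma word_lin_free_gen_mult: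
  "f \<in> carrier F \<Longrightarrow> word_lin \<theta> (free_gen g \<otimes>\<^bsub>F\<^esub> f) = word_lin (\<lambda>w. \<theta> ((g, False) # w)) f"
  by (rule word_lin_shift) (simp_all only: free_gen_mult)

lemma word_lin_star_free_gen_mult:
  "f \<in> carrier F \<Longrightarrow> word_lin \<theta> (star F (free_gen g) \<otimes>\<^bsub>F\<^esub> f) = word_lin (\<lambda>w. \<theta> ((g, True) # w)) f"
  by (rule word_lin_shift) (simp_all only: star_free_gen_mult)

end

section \<open>Generated *-subalgebras\<close>

context star_algebra
begin

lemma star_generate_closed:
  assumes "U \<subseteq> carrier A" "x \<in> star_generate A U" shows "x \<in> carrier A"
  using assms(2) by induction (use assms(1) in \<open>auto simp: smult_closed star_closed\<close>)

lemma star_hom_agree: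
  assumes f: "f \<in> star_hom A B" and g: "g \<in> star_hom A B" and U: "U \<subseteq> carrier A"
    and eq: "\<And>x. x \<in> U \<Longrightarrow> f x = g x" and x: "x \<in> star_generate A U"
  shows "f x = g x"
  using x
  by induction (use eq star_generate_closed[OF U] in \<open>auto simp: star_homD[OF f] star_homD[OF g]\<close>)

end

section \<open>Universal seminorms and universal C*-algebras of presentations\<close>

definition admissible ::
  "'g set \<Rightarrow> ((('g \<times> bool) list \<Rightarrow> complex) \<times> (('g \<times> bool) list \<Rightarrow> complex)) set \<Rightarrow>
   ((('g \<times> bool) list \<Rightarrow> complex) \<Rightarrow> real) \<Rightarrow> bool" where
  "admissible G R p \<longleftrightarrow> cstar_seminorm (free_star_algebra G) p \<and>
     (\<forall>(l, r)\<in>R. p (l \<ominus>\<^bsub>free_star_algebra G\<^esub> r) = 0)"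

text \<open>A real supremum is meaningful only over a bounded set. So each generator must come with
  a bound that is uniform over all admissible seminorms; \<open>bounded\<close> spreads it to every
  element.\<close>

locale presentation = free_alg G for G :: "'g set" +
  fixes R
  assumes relations: "(l, r) \<in> R \<Longrightarrow> l \<in> carrier F \<and> r \<in> carrier F"
    and bounded_gens: "g \<in> G \<Longrightarrow> \<exists>M. \<forall>p. admissible G R p \<longrightarrow> p (free_gen g) \<le> M"
begin

abbreviation "un \<equiv> universal_seminorm G R"

lemma admissible_seminormed: "admissible G R p \<Longrightarrow> seminormed_star_algebra F p"
  by (simp add: admissible_def seminormed_star_algebra_def seminormed_star_algebra_axioms_def
      star_algebra_F)

text \<open>It makes the set under the supremum nonempty, and the supremum non-negative.\<close>

lemma admissible_zero: "admissible G R (\<lambda>x. 0)"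
  by (auto simp: admissible_def cstar_seminorm_def)

lemma bounded:
  assumes "x \<in> carrier F" shows "\<exists>M. \<forall>p. admissible G R p \<longrightarrow> p x \<le> M"
  using carrier_F_generated[OF assms]
proof induction
  case (incl x)
  then show ?case using bounded_gens by auto
next
  case one
  then show ?case
    using seminormed_star_algebra.p_one_le[OF admissible_seminormed] by blast
next
  case (add x y)
  then obtain M N where M: "\<And>p. admissible G R p \<Longrightarrow> p x \<le> M"
    and N: "\<And>p. admissible G R p \<Longrightarrow> p y \<le> N" by blast
  have "x \<in> carrier F" "y \<in> carrier F"
    using add.hyps F.star_generate_closed[OF gens_subset] by auto
  then have "p (x \<oplus>\<^bsub>F\<^esub> y) \<le> M + N" if "admissible G R p" for p
    using seminormed_star_algebra.triangle[OF admissible_seminormed[OF that], of x y] M[OF that] N[OF that]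
    by linarith
  then show ?case by blast
next
  case (mult x y)
  then obtain M N where M: "\<And>p. admissible G R p \<Longrightarrow> p x \<le> M"
    and N: "\<And>p. admissible G R p \<Longrightarrow> p y \<le> N" by blast
  have xy: "x \<in> carrier F" "y \<in> carrier F"
    using mult.hyps F.star_generate_closed[OF gens_subset] by auto
  have "p (x \<otimes>\<^bsub>F\<^esub> y) \<le> M * N" if p: "admissible G R p" for p
  proof -
    interpret seminormed_star_algebra F p by (rule admissible_seminormed[OF p])
    have "p x * p y \<le> M * N"
      using M[OF p] N[OF p] nonneg[of x] nonneg[of y] xy by (intro mult_mono) auto
    then show ?thesis using p_mult[OF xy] by linarith
  qed
  then show ?case by blast
next
  case (smult x c)
  then obtain M where M: "\<And>p. admissible G R p \<Longrightarrow> p x \<le> M" by blast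
  have "x \<in> carrier F"
    using smult.hyps F.star_generate_closed[OF gens_subset] by auto
  then have "p (c \<odot>\<^bsub>F\<^esub> x) \<le> cmod c * M" if "admissible G R p" for p
    using seminormed_star_algebra.p_smult[OF admissible_seminormed[OF that], of x c] M[OF that]
    by (simp only: mult_left_mono norm_ge_zero)
  then show ?case by blast
next
  case (star x)
  then obtain M where M: "\<And>p. admissible G R p \<Longrightarrow> p x \<le> M" by blast
  have "x \<in> carrier F"
    using star.hyps F.star_generate_closed[OF gens_subset] by auto
  then have "p (star F x) \<le> M" if "admissible G R p" for p
    using seminormed_star_algebra.p_star[OF admissible_seminormed[OF that], of x] M[OF that] by simp
  then show ?case by blast
qed

lemma un_eq: "un x = Sup {p x | p. admissible G R p}"
  by (simp add: universal_seminorm_def admissible_def)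

lemma admissible_le_un:
  assumes p: "admissible G R p" and x: "x \<in> carrier F" shows "p x \<le> un x"
  unfolding un_eq
proof (rule cSup_upper)
  show "bdd_above {p x | p. admissible G R p}"
    using bounded[OF x] by (auto intro: bdd_aboveI)
qed (use p in blast)

lemma un_least: "(\<And>p. admissible G R p \<Longrightarrow> p x \<le> M) \<Longrightarrow> un x \<le> M"
  unfolding un_eq using admissible_zero by (intro cSup_least) blast+

text \<open>Each inequality passes to the supremum. Homogeneity becomes an equality by applying the
  inequality to \<open>inverse c\<close> as well, and the lower half of the C*-identity by taking
  square roots before the supremum.\<close>

lemma un_seminorm: "cstar_seminorm F un"
proof -
  have nonneg: "0 \<le> un x" if "x \<in> carrier F" for x
    using admissible_le_un[OF admissible_zero that] .
  have smult_le: "un (c \<odot>\<^bsub>F\<^esub> x) \<le> cmod c * un x" if x: "x \<in> carrier F" for c x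
  proof (rule un_least)
    fix p assume p: "admissible G R p"
    interpret seminormed_star_algebra F p by (rule admissible_seminormed[OF p])
    show "p (c \<odot>\<^bsub>F\<^esub> x) \<le> cmod c * un x"
      using admissible_le_un[OF p x] by (simp only: p_smult[OF x] mult_left_mono norm_ge_zero)
  qed
  show ?thesis
    unfolding cstar_seminorm_def
  proof (intro conjI ballI allI)
    fix x y c assume x: "x \<in> carrier F"
    show "0 \<le> un x" by (rule nonneg[OF x])
    show "un (c \<odot>\<^bsub>F\<^esub> x) = cmod c * un x"
    proof (cases "c = 0")
      case True
      then show ?thesis
        using smult_le[OF x, of 0] nonneg[of "0 \<odot>\<^bsub>F\<^esub> x"] F.smult_closed[OF x, of 0] by simp
    next
      case False
      have "un x = un (inverse c \<odot>\<^bsub>F\<^esub> (c \<odot>\<^bsub>F\<^esub> x))"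
        using False by (simp only: F.smult_smult[OF x]) (simp add: F.smult_1[OF x, simplified])
      also have "\<dots> \<le> cmod (inverse c) * un (c \<odot>\<^bsub>F\<^esub> x)"
        by (rule smult_le[OF F.smult_closed[OF x]])
      finally have "cmod c * un x \<le> un (c \<odot>\<^bsub>F\<^esub> x)"
        using False by (simp add: norm_inverse norm_divide field_simps)
      then show ?thesis using smult_le[OF x, of c] by linarith
    qed
    show "un (star F x \<otimes>\<^bsub>F\<^esub> x) = (un x)\<^sup>2"
    proof (rule antisym)
      show "un (star F x \<otimes>\<^bsub>F\<^esub> x) \<le> (un x)\<^sup>2"
      proof (rule un_least)
        fix p assume p: "admissible G R p"
        interpret seminormed_star_algebra F p by (rule admissible_seminormed[OF p])
        show "p (star F x \<otimes>\<^bsub>F\<^esub> x) \<le> (un x)\<^sup>2"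
          unfolding cstar[OF x] using admissible_le_un[OF p x] local.nonneg[OF x] by (rule power_mono)
      qed
      have xx: "star F x \<otimes>\<^bsub>F\<^esub> x \<in> carrier F" using x F.star_closed F.m_closed by blast
      have "un x \<le> sqrt (un (star F x \<otimes>\<^bsub>F\<^esub> x))"
      proof (rule un_least)
        fix p assume p: "admissible G R p"
        interpret seminormed_star_algebra F p by (rule admissible_seminormed[OF p])
        show "p x \<le> sqrt (un (star F x \<otimes>\<^bsub>F\<^esub> x))"
          using admissible_le_un[OF p xx] by (intro real_le_rsqrt) (simp only: cstar[OF x])
      qed
      then show "(un x)\<^sup>2 \<le> un (star F x \<otimes>\<^bsub>F\<^esub> x)"
        using power_mono[OF _ nonneg[OF x], of _ 2] nonneg[OF xx] by (metis real_sqrt_pow2)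
    qed
    assume y: "y \<in> carrier F"
    show "un (x \<oplus>\<^bsub>F\<^esub> y) \<le> un x + un y"
    proof (rule un_least)
      fix p assume p: "admissible G R p"
      interpret seminormed_star_algebra F p by (rule admissible_seminormed[OF p])
      show "p (x \<oplus>\<^bsub>F\<^esub> y) \<le> un x + un y"
        using triangle[OF x y] admissible_le_un[OF p x] admissible_le_un[OF p y] by linarith
    qed
    show "un (x \<otimes>\<^bsub>F\<^esub> y) \<le> un x * un y"
    proof (rule un_least)
      fix p assume p: "admissible G R p"
      interpret seminormed_star_algebra F p by (rule admissible_seminormed[OF p])
      have "p x * p y \<le> un x * un y"
        using admissible_le_un[OF p x] admissible_le_un[OF p y] local.nonneg[OF x] local.nonneg[OF y]
        by (intro mult_mono) auto
      then show "p (x \<otimes>\<^bsub>F\<^esub> y) \<le> un x * un y" using p_mult[OF x y] by linarith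
    qed
  qed
qed

lemma un_relation: "(l, r) \<in> R \<Longrightarrow> un (l \<ominus>\<^bsub>F\<^esub> r) = 0"
  using relations[of l r] un_least[of "l \<ominus>\<^bsub>F\<^esub> r" 0]
    admissible_le_un[OF admissible_zero, of "l \<ominus>\<^bsub>F\<^esub> r"]
  by (fastforce simp: admissible_def)

sublocale seminormed_star_algebra F un
  by unfold_locales (rule un_seminorm)

abbreviation "U \<equiv> universal_cstar G R"

lemma U_eq: "universal_cstar G R = C"
  by (simp add: universal_cstar_def)

lemma cstar_algebra_U: "cstar_algebra U"
  unfolding U_eq by (rule cstar_algebra_completion)

definition emb where "emb x = cls (\<lambda>n. x)"

lemma emb_hom: "emb \<in> star_hom F U"
  unfolding U_eq emb_def[abs_def] by (rule const_star_hom)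

lemma emb_gen: "emb (free_gen g) = universal_gen G R g"
  by (simp add: emb_def universal_gen_def)

lemma emb_relation: "(l, r) \<in> R \<Longrightarrow> emb l = emb r"
  unfolding emb_def using relations[of l r] un_relation[of l r]
  by (subst cls_eq_iff) (auto intro: cs_const)

lemma cnorm_emb: "x \<in> carrier F \<Longrightarrow> cnorm U (emb x) = un x"
  unfolding U_eq emb_def by (rule cnorm_C_const)

lemma universal_gen_closed: "g \<in> G \<Longrightarrow> universal_gen G R g \<in> carrier U"
  using star_homD(1)[OF emb_hom, of "free_gen g"] by (simp add: emb_gen)

text \<open>Both homomorphisms are contractive, because the pulled back norm of \<open>B\<close> is
  a C*-seminorm and thus dominated by the norm of \<open>U\<close>. They agree on the dense image of
  the free algebra, and passing to \<open>z\<close> costs one distance for each of them, whence the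
  factor 2. The hypotheses on \<open>B\<close> are those of a definite C*-seminorm, the form in
  which they are known for \<open>bounded_operators\<close>.\<close>

lemma hom_agree:
  assumes B: "star_algebra B" and q: "cstar_seminorm B (cnorm B)"
    and q0: "\<And>x. x \<in> carrier B \<Longrightarrow> cnorm B x = 0 \<Longrightarrow> x = \<zero>\<^bsub>B\<^esub>"
    and f: "f \<in> star_hom U B" and h: "h \<in> star_hom U B"
    and eq: "\<And>g. g \<in> G \<Longrightarrow> f (universal_gen G R g) = h (universal_gen G R g)"
    and z: "z \<in> carrier U"
  shows "f z = h z"
proof -
  interpret U: cstar_algebra U by (rule cstar_algebra_U)
  interpret B: seminormed_star_algebra B "cnorm B"
    using B q by (simp add: seminormed_star_algebra_def seminormed_star_algebra_axioms_def)
  have le: "cnorm B (k x) \<le> cnorm U x" if "k \<in> star_hom U B" "x \<in> carrier U" for k x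
    using U.cstar_seminorm_le_norm[OF star_hom_seminorm[OF U.star_algebra_axioms B q that(1)] that(2)] .
  have agree: "f (emb x) = h (emb x)" if x: "x \<in> carrier F" for x
  proof -
    have "(f \<circ> emb) y = (h \<circ> emb) y" if "y \<in> free_gen ` G" for y
      using that eq by (auto simp: emb_gen)
    from F.star_hom_agree[OF star_hom_comp[OF emb_hom f] star_hom_comp[OF emb_hom h] gens_subset
        this carrier_F_generated[OF x]]
    show ?thesis by simp
  qed
  obtain W where W: "W \<in> cs" "z = cls W" using z unfolding U_eq by (rule C_cases)
  note Wc = cs_closed[OF W(1)]
  have e: "emb (W m) \<in> carrier U" for m by (rule star_homD(1)[OF emb_hom Wc])
  have lim: "(\<lambda>m. 2 * cnorm U (emb (W m) \<ominus>\<^bsub>U\<^esub> z)) \<longlonglongrightarrow> 2 * 0"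
    using const_classes_dense[OF W(1)] unfolding U_eq emb_def W(2) by (intro tendsto_intros)
  have fz: "f z \<in> carrier B" "h z \<in> carrier B" using z star_homD(1)[OF f] star_homD(1)[OF h] by auto
  have "cnorm B (f z \<ominus>\<^bsub>B\<^esub> h z) \<le> 2 * cnorm U (emb (W m) \<ominus>\<^bsub>U\<^esub> z)" for m
  proof -
    have ef: "f (emb (W m)) \<in> carrier B" by (rule star_homD(1)[OF f e])
    have "cnorm B (f z \<ominus>\<^bsub>B\<^esub> h z)
        \<le> cnorm B (f z \<ominus>\<^bsub>B\<^esub> f (emb (W m))) + cnorm B (f (emb (W m)) \<ominus>\<^bsub>B\<^esub> h z)"
      by (rule B.p_diff_triangle[OF fz(1) ef fz(2)])
    also have "cnorm B (f z \<ominus>\<^bsub>B\<^esub> f (emb (W m))) = cnorm B (f (emb (W m) \<ominus>\<^bsub>U\<^esub> z))"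
      using B.p_diff_commute[OF fz(1) ef] star_hom_diff[OF U.star_algebra_axioms B f e z] by simp
    also have "\<dots> \<le> cnorm U (emb (W m) \<ominus>\<^bsub>U\<^esub> z)"
      by (rule le[OF f]) (simp add: e z)
    also have "cnorm B (f (emb (W m)) \<ominus>\<^bsub>B\<^esub> h z) = cnorm B (h (emb (W m) \<ominus>\<^bsub>U\<^esub> z))"
      using agree[OF Wc] star_hom_diff[OF U.star_algebra_axioms B h e z] by simp
    also have "\<dots> \<le> cnorm U (emb (W m) \<ominus>\<^bsub>U\<^esub> z)"
      by (rule le[OF h]) (simp add: e z)
    finally show ?thesis by simp
  qed
  then have "cnorm B (f z \<ominus>\<^bsub>B\<^esub> h z) \<le> 0"
    using LIMSEQ_le_const[OF lim, of "cnorm B (f z \<ominus>\<^bsub>B\<^esub> h z)"] by simp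
  then have "f z \<ominus>\<^bsub>B\<^esub> h z = \<zero>\<^bsub>B\<^esub>"
    using q0[of "f z \<ominus>\<^bsub>B\<^esub> h z"] B.nonneg[of "f z \<ominus>\<^bsub>B\<^esub> h z"] fz by simp
  then show ?thesis using B.minus_eq_zero_iff fz by simp
qed

end

section \<open>C*-seminorms from positive definite kernels\<close>

text \<open>
  If \<open>M s s \<noteq> 0\<close>, subtracting the rank one kernel \<open>M i s * M s j / M s s\<close> leaves a positive
  kernel supported off \<open>s\<close>.
\<close>

lemma schur_product:
  fixes M :: "'i \<Rightarrow> 'i \<Rightarrow> complex" and k :: "'i \<Rightarrow> 'h::chilbert_space"
  assumes "finite I" and herm: "\<And>i j. i \<in> I \<Longrightarrow> j \<in> I \<Longrightarrow> M i j = cnj (M j i)"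
    and pos: "\<And>c. 0 \<le> Re (\<Sum>i\<in>I. \<Sum>j\<in>I. c i * cnj (c j) * M i j)"
  shows "0 \<le> Re (\<Sum>i\<in>I. \<Sum>j\<in>I. M i j * cinner (k i) (k j))"
  using assms
proof (induction I arbitrary: M rule: finite_induct)
  case empty
  then show ?case by simp
next
  case (insert s I)
  let ?J = "insert s I"
  note fin = \<open>finite I\<close> and s = \<open>s \<notin> I\<close>
  have herm: "M i j = cnj (M j i)" if "i \<in> ?J" "j \<in> ?J" for i j
    using insert.prems(1) that by blast
  have pos: "0 \<le> Re (\<Sum>i\<in>?J. \<Sum>j\<in>?J. c i * cnj (c j) * M i j)" for c
    using insert.prems(2) by blast
  have split: "(\<Sum>i\<in>?J. \<Sum>j\<in>?J. f i j) = f s s + (\<Sum>j\<in>I. f s j) + (\<Sum>i\<in>I. f i s) + (\<Sum>i\<in>I. \<Sum>j\<in>I. f i j)"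
    for f :: "'i \<Rightarrow> 'i \<Rightarrow> complex"
    using fin s by (simp add: sum.distrib)
  define r where "r = Re (M s s)"
  have Mss: "M s s = complex_of_real r"
    using herm[of s s] by (simp add: r_def complex_eq_iff)
  have r: "r \<ge> 0"
  proof -
    define e :: "'i \<Rightarrow> complex" where "e i = (if i = s then 1 else 0)" for i
    have e: "e s = 1" "\<And>i. i \<in> I \<Longrightarrow> e i = 0" using s by (auto simp: e_def)
    have "(\<Sum>i\<in>?J. \<Sum>j\<in>?J. e i * cnj (e j) * M i j) = M s s"
      unfolding split by (simp add: e)
    then show ?thesis using pos[of e] by (simp add: r_def)
  qed
  show ?case
  proof (cases "r = 0")
    case True
    \<comment> \<open>A zero diagonal entry forces its row to vanish: with coefficient
      \<open>t\<close> at \<open>s\<close> and 1 at \<open>j\<close> the form has no term quadratic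
      in \<open>t\<close>, so a nonzero \<open>M s j\<close> would drive it below zero.\<close>
    have zero: "M s j = 0" if j: "j \<in> I" for j
    proof (rule ccontr)
      assume nz: "M s j \<noteq> 0"
      have "0 \<le> 2 * Re (t * M s j) + Re (M j j)" for t
      proof -
        define c where "c i = (if i = s then t else if i = j then 1 else 0)" for i
        have cI: "c i = (if i = j then 1 else 0)" if "i \<in> I" for i using that s by (auto simp: c_def)
        have cs: "c s = t" by (simp add: c_def)
        have "(\<Sum>i\<in>?J. \<Sum>j\<in>?J. c i * cnj (c j) * M i j)
            = t * M s j + cnj t * M j s + M j j"
        proof -
          have 1: "(\<Sum>i\<in>I. c s * cnj (c i) * M s i) = t * M s j"
            using j fin by (subst sum.remove[OF fin j]) (auto simp: cI cs)
          have 2: "(\<Sum>i\<in>I. c i * cnj (c s) * M i s) = cnj t * M j s"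
            using j fin by (subst sum.remove[OF fin j]) (auto simp: cI cs)
          have "(\<Sum>i\<in>I. \<Sum>l\<in>I. c i * cnj (c l) * M i l) = (\<Sum>l\<in>I. c j * cnj (c l) * M j l)"
            using j fin by (subst sum.remove[OF fin j]) (auto simp: cI)
          also have "\<dots> = M j j"
            using j fin by (subst sum.remove[OF fin j]) (auto simp: cI)
          finally show ?thesis unfolding split 1 2 using True Mss by simp
        qed
        moreover have "M j s = cnj (M s j)" using herm[of j s] j by blast
        ultimately have "(\<Sum>i\<in>?J. \<Sum>j\<in>?J. c i * cnj (c j) * M i j) = t * M s j + cnj (t * M s j) + M j j"
          by simp
        then show ?thesis using pos[of c] by (simp only: plus_complex.sel) simp
      qed
      \<comment> \<open>For this \<open>t\<close> the product \<open>t * M s j\<close> is the real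
        number \<open>- (\<bar>Re (M j j)\<bar> + 1)\<close>, and twice that outweighs the remaining
        term.\<close>
      from this[of "complex_of_real (- (\<bar>Re (M j j)\<bar> + 1)) / M s j"] nz show False by simp
    qed
    have zero': "M j s = 0" if "j \<in> I" for j using zero[OF that] herm[of j s] that by simp
    have "0 \<le> Re (\<Sum>i\<in>I. \<Sum>j\<in>I. c i * cnj (c j) * M i j)" for c
      using pos[of c] zero zero' True Mss unfolding split by simp
    then have "0 \<le> Re (\<Sum>i\<in>I. \<Sum>j\<in>I. M i j * cinner (k i) (k j))"
      using insert.IH[of M] herm by blast
    then show ?thesis unfolding split using zero zero' True Mss by simp
  next
    case False
    with r have r: "r > 0" by simp
    define M' where "M' i j = M i j - M i s * M s j / complex_of_real r" for i j
    have M's: "M' i s = 0" "M' s i = 0" for i using r by (auto simp: M'_def Mss)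
    have "0 \<le> Re (\<Sum>i\<in>I. \<Sum>j\<in>I. M' i j * cinner (k i) (k j))"
    proof (rule insert.IH)
      fix i j assume ij: "i \<in> I" "j \<in> I"
      have "cnj (M j s) = M s j" "cnj (M s i) = M i s" "cnj (M j i) = M i j"
        using ij herm[of s j] herm[of i s] herm[of i j] by auto
      then show "M' i j = cnj (M' j i)" by (simp add: M'_def mult.commute)
    next
      fix c :: "'i \<Rightarrow> complex"
      define a where "a = (\<Sum>i\<in>I. c i * M i s)"
      \<comment> \<open>The coefficient at \<open>s\<close> minimises the form with the others held
        fixed; completing the square there leaves exactly the form of \<open>M'\<close> in
        \<open>c\<close>.\<close>
      define d where "d i = (if i = s then - a / complex_of_real r else c i)" for i
      have dI: "d i = c i" if "i \<in> I" for i using that s by (auto simp: d_def)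
      have ca: "cnj a = (\<Sum>j\<in>I. cnj (c j) * M s j)"
        unfolding a_def cnj_sum
      proof (rule sum.cong)
        fix i assume "i \<in> I"
        then have "M s i = cnj (M i s)" by (intro herm) auto
        then show "cnj (c i * M i s) = cnj (c i) * M s i" by simp
      qed simp
      have aa: "a * cnj a = (\<Sum>i\<in>I. \<Sum>j\<in>I. (c i * M i s) * (cnj (c j) * M s j))"
        by (subst ca) (simp add: a_def sum_product)
      have "(\<Sum>j\<in>I. d s * cnj (d j) * M s j) = d s * cnj a"
        unfolding ca sum_distrib_left by (rule sum.cong) (auto simp: dI)
      moreover have "(\<Sum>i\<in>I. d i * cnj (d s) * M i s) = cnj (d s) * a"
        unfolding a_def sum_distrib_left by (rule sum.cong) (auto simp: dI)
      moreover have "(\<Sum>i\<in>I. \<Sum>j\<in>I. d i * cnj (d j) * M i j) = (\<Sum>i\<in>I. \<Sum>j\<in>I. c i * cnj (c j) * M i j)"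
        by (intro sum.cong) (auto simp: dI)
      moreover have "(\<Sum>i\<in>I. \<Sum>j\<in>I. c i * cnj (c j) * M' i j)
          = (\<Sum>i\<in>I. \<Sum>j\<in>I. c i * cnj (c j) * M i j) - a * cnj a / complex_of_real r"
        unfolding aa sum_divide_distrib sum_subtractf[symmetric] M'_def
        by (intro sum.cong refl) (simp add: algebra_simps)
      moreover have "d s * cnj (d s) * M s s = a * cnj a / complex_of_real r"
        "d s * cnj a = - (a * cnj a / complex_of_real r)" "cnj (d s) * a = - (a * cnj a / complex_of_real r)"
        using r by (auto simp: d_def Mss mult.commute)
      ultimately have "(\<Sum>i\<in>?J. \<Sum>j\<in>?J. d i * cnj (d j) * M i j) = (\<Sum>i\<in>I. \<Sum>j\<in>I. c i * cnj (c j) * M' i j)"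
        unfolding split by simp
      then show "0 \<le> Re (\<Sum>i\<in>I. \<Sum>j\<in>I. c i * cnj (c j) * M' i j)"
        using pos[of d] by simp
    qed
    then have 1: "0 \<le> Re (\<Sum>i\<in>?J. \<Sum>j\<in>?J. M' i j * cinner (k i) (k j))"
      unfolding split by (simp add: M's)
    \<comment> \<open>The rank one kernel that was split off contributes the squared norm of
      \<open>z\<close> divided by \<open>r\<close>, which is non-negative.\<close>
    define z where "z = (\<Sum>i\<in>?J. scaleC (M i s) (k i))"
    have zz: "(\<Sum>i\<in>?J. \<Sum>j\<in>?J. M i s * M s j * cinner (k i) (k j)) = cinner z z"
    proof -
      have "cinner z z = (\<Sum>i\<in>?J. \<Sum>j\<in>?J. cinner (scaleC (M i s) (k i)) (scaleC (M j s) (k j)))"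
        unfolding z_def by (subst cinner_sum_left) (simp only: cinner_sum_right)
      also have "\<dots> = (\<Sum>i\<in>?J. \<Sum>j\<in>?J. M i s * M s j * cinner (k i) (k j))"
      proof (intro sum.cong refl)
        fix i j assume "i \<in> ?J" "j \<in> ?J"
        then have "M s j = cnj (M j s)" by (intro herm) auto
        then show "cinner (scaleC (M i s) (k i)) (scaleC (M j s) (k j)) = M i s * M s j * cinner (k i) (k j)"
          by (simp only: cinner_scaleC_left cinner_scaleC_right mult_ac)
      qed
      finally show ?thesis by simp
    qed
    have "(\<Sum>i\<in>?J. \<Sum>j\<in>?J. M i j * cinner (k i) (k j))
        = (\<Sum>i\<in>?J. \<Sum>j\<in>?J. M' i j * cinner (k i) (k j)) + cinner z z / complex_of_real r"
      unfolding M'_def zz[symmetric] sum_divide_distrib sum.distrib[symmetric]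
      by (intro sum.cong refl) (simp add: left_diff_distrib)
    moreover have "Re (cinner z z / complex_of_real r) \<ge> 0"
      using r by (simp add: cinner_self Re_divide_of_real del: of_real_power)
    ultimately show ?thesis using 1 by simp
  qed
qed

text \<open>\<open>p t\<close> is the operator seminorm of left multiplication by \<open>t\<close>
  for the semi-inner product \<open>S\<close>. The second clause of the conclusion bounds
  \<open>p\<close> from below, which shows that elements survive; the third shows that relations are
  killed.\<close>

lemma (in star_algebra) gns_seminorm:
  fixes S :: "'a \<Rightarrow> 'a \<Rightarrow> complex"
  assumes add: "\<And>x y z. x \<in> carrier A \<Longrightarrow> y \<in> carrier A \<Longrightarrow> z \<in> carrier A \<Longrightarrow> S (x \<oplus> y) z = S x z + S y z"
    and smult: "\<And>c x y. x \<in> carrier A \<Longrightarrow> y \<in> carrier A \<Longrightarrow> S (c \<odot> x) y = c * S x y"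
    and herm: "\<And>x y. x \<in> carrier A \<Longrightarrow> y \<in> carrier A \<Longrightarrow> S x y = cnj (S y x)"
    and pos: "\<And>x. x \<in> carrier A \<Longrightarrow> 0 \<le> Re (S x x)"
    and adj: "\<And>t x y. t \<in> carrier A \<Longrightarrow> x \<in> carrier A \<Longrightarrow> y \<in> carrier A \<Longrightarrow> S (t \<otimes> x) y = S x (star A t \<otimes> y)"
    and bound: "\<And>t. t \<in> carrier A \<Longrightarrow> \<exists>K\<ge>0. \<forall>x\<in>carrier A. Re (S (t \<otimes> x) (t \<otimes> x)) \<le> K * Re (S x x)"
  shows "\<exists>p. cstar_seminorm A p \<and>
    (\<forall>t\<in>carrier A. \<forall>x\<in>carrier A. sqrt (Re (S (t \<otimes> x) (t \<otimes> x))) \<le> p t * sqrt (Re (S x x))) \<and>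
    (\<forall>t\<in>carrier A. (\<forall>x\<in>carrier A. S (t \<otimes> x) (t \<otimes> x) = 0) \<longrightarrow> p t = 0)"
proof -
  have add_right: "S z (x \<oplus> y) = S z x + S z y"
    if "x \<in> carrier A" "y \<in> carrier A" "z \<in> carrier A" for x y z
    using that add[of x y z] herm[of z "x \<oplus> y"] herm[of z x] herm[of z y] by simp
  have smult_right: "S y (c \<odot> x) = cnj c * S y x" if "x \<in> carrier A" "y \<in> carrier A" for c x y
    using that smult[of x y c] herm[of y "c \<odot> x"] herm[of y x] by (simp add: smult_closed)
  define N where "N x = sqrt (Re (S x x))" for x
  have N_nonneg: "0 \<le> N x" if "x \<in> carrier A" for x using pos[OF that] by (simp add: N_def)
  have N_sq: "(N x)\<^sup>2 = Re (S x x)" if "x \<in> carrier A" for x using pos[OF that] by (simp add: N_def)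
  have N_smult: "N (c \<odot> x) = cmod c * N x" if x: "x \<in> carrier A" for c x
  proof -
    have "S (c \<odot> x) (c \<odot> x) = complex_of_real ((cmod c)\<^sup>2) * S x x"
      using x by (simp add: smult smult_right smult_closed complex_norm_square del: of_real_power)
    then show ?thesis by (simp add: N_def real_sqrt_mult del: of_real_power)
  qed
  have expand: "Re (S (x \<oplus> y) (x \<oplus> y)) = Re (S x x) + 2 * Re (S x y) + Re (S y y)"
    if "x \<in> carrier A" "y \<in> carrier A" for x y
    using that herm[of y x] by (simp add: add add_right)
  have CS: "Re (S x y) \<le> N x * N y" if x: "x \<in> carrier A" and y: "y \<in> carrier A" for x y
  proof -
    have q: "0 \<le> Re (S x x) - 2 * t * Re (S x y) + t\<^sup>2 * Re (S y y)" for t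
    proof -
      let ?y = "complex_of_real (- t) \<odot> y"
      have "0 \<le> Re (S (x \<oplus> ?y) (x \<oplus> ?y))" using x y by (intro pos) (simp add: smult_closed)
      also have "\<dots> = Re (S x x) + 2 * Re (S x ?y) + Re (S ?y ?y)"
        using x y by (intro expand) (simp_all add: smult_closed)
      finally show ?thesis
        using x y by (simp add: smult smult_right smult_closed power2_eq_square)
    qed
    show ?thesis
    proof (cases "N y = 0")
      \<comment> \<open>With \<open>N y = 0\<close> the inequality \<open>q\<close> is affine in
        \<open>t\<close>, so it can hold for all \<open>t\<close> only if the linear coefficient has
        the right sign; \<open>S\<close> may be degenerate, so this case does occur.\<close>
      case True
      then have y0: "Re (S y y) = 0" using N_sq[OF y] by simp
      have "Re (S x y) \<le> 0"
      proof (rule ccontr)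
        assume c: "\<not> Re (S x y) \<le> 0"
        define t where "t = (Re (S x x) + 1) / Re (S x y)"
        have "t * Re (S x y) = Re (S x x) + 1" using c by (simp add: t_def)
        then show False using q[of t] pos[OF x] y0 by simp
      qed
      then show ?thesis using True by simp
    next
      case False
      then have Ny: "N y > 0" using N_nonneg[OF y] by simp
      have "0 \<le> (N x)\<^sup>2 - 2 * (N x / N y) * Re (S x y) + (N x / N y)\<^sup>2 * (N y)\<^sup>2"
        using q[of "N x / N y"] N_sq x y by simp
      then have le: "N x * Re (S x y) \<le> N x * (N x * N y)"
        using Ny by (simp add: power2_eq_square field_simps)
      show ?thesis
      proof (cases "N x = 0")
        case True
        then have x0: "Re (S x x) = 0" using N_sq[OF x] by simp
        have "Re (S x y) \<le> 0"
        proof (rule ccontr)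
          assume c: "\<not> Re (S x y) \<le> 0"
          have "0 \<le> - 2 * (Re (S x y) / (N y)\<^sup>2) * Re (S x y) + (Re (S x y) / (N y)\<^sup>2)\<^sup>2 * (N y)\<^sup>2"
            using q[of "Re (S x y) / (N y)\<^sup>2"] x0 N_sq[OF y] by simp
          then have "0 \<le> - ((Re (S x y))\<^sup>2 / (N y)\<^sup>2)"
            using Ny by (simp add: power2_eq_square)
          then show False using c Ny by (simp add: divide_le_0_iff)
        qed
        then show ?thesis using True by simp
      next
        case False
        then show ?thesis using le N_nonneg[OF x] by (simp add: mult_le_cancel_left)
      qed
    qed
  qed
  have N_triangle: "N (x \<oplus> y) \<le> N x + N y" if x: "x \<in> carrier A" and y: "y \<in> carrier A" for x y
  proof (rule power2_le_imp_le)
    show "(N (x \<oplus> y))\<^sup>2 \<le> (N x + N y)\<^sup>2"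
      using CS[OF x y] x y by (simp add: N_sq expand power2_sum)
  qed (use N_nonneg x y in simp)
  \<comment> \<open>The infimum of all admissible constants is used instead of a supremum of
    quotients, since \<open>N x\<close> can vanish for nonzero \<open>x\<close>.\<close>
  define B where "B t = {k. 0 \<le> k \<and> (\<forall>x\<in>carrier A. N (t \<otimes> x) \<le> k * N x)}" for t
  define p where "p t = Inf (B t)" for t
  have bdd: "bdd_below (B t)" for t by (auto simp: B_def intro: bdd_belowI[of _ 0])
  have ne: "B t \<noteq> {}" if t: "t \<in> carrier A" for t
  proof -
    obtain K where K: "K \<ge> 0" "\<And>x. x \<in> carrier A \<Longrightarrow> Re (S (t \<otimes> x) (t \<otimes> x)) \<le> K * Re (S x x)"
      using bound[OF t] by blast
    have "sqrt K \<in> B t"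
      using K by (simp add: B_def N_def real_sqrt_mult[symmetric])
    then show ?thesis by blast
  qed
  have p_le: "p t \<le> k" if "0 \<le> k" "\<And>x. x \<in> carrier A \<Longrightarrow> N (t \<otimes> x) \<le> k * N x" for t k
    unfolding p_def by (rule cInf_lower[OF _ bdd]) (use that in \<open>simp add: B_def\<close>)
  have p_nonneg: "0 \<le> p t" if "t \<in> carrier A" for t
    unfolding p_def by (rule cInf_greatest[OF ne[OF that]]) (simp add: B_def)
  have p_bound: "N (t \<otimes> x) \<le> p t * N x" if t: "t \<in> carrier A" and x: "x \<in> carrier A" for t x
  proof (cases "N x = 0")
    case True
    obtain k where "k \<in> B t" using ne[OF t] by blast
    then have "N (t \<otimes> x) \<le> k * N x" using x by (simp add: B_def)
    then show ?thesis using True by simp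
  next
    case False
    then have Nx: "N x > 0" using N_nonneg[OF x] by simp
    have "N (t \<otimes> x) / N x \<le> p t"
      unfolding p_def
      by (rule cInf_greatest[OF ne[OF t]]) (use Nx x in \<open>simp add: B_def pos_divide_le_eq\<close>)
    then show ?thesis using Nx by (simp add: pos_divide_le_eq)
  qed
  have p_smult_le: "p (c \<odot> t) \<le> cmod c * p t" if t: "t \<in> carrier A" for c t
  proof (rule p_le)
    fix x assume x: "x \<in> carrier A"
    show "N ((c \<odot> t) \<otimes> x) \<le> cmod c * p t * N x"
      using p_bound[OF t x] x t
      by (simp add: smult_mult_left N_smult mult.assoc mult_left_mono)
  qed (use p_nonneg[OF t] in simp)
  have p_mult_le: "p (t \<otimes> u) \<le> p t * p u" if t: "t \<in> carrier A" and u: "u \<in> carrier A" for t u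
  proof (rule p_le)
    fix x assume x: "x \<in> carrier A"
    have "N (t \<otimes> (u \<otimes> x)) \<le> p t * N (u \<otimes> x)" using p_bound t u x by simp
    also have "\<dots> \<le> p t * (p u * N x)"
      using p_bound[OF u x] p_nonneg[OF t] by (rule mult_left_mono)
    finally show "N (t \<otimes> u \<otimes> x) \<le> p t * p u * N x" using t u x by (simp add: m_assoc)
  qed (use p_nonneg t u in simp)
  \<comment> \<open>Lower half of the C*-identity: the square of \<open>N (t \<otimes> x)\<close> is
    \<open>S\<close> of \<open>x\<close> against the product of \<open>star A t\<close>,
    \<open>t\<close> and \<open>x\<close>, to which Cauchy-Schwarz applies.\<close>
  have p_sq_le: "(p t)\<^sup>2 \<le> p (star A t \<otimes> t)" if t: "t \<in> carrier A" for t
  proof -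
    have tt: "star A t \<otimes> t \<in> carrier A" using t by (simp add: star_closed)
    have "p t \<le> sqrt (p (star A t \<otimes> t))"
    proof (rule p_le)
      fix x assume x: "x \<in> carrier A"
      have "(N (t \<otimes> x))\<^sup>2 = Re (S x ((star A t \<otimes> t) \<otimes> x))"
        using adj[OF t x, of "t \<otimes> x"] t x by (simp add: N_sq m_assoc star_closed)
      also have "\<dots> \<le> N x * N ((star A t \<otimes> t) \<otimes> x)"
        using x tt by (intro CS) auto
      also have "\<dots> \<le> N x * (p (star A t \<otimes> t) * N x)"
        using p_bound[OF tt x] N_nonneg[OF x] by (rule mult_left_mono)
      also have "\<dots> = (sqrt (p (star A t \<otimes> t)) * N x)\<^sup>2"
        using p_nonneg[OF tt] by (simp add: power_mult_distrib) (simp add: power2_eq_square)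
      finally show "N (t \<otimes> x) \<le> sqrt (p (star A t \<otimes> t)) * N x"
        by (rule power2_le_imp_le) (use p_nonneg[OF tt] N_nonneg[OF x] in simp)
    qed (use p_nonneg[OF tt] in simp)
    from power_mono[OF this p_nonneg[OF t], of 2] show ?thesis
      using p_nonneg[OF tt] by simp
  qed
  have p_star_le: "p t \<le> p (star A t)" if t: "t \<in> carrier A" for t
    using order_trans[OF p_sq_le[OF t] p_mult_le[OF star_closed[OF t] t]]
      p_nonneg[OF t] p_nonneg[OF star_closed[OF t]]
    by (cases "p t = 0") (auto simp: power2_eq_square mult_le_cancel_right)
  have "cstar_seminorm A p"
    unfolding cstar_seminorm_def
  proof (intro conjI ballI allI)
    fix t u c assume t: "t \<in> carrier A"
    show "0 \<le> p t" by (rule p_nonneg[OF t])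
    show "p (c \<odot> t) = cmod c * p t"
    proof (cases "c = 0")
      case True
      then show ?thesis
        using p_smult_le[OF t, of 0] p_nonneg[of "0 \<odot> t"] t by (simp add: smult_closed)
    next
      case False
      have "p t = p (inverse c \<odot> (c \<odot> t))"
        using False t by (simp add: smult_smult smult_1)
      also have "\<dots> \<le> cmod (inverse c) * p (c \<odot> t)"
        by (rule p_smult_le) (simp add: smult_closed t)
      finally have "cmod c * p t \<le> p (c \<odot> t)"
        using False by (simp add: norm_inverse norm_divide field_simps)
      then show ?thesis using p_smult_le[OF t, of c] by linarith
    qed
    have "p (star A t) = p t"
      using p_star_le[OF t] p_star_le[OF star_closed[OF t]] t by (simp add: star_star)
    then show "p (star A t \<otimes> t) = (p t)\<^sup>2"
      using p_sq_le[OF t] p_mult_le[OF star_closed[OF t] t] by (simp add: power2_eq_square)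
    assume u: "u \<in> carrier A"
    show "p (t \<otimes> u) \<le> p t * p u" by (rule p_mult_le[OF t u])
    show "p (t \<oplus> u) \<le> p t + p u"
    proof (rule p_le)
      fix x assume x: "x \<in> carrier A"
      have "N (t \<otimes> x \<oplus> u \<otimes> x) \<le> N (t \<otimes> x) + N (u \<otimes> x)" using t u x by (intro N_triangle) auto
      then show "N ((t \<oplus> u) \<otimes> x) \<le> (p t + p u) * N x"
        using p_bound[OF t x] p_bound[OF u x] t u x by (simp add: l_distr distrib_right)
    qed (use p_nonneg t u in simp)
  qed
  moreover have "p t = 0" if t: "t \<in> carrier A" and z: "\<forall>x\<in>carrier A. S (t \<otimes> x) (t \<otimes> x) = 0" for t
    using p_le[of 0 t] p_nonneg[OF t] z by (simp add: N_def)
  ultimately show ?thesis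
    using p_bound by (intro exI[of _ p] conjI ballI impI) (simp_all add: N_def)
qed

section \<open>Kernels on the words of a free *-algebra\<close>

context free_alg
begin

text \<open>The value of the form at the basis word \<open>w\<close> and the element
  \<open>f\<close>; the two conjugations make it conjugate linear in \<open>f\<close>. Building the
  form from two nested \<open>word_lin\<close> lets left multiplication by a letter be moved into
  the kernel.\<close>

definition kernel_functional where
  "kernel_functional K f w = cnj (word_lin (\<lambda>v. cnj (K w v)) f)"

definition kernel_form where
  "kernel_form K f g = word_lin (kernel_functional K g) f"

definition "words = {w. fst ` set w \<subseteq> G}"

lemma kernel_form_sum:
  assumes "finite I" "{w. f w \<noteq> 0} \<subseteq> I" "{w. g w \<noteq> 0} \<subseteq> I"
  shows "kernel_form K f g = (\<Sum>w\<in>I. \<Sum>v\<in>I. f w * cnj (g v) * K w v)"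
  unfolding kernel_form_def kernel_functional_def
    word_lin_superset[OF assms(1,2)] word_lin_superset[OF assms(1,3)]
  by (simp add: sum_distrib_left mult.assoc)

text \<open>The kernel stands for the inner products of vectors obtained by letting the words
  \<open>w\<close> and \<open>v\<close> act on one cyclic vector. The hypotheses say that each
  letter acts boundedly and has the starred letter as adjoint; both properties spread from letters
  to the whole algebra, and then \<open>gns_seminorm\<close> applies. The last clause reduces the
  vanishing of a relation to an identity of forms.\<close>

lemma kernel_seminorm:
  assumes herm: "\<And>w v. K w v = cnj (K v w)"
    and pos: "\<And>I c. finite I \<Longrightarrow> I \<subseteq> words \<Longrightarrow>
      0 \<le> Re (\<Sum>w\<in>I. \<Sum>v\<in>I. c w * cnj (c v) * K w v)"
    and adj: "\<And>l w v. fst l \<in> G \<Longrightarrow> K (l # w) v = K w (letter_star l # v)"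
    and bound: "\<And>l. fst l \<in> G \<Longrightarrow> \<exists>\<rho>\<ge>0. \<forall>I c. finite I \<longrightarrow> I \<subseteq> words \<longrightarrow>
      Re (\<Sum>w\<in>I. \<Sum>v\<in>I. c w * cnj (c v) * K (l # w) (l # v))
        \<le> \<rho> * Re (\<Sum>w\<in>I. \<Sum>v\<in>I. c w * cnj (c v) * K w v)"
  shows "\<exists>p. cstar_seminorm F p \<and>
    (\<forall>g\<in>G. sqrt (Re (K [(g, False)] [(g, False)])) \<le> p (free_gen g) * sqrt (Re (K [] []))) \<and>
    (\<forall>f\<in>carrier F. \<forall>f'\<in>carrier F.
      (\<forall>h\<in>carrier F. \<forall>h'\<in>carrier F.
        kernel_form K (f \<otimes>\<^bsub>F\<^esub> h) h' = kernel_form K (f' \<otimes>\<^bsub>F\<^esub> h) h') \<longrightarrow> p (f \<ominus>\<^bsub>F\<^esub> f') = 0)"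
proof -
  let ?S = "kernel_form K"
  note gens = gens_subset
  have S_add: "?S (x \<oplus>\<^bsub>F\<^esub> y) z = ?S x z + ?S y z" if "x \<in> carrier F" "y \<in> carrier F" for x y z
    using that by (simp add: kernel_form_def word_lin_add)
  have S_smult: "?S (c \<odot>\<^bsub>F\<^esub> x) y = c * ?S x y" for c x y
    by (simp add: kernel_form_def word_lin_smult)
  have S_herm: "?S x y = cnj (?S y x)" if "x \<in> carrier F" "y \<in> carrier F" for x y
  proof -
    let ?I = "{w. x w \<noteq> 0} \<union> {w. y w \<noteq> 0}"
    have I: "finite ?I" using that finite_support by blast
    have "?S x y = (\<Sum>w\<in>?I. \<Sum>v\<in>?I. x w * cnj (y v) * K w v)"
      by (rule kernel_form_sum[OF I]) auto
    also have "\<dots> = (\<Sum>w\<in>?I. \<Sum>v\<in>?I. x v * cnj (y w) * K v w)"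
      by (rule sum.swap)
    also have "\<dots> = cnj (\<Sum>w\<in>?I. \<Sum>v\<in>?I. y w * cnj (x v) * K w v)"
      unfolding cnj_sum
    proof (intro sum.cong refl)
      fix w v
      have "K v w = cnj (K w v)" by (rule herm)
      then show "x v * cnj (y w) * K v w = cnj (y w * cnj (x v) * K w v)" by simp
    qed
    also have "(\<Sum>w\<in>?I. \<Sum>v\<in>?I. y w * cnj (x v) * K w v) = ?S y x"
      by (rule kernel_form_sum[OF I, symmetric]) auto
    finally show ?thesis .
  qed
  have support: "{w. x w \<noteq> 0} \<subseteq> words" if "x \<in> carrier F" for x
    using that by (auto simp: carrier_F words_def)
  have S_pos: "0 \<le> Re (?S x x)" if x: "x \<in> carrier F" for x
    using pos[OF finite_support[OF x] support[OF x], of x]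
    by (simp add: kernel_form_sum[OF finite_support[OF x]])
  have mult_gen: "word_lin \<theta> (word_coeff [l] \<otimes>\<^bsub>F\<^esub> f) = word_lin (\<lambda>w. \<theta> (l # w)) f"
    if "f \<in> carrier F" for \<theta> l f
  proof -
    obtain g b where l: "l = (g, b)" by (cases l)
    have "word_coeff [(g, False)] = free_gen g"
      by (auto simp: word_coeff_def free_gen_def)
    moreover have "word_coeff [(g, True)] = star F (free_gen g)"
      by (auto simp: free_gen_def word_coeff_def fun_eq_iff word_star_eq_iff) (auto simp: word_star_def)
    ultimately show ?thesis
      using word_lin_free_gen_mult[OF that] word_lin_star_free_gen_mult[OF that] l by (cases b) auto
  qed
  have gen_adj: "?S (word_coeff [l] \<otimes>\<^bsub>F\<^esub> x) y = ?S x (word_coeff [letter_star l] \<otimes>\<^bsub>F\<^esub> y)"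
    if "fst l \<in> G" "x \<in> carrier F" "y \<in> carrier F" for l x y
    using that by (simp only: kernel_form_def kernel_functional_def[abs_def] mult_gen adj)
  have letter: "word_coeff [l] \<in> carrier F" if "fst l \<in> G" for l
    by (rule F.star_generate_closed[OF gens word_coeff_generated]) (use that in auto)
  have gen_bound: "\<exists>k\<ge>0. \<forall>x\<in>carrier F. Re (?S (word_coeff [l] \<otimes>\<^bsub>F\<^esub> x) (word_coeff [l] \<otimes>\<^bsub>F\<^esub> x)) \<le> k * Re (?S x x)"
    if l: "fst l \<in> G" for l
  proof -
    obtain \<rho> where \<rho>: "\<rho> \<ge> 0" "\<And>I c. finite I \<Longrightarrow> I \<subseteq> words \<Longrightarrow>
      Re (\<Sum>w\<in>I. \<Sum>v\<in>I. c w * cnj (c v) * K (l # w) (l # v))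
        \<le> \<rho> * Re (\<Sum>w\<in>I. \<Sum>v\<in>I. c w * cnj (c v) * K w v)"
      using bound[OF l] by blast
    have "?S (word_coeff [l] \<otimes>\<^bsub>F\<^esub> x) (word_coeff [l] \<otimes>\<^bsub>F\<^esub> x)
        = (\<Sum>w | x w \<noteq> 0. \<Sum>v | x v \<noteq> 0. x w * cnj (x v) * K (l # w) (l # v))"
      if "x \<in> carrier F" for x
      using that unfolding kernel_form_def kernel_functional_def mult_gen[OF that]
      by (simp add: word_lin_def sum_distrib_left mult.assoc)
    moreover have "?S x x = (\<Sum>w | x w \<noteq> 0. \<Sum>v | x v \<noteq> 0. x w * cnj (x v) * K w v)"
      if "x \<in> carrier F" for x
      by (rule kernel_form_sum) (use finite_support[OF that] in auto)
    ultimately show ?thesis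
      using \<rho> finite_support support by (intro exI[of _ \<rho>]) simp
  qed
  have gen_eq: "word_coeff [(g, False)] = free_gen g" "star F (free_gen g) = word_coeff [(g, True)]" for g
    by (auto simp: free_gen_def word_coeff_def fun_eq_iff word_star_eq_iff) (auto simp: word_star_def)
  note cl = F.star_generate_closed[OF gens]
  have S_adj: "\<forall>x\<in>carrier F. \<forall>y\<in>carrier F. ?S (t \<otimes>\<^bsub>F\<^esub> x) y = ?S x (star F t \<otimes>\<^bsub>F\<^esub> y)"
    if "t \<in> star_generate F (free_gen ` G)" for t
    using that
  proof induction
    case (incl t)
    then obtain g where "g \<in> G" "t = free_gen g" by blast
    then show ?case using gen_adj[of "(g, False)"] by (simp only: gen_eq) simp
  next
    case one
    then show ?case by (simp del: F_simps)
  next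
    case (add t u)
    have t: "t \<in> carrier F" "u \<in> carrier F" using add.hyps cl by auto
    show ?case
    proof (intro ballI)
      fix x y assume x: "x \<in> carrier F" and y: "y \<in> carrier F"
      have r: "?S x (a \<oplus>\<^bsub>F\<^esub> b) = ?S x a + ?S x b" if "a \<in> carrier F" "b \<in> carrier F" for a b
        using that x S_add[of a b x] S_herm[of x a] S_herm[of x b] S_herm[of x "a \<oplus>\<^bsub>F\<^esub> b"]
        by (simp del: F_simps)
      show "?S ((t \<oplus>\<^bsub>F\<^esub> u) \<otimes>\<^bsub>F\<^esub> x) y = ?S x (star F (t \<oplus>\<^bsub>F\<^esub> u) \<otimes>\<^bsub>F\<^esub> y)"
        using add.IH x y t by (simp add: F.l_distr F.star_add F.star_closed S_add r del: F_simps)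
    qed
  next
    case (mult t u)
    have "t \<in> carrier F" "u \<in> carrier F" using mult.hyps cl by auto
    then show ?case
      using mult.IH by (simp add: F.m_assoc F.star_mult F.star_closed del: F_simps)
  next
    case (smult t c)
    have t: "t \<in> carrier F" using smult.hyps cl by auto
    show ?case
    proof (intro ballI)
      fix x y assume x: "x \<in> carrier F" and y: "y \<in> carrier F"
      have r: "?S x (cnj c \<odot>\<^bsub>F\<^esub> a) = c * ?S x a" if "a \<in> carrier F" for a
        using that x S_smult[of "cnj c" a x] S_herm[of x a] S_herm[of x "cnj c \<odot>\<^bsub>F\<^esub> a"]
        by (simp add: F.smult_closed del: F_simps)
      show "?S ((c \<odot>\<^bsub>F\<^esub> t) \<otimes>\<^bsub>F\<^esub> x) y = ?S x (star F (c \<odot>\<^bsub>F\<^esub> t) \<otimes>\<^bsub>F\<^esub> y)"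
        using smult.IH x y t
        by (simp add: F.smult_mult_left F.star_smult F.star_closed S_smult r del: F_simps)
    qed
  next
    case (star t)
    have t: "t \<in> carrier F" using star.hyps cl by auto
    show ?case
    proof (intro ballI)
      fix x y assume x: "x \<in> carrier F" and y: "y \<in> carrier F"
      have "star F t \<otimes>\<^bsub>F\<^esub> x \<in> carrier F" "t \<otimes>\<^bsub>F\<^esub> y \<in> carrier F"
        using x y t F.star_closed F.m_closed by blast+
      then have "?S (star F t \<otimes>\<^bsub>F\<^esub> x) y = cnj (?S y (star F t \<otimes>\<^bsub>F\<^esub> x))"
        "?S x (t \<otimes>\<^bsub>F\<^esub> y) = cnj (?S (t \<otimes>\<^bsub>F\<^esub> y) x)"
        using x y S_herm by blast+
      then show "?S (star F t \<otimes>\<^bsub>F\<^esub> x) y = ?S x (star F (star F t) \<otimes>\<^bsub>F\<^esub> y)"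
        using star.IH x y by (simp only: F.star_star[OF t])
    qed
  qed
  define bdd where "bdd t \<longleftrightarrow> (\<exists>k\<ge>0. \<forall>x\<in>carrier F. Re (?S (t \<otimes>\<^bsub>F\<^esub> x) (t \<otimes>\<^bsub>F\<^esub> x)) \<le> k * Re (?S x x))" for t
  have bdd_add: "bdd (t \<oplus>\<^bsub>F\<^esub> u)" if "bdd t" "bdd u" "t \<in> carrier F" "u \<in> carrier F" for t u
  proof -
    obtain k where k: "k \<ge> 0" "\<And>x. x \<in> carrier F \<Longrightarrow> Re (?S (t \<otimes>\<^bsub>F\<^esub> x) (t \<otimes>\<^bsub>F\<^esub> x)) \<le> k * Re (?S x x)"
      using \<open>bdd t\<close> unfolding bdd_def by blast
    obtain m where m: "m \<ge> 0" "\<And>x. x \<in> carrier F \<Longrightarrow> Re (?S (u \<otimes>\<^bsub>F\<^esub> x) (u \<otimes>\<^bsub>F\<^esub> x)) \<le> m * Re (?S x x)"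
      using \<open>bdd u\<close> unfolding bdd_def by blast
    \<comment> \<open>Taken from the non-negativity of the form at the difference of
      \<open>x\<close> and \<open>y\<close>, this inequality keeps the bounds for sums in terms of
      squares.\<close>
    have par: "Re (?S (x \<oplus>\<^bsub>F\<^esub> y) (x \<oplus>\<^bsub>F\<^esub> y)) \<le> 2 * Re (?S x x) + 2 * Re (?S y y)"
      if x: "x \<in> carrier F" and y: "y \<in> carrier F" for x y
    proof -
      have cl: "x \<oplus>\<^bsub>F\<^esub> y \<in> carrier F" "(-1) \<odot>\<^bsub>F\<^esub> y \<in> carrier F" "x \<oplus>\<^bsub>F\<^esub> ((-1) \<odot>\<^bsub>F\<^esub> y) \<in> carrier F"
        using x y by (simp_all add: F.smult_closed del: F_simps)
      have sq: "Re (?S (x \<oplus>\<^bsub>F\<^esub> z) (x \<oplus>\<^bsub>F\<^esub> z)) = Re (?S x x) + 2 * Re (?S z x) + Re (?S z z)"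
        if z: "z \<in> carrier F" for z
      proof -
        have "x \<oplus>\<^bsub>F\<^esub> z \<in> carrier F" using x z by (simp del: F_simps)
        then show ?thesis
          using x z S_add[OF x z, of "x \<oplus>\<^bsub>F\<^esub> z"] S_herm[of x "x \<oplus>\<^bsub>F\<^esub> z"] S_herm[of z "x \<oplus>\<^bsub>F\<^esub> z"]
            S_add[OF x z, of x] S_add[OF x z, of z] S_herm[of x z]
          by (simp del: F_simps)
      qed
      have "?S ((-1) \<odot>\<^bsub>F\<^esub> y) x = - ?S y x" by (simp add: S_smult del: F_simps)
      moreover have "?S ((-1) \<odot>\<^bsub>F\<^esub> y) ((-1) \<odot>\<^bsub>F\<^esub> y) = ?S y y"
      proof -
        have "?S ((-1) \<odot>\<^bsub>F\<^esub> y) ((-1) \<odot>\<^bsub>F\<^esub> y) = (-1) * cnj ((-1) * ?S y y)"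
          by (simp only: S_smult S_herm[OF y cl(2)])
        also have "\<dots> = cnj (?S y y)" by simp
        also have "\<dots> = ?S y y" by (rule S_herm[OF y y, symmetric])
        finally show ?thesis .
      qed
      ultimately show ?thesis
        using sq[OF y] sq[OF cl(2)] S_pos[OF cl(3)] by simp
    qed
    show ?thesis
      unfolding bdd_def
    proof (intro exI[of _ "2 * k + 2 * m"] conjI ballI)
      fix x assume x: "x \<in> carrier F"
      show "Re (?S ((t \<oplus>\<^bsub>F\<^esub> u) \<otimes>\<^bsub>F\<^esub> x) ((t \<oplus>\<^bsub>F\<^esub> u) \<otimes>\<^bsub>F\<^esub> x)) \<le> (2 * k + 2 * m) * Re (?S x x)"
        using par[of "t \<otimes>\<^bsub>F\<^esub> x" "u \<otimes>\<^bsub>F\<^esub> x"] k(2)[OF x] m(2)[OF x] x that(3,4)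
        by (simp add: F.l_distr algebra_simps del: F_simps)
    qed (use k m in simp)
  qed
  have bdd_mult: "bdd (t \<otimes>\<^bsub>F\<^esub> u)" if "bdd t" "bdd u" "t \<in> carrier F" "u \<in> carrier F" for t u
  proof -
    obtain k where k: "k \<ge> 0" "\<And>x. x \<in> carrier F \<Longrightarrow> Re (?S (t \<otimes>\<^bsub>F\<^esub> x) (t \<otimes>\<^bsub>F\<^esub> x)) \<le> k * Re (?S x x)"
      using \<open>bdd t\<close> unfolding bdd_def by blast
    obtain m where m: "m \<ge> 0" "\<And>x. x \<in> carrier F \<Longrightarrow> Re (?S (u \<otimes>\<^bsub>F\<^esub> x) (u \<otimes>\<^bsub>F\<^esub> x)) \<le> m * Re (?S x x)"
      using \<open>bdd u\<close> unfolding bdd_def by blast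
    show ?thesis
      unfolding bdd_def
    proof (intro exI[of _ "k * m"] conjI ballI)
      fix x assume x: "x \<in> carrier F"
      have "Re (?S (t \<otimes>\<^bsub>F\<^esub> (u \<otimes>\<^bsub>F\<^esub> x)) (t \<otimes>\<^bsub>F\<^esub> (u \<otimes>\<^bsub>F\<^esub> x))) \<le> k * Re (?S (u \<otimes>\<^bsub>F\<^esub> x) (u \<otimes>\<^bsub>F\<^esub> x))"
        by (rule k(2)) (use x that in \<open>simp del: F_simps\<close>)
      also have "\<dots> \<le> k * (m * Re (?S x x))" using m(2)[OF x] k(1) by (rule mult_left_mono)
      finally show "Re (?S ((t \<otimes>\<^bsub>F\<^esub> u) \<otimes>\<^bsub>F\<^esub> x) ((t \<otimes>\<^bsub>F\<^esub> u) \<otimes>\<^bsub>F\<^esub> x)) \<le> k * m * Re (?S x x)"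
        using x that by (simp add: F.m_assoc mult.assoc del: F_simps)
    qed (use k m in simp)
  qed
  have bdd_smult: "bdd (c \<odot>\<^bsub>F\<^esub> t)" if "bdd t" "t \<in> carrier F" for c t
  proof -
    obtain k where k: "k \<ge> 0" "\<And>x. x \<in> carrier F \<Longrightarrow> Re (?S (t \<otimes>\<^bsub>F\<^esub> x) (t \<otimes>\<^bsub>F\<^esub> x)) \<le> k * Re (?S x x)"
      using \<open>bdd t\<close> unfolding bdd_def by blast
    have sq: "?S (c \<odot>\<^bsub>F\<^esub> z) (c \<odot>\<^bsub>F\<^esub> z) = complex_of_real ((cmod c)\<^sup>2) * ?S z z" if z: "z \<in> carrier F" for z
    proof -
      have cz: "c \<odot>\<^bsub>F\<^esub> z \<in> carrier F" using z by (rule F.smult_closed)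
      have "?S (c \<odot>\<^bsub>F\<^esub> z) (c \<odot>\<^bsub>F\<^esub> z) = c * cnj (c * ?S z z)"
        by (simp only: S_smult S_herm[OF z cz])
      also have "\<dots> = c * cnj c * cnj (?S z z)" by simp
      also have "cnj (?S z z) = ?S z z" by (rule S_herm[OF z z, symmetric])
      finally show ?thesis by (simp only: complex_norm_square)
    qed
    show ?thesis
      unfolding bdd_def
    proof (intro exI[of _ "(cmod c)\<^sup>2 * k"] conjI ballI)
      fix x assume x: "x \<in> carrier F"
      have "t \<otimes>\<^bsub>F\<^esub> x \<in> carrier F" using x that(2) by (simp del: F_simps)
      then have "Re (?S ((c \<odot>\<^bsub>F\<^esub> t) \<otimes>\<^bsub>F\<^esub> x) ((c \<odot>\<^bsub>F\<^esub> t) \<otimes>\<^bsub>F\<^esub> x))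
          = (cmod c)\<^sup>2 * Re (?S (t \<otimes>\<^bsub>F\<^esub> x) (t \<otimes>\<^bsub>F\<^esub> x))"
        using sq[of "t \<otimes>\<^bsub>F\<^esub> x"] x that(2)
        by (simp only: F.smult_mult_left) (simp del: F_simps of_real_power)
      then show "Re (?S ((c \<odot>\<^bsub>F\<^esub> t) \<otimes>\<^bsub>F\<^esub> x) ((c \<odot>\<^bsub>F\<^esub> t) \<otimes>\<^bsub>F\<^esub> x)) \<le> (cmod c)\<^sup>2 * k * Re (?S x x)"
        using mult_left_mono[OF k(2)[OF x], of "(cmod c)\<^sup>2"] by (simp add: mult.assoc del: F_simps)
    qed (use k in simp)
  qed
  \<comment> \<open>The adjoint is carried along in the induction so that the case of a star closes
    by \<open>F.star_star\<close>.\<close>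
  have bdd_all: "bdd t \<and> bdd (star F t)" if "t \<in> star_generate F (free_gen ` G)" for t
    using that
  proof induction
    case (incl t)
    then obtain g where "g \<in> G" "t = free_gen g" by blast
    then show ?case
      using gen_bound[of "(g, False)"] gen_bound[of "(g, True)"] unfolding bdd_def by (simp only: gen_eq fst_conv)
  next
    case one
    have "bdd \<one>\<^bsub>F\<^esub>" unfolding bdd_def by (intro exI[of _ 1]) (simp del: F_simps)
    then show ?case by (simp del: F_simps)
  next
    case (add t u)
    have "t \<in> carrier F" "u \<in> carrier F" using add.hyps cl by auto
    then show ?case
      using add.IH by (simp add: F.star_add F.star_closed bdd_add del: F_simps)
  next
    case (mult t u)
    have "t \<in> carrier F" "u \<in> carrier F" using mult.hyps cl by auto
    then show ?case
      using mult.IH by (simp add: F.star_mult F.star_closed bdd_mult del: F_simps)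
  next
    case (smult t c)
    have "t \<in> carrier F" using smult.hyps cl by auto
    then show ?case
      using smult.IH by (simp add: F.star_smult F.star_closed bdd_smult del: F_simps)
  next
    case (star t)
    have "t \<in> carrier F" using star.hyps cl by auto
    then show ?case using star.IH by (simp add: F.star_star del: F_simps)
  qed
  have "\<exists>p. cstar_seminorm F p \<and>
    (\<forall>t\<in>carrier F. \<forall>x\<in>carrier F.
      sqrt (Re (?S (t \<otimes>\<^bsub>F\<^esub> x) (t \<otimes>\<^bsub>F\<^esub> x))) \<le> p t * sqrt (Re (?S x x))) \<and>
    (\<forall>t\<in>carrier F. (\<forall>x\<in>carrier F. ?S (t \<otimes>\<^bsub>F\<^esub> x) (t \<otimes>\<^bsub>F\<^esub> x) = 0) \<longrightarrow> p t = 0)"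
  proof (rule F.gns_seminorm[of ?S])
    fix t assume "t \<in> carrier F"
    then have "t \<in> star_generate F (free_gen ` G)" by (rule carrier_F_generated)
    then show "\<exists>k\<ge>0. \<forall>x\<in>carrier F. Re (?S (t \<otimes>\<^bsub>F\<^esub> x) (t \<otimes>\<^bsub>F\<^esub> x)) \<le> k * Re (?S x x)"
      using bdd_all unfolding bdd_def by blast
  next
    fix t x y assume "t \<in> carrier F" "x \<in> carrier F" "y \<in> carrier F"
    then show "?S (t \<otimes>\<^bsub>F\<^esub> x) y = ?S x (star F t \<otimes>\<^bsub>F\<^esub> y)"
      using S_adj[OF carrier_F_generated] by blast
  next
    fix x y z assume "x \<in> carrier F" "y \<in> carrier F"
    then show "?S (x \<oplus>\<^bsub>F\<^esub> y) z = ?S x z + ?S y z" by (rule S_add)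
  next
    fix c x y show "?S (c \<odot>\<^bsub>F\<^esub> x) y = c * ?S x y" by (rule S_smult)
  next
    fix x y assume "x \<in> carrier F" "y \<in> carrier F"
    then show "?S x y = cnj (?S y x)" by (rule S_herm)
  next
    fix x assume "x \<in> carrier F"
    then show "0 \<le> Re (?S x x)" by (rule S_pos)
  qed
  then obtain p where p: "cstar_seminorm F p"
    and le: "\<And>t x. t \<in> carrier F \<Longrightarrow> x \<in> carrier F \<Longrightarrow>
      sqrt (Re (?S (t \<otimes>\<^bsub>F\<^esub> x) (t \<otimes>\<^bsub>F\<^esub> x))) \<le> p t * sqrt (Re (?S x x))"
    and zero: "\<And>t. t \<in> carrier F \<Longrightarrow> (\<forall>x\<in>carrier F. ?S (t \<otimes>\<^bsub>F\<^esub> x) (t \<otimes>\<^bsub>F\<^esub> x) = 0) \<Longrightarrow> p t = 0"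
    by blast
  show ?thesis
  proof (intro exI[of _ p] conjI ballI impI)
    show "cstar_seminorm F p" by (rule p)
    fix g assume g: "g \<in> G"
    have "?S (free_gen g) (free_gen g) = K [(g, False)] [(g, False)]"
      by (simp add: kernel_form_def kernel_functional_def word_lin_free_gen)
    moreover have "?S \<one>\<^bsub>F\<^esub> \<one>\<^bsub>F\<^esub> = K [] []"
      by (simp only: kernel_form_def kernel_functional_def word_lin_one) simp
    ultimately show "sqrt (Re (K [(g, False)] [(g, False)])) \<le> p (free_gen g) * sqrt (Re (K [] []))"
      using le[OF free_gen_closed[OF g] F.one_closed] g by (simp del: F_simps)
  next
    fix f f' assume f: "f \<in> carrier F" "f' \<in> carrier F"
      and eq: "\<forall>h\<in>carrier F. \<forall>h'\<in>carrier F. ?S (f \<otimes>\<^bsub>F\<^esub> h) h' = ?S (f' \<otimes>\<^bsub>F\<^esub> h) h'"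
    show "p (f \<ominus>\<^bsub>F\<^esub> f') = 0"
    proof (rule zero)
      show "f \<ominus>\<^bsub>F\<^esub> f' \<in> carrier F" using f by (rule F.minus_closed)
    next
      show "\<forall>x\<in>carrier F. ?S ((f \<ominus>\<^bsub>F\<^esub> f') \<otimes>\<^bsub>F\<^esub> x) ((f \<ominus>\<^bsub>F\<^esub> f') \<otimes>\<^bsub>F\<^esub> x) = 0"
      proof
      fix x assume x: "x \<in> carrier F"
      have "(f \<ominus>\<^bsub>F\<^esub> f') \<otimes>\<^bsub>F\<^esub> x = f \<otimes>\<^bsub>F\<^esub> x \<oplus>\<^bsub>F\<^esub> (-1) \<odot>\<^bsub>F\<^esub> (f' \<otimes>\<^bsub>F\<^esub> x)"
        using f x by (simp add: F.minus_eq F.l_distr F.l_minus F.smult_minus_one del: F_simps)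
      then have "?S ((f \<ominus>\<^bsub>F\<^esub> f') \<otimes>\<^bsub>F\<^esub> x) h = ?S (f \<otimes>\<^bsub>F\<^esub> x) h - ?S (f' \<otimes>\<^bsub>F\<^esub> x) h" for h
        using f x S_add[of "f \<otimes>\<^bsub>F\<^esub> x" "(-1) \<odot>\<^bsub>F\<^esub> (f' \<otimes>\<^bsub>F\<^esub> x)" h]
        by (simp add: S_smult F.smult_closed del: F_simps)
      then show "?S ((f \<ominus>\<^bsub>F\<^esub> f') \<otimes>\<^bsub>F\<^esub> x) ((f \<ominus>\<^bsub>F\<^esub> f') \<otimes>\<^bsub>F\<^esub> x) = 0"
        using eq f x by (simp del: F_simps)
      qed
    qed
  qed
qed

end

section \<open>Tensor products\<close>

lemma gram_eq:
  "cinner (\<Sum>i\<in>I. scaleC (c i) (v i)) (\<Sum>i\<in>I. scaleC (c i) (v i))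
    = (\<Sum>i\<in>I. \<Sum>j\<in>I. c i * cnj (c j) * cinner (v i) (v j))"
proof -
  have "cinner (\<Sum>i\<in>I. scaleC (c i) (v i)) (\<Sum>i\<in>I. scaleC (c i) (v i))
      = (\<Sum>i\<in>I. \<Sum>j\<in>I. cinner (scaleC (c i) (v i)) (scaleC (c j) (v j)))"
    by (subst cinner_sum_left) (simp only: cinner_sum_right)
  then show ?thesis
    by (simp add: cinner_scaleC_left cinner_scaleC_right mult.assoc mult.left_commute)
qed

lemma gram_nonneg: "0 \<le> Re (\<Sum>i\<in>I. \<Sum>j\<in>I. c i * cnj (c j) * cinner (v i) (v j))"
  by (subst gram_eq[symmetric]) simp

lemma gram_contraction:
  assumes Z: "Z \<in> carrier bounded_operators"
  shows "Re (\<Sum>i\<in>I. \<Sum>j\<in>I. c i * cnj (c j) * cinner (Z (v i)) (Z (v j)))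
      \<le> (onorm Z)\<^sup>2 * Re (\<Sum>i\<in>I. \<Sum>j\<in>I. c i * cnj (c j) * cinner (v i) (v j))"
proof -
  have bl: "bounded_linear Z" using Z by (simp add: carrier_bounded_operators)
  let ?z = "\<Sum>i\<in>I. scaleC (c i) (v i)"
  have "(\<Sum>i\<in>I. scaleC (c i) (Z (v i))) = Z ?z"
    using bl by (simp add: linear_sum bounded_linear.linear operator_linear[OF Z])
  then have 1: "(\<Sum>i\<in>I. \<Sum>j\<in>I. c i * cnj (c j) * cinner (Z (v i)) (Z (v j))) = cinner (Z ?z) (Z ?z)"
    using gram_eq[of c "\<lambda>i. Z (v i)" I] by (simp only:)
  have 2: "(\<Sum>i\<in>I. \<Sum>j\<in>I. c i * cnj (c j) * cinner (v i) (v j)) = cinner ?z ?z"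
    by (rule gram_eq[symmetric])
  show ?thesis
    unfolding 1 2 Re_cinner_self
    using power_mono[OF onorm[OF bl, of ?z], of 2] by (simp add: power_mult_distrib)
qed

text \<open>Boundedness of \<open>Z\<close> acting on one leg of a tensor product. The kernel formed
  by the squared norm of \<open>Z\<close> times the Gram kernel of \<open>e\<close>, minus that of
  the vectors \<open>Z (e w)\<close>, is positive; its Schur product with the Gram kernel of
  \<open>f\<close> is the difference of the two sides.\<close>

lemma schur_contraction:
  assumes I: "finite I" and Z: "Z \<in> carrier bounded_operators"
  shows "Re (\<Sum>w\<in>I. \<Sum>v\<in>I. c w * cnj (c v) * (cinner (Z (e w)) (Z (e v)) * cinner (f w) (f v)))
      \<le> (onorm Z)\<^sup>2 * Re (\<Sum>w\<in>I. \<Sum>v\<in>I. c w * cnj (c v) * (cinner (e w) (e v) * cinner (f w) (f v)))"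
proof -
  let ?\<rho> = "complex_of_real ((onorm Z)\<^sup>2)"
  let ?M = "\<lambda>w v. c w * cnj (c v) * (?\<rho> * cinner (e w) (e v) - cinner (Z (e w)) (Z (e v)))"
  have Re_diff: "Re (?\<rho> * x - y) = (onorm Z)\<^sup>2 * Re x - Re y" for x y
    by simp
  have "0 \<le> Re (\<Sum>w\<in>I. \<Sum>v\<in>I. ?M w v * cinner (f w) (f v))"
  proof (rule schur_product[OF I])
    show "?M w v = cnj (?M v w)" for w v
      using cinner_commute[of "e w" "e v"] cinner_commute[of "Z (e w)" "Z (e v)"] by simp
    fix d
    have "(\<Sum>w\<in>I. \<Sum>v\<in>I. d w * cnj (d v) * ?M w v)
        = ?\<rho> * (\<Sum>w\<in>I. \<Sum>v\<in>I. (d w * c w) * cnj (d v * c v) * cinner (e w) (e v))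
          - (\<Sum>w\<in>I. \<Sum>v\<in>I. (d w * c w) * cnj (d v * c v) * cinner (Z (e w)) (Z (e v)))"
      unfolding sum_distrib_left sum_subtractf[symmetric]
      by (intro sum.cong refl) (simp add: algebra_simps)
    then show "0 \<le> Re (\<Sum>w\<in>I. \<Sum>v\<in>I. d w * cnj (d v) * ?M w v)"
      using gram_contraction[OF Z, of "\<lambda>w. d w * c w" e I] by (simp only: Re_diff)
  qed
  moreover have "(\<Sum>w\<in>I. \<Sum>v\<in>I. ?M w v * cinner (f w) (f v))
      = ?\<rho> * (\<Sum>w\<in>I. \<Sum>v\<in>I. c w * cnj (c v) * (cinner (e w) (e v) * cinner (f w) (f v)))
        - (\<Sum>w\<in>I. \<Sum>v\<in>I. c w * cnj (c v) * (cinner (Z (e w)) (Z (e v)) * cinner (f w) (f v)))"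
    unfolding sum_distrib_left sum_subtractf[symmetric]
    by (intro sum.cong refl) (simp add: algebra_simps)
  ultimately show ?thesis by (simp only: Re_diff)
qed

lemma (in seminormed_star_algebra) p_eq_of_null:
  "x \<in> carrier A \<Longrightarrow> y \<in> carrier A \<Longrightarrow> p (x \<ominus> y) = 0 \<Longrightarrow> p x = p y"
  using p_reverse_triangle[of x y] by simp

text \<open>The map that sends \<open>x\<close> to the symbol of \<open>x\<close> paired with the
  unit is a homomorphism only modulo the tensor relations. That is enough for pulling back a
  seminorm in which the relations are null.\<close>

lemma (in seminormed_star_algebra) approximate_hom_seminorm:
  assumes B: "star_algebra B" and f: "\<And>x. x \<in> carrier B \<Longrightarrow> f x \<in> carrier A"
    and add: "\<And>x y. x \<in> carrier B \<Longrightarrow> y \<in> carrier B \<Longrightarrow> p (f (x \<oplus>\<^bsub>B\<^esub> y) \<ominus> (f x \<oplus> f y)) = 0"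
    and mult: "\<And>x y. x \<in> carrier B \<Longrightarrow> y \<in> carrier B \<Longrightarrow> p (f (x \<otimes>\<^bsub>B\<^esub> y) \<ominus> (f x \<otimes> f y)) = 0"
    and smult: "\<And>c x. x \<in> carrier B \<Longrightarrow> p (f (c \<odot>\<^bsub>B\<^esub> x) \<ominus> c \<odot> f x) = 0"
    and star: "\<And>x. x \<in> carrier B \<Longrightarrow> p (f (star B x) \<ominus> star A (f x)) = 0"
  shows "cstar_seminorm B (\<lambda>x. p (f x))"
proof -
  interpret B: star_algebra B by fact
  have mult': "p (f (x \<otimes>\<^bsub>B\<^esub> y)) = p (f x \<otimes> f y)" if "x \<in> carrier B" "y \<in> carrier B" for x y
    using that f by (intro p_eq_of_null mult) auto
  show ?thesis
    unfolding cstar_seminorm_def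
  proof (intro conjI ballI allI)
    fix x y c assume x: "x \<in> carrier B"
    show "0 \<le> p (f x)" by (rule nonneg[OF f[OF x]])
    have "p (f (c \<odot>\<^bsub>B\<^esub> x)) = p (c \<odot> f x)"
      using x f B.smult_closed smult_closed by (intro p_eq_of_null smult) auto
    then show "p (f (c \<odot>\<^bsub>B\<^esub> x)) = cmod c * p (f x)" using f[OF x] by (simp add: p_smult)
    have sx: "star B x \<in> carrier B" by (rule B.star_closed[OF x])
    note cl = f[OF x] f[OF sx] star_closed[OF f[OF x]]
    \<comment> \<open>The null difference of \<open>f (star B x)\<close> and
      \<open>star A (f x)\<close> stays null after multiplication by \<open>f x\<close>, so the
      C*-identity of \<open>p\<close> can be used in the pullback.\<close>
    have "p ((f (star B x) \<otimes> f x) \<ominus> (star A (f x) \<otimes> f x)) = p ((f (star B x) \<ominus> star A (f x)) \<otimes> f x)"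
      using cl by (simp add: minus_eq l_distr l_minus)
    also have "\<dots> \<le> p (f (star B x) \<ominus> star A (f x)) * p (f x)"
      using cl by (intro p_mult) auto
    also have "\<dots> = 0" using star[OF x] by simp
    finally have "p ((f (star B x) \<otimes> f x) \<ominus> (star A (f x) \<otimes> f x)) = 0"
      using nonneg[of "(f (star B x) \<otimes> f x) \<ominus> (star A (f x) \<otimes> f x)"] cl by simp
    then have "p (f (star B x) \<otimes> f x) = p (star A (f x) \<otimes> f x)"
      using cl by (intro p_eq_of_null) auto
    then show "p (f (star B x \<otimes>\<^bsub>B\<^esub> x)) = (p (f x))\<^sup>2"
      using cl by (simp add: mult'[OF sx x] cstar)
    assume y: "y \<in> carrier B"
    show "p (f (x \<otimes>\<^bsub>B\<^esub> y)) \<le> p (f x) * p (f y)"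
      using p_mult[OF f[OF x] f[OF y]] by (simp add: mult'[OF x y])
    have "p (f (x \<oplus>\<^bsub>B\<^esub> y)) = p (f x \<oplus> f y)"
      using x y f by (intro p_eq_of_null add) auto
    then show "p (f (x \<oplus>\<^bsub>B\<^esub> y)) \<le> p (f x) + p (f y)"
      using triangle[OF f[OF x] f[OF y]] by simp
  qed
qed

section \<open>The maximal tensor product of two C*-algebras\<close>

locale cstar_tensor = A: cstar_algebra A + B: cstar_algebra B
  for A :: "('a, 'm) cstar_scheme" and B :: "('b, 'l) cstar_scheme"
begin

sublocale free_alg "carrier A \<times> carrier B" .

abbreviation "R \<equiv> tensor_relations A B"

lemma tensor_relationsI:
  assumes "x \<in> carrier A" "y \<in> carrier B"
  shows "x' \<in> carrier A \<Longrightarrow> (free_gen (x \<oplus>\<^bsub>A\<^esub> x', y), free_gen (x, y) \<oplus>\<^bsub>F\<^esub> free_gen (x', y)) \<in> R"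
    and "y' \<in> carrier B \<Longrightarrow> (free_gen (x, y \<oplus>\<^bsub>B\<^esub> y'), free_gen (x, y) \<oplus>\<^bsub>F\<^esub> free_gen (x, y')) \<in> R"
    and "(free_gen (c \<odot>\<^bsub>A\<^esub> x, y), c \<odot>\<^bsub>F\<^esub> free_gen (x, y)) \<in> R"
    and "(free_gen (x, c \<odot>\<^bsub>B\<^esub> y), c \<odot>\<^bsub>F\<^esub> free_gen (x, y)) \<in> R"
    and "x' \<in> carrier A \<Longrightarrow> y' \<in> carrier B \<Longrightarrow>
      (free_gen (x \<otimes>\<^bsub>A\<^esub> x', y \<otimes>\<^bsub>B\<^esub> y'), free_gen (x, y) \<otimes>\<^bsub>F\<^esub> free_gen (x', y')) \<in> R"
    and "(free_gen (star A x, star B y), star F (free_gen (x, y))) \<in> R"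
    and "(free_gen (\<one>\<^bsub>A\<^esub>, \<one>\<^bsub>B\<^esub>), \<one>\<^bsub>F\<^esub>) \<in> R"
  unfolding tensor_relations_def Let_def using assms by blast+

lemma tensor_relationsE:
  assumes "(l, r) \<in> R"
    and "\<And>x x' y. x \<in> carrier A \<Longrightarrow> x' \<in> carrier A \<Longrightarrow> y \<in> carrier B \<Longrightarrow>
      P (free_gen (x \<oplus>\<^bsub>A\<^esub> x', y)) (free_gen (x, y) \<oplus>\<^bsub>F\<^esub> free_gen (x', y))"
    and "\<And>x y y'. x \<in> carrier A \<Longrightarrow> y \<in> carrier B \<Longrightarrow> y' \<in> carrier B \<Longrightarrow>
      P (free_gen (x, y \<oplus>\<^bsub>B\<^esub> y')) (free_gen (x, y) \<oplus>\<^bsub>F\<^esub> free_gen (x, y'))"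
    and "\<And>c x y. x \<in> carrier A \<Longrightarrow> y \<in> carrier B \<Longrightarrow>
      P (free_gen (c \<odot>\<^bsub>A\<^esub> x, y)) (c \<odot>\<^bsub>F\<^esub> free_gen (x, y))"
    and "\<And>c x y. x \<in> carrier A \<Longrightarrow> y \<in> carrier B \<Longrightarrow>
      P (free_gen (x, c \<odot>\<^bsub>B\<^esub> y)) (c \<odot>\<^bsub>F\<^esub> free_gen (x, y))"
    and "\<And>x x' y y'. x \<in> carrier A \<Longrightarrow> x' \<in> carrier A \<Longrightarrow> y \<in> carrier B \<Longrightarrow> y' \<in> carrier B \<Longrightarrow>
      P (free_gen (x \<otimes>\<^bsub>A\<^esub> x', y \<otimes>\<^bsub>B\<^esub> y')) (free_gen (x, y) \<otimes>\<^bsub>F\<^esub> free_gen (x', y'))"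
    and "\<And>x y. x \<in> carrier A \<Longrightarrow> y \<in> carrier B \<Longrightarrow>
      P (free_gen (star A x, star B y)) (star F (free_gen (x, y)))"
    and "P (free_gen (\<one>\<^bsub>A\<^esub>, \<one>\<^bsub>B\<^esub>)) \<one>\<^bsub>F\<^esub>"
  shows "P l r"
  using assms(1) unfolding tensor_relations_def Let_def
  by (elim UnE CollectE exE conjE insertE emptyE; simp only: prod.inject; elim conjE)
     (use assms(2-8) in \<open>simp only:\<close>)+

lemma tensor_relations_closed: "(l, r) \<in> R \<Longrightarrow> l \<in> carrier F \<and> r \<in> carrier F"
  by (erule tensor_relationsE)
     (simp_all add: A.smult_closed B.smult_closed A.star_closed B.star_closed
       F.smult_closed F.star_closed del: F_simps)

text \<open>The symbol of \<open>(x, y)\<close> is, modulo null elements, the product of those of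
  \<open>(x, 1)\<close> and \<open>(1, y)\<close>. Each leg pulls \<open>p\<close> back to a
  C*-seminorm on a C*-algebra, which is dominated by the norm. This is the uniform bound that makes
  the tensor product a \<open>presentation\<close>.\<close>

lemma admissible_elem_le:
  assumes p: "admissible (carrier A \<times> carrier B) R p" and x: "x \<in> carrier A" and y: "y \<in> carrier B"
  shows "p (free_gen (x, y)) \<le> cnorm A x * cnorm B y"
proof -
  interpret P: seminormed_star_algebra F p
    using p by (simp add: admissible_def seminormed_star_algebra_def
        seminormed_star_algebra_axioms_def star_algebra_F)
  have null: "p (l \<ominus>\<^bsub>F\<^esub> r) = 0" if "(l, r) \<in> R" for l r
    using p that by (auto simp: admissible_def)
  have qA: "cstar_seminorm A (\<lambda>x. p (free_gen (x, \<one>\<^bsub>B\<^esub>)))"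
    by (rule P.approximate_hom_seminorm)
       (use null tensor_relationsI(1)[OF _ B.one_closed] tensor_relationsI(3)[OF _ B.one_closed]
          tensor_relationsI(5)[OF _ B.one_closed _ B.one_closed]
          tensor_relationsI(6)[OF _ B.one_closed] A.star_algebra_axioms
        in \<open>simp_all del: F_simps\<close>)
  have qB: "cstar_seminorm B (\<lambda>y. p (free_gen (\<one>\<^bsub>A\<^esub>, y)))"
    by (rule P.approximate_hom_seminorm)
       (use null tensor_relationsI(2)[OF A.one_closed] tensor_relationsI(4)[OF A.one_closed]
          tensor_relationsI(5)[OF A.one_closed _ A.one_closed]
          tensor_relationsI(6)[OF A.one_closed] B.star_algebra_axioms
        in \<open>simp_all del: F_simps\<close>)
  have "p (free_gen (x, y)) = p (free_gen (x, \<one>\<^bsub>B\<^esub>) \<otimes>\<^bsub>F\<^esub> free_gen (\<one>\<^bsub>A\<^esub>, y))"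
    using null[OF tensor_relationsI(5)[OF x B.one_closed A.one_closed y]] x y
    by (intro P.p_eq_of_null) (simp_all del: F_simps)
  also have "\<dots> \<le> p (free_gen (x, \<one>\<^bsub>B\<^esub>)) * p (free_gen (\<one>\<^bsub>A\<^esub>, y))"
    by (rule P.p_mult) (use x y in simp_all)
  also have "\<dots> \<le> cnorm A x * cnorm B y"
    using A.cstar_seminorm_le_norm[OF qA x] B.cstar_seminorm_le_norm[OF qB y] x y
    by (intro mult_mono P.nonneg A.N.nonneg) auto
  finally show ?thesis .
qed

sublocale presentation "carrier A \<times> carrier B" "tensor_relations A B"
proof unfold_locales
  fix g assume "g \<in> carrier A \<times> carrier B"
  then show "\<exists>M. \<forall>p. admissible (carrier A \<times> carrier B) R p \<longrightarrow> p (free_gen g) \<le> M"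
    using admissible_elem_le by (metis mem_Times_iff prod.collapse)
qed (use tensor_relations_closed in blast)

lemma tensor_eq: "tensor A B = U"
  by (simp add: tensor_def)

lemma elem_tensor_emb: "elem_tensor A B x y = emb (free_gen (x, y))"
  by (simp add: elem_tensor_def emb_gen)

sublocale T: cstar_algebra "tensor A B"
  unfolding tensor_eq by (rule cstar_algebra_U)

lemma emb_hom': "emb \<in> star_hom F (tensor A B)"
  unfolding tensor_eq by (rule emb_hom)

lemma elem_tensor_closed [simp]:
  "x \<in> carrier A \<Longrightarrow> y \<in> carrier B \<Longrightarrow> elem_tensor A B x y \<in> carrier (tensor A B)"
  unfolding elem_tensor_emb by (rule star_homD(1)[OF emb_hom']) simp

lemma elem_tensor_simps:
  assumes "x \<in> carrier A" "y \<in> carrier B"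
  shows "x' \<in> carrier A \<Longrightarrow>
      elem_tensor A B (x \<oplus>\<^bsub>A\<^esub> x') y = elem_tensor A B x y \<oplus>\<^bsub>tensor A B\<^esub> elem_tensor A B x' y"
    and "y' \<in> carrier B \<Longrightarrow>
      elem_tensor A B x (y \<oplus>\<^bsub>B\<^esub> y') = elem_tensor A B x y \<oplus>\<^bsub>tensor A B\<^esub> elem_tensor A B x y'"
    and "elem_tensor A B (c \<odot>\<^bsub>A\<^esub> x) y = c \<odot>\<^bsub>tensor A B\<^esub> elem_tensor A B x y"
    and "elem_tensor A B x (c \<odot>\<^bsub>B\<^esub> y) = c \<odot>\<^bsub>tensor A B\<^esub> elem_tensor A B x y"
    and "x' \<in> carrier A \<Longrightarrow> y' \<in> carrier B \<Longrightarrow>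
      elem_tensor A B x y \<otimes>\<^bsub>tensor A B\<^esub> elem_tensor A B x' y' = elem_tensor A B (x \<otimes>\<^bsub>A\<^esub> x') (y \<otimes>\<^bsub>B\<^esub> y')"
    and "star (tensor A B) (elem_tensor A B x y) = elem_tensor A B (star A x) (star B y)"
    and "elem_tensor A B \<one>\<^bsub>A\<^esub> \<one>\<^bsub>B\<^esub> = \<one>\<^bsub>tensor A B\<^esub>"
  using assms emb_relation[OF tensor_relationsI(1)[OF assms]]
    emb_relation[OF tensor_relationsI(2)[OF assms]]
    emb_relation[OF tensor_relationsI(3)[OF assms]] emb_relation[OF tensor_relationsI(4)[OF assms]]
    emb_relation[OF tensor_relationsI(5)[OF assms]] emb_relation[OF tensor_relationsI(6)[OF assms]]
    emb_relation[OF tensor_relationsI(7)[OF assms]]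
  unfolding elem_tensor_emb
  by (simp_all add: star_homD[OF emb_hom'] del: F_simps)

lemma elem_tensor_zero_left: "y \<in> carrier B \<Longrightarrow> elem_tensor A B \<zero>\<^bsub>A\<^esub> y = \<zero>\<^bsub>tensor A B\<^esub>"
  using elem_tensor_simps(3)[of "\<zero>\<^bsub>A\<^esub>" y 0] by simp

lemma elem_tensor_zero_right: "x \<in> carrier A \<Longrightarrow> elem_tensor A B x \<zero>\<^bsub>B\<^esub> = \<zero>\<^bsub>tensor A B\<^esub>"
  using elem_tensor_simps(4)[of x "\<zero>\<^bsub>B\<^esub>" 0] by simp

lemma elem_tensor_finsum_left:
  assumes "finite I" "\<And>i. i \<in> I \<Longrightarrow> x i \<in> carrier A" "y \<in> carrier B"
  shows "elem_tensor A B (\<Oplus>\<^bsub>A\<^esub>i\<in>I. x i) y = (\<Oplus>\<^bsub>tensor A B\<^esub>i\<in>I. elem_tensor A B (x i) y)"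
  using assms
proof (induction I rule: finite_induct)
  case (insert i I)
  then have "x \<in> I \<rightarrow> carrier A" "(\<lambda>i. elem_tensor A B (x i) y) \<in> I \<rightarrow> carrier (tensor A B)" by auto
  with insert show ?case
    by (simp add: A.finsum_insert T.finsum_insert elem_tensor_simps A.finsum_closed)
qed (simp add: elem_tensor_zero_left)

lemma elem_tensor_finsum_right:
  assumes "finite I" "\<And>i. i \<in> I \<Longrightarrow> y i \<in> carrier B" "x \<in> carrier A"
  shows "elem_tensor A B x (\<Oplus>\<^bsub>B\<^esub>i\<in>I. y i) = (\<Oplus>\<^bsub>tensor A B\<^esub>i\<in>I. elem_tensor A B x (y i))"
  using assms
proof (induction I rule: finite_induct)
  case (insert i I)
  then have "y \<in> I \<rightarrow> carrier B" "(\<lambda>i. elem_tensor A B x (y i)) \<in> I \<rightarrow> carrier (tensor A B)" by auto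
  with insert show ?case
    by (simp add: B.finsum_insert T.finsum_insert elem_tensor_simps B.finsum_closed)
qed (simp add: elem_tensor_zero_right)

text \<open>
  The vectors \<open>\<phi> x h\<close> and \<open>\<psi> y k\<close> give the words a positive definite kernel by the Schur
  product theorem; its form is that of \<open>h \<otimes> k\<close> in the spatial tensor product of \<open>\<phi>\<close> and \<open>\<psi>\<close>.
\<close>

theorem elem_tensor_eq_zero:
  fixes \<phi> :: "'a \<Rightarrow> 'h::chilbert_space \<Rightarrow> 'h" and \<psi> :: "'b \<Rightarrow> 'k::chilbert_space \<Rightarrow> 'k"
  assumes \<phi>: "\<phi> \<in> star_hom A bounded_operators" and \<psi>: "\<psi> \<in> star_hom B bounded_operators"
    and a: "a \<in> carrier A" and b: "b \<in> carrier B"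
    and zero: "elem_tensor A B a b = \<zero>\<^bsub>tensor A B\<^esub>"
  shows "\<phi> a = (\<lambda>_. 0) \<or> \<psi> b = (\<lambda>_. 0)"
proof (rule ccontr)
  assume "\<not> ?thesis"
  then obtain h k where hk: "\<phi> a h \<noteq> 0" "\<psi> b k \<noteq> 0" by blast
  \<comment> \<open>Letters act on the left leg through \<phi> and on the right leg through \<psi>,
    a letter with flag \<open>True\<close> through the adjoint. So \<open>K w v\<close> is the inner
    product of the word \<open>w\<close> applied to h \<otimes> k with the word \<open>v\<close>
    applied to it.\<close>
  define X where "X l = (case l of ((x, y), s) \<Rightarrow> \<phi> (if s then star A x else x))" for l :: "('a \<times> 'b) \<times> bool"
  define Y where "Y l = (case l of ((x, y), s) \<Rightarrow> \<psi> (if s then star B y else y))" for l :: "('a \<times> 'b) \<times> bool"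
  define \<alpha> where "\<alpha> w = foldr X w h" for w
  define \<beta> where "\<beta> w = foldr Y w k" for w
  define K where "K w v = cinner (\<alpha> w) (\<alpha> v) * cinner (\<beta> w) (\<beta> v)" for w v
  have rec: "\<alpha> [] = h" "\<beta> [] = k" "\<alpha> (l # w) = X l (\<alpha> w)" "\<beta> (l # w) = Y l (\<beta> w)" for l w
    by (simp_all add: \<alpha>_def \<beta>_def)
  have X: "X l \<in> carrier bounded_operators" "X (letter_star l) = star bounded_operators (X l)"
    and Y: "Y l \<in> carrier bounded_operators" "Y (letter_star l) = star bounded_operators (Y l)"
    if "fst l \<in> carrier A \<times> carrier B" for l
    using that by (auto simp: X_def Y_def star_homD[OF \<phi>] star_homD[OF \<psi>] A.star_closed B.star_closed
        A.star_star B.star_star simp flip: star_homD(6)[OF \<phi>] star_homD(6)[OF \<psi>] split: prod.splits)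
  have herm: "K w v = cnj (K v w)" for w v
    unfolding K_def using cinner_commute by (metis complex_cnj_mult)
  have K_pos: "0 \<le> Re (\<Sum>w\<in>I. \<Sum>v\<in>I. c w * cnj (c v) * K w v)" if "finite I" for I c
  proof -
    have "0 \<le> Re (\<Sum>w\<in>I. \<Sum>v\<in>I. (c w * cnj (c v) * cinner (\<alpha> w) (\<alpha> v)) * cinner (\<beta> w) (\<beta> v))"
    proof (rule schur_product[OF that])
      show "c w * cnj (c v) * cinner (\<alpha> w) (\<alpha> v) = cnj (c v * cnj (c w) * cinner (\<alpha> v) (\<alpha> w))" for w v
        using cinner_commute[of "\<alpha> w" "\<alpha> v"] by simp
      show "0 \<le> Re (\<Sum>w\<in>I. \<Sum>v\<in>I. d w * cnj (d v) * (c w * cnj (c v) * cinner (\<alpha> w) (\<alpha> v)))" for d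
        using gram_nonneg[where I = I and c = "\<lambda>w. d w * c w" and v = \<alpha>] by (simp add: mult_ac)
    qed
    then show ?thesis by (simp add: K_def mult.assoc)
  qed
  have "\<exists>p. cstar_seminorm F p \<and>
    (\<forall>g\<in>carrier A \<times> carrier B.
      sqrt (Re (K [(g, False)] [(g, False)])) \<le> p (free_gen g) * sqrt (Re (K [] []))) \<and>
    (\<forall>f\<in>carrier F. \<forall>f'\<in>carrier F.
      (\<forall>h\<in>carrier F. \<forall>h'\<in>carrier F.
        kernel_form K (f \<otimes>\<^bsub>F\<^esub> h) h' = kernel_form K (f' \<otimes>\<^bsub>F\<^esub> h) h') \<longrightarrow> p (f \<ominus>\<^bsub>F\<^esub> f') = 0)"
  proof (rule kernel_seminorm[of K])
    show "K w v = cnj (K v w)" for w v by (rule herm)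
    show "0 \<le> Re (\<Sum>w\<in>I. \<Sum>v\<in>I. c w * cnj (c v) * K w v)" if "finite I" for I c
      by (rule K_pos[OF that])
    fix l :: "('a \<times> 'b) \<times> bool" assume l: "fst l \<in> carrier A \<times> carrier B"
    show "K (l # w) v = K w (letter_star l # v)" for w v
      by (simp only: K_def rec X(2)[OF l] Y(2)[OF l] cinner_star_operator(2)[OF X(1)[OF l]]
          cinner_star_operator(2)[OF Y(1)[OF l]])
    let ?\<rho> = "(onorm (X l))\<^sup>2" and ?\<sigma> = "(onorm (Y l))\<^sup>2"
    have "Re (\<Sum>w\<in>I. \<Sum>v\<in>I. c w * cnj (c v) * K (l # w) (l # v))
        \<le> ?\<rho> * ?\<sigma> * Re (\<Sum>w\<in>I. \<Sum>v\<in>I. c w * cnj (c v) * K w v)" if I: "finite I" for I c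
    proof -
      \<comment> \<open>The two legs of the letter are bounded one after the other, each time with
        the Gram kernel of the other leg as the Schur factor.\<close>
      have "Re (\<Sum>w\<in>I. \<Sum>v\<in>I. c w * cnj (c v) * K (l # w) (l # v))
          \<le> ?\<rho> * Re (\<Sum>w\<in>I. \<Sum>v\<in>I. c w * cnj (c v) * (cinner (\<alpha> w) (\<alpha> v) * cinner (Y l (\<beta> w)) (Y l (\<beta> v))))"
        unfolding K_def rec by (rule schur_contraction[OF I X(1)[OF l]])
      also have "Re (\<Sum>w\<in>I. \<Sum>v\<in>I. c w * cnj (c v) * (cinner (\<alpha> w) (\<alpha> v) * cinner (Y l (\<beta> w)) (Y l (\<beta> v))))
          \<le> ?\<sigma> * Re (\<Sum>w\<in>I. \<Sum>v\<in>I. c w * cnj (c v) * K w v)"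
        using schur_contraction[OF I Y(1)[OF l], where c = c and e = \<beta> and f = \<alpha>] by (simp add: K_def mult.commute)
      then have "?\<rho> * Re (\<Sum>w\<in>I. \<Sum>v\<in>I. c w * cnj (c v) * (cinner (\<alpha> w) (\<alpha> v) * cinner (Y l (\<beta> w)) (Y l (\<beta> v))))
          \<le> ?\<rho> * (?\<sigma> * Re (\<Sum>w\<in>I. \<Sum>v\<in>I. c w * cnj (c v) * K w v))"
        by (rule mult_left_mono) simp
      finally show ?thesis by (simp add: mult.assoc)
    qed
    then show "\<exists>\<rho>\<ge>0. \<forall>I c. finite I \<longrightarrow> I \<subseteq> words \<longrightarrow>
        Re (\<Sum>w\<in>I. \<Sum>v\<in>I. c w * cnj (c v) * K (l # w) (l # v))
          \<le> \<rho> * Re (\<Sum>w\<in>I. \<Sum>v\<in>I. c w * cnj (c v) * K w v)"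
      by (intro exI[of _ "?\<rho> * ?\<sigma>"]) simp
  qed
  then obtain p where p: "cstar_seminorm F p"
    and p_gen: "\<And>g. g \<in> carrier A \<times> carrier B \<Longrightarrow>
      sqrt (Re (K [(g, False)] [(g, False)])) \<le> p (free_gen g) * sqrt (Re (K [] []))"
    and p_zero: "\<And>f f'. f \<in> carrier F \<Longrightarrow> f' \<in> carrier F \<Longrightarrow>
      \<forall>h\<in>carrier F. \<forall>h'\<in>carrier F.
        kernel_form K (f \<otimes>\<^bsub>F\<^esub> h) h' = kernel_form K (f' \<otimes>\<^bsub>F\<^esub> h) h' \<Longrightarrow> p (f \<ominus>\<^bsub>F\<^esub> f') = 0"
    by blast
  have form_gen: "kernel_form K (free_gen g \<otimes>\<^bsub>F\<^esub> f) f' = word_lin (\<lambda>w. kernel_functional K f' ((g, False) # w)) f"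
    and form_star_gen: "kernel_form K (star F (free_gen g) \<otimes>\<^bsub>F\<^esub> f) f' = word_lin (\<lambda>w. kernel_functional K f' ((g, True) # w)) f"
    if "f \<in> carrier F" for f f' g
    unfolding kernel_form_def by (rule word_lin_free_gen_mult[OF that] word_lin_star_free_gen_mult[OF that])+
  have form_add: "kernel_form K (f \<oplus>\<^bsub>F\<^esub> f') g = kernel_form K f g + kernel_form K f' g"
    if "f \<in> carrier F" "f' \<in> carrier F" for f f' g
    using that by (simp add: kernel_form_def word_lin_add)
  have form_smult: "kernel_form K (c \<odot>\<^bsub>F\<^esub> f) g = c * kernel_form K f g" for c f g
    by (simp add: kernel_form_def word_lin_smult)
  have functional_add: "kernel_functional K f w = kernel_functional K f w' + kernel_functional K f w''"
    if "\<And>v. K w v = K w' v + K w'' v" for f w w' w''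
    by (simp add: kernel_functional_def that word_lin_add_fun)
  have functional_smult: "kernel_functional K f w = c * kernel_functional K f w'"
    if "\<And>v. K w v = c * K w' v" for f w w' c
    by (simp add: kernel_functional_def that word_lin_smult_fun)
  have functional_eq: "kernel_functional K f w = kernel_functional K f w'"
    if "\<And>v. K w v = K w' v" for f w w'
    by (simp add: kernel_functional_def that)
  have adm: "admissible (carrier A \<times> carrier B) R p"
    unfolding admissible_def
  proof (intro conjI p ballI, clarify)
    fix l r assume lr: "(l, r) \<in> R"
    \<comment> \<open>Multiplying by a letter is a shift, so each relation becomes an identity
      between rows of \<open>K\<close>, and that identity is a homomorphism property of \<phi> or
      \<psi>.\<close>
    have "\<forall>f\<in>carrier F. \<forall>f'\<in>carrier F. kernel_form K (l \<otimes>\<^bsub>F\<^esub> f) f' = kernel_form K (r \<otimes>\<^bsub>F\<^esub> f) f'"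
      using lr
    proof (rule tensor_relationsE; intro ballI)
      fix x x' y f f' assume "x \<in> carrier A" "x' \<in> carrier A" "y \<in> carrier B" "f \<in> carrier F" "f' \<in> carrier F"
      moreover from this have "kernel_functional K f' (((x \<oplus>\<^bsub>A\<^esub> x', y), False) # w)
          = kernel_functional K f' (((x, y), False) # w) + kernel_functional K f' (((x', y), False) # w)" for w
        by (intro functional_add)
           (simp add: K_def rec X_def Y_def star_homD[OF \<phi>] cinner_add_left distrib_right)
      ultimately show "kernel_form K (free_gen (x \<oplus>\<^bsub>A\<^esub> x', y) \<otimes>\<^bsub>F\<^esub> f) f'
          = kernel_form K ((free_gen (x, y) \<oplus>\<^bsub>F\<^esub> free_gen (x', y)) \<otimes>\<^bsub>F\<^esub> f) f'"
        by (simp add: F.l_distr form_add form_gen word_lin_add_fun del: F_simps)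
    next
      fix x y y' f f' assume "x \<in> carrier A" "y \<in> carrier B" "y' \<in> carrier B" "f \<in> carrier F" "f' \<in> carrier F"
      moreover from this have "kernel_functional K f' (((x, y \<oplus>\<^bsub>B\<^esub> y'), False) # w)
          = kernel_functional K f' (((x, y), False) # w) + kernel_functional K f' (((x, y'), False) # w)" for w
        by (intro functional_add)
           (simp add: K_def rec X_def Y_def star_homD[OF \<psi>] cinner_add_left distrib_left)
      ultimately show "kernel_form K (free_gen (x, y \<oplus>\<^bsub>B\<^esub> y') \<otimes>\<^bsub>F\<^esub> f) f'
          = kernel_form K ((free_gen (x, y) \<oplus>\<^bsub>F\<^esub> free_gen (x, y')) \<otimes>\<^bsub>F\<^esub> f) f'"
        by (simp add: F.l_distr form_add form_gen word_lin_add_fun del: F_simps)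
    next
      fix c x y f f' assume "x \<in> carrier A" "y \<in> carrier B" "f \<in> carrier F" "f' \<in> carrier F"
      moreover from this have "kernel_functional K f' (((c \<odot>\<^bsub>A\<^esub> x, y), False) # w)
          = c * kernel_functional K f' (((x, y), False) # w)" for w
        by (intro functional_smult)
           (simp add: K_def rec X_def Y_def star_homD[OF \<phi>] cinner_scaleC_left)
      ultimately show "kernel_form K (free_gen (c \<odot>\<^bsub>A\<^esub> x, y) \<otimes>\<^bsub>F\<^esub> f) f'
          = kernel_form K ((c \<odot>\<^bsub>F\<^esub> free_gen (x, y)) \<otimes>\<^bsub>F\<^esub> f) f'"
        by (simp add: F.smult_mult_left form_smult form_gen word_lin_smult_fun del: F_simps)
    next
      fix c x y f f' assume "x \<in> carrier A" "y \<in> carrier B" "f \<in> carrier F" "f' \<in> carrier F"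
      moreover from this have "kernel_functional K f' (((x, c \<odot>\<^bsub>B\<^esub> y), False) # w)
          = c * kernel_functional K f' (((x, y), False) # w)" for w
        by (intro functional_smult)
           (simp add: K_def rec X_def Y_def star_homD[OF \<psi>] cinner_scaleC_left)
      ultimately show "kernel_form K (free_gen (x, c \<odot>\<^bsub>B\<^esub> y) \<otimes>\<^bsub>F\<^esub> f) f'
          = kernel_form K ((c \<odot>\<^bsub>F\<^esub> free_gen (x, y)) \<otimes>\<^bsub>F\<^esub> f) f'"
        by (simp add: F.smult_mult_left form_smult form_gen word_lin_smult_fun del: F_simps)
    next
      fix x x' y y' f f'
      assume as: "x \<in> carrier A" "x' \<in> carrier A" "y \<in> carrier B" "y' \<in> carrier B" "f \<in> carrier F" "f' \<in> carrier F"
      then have "kernel_functional K f' (((x \<otimes>\<^bsub>A\<^esub> x', y \<otimes>\<^bsub>B\<^esub> y'), False) # w)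
          = kernel_functional K f' (((x, y), False) # ((x', y'), False) # w)" for w
        by (intro functional_eq)
           (simp add: K_def rec X_def Y_def star_homD[OF \<psi>] star_homD[OF \<phi>])
      moreover have "free_gen (x', y') \<otimes>\<^bsub>F\<^esub> f \<in> carrier F" using as by (simp del: F_simps)
      ultimately show "kernel_form K (free_gen (x \<otimes>\<^bsub>A\<^esub> x', y \<otimes>\<^bsub>B\<^esub> y') \<otimes>\<^bsub>F\<^esub> f) f'
          = kernel_form K ((free_gen (x, y) \<otimes>\<^bsub>F\<^esub> free_gen (x', y')) \<otimes>\<^bsub>F\<^esub> f) f'"
        using as by (simp add: F.m_assoc form_gen word_lin_free_gen_mult del: F_simps)
    next
      fix x y f f' assume "x \<in> carrier A" "y \<in> carrier B" "f \<in> carrier F" "f' \<in> carrier F"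
      moreover from this have "kernel_functional K f' (((star A x, star B y), False) # w)
          = kernel_functional K f' (((x, y), True) # w)" for w
        by (intro functional_eq) (simp add: K_def rec X_def Y_def)
      ultimately show "kernel_form K (free_gen (star A x, star B y) \<otimes>\<^bsub>F\<^esub> f) f'
          = kernel_form K (star F (free_gen (x, y)) \<otimes>\<^bsub>F\<^esub> f) f'"
        by (simp add: form_gen form_star_gen del: F_simps)
    next
      fix f f' assume "f \<in> carrier F" "f' \<in> carrier F"
      moreover have "kernel_functional K f' (((\<one>\<^bsub>A\<^esub>, \<one>\<^bsub>B\<^esub>), False) # w) = kernel_functional K f' w" for w
        by (intro functional_eq) (simp add: K_def rec X_def Y_def star_homD(4)[OF \<phi>] star_homD(4)[OF \<psi>])
      ultimately show "kernel_form K (free_gen (\<one>\<^bsub>A\<^esub>, \<one>\<^bsub>B\<^esub>) \<otimes>\<^bsub>F\<^esub> f) f'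
          = kernel_form K (\<one>\<^bsub>F\<^esub> \<otimes>\<^bsub>F\<^esub> f) f'"
        by (simp add: form_gen del: F_simps) (simp only: kernel_form_def)
    qed
    then show "p (l \<ominus>\<^bsub>F\<^esub> r) = 0"
      using tensor_relations_closed[OF lr] by (intro p_zero) auto
  qed
  \<comment> \<open>A vanishing elementary tensor has universal seminorm 0, hence \<open>p\<close>
    is 0 on its symbol. But \<open>p_gen\<close> compares that value with the product of the norms
    of \<open>\<phi> a h\<close> and \<open>\<psi> b k\<close>.\<close>
  have "cnorm (tensor A B) (elem_tensor A B a b) = un (free_gen (a, b))"
    unfolding elem_tensor_emb tensor_eq using a b by (intro cnorm_emb) simp
  then have "un (free_gen (a, b)) = 0" using zero by simp
  then have "p (free_gen (a, b)) \<le> 0"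
    using admissible_le_un[OF adm, of "free_gen (a, b)"] a b by simp
  moreover have "Re (K [] []) = (norm h)\<^sup>2 * (norm k)\<^sup>2"
    by (simp add: K_def rec cinner_self del: of_real_power)
  ultimately have "p (free_gen (a, b)) * sqrt (Re (K [] [])) \<le> 0"
    by (intro mult_nonpos_nonneg) auto
  then have "sqrt (Re (K [((a, b), False)] [((a, b), False)])) \<le> 0"
    by (rule order_trans[OF p_gen, rotated]) (use a b in simp)
  moreover have "Re (K [((a, b), False)] [((a, b), False)]) = (norm (\<phi> a h))\<^sup>2 * (norm (\<psi> b k))\<^sup>2"
    by (simp add: K_def rec X_def Y_def cinner_self del: of_real_power)
  ultimately show False using hk by (simp add: mult_le_0_iff)
qed

end

subsection \<open>The flip\<close>

context cstar_algebra
begin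

text \<open>Swapping the two labels of every letter is an automorphism of the free *-algebra that
  maps the tensor relations into themselves. Admissible seminorms therefore pull back to admissible
  ones, so the swap is contractive for the universal seminorm and extends to the completion.\<close>

lemma tensor_flip_ex:
  "\<exists>\<tau>\<in>star_hom (tensor A A) (tensor A A).
    \<forall>x\<in>carrier A. \<forall>y\<in>carrier A. \<tau> (elem_tensor A A x y) = elem_tensor A A y x"
proof -
  interpret T: cstar_tensor A A ..
  define sw :: "('a \<times> 'a) \<times> bool \<Rightarrow> ('a \<times> 'a) \<times> bool" where "sw = map_prod prod.swap id"
  have sw: "sw (sw l) = l" "sw ((x, y), b) = ((y, x), b)" "sw (letter_star l) = letter_star (sw l)" for l x y b
    by (auto simp: sw_def map_prod_def split: prod.splits)
  have msw: "map sw (map sw w) = w" for w by (simp add: sw o_def)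
  have msw_star: "word_star (map sw w) = map sw (word_star w)" for w
    by (simp add: word_star_def rev_map sw o_def)
  have msw_words: "fst ` set (map sw w) \<subseteq> carrier A \<times> carrier A \<longleftrightarrow> fst ` set w \<subseteq> carrier A \<times> carrier A" for w
    by (fastforce simp: sw_def)
  define \<sigma> :: "((('a \<times> 'a) \<times> bool) list \<Rightarrow> complex) \<Rightarrow> (('a \<times> 'a) \<times> bool) list \<Rightarrow> complex"
    where "\<sigma> f w = f (map sw w)" for f w
  have \<sigma>: "\<sigma> \<in> star_hom T.F T.F"
  proof (rule star_homI)
    fix f assume f: "f \<in> carrier T.F"
    have "{w. \<sigma> f w \<noteq> 0} \<subseteq> map sw ` {w. f w \<noteq> 0}"
      by (auto simp: \<sigma>_def image_iff) (metis msw)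
    then have "finite {w. \<sigma> f w \<noteq> 0}" using T.finite_support[OF f] finite_surj by blast
    then show "\<sigma> f \<in> carrier T.F"
      using f msw_words unfolding T.carrier_F \<sigma>_def by blast
  qed (auto simp: \<sigma>_def fun_eq_iff take_map drop_map msw_star)
  have \<sigma>_gen: "\<sigma> (free_gen (x, y)) = free_gen (y, x)" for x y
  proof
    fix w
    have "map sw w = [((x, y), False)] \<longleftrightarrow> w = [((y, x), False)]"
      by (metis (no_types, lifting) msw sw(2) list.map)
    then show "\<sigma> (free_gen (x, y)) w = free_gen (y, x) w" by (simp add: \<sigma>_def free_gen_def)
  qed
  have \<sigma>_rel: "(\<sigma> l, \<sigma> r) \<in> T.R" if "(l, r) \<in> T.R" for l r
    using that
    by (rule T.tensor_relationsE)
       (simp_all only: star_homD[OF \<sigma>] T.free_gen_closed mem_Times_iff fst_conv snd_conv \<sigma>_gen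
         T.tensor_relationsI(1-6) T.tensor_relationsI(7)[OF one_closed one_closed] simp_thms)
  have le: "T.un (\<sigma> f) \<le> T.un f" if f: "f \<in> carrier T.F" for f
  proof (rule T.un_least)
    fix p assume p: "admissible (carrier A \<times> carrier A) T.R p"
    then have "cstar_seminorm T.F p" and null: "\<And>l r. (l, r) \<in> T.R \<Longrightarrow> p (l \<ominus>\<^bsub>T.F\<^esub> r) = 0"
      by (auto simp: admissible_def)
    have "admissible (carrier A \<times> carrier A) T.R (\<lambda>f. p (\<sigma> f))"
      unfolding admissible_def
    proof (intro conjI ballI, goal_cases)
      case 1
      show ?case
        by (rule star_hom_seminorm[OF T.star_algebra_F T.star_algebra_F _ \<sigma>]) fact
    next
      case (2 z)
      then obtain l r where z: "z = (l, r)" "(l, r) \<in> T.R" by (cases z) auto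
      have "\<sigma> (l \<ominus>\<^bsub>T.F\<^esub> r) = \<sigma> l \<ominus>\<^bsub>T.F\<^esub> \<sigma> r"
        using T.relations[OF z(2)] by (intro star_hom_diff[OF T.star_algebra_F T.star_algebra_F \<sigma>]) auto
      then show ?case using null[OF \<sigma>_rel[OF z(2)]] z by simp
    qed
    then show "p (\<sigma> f) \<le> T.un f" using f by (rule T.admissible_le_un)
  qed
  obtain \<tau> where \<tau>: "\<tau> \<in> star_hom T.C T.C"
    and eq: "\<And>X. X \<in> T.cs \<Longrightarrow> \<tau> (T.cls X) = T.cls (\<lambda>n. \<sigma> (X n))"
    using T.extend_star_hom[where B = T.F and q = T.un and f = \<sigma>, OF T.seminormed_star_algebra_axioms \<sigma> le]
    by blast
  have "\<tau> (elem_tensor A A x y) = elem_tensor A A y x" if "x \<in> carrier A" "y \<in> carrier A" for x y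
    using that by (simp add: T.elem_tensor_emb T.emb_def eq T.cs_const \<sigma>_gen)
  then show ?thesis using \<tau> unfolding T.U_eq[symmetric] T.tensor_eq by blast
qed

end

section \<open>Magic unitaries and characters\<close>

lemma finsum_complex: "finite I \<Longrightarrow> (\<Oplus>\<^bsub>complex_cstar\<^esub>i\<in>I. f i) = (\<Sum>i\<in>I. f i)"
proof (induction I rule: finite_induct)
  interpret star_algebra complex_cstar by (rule complex_star_algebra)
  case empty
  then show ?case by simp
next
  interpret star_algebra complex_cstar by (rule complex_star_algebra)
  case (insert i I)
  then show ?case by (simp add: finsum_insert)
qed

lemma finsum_bounded_operators:
  assumes "finite I" "\<And>i. i \<in> I \<Longrightarrow> T i \<in> carrier bounded_operators"
  shows "(\<Oplus>\<^bsub>bounded_operators\<^esub>i\<in>I. T i) x = (\<Sum>i\<in>I. T i x)"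
proof -
  interpret star_algebra bounded_operators by (rule bounded_operators_star_algebra)
  show ?thesis
    using assms
  proof (induction I rule: finite_induct)
    case (insert i I)
    then have "T \<in> I \<rightarrow> carrier bounded_operators" by auto
    with insert show ?case by (simp add: finsum_insert)
  qed simp
qed

lemma (in abelian_monoid) finsum_cartesian_product:
  assumes "finite I" "finite J" "\<And>i j. i \<in> I \<Longrightarrow> j \<in> J \<Longrightarrow> f i j \<in> carrier G"
  shows "(\<Oplus>i\<in>I. \<Oplus>j\<in>J. f i j) = (\<Oplus>z\<in>I \<times> J. f (fst z) (snd z))"
  using assms(1,3)
proof (induction I rule: finite_induct)
  case (insert i I)
  have J: "(\<Oplus>z\<in>{i} \<times> J. f (fst z) (snd z)) = (\<Oplus>j\<in>J. f i j)"
  proof -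
    have "{i} \<times> J = Pair i ` J" by auto
    moreover have "(\<Oplus>z\<in>Pair i ` J. f (fst z) (snd z)) = (\<Oplus>j\<in>J. f (fst (i, j)) (snd (i, j)))"
      by (rule finsum_reindex) (use insert in \<open>auto simp: inj_on_def\<close>)
    ultimately show ?thesis by simp
  qed
  have "(\<Oplus>z\<in>insert i I \<times> J. f (fst z) (snd z)) = (\<Oplus>z\<in>({i} \<times> J) \<union> (I \<times> J). f (fst z) (snd z))"
    by (rule arg_cong2[where f = "finsum G"]) auto
  also have "\<dots> = (\<Oplus>z\<in>{i} \<times> J. f (fst z) (snd z)) \<oplus> (\<Oplus>z\<in>I \<times> J. f (fst z) (snd z))"
    by (rule finsum_Un_disjoint) (use insert assms(2) in auto)
  also have "\<dots> = (\<Oplus>i\<in>insert i I. \<Oplus>j\<in>J. f i j)"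
    using insert assms(2) unfolding J by (subst finsum_insert) (auto intro!: finsum_closed)
  finally show ?case ..
qed simp

section \<open>Linear combinations of orthogonal projections\<close>

context star_algebra
begin

text \<open>For pairwise orthogonal projections \<open>e\<close> this is multiplicative and
  *-preserving in \<open>c\<close>. The comultiplication of a function algebra and its
  representation on the Hilbert space are both built in this way.\<close>

definition combination :: "'i set \<Rightarrow> ('i \<Rightarrow> 'a) \<Rightarrow> ('i \<Rightarrow> complex) \<Rightarrow> 'a" where
  "combination I e c = (\<Oplus>i\<in>I. c i \<odot> e i)"

lemma combination_closed:
  "(\<And>i. i \<in> I \<Longrightarrow> e i \<in> carrier A) \<Longrightarrow> combination I e c \<in> carrier A"
  unfolding combination_def by (intro finsum_closed) (auto simp: smult_closed)

lemma combination_add: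
  assumes "finite I" "\<And>i. i \<in> I \<Longrightarrow> e i \<in> carrier A"
  shows "combination I e (\<lambda>i. c i + d i) = combination I e c \<oplus> combination I e d"
proof -
  have "combination I e (\<lambda>i. c i + d i) = (\<Oplus>i\<in>I. c i \<odot> e i \<oplus> d i \<odot> e i)"
    unfolding combination_def
    by (rule finsum_cong') (use assms in \<open>auto simp: smult_add_left smult_closed\<close>)
  also have "\<dots> = combination I e c \<oplus> combination I e d"
    unfolding combination_def by (rule finsum_addf) (use assms in \<open>auto simp: smult_closed\<close>)
  finally show ?thesis .
qed

lemma combination_cong:
  "(\<And>i. i \<in> I \<Longrightarrow> e i \<in> carrier A) \<Longrightarrow> (\<And>i. i \<in> I \<Longrightarrow> c i = d i) \<Longrightarrow> combination I e c = combination I e d"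
  unfolding combination_def by (rule finsum_cong') (auto simp: smult_closed)

lemma combination_zero:
  "(\<And>i. i \<in> I \<Longrightarrow> e i \<in> carrier A) \<Longrightarrow> combination I e (\<lambda>_. 0) = \<zero>"
  unfolding combination_def
  by (subst finsum_cong'[of I I "\<lambda>_. \<zero>"]) auto

lemma combination_sum:
  assumes "finite I" "\<And>i. i \<in> I \<Longrightarrow> e i \<in> carrier A" "finite K"
  shows "combination I e (\<lambda>i. \<Sum>k\<in>K. c k i) = (\<Oplus>k\<in>K. combination I e (c k))"
  using assms(3)
proof (induction K rule: finite_induct)
  case (insert k K)
  then show ?case
    using assms(1,2)
    by (simp add: combination_add finsum_insert combination_closed)
qed (simp add: combination_zero assms(2))

lemma smult_combination:
  assumes "finite I" "\<And>i. i \<in> I \<Longrightarrow> e i \<in> carrier A"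
  shows "combination I e (\<lambda>i. k * c i) = k \<odot> combination I e c"
  using assms
proof (induction I rule: finite_induct)
  case (insert i I)
  then have "(\<lambda>i. c i \<odot> e i) \<in> I \<rightarrow> carrier A" "(\<lambda>i. (k * c i) \<odot> e i) \<in> I \<rightarrow> carrier A"
    by (auto simp: smult_closed)
  with insert show ?case
    by (simp add: combination_def finsum_insert smult_closed smult_add_right smult_smult finsum_closed)
qed (simp add: combination_def)

lemma star_combination:
  assumes "finite I" "\<And>i. i \<in> I \<Longrightarrow> e i \<in> carrier A" "\<And>i. i \<in> I \<Longrightarrow> star A (e i) = e i"
  shows "combination I e (\<lambda>i. cnj (c i)) = star A (combination I e c)"
  using assms
proof (induction I rule: finite_induct)
  case (insert i I)
  then have "(\<lambda>i. c i \<odot> e i) \<in> I \<rightarrow> carrier A" "(\<lambda>i. cnj (c i) \<odot> e i) \<in> I \<rightarrow> carrier A"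
    by (auto simp: smult_closed)
  with insert show ?case
    by (simp add: combination_def finsum_insert smult_closed star_add star_smult finsum_closed)
qed (simp add: combination_def)

lemma mult_combination:
  assumes I: "finite I" and e: "\<And>i. i \<in> I \<Longrightarrow> e i \<in> carrier A"
    and idem: "\<And>i. i \<in> I \<Longrightarrow> e i \<otimes> e i = e i"
    and orth: "\<And>i j. i \<in> I \<Longrightarrow> j \<in> I \<Longrightarrow> i \<noteq> j \<Longrightarrow> e i \<otimes> e j = \<zero>"
  shows "combination I e (\<lambda>i. c i * d i) = combination I e c \<otimes> combination I e d"
proof -
  have one: "(c i \<odot> e i) \<otimes> combination I e d = (c i * d i) \<odot> e i" if i: "i \<in> I" for i
  proof -
    have "(c i \<odot> e i) \<otimes> combination I e d = (\<Oplus>j\<in>I. (c i \<odot> e i) \<otimes> (d j \<odot> e j))"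
      unfolding combination_def
      by (rule finsum_rdistr) (use I e i in \<open>auto simp: smult_closed\<close>)
    also have "\<dots> = (\<Oplus>j\<in>I. if i = j then (c j * d j) \<odot> e j else \<zero>)"
      by (rule finsum_cong')
         (use e i idem orth in \<open>auto simp: smult_closed smult_mult_left smult_mult_right smult_smult
           mult.commute\<close>)
    also have "\<dots> = (c i * d i) \<odot> e i"
      using I e i by (intro finsum_singleton) (auto simp: smult_closed)
    finally show ?thesis .
  qed
  have "combination I e c \<otimes> combination I e d = (\<Oplus>i\<in>I. (c i \<odot> e i) \<otimes> combination I e d)"
    unfolding combination_def[of I e c]
    by (rule finsum_ldistr) (use I e combination_closed in \<open>auto simp: smult_closed\<close>)
  also have "\<dots> = combination I e (\<lambda>i. c i * d i)"
    unfolding combination_def[of I e "\<lambda>i. c i * d i"]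
    by (rule finsum_cong') (use e one in \<open>auto simp: smult_closed\<close>)
  finally show ?thesis ..
qed

end

section \<open>Characters of a free *-algebra\<close>

lemma (in free_alg) word_lin_star:
  assumes "\<And>w. \<theta> (word_star w) = cnj (\<theta> w)"
  shows "word_lin \<theta> (star F f) = cnj (word_lin \<theta> f)"
proof -
  have "word_lin \<theta> (star F f) = (\<Sum>w | f (word_star w) \<noteq> 0. cnj (f (word_star w)) * \<theta> w)"
    by (simp add: word_lin_def)
  also have "\<dots> = (\<Sum>w | f w \<noteq> 0. cnj (f w) * cnj (\<theta> w))"
    by (rule sum.reindex_bij_witness[of _ word_star word_star]) (auto simp: assms)
  finally show ?thesis by (simp add: word_lin_def)
qed

text \<open>Left multiplication by a generator is a shift of words, so splitting off one letter
  suffices. The induction runs over \<open>f\<close> for all \<open>h\<close> at once, and treats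
  \<open>f\<close> together with its adjoint so that the case of a star closes.\<close>

lemma (in free_alg) word_lin_mult:
  assumes one: "\<theta> [] = 1" and cons: "\<And>l w. \<theta> (l # w) = \<theta> [l] * \<theta> w"
    and star: "\<And>w. \<theta> (word_star w) = cnj (\<theta> w)"
    and f: "f \<in> carrier F" and h: "h \<in> carrier F"
  shows "word_lin \<theta> (f \<otimes>\<^bsub>F\<^esub> h) = word_lin \<theta> f * word_lin \<theta> h"
proof -
  have "\<forall>h\<in>carrier F. word_lin \<theta> (f \<otimes>\<^bsub>F\<^esub> h) = word_lin \<theta> f * word_lin \<theta> h \<and>
      word_lin \<theta> (star F f \<otimes>\<^bsub>F\<^esub> h) = word_lin \<theta> (star F f) * word_lin \<theta> h"
    using carrier_F_generated[OF f]
  proof induction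
    case (incl f)
    then obtain g where g: "f = free_gen g" by blast
    have cons': "(\<lambda>w. \<theta> (l # w)) = (\<lambda>w. \<theta> [l] * \<theta> w)" for l
      by (rule ext) (rule cons)
    have "word_lin \<theta> (star F (free_gen g)) = \<theta> [(g, True)]"
      using star[of "[(g, False)]"]
      by (simp only: word_lin_star[where \<theta> = \<theta>, OF star] word_lin_free_gen) (simp add: word_star_def)
    then show ?case
      by (simp add: g word_lin_free_gen_mult word_lin_star_free_gen_mult cons'[of "(g, _)"]
          word_lin_smult_fun word_lin_free_gen del: F_simps)
  next
    case one
    then show ?case using word_lin_one[of \<theta>] assms(1) by (simp del: F_simps)
  next
    case (add f f')
    have "f \<in> carrier F" "f' \<in> carrier F" using add.hyps F.star_generate_closed[OF gens_subset] by auto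
    moreover have "word_lin \<theta> (a \<oplus>\<^bsub>F\<^esub> b) = word_lin \<theta> a + word_lin \<theta> b"
      if "a \<in> carrier F" "b \<in> carrier F" for a b
      using word_lin_add[OF that] by simp
    ultimately show ?case
      using add.IH by (simp add: F.l_distr F.star_add F.star_closed distrib_right del: F_simps)
  next
    case (mult f f')
    have cl: "f \<in> carrier F" "f' \<in> carrier F" using mult.hyps F.star_generate_closed[OF gens_subset] by auto
    have "f' \<otimes>\<^bsub>F\<^esub> h \<in> carrier F" "star F f \<otimes>\<^bsub>F\<^esub> h \<in> carrier F" if "h \<in> carrier F" for h
      using cl that F.star_closed F.m_closed by blast+
    then show ?case
      using mult.IH cl by (simp add: F.m_assoc F.star_mult F.star_closed mult.assoc del: F_simps)
  next
    case (smult f c)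
    have "f \<in> carrier F" using smult.hyps F.star_generate_closed[OF gens_subset] by auto
    moreover have "word_lin \<theta> (c \<odot>\<^bsub>F\<^esub> a) = c * word_lin \<theta> a" for a c
      using word_lin_smult[of \<theta> c a] by simp
    ultimately show ?case
      using smult.IH by (simp add: F.smult_mult_left F.star_smult F.star_closed mult.assoc del: F_simps)
  next
    case (star f)
    have "f \<in> carrier F" using star.hyps F.star_generate_closed[OF gens_subset] by auto
    then show ?case using star.IH by (simp add: F.star_star del: F_simps)
  qed
  then show ?thesis using h by blast
qed

lemma (in free_alg) word_lin_character:
  assumes "\<theta> [] = 1" "\<And>l w. \<theta> (l # w) = \<theta> [l] * \<theta> w" "\<And>w. \<theta> (word_star w) = cnj (\<theta> w)"
  shows "word_lin \<theta> \<in> star_hom F complex_cstar"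
proof (rule star_homI)
  show "word_lin \<theta> (f \<otimes>\<^bsub>F\<^esub> h) = word_lin \<theta> f \<otimes>\<^bsub>complex_cstar\<^esub> word_lin \<theta> h"
    if "f \<in> carrier F" "h \<in> carrier F" for f h
    using word_lin_mult[OF assms that] by simp
  show "word_lin \<theta> (star F f) = star complex_cstar (word_lin \<theta> f)" for f
    using word_lin_star[where \<theta> = \<theta>, OF assms(3)] by simp
  show "word_lin \<theta> (f \<oplus>\<^bsub>F\<^esub> h) = word_lin \<theta> f \<oplus>\<^bsub>complex_cstar\<^esub> word_lin \<theta> h"
    if "f \<in> carrier F" "h \<in> carrier F" for f h
    using word_lin_add[OF that] by simp
  show "word_lin \<theta> \<one>\<^bsub>F\<^esub> = \<one>\<^bsub>complex_cstar\<^esub>"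
    using word_lin_one[of \<theta>] assms(1) by simp
  show "word_lin \<theta> (c \<odot>\<^bsub>F\<^esub> f) = c \<odot>\<^bsub>complex_cstar\<^esub> word_lin \<theta> f" for c f
    using word_lin_smult[of \<theta> c f] by simp
qed simp

section \<open>The universal algebra \<open>A\<^sub>s\<close> and its characters\<close>

interpretation M: free_alg "UNIV :: ('n::finite \<times> 'n) set" .

lemma magic_relationsE:
  assumes "(l, r) \<in> (magic_relations :: (((('n::finite \<times> 'n) \<times> bool) list \<Rightarrow> complex) \<times> _) set)"
    and "\<And>i j. P (star M.F (free_gen (i, j))) (free_gen (i, j))"
    and "\<And>i j. P (free_gen (i, j) \<otimes>\<^bsub>M.F\<^esub> free_gen (i, j)) (free_gen (i, j))"
    and "\<And>i j k. j \<noteq> k \<Longrightarrow> P (free_gen (i, j) \<otimes>\<^bsub>M.F\<^esub> free_gen (i, k)) \<zero>\<^bsub>M.F\<^esub>"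
    and "\<And>i j k. i \<noteq> k \<Longrightarrow> P (free_gen (i, j) \<otimes>\<^bsub>M.F\<^esub> free_gen (k, j)) \<zero>\<^bsub>M.F\<^esub>"
    and "\<And>i. P (\<Oplus>\<^bsub>M.F\<^esub>j\<in>UNIV. free_gen (i, j)) \<one>\<^bsub>M.F\<^esub>"
    and "\<And>j. P (\<Oplus>\<^bsub>M.F\<^esub>i\<in>UNIV. free_gen (i, j)) \<one>\<^bsub>M.F\<^esub>"
  shows "P l r"
  using assms(1) unfolding magic_relations_def Let_def
  by (elim UnE CollectE exE conjE Pair_inject; hypsubst)
     (rule assms(2,3,6,7) | rule assms(4), assumption | rule assms(5), assumption)+

lemma magic_relations_projection:
  "(star M.F (free_gen (i, j)), free_gen (i, j)) \<in> magic_relations"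
  "(free_gen (i, j) \<otimes>\<^bsub>M.F\<^esub> free_gen (i, j), free_gen (i, j)) \<in> magic_relations"
  unfolding magic_relations_def Let_def by blast+

interpretation M: presentation "UNIV :: ('n::finite \<times> 'n) set" magic_relations
proof unfold_locales
  fix l r :: "(('n \<times> 'n) \<times> bool) list \<Rightarrow> complex" assume "(l, r) \<in> magic_relations"
  then show "l \<in> carrier M.F \<and> r \<in> carrier M.F"
    by (rule magic_relationsE)
       (simp_all add: M.F.star_closed M.F.finsum_closed Pi_iff del: M.F_simps)
next
  fix g :: "'n \<times> 'n"
  \<comment> \<open>Modulo null elements a generator is a self-adjoint idempotent, so the
    C*-identity makes its value equal to its own square, hence 0 or 1.\<close>
  have "p (free_gen g) \<le> 1" if p: "admissible UNIV magic_relations p" for p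
  proof -
    interpret P: seminormed_star_algebra M.F p
      using p by (simp add: admissible_def seminormed_star_algebra_def
          seminormed_star_algebra_axioms_def M.star_algebra_F)
    obtain i j where g: "g = (i, j)" by (cases g)
    let ?w = "free_gen (i, j) :: (('n \<times> 'n) \<times> bool) list \<Rightarrow> complex"
    have null: "p (l \<ominus>\<^bsub>M.F\<^esub> r) = 0" if "(l, r) \<in> magic_relations" for l r
      using p that by (auto simp: admissible_def)
    have w: "?w \<in> carrier M.F" "star M.F ?w \<in> carrier M.F"
      by (simp_all add: M.F.star_closed del: M.F_simps)
    have "p ((star M.F ?w \<otimes>\<^bsub>M.F\<^esub> ?w) \<ominus>\<^bsub>M.F\<^esub> (?w \<otimes>\<^bsub>M.F\<^esub> ?w)) = p ((star M.F ?w \<ominus>\<^bsub>M.F\<^esub> ?w) \<otimes>\<^bsub>M.F\<^esub> ?w)"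
      using w by (simp add: M.F.minus_eq M.F.l_distr M.F.l_minus del: M.F_simps)
    also have "\<dots> \<le> p (star M.F ?w \<ominus>\<^bsub>M.F\<^esub> ?w) * p ?w"
      using w by (intro P.p_mult) (simp_all del: M.F_simps)
    also have "\<dots> = 0" using null[OF magic_relations_projection(1)] by simp
    finally have "p ((star M.F ?w \<otimes>\<^bsub>M.F\<^esub> ?w) \<ominus>\<^bsub>M.F\<^esub> (?w \<otimes>\<^bsub>M.F\<^esub> ?w)) = 0"
      using P.nonneg[of "(star M.F ?w \<otimes>\<^bsub>M.F\<^esub> ?w) \<ominus>\<^bsub>M.F\<^esub> (?w \<otimes>\<^bsub>M.F\<^esub> ?w)"] w by (simp del: M.F_simps)
    then have "(p ?w)\<^sup>2 = p (?w \<otimes>\<^bsub>M.F\<^esub> ?w)"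
      using P.p_eq_of_null[of "star M.F ?w \<otimes>\<^bsub>M.F\<^esub> ?w" "?w \<otimes>\<^bsub>M.F\<^esub> ?w"] P.cstar[OF w(1)] w
      by (simp del: M.F_simps)
    also have "\<dots> = p ?w"
      using null[OF magic_relations_projection(2)] w by (intro P.p_eq_of_null) (simp_all del: M.F_simps)
    finally show ?thesis
      unfolding g using P.nonneg[OF w(1)] by (cases "p ?w = 0") (auto simp: power2_eq_square)
  qed
  then show "\<exists>M. \<forall>p. admissible UNIV magic_relations p \<longrightarrow> p (free_gen g) \<le> M" by blast
qed

lemma A\<^sub>s_eq: "A\<^sub>s = M.U"
  by (simp add: A\<^sub>s_def)

lemma A\<^sub>s_gen_eq: "A\<^sub>s_gen i j = universal_gen UNIV magic_relations (i, j)"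
  by (simp add: A\<^sub>s_gen_def)

lemma A\<^sub>s_hom_agree:
  assumes "star_algebra B" "cstar_seminorm B (cnorm B)"
    "\<And>x. x \<in> carrier B \<Longrightarrow> cnorm B x = 0 \<Longrightarrow> x = \<zero>\<^bsub>B\<^esub>"
    and "f \<in> star_hom A\<^sub>s B" "h \<in> star_hom A\<^sub>s B"
    and "\<And>i j. f (A\<^sub>s_gen i j) = h (A\<^sub>s_gen i j)" "z \<in> carrier A\<^sub>s"
  shows "f z = h z"
proof (rule M.hom_agree[OF assms(1-3)])
  show "f \<in> star_hom M.U B" "h \<in> star_hom M.U B" "z \<in> carrier M.U"
    using assms(4,5,7) by (simp_all only: A\<^sub>s_eq)
  show "f (universal_gen UNIV magic_relations g) = h (universal_gen UNIV magic_relations g)" for g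
    using assms(6)[of "fst g" "snd g"] by (simp only: A\<^sub>s_gen_eq prod.collapse)
qed

text \<open>Evaluation at the permutation \<open>g\<close> of the coordinate functions on the
  symmetric group. The row relations use that \<open>g\<close> is bijective; the column relations
  only that it is a function.\<close>

lemma A\<^sub>s_character:
  assumes g: "bij (g :: 'n::finite \<Rightarrow> 'n)"
  shows "\<exists>\<eta>\<in>star_hom A\<^sub>s complex_cstar. \<forall>i j. \<eta> (A\<^sub>s_gen i j) = (if g j = i then 1 else 0)"
proof -
  \<comment> \<open>The product of the values of the letters, each 0 or 1. The adjoint flags are
    ignored because these values are real.\<close>
  define \<theta> :: "(('n \<times> 'n) \<times> bool) list \<Rightarrow> complex"
    where "\<theta> w = (if \<forall>z\<in>fst ` set w. g (snd z) = fst z then 1 else 0)" for w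
  have ch: "word_lin \<theta> \<in> star_hom M.F complex_cstar"
  proof (rule M.word_lin_character)
    show "\<theta> (word_star w) = cnj (\<theta> w)" for w
      by (simp only: \<theta>_def word_star_simps(5)) simp
  qed (auto simp: \<theta>_def)
  note h = star_homD[OF ch] and cl = M.free_gen_closed[OF UNIV_I]
  have gen: "word_lin \<theta> (free_gen (i, j)) = (if g j = i then 1 else 0)" for i j
    unfolding M.word_lin_free_gen by (simp add: \<theta>_def)
  have finsum: "word_lin \<theta> (\<Oplus>\<^bsub>M.F\<^esub>i\<in>UNIV. free_gen (f i)) = (\<Sum>i\<in>UNIV. word_lin \<theta> (free_gen (f i)))"
    for f :: "'n \<Rightarrow> 'n \<times> 'n"
    by (subst star_hom_finsum[OF M.star_algebra_F complex_star_algebra ch])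
       (simp_all add: finsum_complex del: M.F_simps)
  have zero: "word_lin \<theta> \<zero>\<^bsub>M.F\<^esub> = 0"
    using star_hom_zero[OF M.star_algebra_F complex_star_algebra ch] by simp
  have rel: "word_lin \<theta> l = word_lin \<theta> r" if "(l, r) \<in> magic_relations" for l r
    using that
  proof (rule magic_relationsE)
    fix i j
    show "word_lin \<theta> (star M.F (free_gen (i, j))) = word_lin \<theta> (free_gen (i, j))"
      unfolding h(6)[OF cl] gen by simp
    show "word_lin \<theta> (free_gen (i, j) \<otimes>\<^bsub>M.F\<^esub> free_gen (i, j)) = word_lin \<theta> (free_gen (i, j))"
      unfolding h(2)[OF cl cl] gen by simp
    show "word_lin \<theta> (free_gen (i, j) \<otimes>\<^bsub>M.F\<^esub> free_gen (i, k)) = word_lin \<theta> \<zero>\<^bsub>M.F\<^esub>" if "j \<noteq> k" for k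
      unfolding h(2)[OF cl cl] gen zero using injD[OF bij_is_inj[OF g], of j k] that by auto
    show "word_lin \<theta> (free_gen (i, j) \<otimes>\<^bsub>M.F\<^esub> free_gen (k, j)) = word_lin \<theta> \<zero>\<^bsub>M.F\<^esub>" if "i \<noteq> k" for k
      unfolding h(2)[OF cl cl] gen zero using that by auto
    have "(\<Sum>j\<in>UNIV. if g j = i then 1 else 0) = (\<Sum>i'\<in>UNIV. if i' = i then 1 else (0::complex))"
      by (rule sum.reindex_bij_betw[OF g])
    then have "(\<Sum>j\<in>UNIV. if g j = i then 1 else (0::complex)) = 1" by simp
    then show "word_lin \<theta> (\<Oplus>\<^bsub>M.F\<^esub>j\<in>UNIV. free_gen (i, j)) = word_lin \<theta> \<one>\<^bsub>M.F\<^esub>"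
      unfolding finsum[of "\<lambda>j. (i, j)"] gen h(4) by simp
    show "word_lin \<theta> (\<Oplus>\<^bsub>M.F\<^esub>i\<in>UNIV. free_gen (i, j)) = word_lin \<theta> \<one>\<^bsub>M.F\<^esub>"
      unfolding finsum[of "\<lambda>i. (i, j)"] gen h(4) by simp
  qed
  have adm: "admissible UNIV magic_relations (\<lambda>f. cmod (word_lin \<theta> f))"
    unfolding admissible_def
  proof (intro conjI ballI)
    have "cstar_seminorm complex_cstar cmod"
      by (auto simp: cstar_seminorm_def norm_mult norm_triangle_ineq power2_eq_square)
    then show "cstar_seminorm M.F (\<lambda>f. cmod (word_lin \<theta> f))"
      by (rule star_hom_seminorm[OF M.star_algebra_F complex_star_algebra _ ch])
    fix z :: "((('n \<times> 'n) \<times> bool) list \<Rightarrow> complex) \<times> ((('n \<times> 'n) \<times> bool) list \<Rightarrow> complex)"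
    assume z: "z \<in> magic_relations"
    obtain l r where lr: "z = (l, r)" by (cases z)
    note cl = M.relations[OF z[unfolded lr], THEN conjunct1] M.relations[OF z[unfolded lr], THEN conjunct2]
    have "word_lin \<theta> (l \<oplus>\<^bsub>M.F\<^esub> ((-1) \<odot>\<^bsub>M.F\<^esub> r)) = word_lin \<theta> l - word_lin \<theta> r"
      unfolding h(3)[OF cl(1) M.F.smult_closed[OF cl(2)]] h(5)[OF cl(2)] by simp
    moreover have "l \<ominus>\<^bsub>M.F\<^esub> r = l \<oplus>\<^bsub>M.F\<^esub> ((-1) \<odot>\<^bsub>M.F\<^esub> r)"
      using cl by (simp only: M.F.minus_eq M.F.smult_minus_one)
    ultimately show "case z of (l, r) \<Rightarrow> cmod (word_lin \<theta> (l \<ominus>\<^bsub>M.F\<^esub> r)) = 0"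
      using rel[OF z[unfolded lr]] by (simp add: lr del: M.F_simps)
  qed
  obtain \<eta> where "\<eta> \<in> star_hom M.C complex_cstar"
    and "\<And>f. f \<in> carrier M.F \<Longrightarrow> \<eta> (M.cls (\<lambda>n. f)) = word_lin \<theta> f"
    using M.extend_character[OF ch M.admissible_le_un[OF adm]] by blast
  then show ?thesis
    unfolding A\<^sub>s_eq M.U_eq A\<^sub>s_gen_eq by (intro bexI[of _ \<eta>]) (auto simp: universal_gen_def gen)
qed

text \<open>A cardinality argument: the real and imaginary parts at each point are coded as sets of
  natural numbers, and the finitely many sets are merged into one by pairing with the number of the
  point.\<close>

lemma function_space_inj:
  "\<exists>\<iota> :: ('g::finite \<Rightarrow> complex) \<Rightarrow> complex. inj \<iota>"
proof -
  obtain r :: "real \<Rightarrow> nat set" where r: "inj r"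
    using nat_sets_eqpoll_reals eqpoll_sym eqpoll_imp_lepoll unfolding lepoll_def by metis
  obtain s :: "nat set \<Rightarrow> real" where s: "inj s"
    using nat_sets_eqpoll_reals eqpoll_imp_lepoll unfolding lepoll_def by metis
  obtain e :: "'g \<times> bool \<Rightarrow> nat" where e: "inj e"
    using finite_imp_inj_to_nat_seg[of "UNIV :: ('g \<times> bool) set"] by auto
  define part where "part f z = (if snd z then Re (f (fst z)) else Im (f (fst z)))"
    for f :: "'g \<Rightarrow> complex" and z
  define code where "code f = {prod_encode (e z, m) | z m. m \<in> r (part f z)}" for f
  have mem: "prod_encode (e z, m) \<in> code f \<longleftrightarrow> m \<in> r (part f z)" for z m f
    using e by (cases z) (auto simp: code_def inj_eq)
  have "inj code"
  proof (rule injI)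
    fix f f' assume "code f = code f'"
    then have "r (part f z) = r (part f' z)" for z using mem by blast
    then have p: "part f z = part f' z" for z using r by (simp add: inj_eq)
    show "f = f'"
    proof
      fix g show "f g = f' g"
        using p[of "(g, True)"] p[of "(g, False)"] by (simp add: part_def complex_eq_iff)
    qed
  qed
  then have "inj (\<lambda>f. complex_of_real (s (code f)))"
    using s by (auto simp: inj_def)
  then show ?thesis by blast
qed

section \<open>Function algebras of finite permutation groups\<close>

lemma (in cstar_tensor) elem_tensor_combination:
  assumes I: "finite I" "\<And>i. i \<in> I \<Longrightarrow> e i \<in> carrier A" and J: "finite J" "\<And>j. j \<in> J \<Longrightarrow> f j \<in> carrier B"
  shows "elem_tensor A B (A.combination I e c) (B.combination J f d)
    = T.combination (I \<times> J) (\<lambda>z. elem_tensor A B (e (fst z)) (f (snd z))) (\<lambda>z. c (fst z) * d (snd z))"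
proof -
  have "elem_tensor A B (A.combination I e c) (B.combination J f d)
      = (\<Oplus>\<^bsub>tensor A B\<^esub>i\<in>I. elem_tensor A B (c i \<odot>\<^bsub>A\<^esub> e i) (B.combination J f d))"
    unfolding A.combination_def
    by (rule elem_tensor_finsum_left) (use I J in \<open>auto simp: A.smult_closed B.combination_closed\<close>)
  also have "\<dots> = (\<Oplus>\<^bsub>tensor A B\<^esub>i\<in>I. \<Oplus>\<^bsub>tensor A B\<^esub>j\<in>J. (c i * d j) \<odot>\<^bsub>tensor A B\<^esub> elem_tensor A B (e i) (f j))"
  proof (rule T.finsum_cong')
    fix i assume i: "i \<in> I"
    have "elem_tensor A B (c i \<odot>\<^bsub>A\<^esub> e i) (B.combination J f d)
        = (\<Oplus>\<^bsub>tensor A B\<^esub>j\<in>J. elem_tensor A B (c i \<odot>\<^bsub>A\<^esub> e i) (d j \<odot>\<^bsub>B\<^esub> f j))"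
      unfolding B.combination_def
      by (rule elem_tensor_finsum_right) (use I J i in \<open>auto simp: A.smult_closed B.smult_closed\<close>)
    also have "\<dots> = (\<Oplus>\<^bsub>tensor A B\<^esub>j\<in>J. (c i * d j) \<odot>\<^bsub>tensor A B\<^esub> elem_tensor A B (e i) (f j))"
      by (rule T.finsum_cong')
         (use I J i in \<open>auto simp: elem_tensor_simps A.smult_closed B.smult_closed T.smult_closed T.smult_smult
           mult.commute\<close>)
    finally show "elem_tensor A B (c i \<odot>\<^bsub>A\<^esub> e i) (B.combination J f d)
        = (\<Oplus>\<^bsub>tensor A B\<^esub>j\<in>J. (c i * d j) \<odot>\<^bsub>tensor A B\<^esub> elem_tensor A B (e i) (f j))" .
  qed (use I J in \<open>auto intro!: T.finsum_closed simp: T.smult_closed\<close>)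
  also have "\<dots> = T.combination (I \<times> J) (\<lambda>z. elem_tensor A B (e (fst z)) (f (snd z))) (\<lambda>z. c (fst z) * d (snd z))"
    unfolding T.combination_def
    by (rule T.finsum_cartesian_product) (use I J in \<open>auto simp: T.smult_closed\<close>)
  finally show ?thesis .
qed

text \<open>
  The functions on \<open>S\<close> are transported along an injection \<open>\<iota>\<close>, because a competitor in
  \<^const>\<open>hopf_image\<close> must have its carrier in the type of the given algebra.
\<close>

locale function_algebra =
  fixes \<iota> :: "('g \<Rightarrow> complex) \<Rightarrow> 'a" and S :: "'g set"
  assumes inj: "inj \<iota>" and fin: "finite S" and ne: "S \<noteq> {}"
begin

definition crd where "crd a = inv_into UNIV \<iota> a"

text \<open>Functions on \<open>S\<close> are represented by their extension by zero, so that
  equality on \<open>S\<close> is equality of elements.\<close>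

definition funs where "funs = {f. \<forall>g. g \<notin> S \<longrightarrow> f g = (0 :: complex)}"

definition B :: "'a cstar" where
  "B = \<lparr>carrier = \<iota> ` funs, mult = (\<lambda>a b. \<iota> (\<lambda>g. crd a g * crd b g)),
     one = \<iota> (\<lambda>g. if g \<in> S then 1 else 0), zero = \<iota> (\<lambda>g. 0),
     add = (\<lambda>a b. \<iota> (\<lambda>g. crd a g + crd b g)), smult = (\<lambda>c a. \<iota> (\<lambda>g. c * crd a g)),
     star = (\<lambda>a. \<iota> (\<lambda>g. cnj (crd a g))), cnorm = (\<lambda>a. Max ((\<lambda>g. cmod (crd a g)) ` S))\<rparr>"

lemma crd_\<iota> [simp]: "crd (\<iota> f) = f"
  using inj by (simp add: crd_def)

lemma \<iota>_eq_iff [simp]: "\<iota> f = \<iota> f' \<longleftrightarrow> f = f'"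
  using inj by (simp add: inj_eq)

lemma B_simps [simp]:
  "carrier B = \<iota> ` funs" "mult B = (\<lambda>a b. \<iota> (\<lambda>g. crd a g * crd b g))"
  "one B = \<iota> (\<lambda>g. if g \<in> S then 1 else 0)" "zero B = \<iota> (\<lambda>g. 0)"
  "add B = (\<lambda>a b. \<iota> (\<lambda>g. crd a g + crd b g))" "smult B = (\<lambda>c a. \<iota> (\<lambda>g. c * crd a g))"
  "star B = (\<lambda>a. \<iota> (\<lambda>g. cnj (crd a g)))"
  by (simp_all add: B_def)

lemma cnorm_B: "cnorm B a = Max ((\<lambda>g. cmod (crd a g)) ` S)"
  by (simp add: B_def)

lemma crd_outside: "a \<in> \<iota> ` funs \<Longrightarrow> g \<notin> S \<Longrightarrow> crd a g = 0"
  by (auto simp: funs_def)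

lemma \<iota>_crd: "a \<in> \<iota> ` funs \<Longrightarrow> \<iota> (crd a) = a"
  by auto

lemma B_star_algebra: "star_algebra B"
proof -
  have inverse: "\<exists>b\<in>carrier B. b \<oplus>\<^bsub>B\<^esub> a = \<zero>\<^bsub>B\<^esub>" if "a \<in> carrier B" for a
    by (rule bexI[of _ "\<iota> (\<lambda>g. - crd a g)"]) (use that in \<open>auto simp: funs_def\<close>)
  interpret abelian_group B
    by (rule abelian_groupI) (use inverse in \<open>auto simp: funs_def ac_simps\<close>)
  interpret monoid B
    by (rule monoidI) (auto simp: funs_def ac_simps fun_eq_iff)
  interpret ring B
    by (rule ringI)
       (simp_all add: abelian_group_axioms monoid_axioms algebra_simps)
  show ?thesis
    by unfold_locales (auto simp: funs_def algebra_simps)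
qed

sublocale B: star_algebra B
  by (rule B_star_algebra)

lemma cmod_le_cnorm: "g \<in> S \<Longrightarrow> cmod (crd a g) \<le> cnorm B a"
  unfolding cnorm_B using fin by (intro Max_ge) auto

lemma cnorm_B_le: "(\<And>g. g \<in> S \<Longrightarrow> cmod (crd a g) \<le> k) \<Longrightarrow> cnorm B a \<le> k"
  unfolding cnorm_B using fin ne by (subst Max_le_iff) auto

lemma cnorm_B_nonneg: "0 \<le> cnorm B a"
  using ne cmod_le_cnorm norm_ge_zero order_trans by blast

lemma B_cstar_seminorm: "cstar_seminorm B (cnorm B)"
  unfolding cstar_seminorm_def
proof (intro conjI ballI allI)
  fix a b c
  show "0 \<le> cnorm B a" by (rule cnorm_B_nonneg)
  have le: "cnorm B (c \<odot>\<^bsub>B\<^esub> a) \<le> cmod c * cnorm B a" for c a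
    by (rule cnorm_B_le) (simp add: norm_mult mult_left_mono cmod_le_cnorm)
  show "cnorm B (c \<odot>\<^bsub>B\<^esub> a) = cmod c * cnorm B a"
  proof (rule antisym[OF le])
    have "cmod c * cmod (crd a g) \<le> cnorm B (c \<odot>\<^bsub>B\<^esub> a)" if "g \<in> S" for g
      using cmod_le_cnorm[OF that, of "c \<odot>\<^bsub>B\<^esub> a"] by (simp add: norm_mult)
    then have "cnorm B a \<le> cnorm B (c \<odot>\<^bsub>B\<^esub> a) / cmod c" if "c \<noteq> 0"
      using that by (intro cnorm_B_le) (simp add: pos_le_divide_eq mult.commute)
    then show "cmod c * cnorm B a \<le> cnorm B (c \<odot>\<^bsub>B\<^esub> a)"
      using cnorm_B_nonneg by (cases "c = 0") (auto simp: pos_le_divide_eq mult.commute)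
  qed
  show "cnorm B (a \<oplus>\<^bsub>B\<^esub> b) \<le> cnorm B a + cnorm B b"
  proof (rule cnorm_B_le)
    fix g assume g: "g \<in> S"
    show "cmod (crd (a \<oplus>\<^bsub>B\<^esub> b) g) \<le> cnorm B a + cnorm B b"
      using norm_triangle_ineq[of "crd a g" "crd b g"] cmod_le_cnorm[OF g, of a] cmod_le_cnorm[OF g, of b]
      by simp
  qed
  show "cnorm B (a \<otimes>\<^bsub>B\<^esub> b) \<le> cnorm B a * cnorm B b"
    by (rule cnorm_B_le) (simp add: norm_mult mult_mono cmod_le_cnorm cnorm_B_nonneg)
  show "cnorm B (star B a \<otimes>\<^bsub>B\<^esub> a) = (cnorm B a)\<^sup>2"
  proof (rule antisym)
    show "cnorm B (star B a \<otimes>\<^bsub>B\<^esub> a) \<le> (cnorm B a)\<^sup>2"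
      by (rule cnorm_B_le) (simp add: norm_mult power2_eq_square mult_mono cmod_le_cnorm cnorm_B_nonneg)
    have "cmod (crd a g) \<le> sqrt (cnorm B (star B a \<otimes>\<^bsub>B\<^esub> a))" if "g \<in> S" for g
      using cmod_le_cnorm[OF that, of "star B a \<otimes>\<^bsub>B\<^esub> a"]
      by (intro real_le_rsqrt) (simp add: norm_mult power2_eq_square)
    then have "cnorm B a \<le> sqrt (cnorm B (star B a \<otimes>\<^bsub>B\<^esub> a))"
      by (rule cnorm_B_le)
    from power_mono[OF this cnorm_B_nonneg, of 2]
    show "(cnorm B a)\<^sup>2 \<le> cnorm B (star B a \<otimes>\<^bsub>B\<^esub> a)"
      using cnorm_B_nonneg by simp
  qed
qed

lemma B_minus: "a \<in> carrier B \<Longrightarrow> b \<in> carrier B \<Longrightarrow> a \<ominus>\<^bsub>B\<^esub> b = \<iota> (\<lambda>g. crd a g - crd b g)"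
  using B.smult_minus_one[of b] by (simp add: B.minus_eq flip: B.smult_minus_one)

lemma B_cstar_algebra: "cstar_algebra B"
proof
  show "cstar_seminorm B (cnorm B)" by (rule B_cstar_seminorm)
next
  fix a assume a: "a \<in> carrier B" "cnorm B a = 0"
  have "crd a g = 0" for g
    using cmod_le_cnorm[of g a] a crd_outside[of a g] by (cases "g \<in> S") auto
  then show "a = \<zero>\<^bsub>B\<^esub>" using \<iota>_crd[of a] a(1) by (metis B_simps(1,4) ext)
next
  fix X assume "X \<in> cauchy_seqs B (cnorm B)"
  then have X: "\<And>n. X n \<in> carrier B"
    and c: "\<And>e. e > 0 \<Longrightarrow> \<exists>M. \<forall>m\<ge>M. \<forall>n\<ge>M. cnorm B (X m \<ominus>\<^bsub>B\<^esub> X n) < e"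
    by (auto simp: cauchy_seqs_def)
  have "convergent (\<lambda>n. crd (X n) g)" if g: "g \<in> S" for g
  proof (rule Cauchy_convergent, rule CauchyI)
    fix e :: real assume "e > 0"
    then obtain M where M: "\<And>m n. m \<ge> M \<Longrightarrow> n \<ge> M \<Longrightarrow> cnorm B (X m \<ominus>\<^bsub>B\<^esub> X n) < e"
      using c by blast
    have "cmod (crd (X m) g - crd (X n) g) \<le> cnorm B (X m \<ominus>\<^bsub>B\<^esub> X n)" for m n
      using cmod_le_cnorm[OF g, of "X m \<ominus>\<^bsub>B\<^esub> X n"] B_minus[OF X[of m] X[of n]] by simp
    then show "\<exists>M. \<forall>m\<ge>M. \<forall>n\<ge>M. cmod (crd (X m) g - crd (X n) g) < e"
      using M by (meson order_le_less_trans)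
  qed
  then obtain l where l: "\<And>g. g \<in> S \<Longrightarrow> (\<lambda>n. crd (X n) g) \<longlonglongrightarrow> l g"
    unfolding convergent_def by metis
  define L where "L = \<iota> (\<lambda>g. if g \<in> S then l g else 0)"
  have L: "L \<in> carrier B" by (auto simp: L_def funs_def)
  have "(\<lambda>n. cnorm B (X n \<ominus>\<^bsub>B\<^esub> L)) \<longlonglongrightarrow> 0"
  proof (rule tendsto_sandwich[OF _ _ tendsto_const])
    show "\<forall>\<^sub>F n in sequentially. 0 \<le> cnorm B (X n \<ominus>\<^bsub>B\<^esub> L)" by (simp add: cnorm_B_nonneg)
    \<comment> \<open>Uniform convergence follows from pointwise convergence because the maximum
      over the finite set \<open>S\<close> is at most the sum.\<close>
    show "\<forall>\<^sub>F n in sequentially. cnorm B (X n \<ominus>\<^bsub>B\<^esub> L) \<le> (\<Sum>g\<in>S. cmod (crd (X n) g - l g))"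
    proof (intro always_eventually allI cnorm_B_le)
      fix n g assume g: "g \<in> S"
      then have "cmod (crd (X n \<ominus>\<^bsub>B\<^esub> L) g) = cmod (crd (X n) g - l g)"
        using B_minus[OF X[of n] L] by (simp add: L_def)
      also have "\<dots> \<le> (\<Sum>g\<in>S. cmod (crd (X n) g - l g))"
        using fin g by (intro member_le_sum) auto
      finally show "cmod (crd (X n \<ominus>\<^bsub>B\<^esub> L) g) \<le> (\<Sum>g\<in>S. cmod (crd (X n) g - l g))" .
    qed
    have "(\<lambda>n. \<Sum>g\<in>S. cmod (crd (X n) g - l g)) \<longlonglongrightarrow> (\<Sum>g\<in>S. 0)"
      by (intro tendsto_sum tendsto_norm_zero LIM_zero l)
    then show "(\<lambda>n. \<Sum>g\<in>S. cmod (crd (X n) g - l g)) \<longlonglongrightarrow> 0" by simp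
  qed
  then show "\<exists>L\<in>carrier B. (\<lambda>n. cnorm B (X n \<ominus>\<^bsub>B\<^esub> L)) \<longlonglongrightarrow> 0" using L by blast
qed

lemma finsum_B:
  assumes "finite I" "\<And>i. i \<in> I \<Longrightarrow> f i \<in> funs"
  shows "(\<Oplus>\<^bsub>B\<^esub>i\<in>I. \<iota> (f i)) = \<iota> (\<lambda>g. \<Sum>i\<in>I. f i g)"
  using assms
proof (induction I rule: finite_induct)
  case (insert i I)
  then have "(\<lambda>i. \<iota> (f i)) \<in> I \<rightarrow> carrier B" by auto
  with insert show ?case by (simp add: B.finsum_insert)
qed simp

definition \<delta> where "\<delta> g = \<iota> (\<lambda>h. if h = g then 1 else 0)"

lemma \<delta>_closed: "g \<in> S \<Longrightarrow> \<delta> g \<in> carrier B"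
  by (auto simp: \<delta>_def funs_def)

lemma \<delta>_projections:
  "\<delta> g \<otimes>\<^bsub>B\<^esub> \<delta> g = \<delta> g" "g \<noteq> h \<Longrightarrow> \<delta> g \<otimes>\<^bsub>B\<^esub> \<delta> h = \<zero>\<^bsub>B\<^esub>" "star B (\<delta> g) = \<delta> g"
  by (auto simp: \<delta>_def)

lemma combination_\<delta>: "B.combination S \<delta> c = \<iota> (\<lambda>g. if g \<in> S then c g else 0)"
proof -
  have "B.combination S \<delta> c = (\<Oplus>\<^bsub>B\<^esub>g\<in>S. \<iota> (\<lambda>h. if h = g then c g else 0))"
    unfolding B.combination_def
    by (rule B.finsum_cong') (auto simp: \<delta>_def funs_def fun_eq_iff)
  also have "\<dots> = \<iota> (\<lambda>h. \<Sum>g\<in>S. if h = g then c g else 0)"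
    by (rule finsum_B[OF fin]) (auto simp: funs_def)
  finally show ?thesis using fin by simp
qed

lemma eq_combination: "a \<in> carrier B \<Longrightarrow> a = B.combination S \<delta> (crd a)"
  unfolding combination_\<delta> by (auto simp: funs_def fun_eq_iff)

lemma hom_eq_combination:
  assumes "star_algebra A" "\<rho> \<in> star_hom B A" "a \<in> carrier B"
  shows "\<rho> a = star_algebra.combination A S (\<lambda>g. \<rho> (\<delta> g)) (crd a)"
proof -
  interpret A: star_algebra A by fact
  have "\<rho> a = \<rho> (\<Oplus>\<^bsub>B\<^esub>g\<in>S. crd a g \<odot>\<^bsub>B\<^esub> \<delta> g)"
    using eq_combination[OF assms(3)] unfolding B.combination_def by simp
  also have "\<dots> = (\<Oplus>\<^bsub>A\<^esub>g\<in>S. \<rho> (crd a g \<odot>\<^bsub>B\<^esub> \<delta> g))"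
    by (rule star_hom_finsum[OF B.star_algebra_axioms assms(1,2) fin])
       (use B.smult_closed \<delta>_closed in blast)
  also have "\<dots> = A.combination S (\<lambda>g. \<rho> (\<delta> g)) (crd a)"
    unfolding A.combination_def
    by (rule A.finsum_cong')
       (use \<delta>_closed in \<open>auto simp: star_homD[OF assms(2)] A.smult_closed simp del: B_simps\<close>)
  finally show ?thesis .
qed

end

section \<open>The Hopf structure of the functions on a finite permutation group\<close>

locale permutation_functions = function_algebra \<iota> S
  for \<iota> :: "(('n::finite \<Rightarrow> 'n) \<Rightarrow> complex) \<Rightarrow> 'a" and S :: "('n \<Rightarrow> 'n) set" +
  assumes bij: "g \<in> S \<Longrightarrow> bij g" and id_mem: "id \<in> S"
    and comp_mem: "g \<in> S \<Longrightarrow> h \<in> S \<Longrightarrow> g \<circ> h \<in> S"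
    and inv_mem: "g \<in> S \<Longrightarrow> inv_into UNIV g \<in> S"
begin

definition v :: "'n \<Rightarrow> 'n \<Rightarrow> 'a" where
  "v i j = \<iota> (\<lambda>g. if g \<in> S \<and> g j = i then 1 else 0)"

lemma v_closed: "v i j \<in> carrier B"
  by (auto simp: v_def funs_def)

lemma crd_v: "crd (v i j) = (\<lambda>g. if g \<in> S \<and> g j = i then 1 else 0)"
  by (simp add: v_def)

lemma magic_v: "magic_unitary B v"
  unfolding magic_unitary_def
proof (intro conjI allI impI)
  fix i j k
  show "projection B (v i j)"
    unfolding projection_def using v_closed by (auto simp: v_def)
  show "v i j \<otimes>\<^bsub>B\<^esub> v i k = \<zero>\<^bsub>B\<^esub>" if "j \<noteq> k"
    using that bij by (auto simp: v_def fun_eq_iff bij_def inj_eq)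
  show "v i j \<otimes>\<^bsub>B\<^esub> v k j = \<zero>\<^bsub>B\<^esub>" if "i \<noteq> k"
    using that by (auto simp: v_def fun_eq_iff)
  show "(\<Oplus>\<^bsub>B\<^esub>j\<in>UNIV. v i j) = \<one>\<^bsub>B\<^esub>"
  proof -
    have "(\<Sum>j\<in>UNIV. if g \<in> S \<and> g j = i then 1 else 0) = (if g \<in> S then 1 else (0::complex))" for g
    proof (cases "g \<in> S")
      case True
      have "(\<Sum>j\<in>UNIV. if g j = i then 1 else 0) = (\<Sum>i'\<in>UNIV. if i' = i then 1 else (0::complex))"
        by (rule sum.reindex_bij_betw[OF bij[OF True]])
      then show ?thesis using True by simp
    qed simp
    then show ?thesis
      unfolding v_def by (subst finsum_B) (auto simp: funs_def)
  qed
  show "(\<Oplus>\<^bsub>B\<^esub>i\<in>UNIV. v i j) = \<one>\<^bsub>B\<^esub>"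
  proof -
    have "(\<Sum>i\<in>UNIV. if g \<in> S \<and> g j = i then 1 else 0) = (if g \<in> S then 1 else (0::complex))" for g
      by simp
    then show ?thesis
      unfolding v_def by (subst finsum_B) (auto simp: funs_def)
  qed
qed

abbreviation "V \<equiv> {v i j | i j. True}"

text \<open>The point mass at \<open>g\<close> is the product over all \<open>j\<close> of the
  entries \<open>v (g j) j\<close>, built up by induction over the set of positions where agreement
  with \<open>g\<close> is imposed. Point masses span.\<close>

lemma generated: "carrier B \<subseteq> star_generate B V"
proof
  have \<delta>: "\<delta> g \<in> star_generate B V" if g: "g \<in> S" for g
  proof -
    have "\<iota> (\<lambda>h. if h \<in> S \<and> (\<forall>j\<in>J. h j = g j) then 1 else 0) \<in> star_generate B V" if "finite J" for J
      using that
    proof (induction J rule: finite_induct)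
      case empty
      then show ?case using star_generate.one[of B V] by simp
    next
      case (insert j J)
      have "v (g j) j \<in> star_generate B V" by (intro star_generate.incl) blast
      moreover have "\<iota> (\<lambda>h. if h \<in> S \<and> (\<forall>j\<in>insert j J. h j = g j) then 1 else 0)
          = v (g j) j \<otimes>\<^bsub>B\<^esub> \<iota> (\<lambda>h. if h \<in> S \<and> (\<forall>j\<in>J. h j = g j) then 1 else 0)"
        by (auto simp: v_def fun_eq_iff)
      ultimately show ?case
        using star_generate.mult[OF _ insert.IH] by (simp only:)
    qed
    from this[of UNIV] have "\<iota> (\<lambda>h. if h \<in> S \<and> (\<forall>j. h j = g j) then 1 else 0) \<in> star_generate B V"
      by simp
    moreover have "(\<lambda>h. if h \<in> S \<and> (\<forall>j. h j = g j) then 1 else (0::complex)) = (\<lambda>h. if h = g then 1 else 0)"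
      using g by (auto intro!: ext)
    ultimately show ?thesis by (simp add: \<delta>_def)
  qed
  fix a assume a: "a \<in> carrier B"
  have "B.combination I \<delta> (crd a) \<in> star_generate B V" if "finite I" "I \<subseteq> S" for I
    using that
  proof (induction I rule: finite_induct)
    case empty
    have "0 \<odot>\<^bsub>B\<^esub> \<one>\<^bsub>B\<^esub> \<in> star_generate B V" by (intro star_generate.intros)
    then show ?case by (simp only: B.combination_def B.finsum_empty B.smult_zero_left B.one_closed)
  next
    case (insert g I)
    then have "(\<lambda>g. crd a g \<odot>\<^bsub>B\<^esub> \<delta> g) \<in> I \<rightarrow> carrier B"
      using B.smult_closed \<delta>_closed by blast
    then have "B.combination (insert g I) \<delta> (crd a) = crd a g \<odot>\<^bsub>B\<^esub> \<delta> g \<oplus>\<^bsub>B\<^esub> B.combination I \<delta> (crd a)"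
      using insert B.smult_closed[OF \<delta>_closed] unfolding B.combination_def
      by (intro B.finsum_insert) auto
    moreover have "crd a g \<odot>\<^bsub>B\<^esub> \<delta> g \<oplus>\<^bsub>B\<^esub> B.combination I \<delta> (crd a) \<in> star_generate B V"
      using insert \<delta> by (intro star_generate.add star_generate.smult) auto
    ultimately show ?case by (simp only:)
  qed
  from this[OF fin order_refl] show "a \<in> star_generate B V"
    using eq_combination[OF a] by simp
qed

lemma generate_eq: "star_generate B V = carrier B"
  using generated B.star_generate_closed[of V] v_closed by blast

lemma V_subset: "V \<subseteq> carrier B"
  using v_closed by blast

lemma cstar_generated: "cstar_generated_by B V"
  unfolding cstar_generated_by_def
proof (intro conjI ballI allI impI)
  show "V \<subseteq> carrier B" by (rule V_subset)
  fix a and e :: real assume a: "a \<in> carrier B" and e: "e > 0"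
  interpret seminormed_star_algebra B "cnorm B" by unfold_locales (rule B_cstar_seminorm)
  have "cnorm B (a \<ominus>\<^bsub>B\<^esub> a) = 0" using a by (simp add: B.minus_eq B.r_neg del: B_simps)
  then show "\<exists>b\<in>star_generate B V. cnorm B (a \<ominus>\<^bsub>B\<^esub> b) < e"
    unfolding generate_eq using a e by (intro bexI[of _ a]) auto
qed

text \<open>The generated *-algebra is already all of \<open>B\<close>, so the competing seminorms
  live on a C*-algebra and are dominated by its norm.\<close>

lemma enveloping: "enveloping_of B V"
  unfolding enveloping_of_def
proof (intro conjI allI impI ballI)
  show "cstar_generated_by B V" by (rule cstar_generated)
  fix p a assume p: "cstar_seminorm (B\<lparr>carrier := star_generate B V\<rparr>) p" and a: "a \<in> star_generate B V"
  interpret cstar_algebra B by (rule B_cstar_algebra)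
  have "cstar_seminorm B p"
    using p unfolding generate_eq cstar_seminorm_def by simp
  then show "p a \<le> cnorm B a"
    using a unfolding generate_eq by (rule cstar_seminorm_le_norm)
qed

lemma counit_B: "counit B v (\<lambda>a. crd a id)"
  unfolding counit_def
proof (intro conjI allI)
  show "(\<lambda>a. crd a id) \<in> star_hom B complex_cstar"
    by (rule star_homI) (auto simp: id_mem)
qed (auto simp: crd_v id_mem)

text \<open>This is composition with inversion in the group; since functions commute, the reversed
  product of the opposite algebra causes no conflict.\<close>

lemma antipode_B: "antipode B v (\<lambda>a. \<iota> (\<lambda>g. if g \<in> S then crd a (inv_into UNIV g) else 0))"
  unfolding antipode_def
proof (intro conjI allI)
  show "(\<lambda>a. \<iota> (\<lambda>g. if g \<in> S then crd a (inv_into UNIV g) else 0)) \<in> star_hom B (opposite B)"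
    by (rule star_homI) (auto simp: opposite_def funs_def fun_eq_iff inv_mem)
  fix i j
  have "inv_into UNIV g j = i \<longleftrightarrow> g i = j" if "g \<in> S" for g
    using bij[OF that] by (metis bij_inv_eq_iff)
  then show "\<iota> (\<lambda>g. if g \<in> S then crd (v i j) (inv_into UNIV g) else 0) = v j i"
    using inv_mem by (auto simp: v_def fun_eq_iff)
qed

text \<open>Both orders of the factors are expanded over the tensors of two point masses g and h.
  The coefficients test g (h j) = i and h (g j) = i, so invariance under the flip becomes
  commutativity of the group. A general homomorphism \<rho> is allowed since this is applied both to
  \<open>B\<close> itself and to its quotient \<open>A\<close>.\<close>

lemma coproduct_eq:
  assumes A: "cstar_algebra A" and \<rho>: "\<rho> \<in> star_hom B A"
  shows "(\<Oplus>\<^bsub>tensor A A\<^esub>k\<in>UNIV. elem_tensor A A (\<rho> (v i k)) (\<rho> (v k j)))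
      = star_algebra.combination (tensor A A) (S \<times> S) (\<lambda>z. elem_tensor A A (\<rho> (\<delta> (fst z))) (\<rho> (\<delta> (snd z))))
          (\<lambda>z. if fst z (snd z j) = i then 1 else 0)" (is ?one)
    and "(\<Oplus>\<^bsub>tensor A A\<^esub>k\<in>UNIV. elem_tensor A A (\<rho> (v k j)) (\<rho> (v i k)))
      = star_algebra.combination (tensor A A) (S \<times> S) (\<lambda>z. elem_tensor A A (\<rho> (\<delta> (fst z))) (\<rho> (\<delta> (snd z))))
          (\<lambda>z. if snd z (fst z j) = i then 1 else 0)" (is ?two)
proof -
  interpret A: cstar_algebra A by fact
  interpret T: cstar_tensor A A ..
  let ?E = "\<lambda>z. elem_tensor A A (\<rho> (\<delta> (fst z))) (\<rho> (\<delta> (snd z)))"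
  have \<rho>\<delta>: "\<rho> (\<delta> g) \<in> carrier A" if "g \<in> S" for g by (rule star_homD(1)[OF \<rho> \<delta>_closed[OF that]])
  then have E: "?E z \<in> carrier (tensor A A)" if "z \<in> S \<times> S" for z using that by auto
  have SS: "finite (S \<times> S)" using fin by simp
  have elem: "elem_tensor A A (\<rho> a) (\<rho> b) = T.T.combination (S \<times> S) ?E (\<lambda>z. crd a (fst z) * crd b (snd z))"
    if "a \<in> carrier B" "b \<in> carrier B" for a b
    unfolding hom_eq_combination[OF A.star_algebra_axioms \<rho> that(1)]
      hom_eq_combination[OF A.star_algebra_axioms \<rho> that(2)]
    by (rule T.elem_tensor_combination) (use fin \<rho>\<delta> in auto)
  have "(\<Oplus>\<^bsub>tensor A A\<^esub>k\<in>UNIV. elem_tensor A A (\<rho> (v i k)) (\<rho> (v k j)))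
      = T.T.combination (S \<times> S) ?E (\<lambda>z. \<Sum>k\<in>UNIV. crd (v i k) (fst z) * crd (v k j) (snd z))"
    unfolding elem[OF v_closed v_closed] by (rule T.T.combination_sum[symmetric]) (use SS E in auto)
  also have "\<dots> = T.T.combination (S \<times> S) ?E (\<lambda>z. if fst z (snd z j) = i then 1 else 0)"
  proof (rule T.T.combination_cong[OF E])
    fix z assume z: "z \<in> S \<times> S"
    have "(\<Sum>k\<in>UNIV. crd (v i k) (fst z) * crd (v k j) (snd z))
        = (\<Sum>k\<in>UNIV. if k = snd z j then (if fst z k = i then 1 else 0) else 0)"
      by (rule sum.cong) (use z in \<open>auto simp: crd_v\<close>)
    then show "(\<Sum>k\<in>UNIV. crd (v i k) (fst z) * crd (v k j) (snd z)) = (if fst z (snd z j) = i then 1 else 0)"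
      by simp
  qed
  finally show ?one .
  have "(\<Oplus>\<^bsub>tensor A A\<^esub>k\<in>UNIV. elem_tensor A A (\<rho> (v k j)) (\<rho> (v i k)))
      = T.T.combination (S \<times> S) ?E (\<lambda>z. \<Sum>k\<in>UNIV. crd (v k j) (fst z) * crd (v i k) (snd z))"
    unfolding elem[OF v_closed v_closed] by (rule T.T.combination_sum[symmetric]) (use SS E in auto)
  also have "\<dots> = T.T.combination (S \<times> S) ?E (\<lambda>z. if snd z (fst z j) = i then 1 else 0)"
  proof (rule T.T.combination_cong[OF E])
    fix z assume z: "z \<in> S \<times> S"
    have "(\<Sum>k\<in>UNIV. crd (v k j) (fst z) * crd (v i k) (snd z))
        = (\<Sum>k\<in>UNIV. if k = fst z j then (if snd z k = i then 1 else 0) else 0)"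
      by (rule sum.cong) (use z in \<open>auto simp: crd_v\<close>)
    then show "(\<Sum>k\<in>UNIV. crd (v k j) (fst z) * crd (v i k) (snd z)) = (if snd z (fst z j) = i then 1 else 0)"
      by simp
  qed
  finally show ?two .
qed

lemma comultiplication_B: "\<exists>\<Delta>. comultiplication B v \<Delta>"
proof -
  interpret B': cstar_algebra B by (rule B_cstar_algebra)
  interpret T: cstar_tensor B B ..
  let ?E = "\<lambda>z. elem_tensor B B (\<delta> (fst z)) (\<delta> (snd z))"
  \<comment> \<open>The function (g, h) \<mapsto> a (g h), expanded over tensors of point masses;
    these are orthogonal projections, so the rules for \<open>combination\<close> apply.\<close>
  define \<Delta> where "\<Delta> a = T.T.combination (S \<times> S) ?E (\<lambda>z. crd a (fst z \<circ> snd z))" for a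
  have SS: "finite (S \<times> S)" using fin by simp
  have E: "?E z \<in> carrier (tensor B B)" if "z \<in> S \<times> S" for z
    using that by (intro T.elem_tensor_closed \<delta>_closed) auto
  have orth: "?E z \<otimes>\<^bsub>tensor B B\<^esub> ?E z' = \<zero>\<^bsub>tensor B B\<^esub>"
    if "z \<in> S \<times> S" "z' \<in> S \<times> S" "z \<noteq> z'" for z z'
  proof -
    have S: "fst z \<in> S" "snd z \<in> S" "fst z' \<in> S" "snd z' \<in> S" using that by auto
    have "?E z \<otimes>\<^bsub>tensor B B\<^esub> ?E z' = elem_tensor B B (\<delta> (fst z) \<otimes>\<^bsub>B\<^esub> \<delta> (fst z')) (\<delta> (snd z) \<otimes>\<^bsub>B\<^esub> \<delta> (snd z'))"
      by (intro T.elem_tensor_simps(5) \<delta>_closed S)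
    moreover have "fst z \<noteq> fst z' \<or> snd z \<noteq> snd z'" using that(3) by (simp add: prod_eq_iff)
    moreover have "\<delta> (fst z) \<otimes>\<^bsub>B\<^esub> \<delta> (fst z') \<in> carrier B" "\<delta> (snd z) \<otimes>\<^bsub>B\<^esub> \<delta> (snd z') \<in> carrier B"
      by (intro B.m_closed \<delta>_closed S)+
    ultimately show ?thesis
      using \<delta>_projections(2) T.elem_tensor_zero_left T.elem_tensor_zero_right by metis
  qed
  have idem: "?E z \<otimes>\<^bsub>tensor B B\<^esub> ?E z = ?E z" if "z \<in> S \<times> S" for z
  proof -
    have "fst z \<in> S" "snd z \<in> S" using that by auto
    then have "?E z \<otimes>\<^bsub>tensor B B\<^esub> ?E z = elem_tensor B B (\<delta> (fst z) \<otimes>\<^bsub>B\<^esub> \<delta> (fst z)) (\<delta> (snd z) \<otimes>\<^bsub>B\<^esub> \<delta> (snd z))"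
      by (intro T.elem_tensor_simps(5) \<delta>_closed)
    then show ?thesis unfolding \<delta>_projections(1) .
  qed
  have sa: "star (tensor B B) (?E z) = ?E z" if "z \<in> S \<times> S" for z
  proof -
    have "fst z \<in> S" "snd z \<in> S" using that by auto
    then have "star (tensor B B) (?E z) = elem_tensor B B (star B (\<delta> (fst z))) (star B (\<delta> (snd z)))"
      by (intro T.elem_tensor_simps(6) \<delta>_closed)
    then show ?thesis unfolding \<delta>_projections(3) .
  qed
  have one: "T.T.combination (S \<times> S) ?E (\<lambda>z. 1) = \<one>\<^bsub>tensor B B\<^esub>"
  proof -
    have "B.combination S \<delta> (\<lambda>_. 1) = \<one>\<^bsub>B\<^esub>" by (simp add: combination_\<delta>)
    then have "elem_tensor B B \<one>\<^bsub>B\<^esub> \<one>\<^bsub>B\<^esub> = T.T.combination (S \<times> S) ?E (\<lambda>z. 1 * 1)"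
      using T.elem_tensor_combination[where e = \<delta> and f = \<delta> and c = "\<lambda>_. 1" and d = "\<lambda>_. 1",
          OF fin \<delta>_closed fin \<delta>_closed] by (simp only:)
    then show ?thesis using T.elem_tensor_simps(7)[OF B.one_closed B.one_closed] by (simp del: B_simps)
  qed
  have "\<Delta> \<in> star_hom B (tensor B B)"
  proof (rule star_homI)
    fix a b assume a: "a \<in> carrier B" and b: "b \<in> carrier B"
    show "\<Delta> a \<in> carrier (tensor B B)"
      unfolding \<Delta>_def by (rule T.T.combination_closed[OF E])
    show "\<Delta> (a \<otimes>\<^bsub>B\<^esub> b) = \<Delta> a \<otimes>\<^bsub>tensor B B\<^esub> \<Delta> b"
    proof -
      have "T.T.combination (S \<times> S) ?E (\<lambda>z. crd a (fst z \<circ> snd z) * crd b (fst z \<circ> snd z)) = \<Delta> a \<otimes>\<^bsub>tensor B B\<^esub> \<Delta> b"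
        unfolding \<Delta>_def by (rule T.T.mult_combination) (use SS E idem orth in blast)+
      then show ?thesis by (simp add: \<Delta>_def[of "\<iota> _"])
    qed
    show "\<Delta> (a \<oplus>\<^bsub>B\<^esub> b) = \<Delta> a \<oplus>\<^bsub>tensor B B\<^esub> \<Delta> b"
    proof -
      have "T.T.combination (S \<times> S) ?E (\<lambda>z. crd a (fst z \<circ> snd z) + crd b (fst z \<circ> snd z)) = \<Delta> a \<oplus>\<^bsub>tensor B B\<^esub> \<Delta> b"
        unfolding \<Delta>_def by (rule T.T.combination_add) (use SS E in blast)+
      then show ?thesis by (simp add: \<Delta>_def[of "\<iota> _"])
    qed
    show "\<Delta> (c \<odot>\<^bsub>B\<^esub> a) = c \<odot>\<^bsub>tensor B B\<^esub> \<Delta> a" for c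
    proof -
      have "T.T.combination (S \<times> S) ?E (\<lambda>z. c * crd a (fst z \<circ> snd z)) = c \<odot>\<^bsub>tensor B B\<^esub> \<Delta> a"
        unfolding \<Delta>_def by (rule T.T.smult_combination) (use SS E in blast)+
      then show ?thesis by (simp add: \<Delta>_def[of "\<iota> _"])
    qed
    show "\<Delta> (star B a) = star (tensor B B) (\<Delta> a)"
    proof -
      have "T.T.combination (S \<times> S) ?E (\<lambda>z. cnj (crd a (fst z \<circ> snd z))) = star (tensor B B) (\<Delta> a)"
        unfolding \<Delta>_def by (rule T.T.star_combination) (use SS E sa in blast)+
      then show ?thesis by (simp add: \<Delta>_def[of "\<iota> _"])
    qed
  next
    show "\<Delta> \<one>\<^bsub>B\<^esub> = \<one>\<^bsub>tensor B B\<^esub>"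
      unfolding \<Delta>_def one[symmetric] by (rule T.T.combination_cong[OF E]) (auto simp: comp_mem)
  qed
  moreover have "\<Delta> (v i j) = (\<Oplus>\<^bsub>tensor B B\<^esub>k\<in>UNIV. elem_tensor B B (v i k) (v k j))" for i j
  proof -
    have "(\<lambda>x. x) \<in> star_hom B B" by (rule star_homI) simp_all
    from coproduct_eq(1)[OF B_cstar_algebra this, of i j]
    show ?thesis
      unfolding \<Delta>_def by (auto simp: crd_v comp_mem intro!: T.T.combination_cong[OF E])
  qed
  ultimately show ?thesis unfolding comultiplication_def by blast
qed

theorem quantum_permutation_algebra_B: "quantum_permutation_algebra B v"
  unfolding quantum_permutation_algebra_def
  using B_cstar_algebra magic_v cstar_generated enveloping comultiplication_B counit_B antipode_B
  by blast

end

section \<open>Orthogonal decompositions and magic partitions\<close>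

text \<open>Closure under differences is what uniqueness uses: the difference of two candidates is
  orthogonal to itself. In this form the rule also covers \<open>sum_subspaces\<close>.\<close>

lemma orth_proj_eqI:
  fixes X :: "'h::chilbert_space set"
  assumes diff: "\<And>x y. x \<in> X \<Longrightarrow> y \<in> X \<Longrightarrow> x - y \<in> X"
    and y: "y \<in> X" and orth: "\<And>z. z \<in> X \<Longrightarrow> cinner (h - y) z = 0"
  shows "orth_proj X h = y"
  unfolding orth_proj_def
proof (rule the_equality)
  fix y' assume y': "y' \<in> X \<and> (\<forall>z\<in>X. cinner (h - y') z = 0)"
  have "y' - y \<in> X" using diff y y' by blast
  then have "cinner (h - y) (y' - y) = 0" "cinner (h - y') (y' - y) = 0" using orth y' by auto
  then have "cinner (y' - y) (y' - y) = 0" by (simp add: cinner_diff_left)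
  then show "y' = y" by simp
qed (use y orth in blast)

lemma closed_csubspace_diff:
  "closed_csubspace X \<Longrightarrow> x \<in> X \<Longrightarrow> y \<in> X \<Longrightarrow> x - y \<in> X"
  unfolding closed_csubspace_def by (metis scaleC_minus_one diff_conv_add_uminus)

section \<open>Projections of a finite orthogonal decomposition\<close>

locale decomposition =
  fixes I :: "'k set" and Y :: "'k \<Rightarrow> 'h::chilbert_space set"
  assumes decomposition: "orthogonal_decomposition I Y" and finite: "finite I"
begin

lemma subspace: "k \<in> I \<Longrightarrow> closed_csubspace (Y k)"
  using decomposition by (auto simp: orthogonal_decomposition_def orthogonal_family_def)

lemma orthogonal: "k \<in> I \<Longrightarrow> l \<in> I \<Longrightarrow> k \<noteq> l \<Longrightarrow> x \<in> Y k \<Longrightarrow> y \<in> Y l \<Longrightarrow> cinner x y = 0"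
  using decomposition by (auto simp: orthogonal_decomposition_def orthogonal_family_def)

lemma components: "\<exists>f. (\<forall>k\<in>I. f k \<in> Y k) \<and> h = (\<Sum>k\<in>I. f k)"
proof -
  have "h \<in> sum_subspaces I Y" using decomposition by (simp add: orthogonal_decomposition_def)
  then show ?thesis by (auto simp: sum_subspaces_def)
qed

lemma cinner_component:
  assumes f: "\<And>k. k \<in> I \<Longrightarrow> f k \<in> Y k" and k: "k \<in> I" and z: "z \<in> Y k"
  shows "cinner (\<Sum>k\<in>I. f k) z = cinner (f k) z"
proof -
  have "cinner (\<Sum>k\<in>I. f k) z = (\<Sum>l\<in>I. if l = k then cinner (f k) z else 0)"
    unfolding cinner_sum_left by (rule sum.cong) (use f k z orthogonal in auto)
  then show ?thesis using finite k by simp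
qed

lemma orth_proj_component:
  assumes f: "\<And>k. k \<in> I \<Longrightarrow> f k \<in> Y k" and k: "k \<in> I"
  shows "orth_proj (Y k) (\<Sum>k\<in>I. f k) = f k"
  by (rule orth_proj_eqI)
     (use closed_csubspace_diff[OF subspace[OF k]] f k cinner_component[OF f k] in
       \<open>auto simp: cinner_diff_left\<close>)

lemma orth_proj_mem: "k \<in> I \<Longrightarrow> orth_proj (Y k) h \<in> Y k"
  using components[of h] orth_proj_component by metis

lemma sum_orth_proj: "(\<Sum>k\<in>I. orth_proj (Y k) h) = h"
proof -
  obtain f where f: "\<And>k. k \<in> I \<Longrightarrow> f k \<in> Y k" "h = (\<Sum>k\<in>I. f k)" using components[of h] by blast
  then show ?thesis using orth_proj_component[OF f(1)] by simp
qed

lemma orth_proj_fix: "k \<in> I \<Longrightarrow> x \<in> Y k \<Longrightarrow> orth_proj (Y k) x = x"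
  by (rule orth_proj_eqI) (auto intro: closed_csubspace_diff[OF subspace])

lemma orth_proj_other: "k \<in> I \<Longrightarrow> l \<in> I \<Longrightarrow> k \<noteq> l \<Longrightarrow> x \<in> Y l \<Longrightarrow> orth_proj (Y k) x = 0"
  by (rule orth_proj_eqI)
     (use orthogonal subspace in \<open>auto intro: closed_csubspace_diff[OF subspace] simp: closed_csubspace_def\<close>)

text \<open>Both sides equal the inner product of the two projected vectors.\<close>

lemma cinner_orth_proj:
  assumes k: "k \<in> I" shows "cinner (orth_proj (Y k) x) y = cinner x (orth_proj (Y k) y)"
proof -
  let ?P = "orth_proj (Y k)"
  have 1: "cinner h z = cinner (?P h) z" if "z \<in> Y k" for h z
    using cinner_component[of "\<lambda>k. orth_proj (Y k) h", OF orth_proj_mem k that] sum_orth_proj[of h] by simp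
  have "cinner (?P x) y = cnj (cinner y (?P x))" by (rule cinner_commute)
  also have "\<dots> = cnj (cinner (?P y) (?P x))" using 1[OF orth_proj_mem[OF k]] by simp
  also have "\<dots> = cinner (?P x) (?P y)" by (rule cinner_commute[symmetric])
  also have "\<dots> = cinner x (?P y)" using 1[OF orth_proj_mem[OF k]] by simp
  finally show ?thesis .
qed

lemma orth_proj_operator:
  assumes k: "k \<in> I" shows "orth_proj (Y k) \<in> carrier bounded_operators"
proof -
  let ?P = "orth_proj (Y k)"
  have add: "?P (x + y) = ?P x + ?P y" for x y
    by (rule cinner_ext) (simp add: cinner_orth_proj[OF k] cinner_add_left)
  have scale: "?P (scaleC c x) = scaleC c (?P x)" for c x
    by (rule cinner_ext) (simp add: cinner_orth_proj[OF k] cinner_scaleC_left)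
  have "norm (?P x) \<le> norm x * 1" for x
  proof (cases "norm (?P x) = 0")
    case False
    have "(norm (?P x))\<^sup>2 = Re (cinner x (?P (?P x)))"
      using cinner_orth_proj[OF k, of x "?P x"] by (metis Re_cinner_self)
    also have "\<dots> = Re (cinner x (?P x))" using orth_proj_fix[OF k orth_proj_mem[OF k]] by simp
    also have "\<dots> \<le> norm x * norm (?P x)"
      using cmod_cinner_le complex_Re_le_cmod order_trans by blast
    finally show ?thesis using False by (simp add: power2_eq_square mult_le_cancel_right)
  qed simp
  then have "bounded_linear ?P"
    by (intro bounded_linear_intro[where K = 1]) (auto simp: add scale scaleR_scaleC)
  then show ?thesis using scale by (simp add: carrier_bounded_operators)
qed

lemma star_orth_proj: "k \<in> I \<Longrightarrow> star bounded_operators (orth_proj (Y k)) = orth_proj (Y k)"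
  by (rule star_bounded_operators_unique) (auto simp: orth_proj_operator cinner_orth_proj)

lemma orth_proj_mult:
  "k \<in> I \<Longrightarrow> orth_proj (Y k) \<circ> orth_proj (Y k) = orth_proj (Y k)"
  "k \<in> I \<Longrightarrow> l \<in> I \<Longrightarrow> k \<noteq> l \<Longrightarrow> orth_proj (Y k) \<circ> orth_proj (Y l) = (\<lambda>_. 0)"
  using orth_proj_fix orth_proj_other orth_proj_mem by (auto simp: fun_eq_iff)

text \<open>What is left of \<open>h\<close> is the sum of its components outside \<open>J\<close>,
  each orthogonal to every summand indexed by \<open>J\<close>.\<close>

lemma orth_proj_sum_subspaces:
  assumes J: "J \<subseteq> I"
  shows "orth_proj (sum_subspaces J Y) h = (\<Sum>k\<in>J. orth_proj (Y k) h)"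
proof (rule orth_proj_eqI)
  show "(\<Sum>k\<in>J. orth_proj (Y k) h) \<in> sum_subspaces J Y"
    using orth_proj_mem J by (auto simp: sum_subspaces_def)
  fix x y assume "x \<in> sum_subspaces J Y" "y \<in> sum_subspaces J Y"
  then obtain f g where fg: "\<forall>k\<in>J. f k \<in> Y k" "\<forall>k\<in>J. g k \<in> Y k" "x = (\<Sum>k\<in>J. f k)" "y = (\<Sum>k\<in>J. g k)"
    by (auto simp: sum_subspaces_def)
  have "x - y = (\<Sum>k\<in>J. f k - g k)" using fg by (simp add: sum_subtractf)
  moreover have "\<forall>k\<in>J. f k - g k \<in> Y k" using fg closed_csubspace_diff subspace J by blast
  ultimately show "x - y \<in> sum_subspaces J Y" by (auto simp: sum_subspaces_def)
next
  fix z assume "z \<in> sum_subspaces J Y"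
  then obtain f where f: "\<And>k. k \<in> J \<Longrightarrow> f k \<in> Y k" "z = (\<Sum>k\<in>J. f k)"
    by (auto simp: sum_subspaces_def)
  have "finite J" using J finite finite_subset by blast
  have "h - (\<Sum>k\<in>J. orth_proj (Y k) h) = (\<Sum>k\<in>I - J. orth_proj (Y k) h)"
    using sum.subset_diff[OF J finite, of "\<lambda>k. orth_proj (Y k) h"]
    unfolding sum_orth_proj by (metis add_diff_cancel)
  moreover have "cinner (orth_proj (Y l) h) (f k) = 0" if "l \<in> I - J" "k \<in> J" for l k
    by (rule orthogonal[of l k]) (use that f J orth_proj_mem in auto)
  ultimately show "cinner (h - (\<Sum>k\<in>J. orth_proj (Y k) h)) z = 0"
    by (simp add: f(2) cinner_sum_left cinner_sum_right)
qed

end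

lemma sum_subspaces_singleton [simp]: "sum_subspaces {k} Y = Y k"
  by (auto simp: sum_subspaces_def intro: exI[of _ "\<lambda>_. _"])

lemma magic_decompositionD:
  assumes "magic_decomposition X"
  shows "decomposition UNIV (X i)" "decomposition UNIV (\<lambda>i. X i j)"
  using assms by (simp_all add: magic_decomposition_def decomposition_def)

section \<open>The permutation group of a magic partition\<close>

lemma carrier_BijGroup_UNIV: "carrier (BijGroup UNIV) = {f. bij f}"
  by (auto simp: BijGroup_def Bij_def)

lemma mult_BijGroup_UNIV:
  "bij f \<Longrightarrow> bij g \<Longrightarrow> f \<otimes>\<^bsub>BijGroup UNIV\<^esub> g = f \<circ> g"
  by (auto simp: BijGroup_def Bij_def compose_def)

lemma one_BijGroup_UNIV: "\<one>\<^bsub>BijGroup UNIV\<^esub> = id"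
  by (auto simp: BijGroup_def id_def)

text \<open>Column \<open>j\<close> is a partition, so exactly one \<open>i\<close> qualifies and
  the definite description is meaningful.\<close>

lemma partition_perm_eq_iff:
  assumes "magic_partition N E" "k \<in> {1..N}"
  shows "partition_perm E k j = i \<longleftrightarrow> k \<in> E i j"
proof -
  from assms have "disjoint_family (\<lambda>i. E i j)" "k \<in> (\<Union>i. E i j)"
    by (auto simp: magic_partition_def set_partition_def)
  then have "\<exists>!i. k \<in> E i j" unfolding disjoint_family_on_def by blast
  then show ?thesis unfolding partition_perm_def using theI'[OF \<open>\<exists>!i. k \<in> E i j\<close>] the1_equality[OF \<open>\<exists>!i. k \<in> E i j\<close>] by blast
qed

text \<open>The rows cover \<open>{1..N}\<close>, which is surjectivity; on a finite type this gives
  injectivity.\<close>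

lemma bij_partition_perm:
  fixes E :: "'n::finite \<Rightarrow> 'n \<Rightarrow> nat set"
  assumes "magic_partition N E" "k \<in> {1..N}"
  shows "bij (partition_perm E k)"
proof -
  have "surj (partition_perm E k)"
    unfolding surj_def
  proof
    fix i
    have "k \<in> (\<Union>j. E i j)" using assms by (auto simp: magic_partition_def set_partition_def)
    then obtain j where "k \<in> E i j" by blast
    then have "i = partition_perm E k j" using partition_perm_eq_iff[OF assms, of j i] by simp
    then show "\<exists>j. i = partition_perm E k j" by (rule exI)
  qed
  then show ?thesis by (simp add: bij_def finite_UNIV_surj_inj)
qed

text \<open>Whatever commutes with the generators commutes with everything they generate. This is
  used twice: for a generator against \<open>y\<close>, and then for \<open>y\<close> against
  \<open>x\<close>.\<close>

lemma (in group) generate_commute: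
  assumes H: "H \<subseteq> carrier G" and comm: "\<And>x y. x \<in> H \<Longrightarrow> y \<in> H \<Longrightarrow> x \<otimes> y = y \<otimes> x"
    and x: "x \<in> generate G H" and y: "y \<in> generate G H"
  shows "x \<otimes> y = y \<otimes> x"
proof -
  have cl: "z \<in> carrier G" if "z \<in> generate G H" for z
    using generate_in_carrier[OF H that] .
  have inverse: "a \<otimes> inv b = inv b \<otimes> a" if "a \<in> carrier G" "b \<in> carrier G" "a \<otimes> b = b \<otimes> a" for a b
    using that by (metis inv_closed inv_solve_left inv_solve_right m_assoc m_closed)
  have step: "a \<otimes> z = z \<otimes> a" if a: "a \<in> carrier G" and z: "z \<in> generate G H"
    and H': "\<And>b. b \<in> H \<Longrightarrow> a \<otimes> b = b \<otimes> a" for a z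
    using z
  proof induction
    case (eng h1 h2)
    then show ?case using a cl by (metis m_assoc)
  qed (use a H H' inverse in \<open>auto simp: subset_eq\<close>)
  have "b \<otimes> y = y \<otimes> b" if "b \<in> H" for b
    by (rule step[OF _ y]) (use that H comm in auto)
  then show ?thesis
    using step[OF cl[OF y] x] by metis
qed

section \<open>Abelian magic partitions give cocommutative algebras\<close>

lemma abelian_magic_partition_cocommutative:
  fixes X :: "'n::finite \<Rightarrow> 'n \<Rightarrow> 'h::chilbert_space set" and A :: "'a cstar" and u :: "'n \<Rightarrow> 'n \<Rightarrow> 'a"
  assumes assoc: "associated_algebra X A u"
    and Y: "orthogonal_decomposition {1..N} Y" and E: "abelian_magic_partition N E"
    and X: "\<And>i j. X i j = sum_subspaces (E i j) Y"
  shows "cocommutative A u"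
proof -
  interpret Y: decomposition "{1..N}" Y using Y by unfold_locales auto
  obtain \<pi> where \<pi>: "\<pi> \<in> star_hom A\<^sub>s bounded_operators" "\<And>i j. \<pi> (A\<^sub>s_gen i j) = orth_proj (X i j)"
    and hopf: "hopf_image \<pi> A u"
    using assoc unfolding associated_algebra_def by blast
  have Aq: "quantum_permutation_algebra A u" using hopf by (simp add: hopf_image_def)
  interpret A: cstar_algebra A using Aq by (simp add: quantum_permutation_algebra_def)
  obtain \<epsilon> where \<epsilon>: "\<epsilon> \<in> star_hom A complex_cstar"
    using Aq unfolding quantum_permutation_algebra_def counit_def by blast
  obtain \<Delta> where \<Delta>: "\<Delta> \<in> star_hom A (tensor A A)"
    and \<Delta>u: "\<And>i j. \<Delta> (u i j) = (\<Oplus>\<^bsub>tensor A A\<^esub>k\<in>UNIV. elem_tensor A A (u i k) (u k j))"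
    using Aq unfolding quantum_permutation_algebra_def comultiplication_def by blast
  have mp: "magic_partition N E" using E by (simp add: abelian_magic_partition_def)
  let ?\<sigma> = "partition_perm E"
  define S where "S = carrier (partition_group N E)"
  interpret Sym: group "BijGroup (UNIV :: 'n set)" by (rule group_BijGroup)
  have PG: "partition_group N E = subgroup_generated (BijGroup UNIV) (?\<sigma> ` {1..N})"
    by (simp add: partition_group_def)
  have S_sub: "S \<subseteq> carrier (BijGroup UNIV)"
    unfolding S_def PG by (rule Sym.carrier_subgroup_generated_subset)
  then have S_bij: "bij g" if "g \<in> S" for g using that by (auto simp: carrier_BijGroup_UNIV)
  interpret PG: group "partition_group N E" unfolding PG by simp
  have \<sigma>_S: "?\<sigma> k \<in> S" if "k \<in> {1..N}" for k
    unfolding S_def PG carrier_subgroup_generated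
    by (rule generate.incl) (use that bij_partition_perm[OF mp] in \<open>auto simp: carrier_BijGroup_UNIV\<close>)
  have mult: "g \<otimes>\<^bsub>partition_group N E\<^esub> h = g \<circ> h" if "g \<in> S" "h \<in> S" for g h
    using that S_bij by (simp add: PG mult_BijGroup_UNIV)
  have one: "\<one>\<^bsub>partition_group N E\<^esub> = id" by (simp add: PG one_BijGroup_UNIV)
  have comp: "g \<circ> h \<in> S" if "g \<in> S" "h \<in> S" for g h
    using PG.m_closed[of g h] mult[OF that] that by (simp add: S_def)
  have comm: "g \<circ> h = h \<circ> g" if "g \<in> S" "h \<in> S" for g h
  proof -
    have "comm_group (partition_group N E)" using E by (simp add: abelian_magic_partition_def)
    then have "g \<otimes>\<^bsub>partition_group N E\<^esub> h = h \<otimes>\<^bsub>partition_group N E\<^esub> g"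
      using that unfolding S_def by (rule comm_groupE(4))
    then show ?thesis using mult that by simp
  qed
  have inv: "inv_into UNIV g \<in> S" if g: "g \<in> S" for g
  proof -
    let ?h = "inv\<^bsub>partition_group N E\<^esub> g"
    have h: "?h \<in> S" using g by (simp add: S_def)
    have "?h \<circ> g = id" using PG.l_inv[of g] mult[OF h g] g one by (simp add: S_def)
    then have "?h = inv_into UNIV g"
      using S_bij[OF g] by (metis bij_is_surj comp_id fun.map_comp surj_iff id_comp)
    then show ?thesis using h by simp
  qed
  obtain \<iota>0 :: "(('n \<Rightarrow> 'n) \<Rightarrow> complex) \<Rightarrow> complex" where \<iota>0: "inj \<iota>0"
    using function_space_inj by blast
  \<comment> \<open>The scalar multiples of the unit provide enough distinct elements of type
    \<open>'a\<close>: the counit takes the value \<open>\<iota>0 f\<close> on them and so keeps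
    them apart.\<close>
  define \<iota> where "\<iota> f = \<iota>0 f \<odot>\<^bsub>A\<^esub> \<one>\<^bsub>A\<^esub>" for f
  have "\<epsilon> (\<iota> f) = \<iota>0 f" for f
    using star_homD[OF \<epsilon>] by (simp add: \<iota>_def)
  then have \<iota>: "inj \<iota>" using \<iota>0 by (metis injD injI)
  interpret P: permutation_functions \<iota> S
  proof
    show "inj \<iota>" by (rule \<iota>)
    show "finite S" by simp
    show "id \<in> S" using PG.one_closed one by (simp add: S_def)
    then show "S \<noteq> {}" by blast
  qed (use S_bij comp inv in auto)
  have "realizes_factorization \<pi> P.B P.v"
  proof -
    have "\<forall>g. \<exists>\<eta>. g \<in> S \<longrightarrow> \<eta> \<in> star_hom A\<^sub>s complex_cstar \<and> (\<forall>i j. \<eta> (A\<^sub>s_gen i j) = (if g j = i then 1 else 0))"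
      using A\<^sub>s_character S_bij by blast
    then obtain \<eta> where \<eta>: "\<And>g. g \<in> S \<Longrightarrow> \<eta> g \<in> star_hom A\<^sub>s complex_cstar"
      and \<eta>_gen: "\<And>g i j. g \<in> S \<Longrightarrow> \<eta> g (A\<^sub>s_gen i j) = (if g j = i then 1 else 0)"
      by metis
    \<comment> \<open>An element of \<open>A\<^sub>s\<close> becomes the function whose value at
      \<open>g\<close> is the character of \<open>g\<close>; on generators this is the classical
      magic unitary \<open>P.v\<close>.\<close>
    define \<phi> where "\<phi> z = \<iota> (\<lambda>g. if g \<in> S then \<eta> g z else 0)" for z
    have \<phi>: "\<phi> \<in> star_hom A\<^sub>s P.B"
      by (rule star_homI) (use star_homD[OF \<eta>] in \<open>auto simp: \<phi>_def P.funs_def fun_eq_iff\<close>)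
    have \<phi>_gen: "\<phi> (A\<^sub>s_gen i j) = P.v i j" for i j
      unfolding \<phi>_def P.v_def by (auto simp: \<eta>_gen fun_eq_iff)
    interpret BO: star_algebra "bounded_operators :: ('h \<Rightarrow> 'h) cstar"
      by (rule bounded_operators_star_algebra)
    let ?Q = "\<lambda>k. orth_proj (Y k)"
    \<comment> \<open>A function \<open>b\<close> acts on the summand \<open>Y k\<close> as
      multiplication by its value at the permutation of \<open>k\<close>. So \<open>P.v i j\<close>
      acts as the projection onto the sum of the \<open>Y k\<close> with \<open>k\<close> in
      \<open>E i j\<close>, which is \<open>X i j\<close>.\<close>
    define \<psi> where "\<psi> b = BO.combination {1..N} ?Q (\<lambda>k. P.crd b (?\<sigma> k))" for b
    have apply_comb: "BO.combination {1..N} ?Q c x = (\<Sum>k\<in>{1..N}. scaleC (c k) (?Q k x))" for c x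
      unfolding BO.combination_def
      by (subst finsum_bounded_operators)
         (use bounded_operators_closed(3)[OF Y.orth_proj_operator] in auto)
    have \<psi>: "\<psi> \<in> star_hom P.B bounded_operators"
    proof (rule star_homI)
      fix a b
      show "\<psi> a \<in> carrier bounded_operators"
        unfolding \<psi>_def by (rule BO.combination_closed[OF Y.orth_proj_operator])
      have "BO.combination {1..N} ?Q (\<lambda>k. P.crd a (?\<sigma> k) * P.crd b (?\<sigma> k)) = \<psi> a \<otimes>\<^bsub>bounded_operators\<^esub> \<psi> b"
        unfolding \<psi>_def
        by (rule BO.mult_combination)
           (use Y.orth_proj_operator Y.orth_proj_mult in \<open>simp_all del: atLeastAtMost_iff\<close>)
      then show "\<psi> (a \<otimes>\<^bsub>P.B\<^esub> b) = \<psi> a \<otimes>\<^bsub>bounded_operators\<^esub> \<psi> b"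
        by (simp add: \<psi>_def[of "\<iota> _"])
      have "BO.combination {1..N} ?Q (\<lambda>k. P.crd a (?\<sigma> k) + P.crd b (?\<sigma> k)) = \<psi> a \<oplus>\<^bsub>bounded_operators\<^esub> \<psi> b"
        unfolding \<psi>_def by (rule BO.combination_add) (use Y.orth_proj_operator in auto)
      then show "\<psi> (a \<oplus>\<^bsub>P.B\<^esub> b) = \<psi> a \<oplus>\<^bsub>bounded_operators\<^esub> \<psi> b"
        by (simp add: \<psi>_def[of "\<iota> _"])
      have "BO.combination {1..N} ?Q (\<lambda>k. c * P.crd a (?\<sigma> k)) = c \<odot>\<^bsub>bounded_operators\<^esub> \<psi> a" for c
        unfolding \<psi>_def by (rule BO.smult_combination) (use Y.orth_proj_operator in auto)
      then show "\<psi> (c \<odot>\<^bsub>P.B\<^esub> a) = c \<odot>\<^bsub>bounded_operators\<^esub> \<psi> a" for c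
        by (simp add: \<psi>_def[of "\<iota> _"])
      have "BO.combination {1..N} ?Q (\<lambda>k. cnj (P.crd a (?\<sigma> k))) = star bounded_operators (\<psi> a)"
        unfolding \<psi>_def
        by (rule BO.star_combination) (use Y.orth_proj_operator Y.star_orth_proj in auto)
      then show "\<psi> (star P.B a) = star bounded_operators (\<psi> a)"
        by (simp add: \<psi>_def[of "\<iota> _"])
    next
      show "\<psi> \<one>\<^bsub>P.B\<^esub> = \<one>\<^bsub>bounded_operators\<^esub>"
      proof
        fix x
        have "\<psi> \<one>\<^bsub>P.B\<^esub> x = (\<Sum>k\<in>{1..N}. ?Q k x)"
          unfolding \<psi>_def apply_comb by (rule sum.cong) (use \<sigma>_S in auto)
        then show "\<psi> \<one>\<^bsub>P.B\<^esub> x = \<one>\<^bsub>bounded_operators\<^esub> x"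
          using Y.sum_orth_proj by simp
      qed
    qed
    have gen: "(\<psi> \<circ> \<phi>) (A\<^sub>s_gen i j) = \<pi> (A\<^sub>s_gen i j)" for i j
    proof
      fix x
      have sub: "E i j \<subseteq> {1..N}" using mp by (auto simp: magic_partition_def set_partition_def)
      have "(\<psi> \<circ> \<phi>) (A\<^sub>s_gen i j) x = (\<Sum>k\<in>{1..N}. if k \<in> E i j then ?Q k x else 0)"
        unfolding o_apply \<phi>_gen \<psi>_def apply_comb
        by (rule sum.cong) (use \<sigma>_S partition_perm_eq_iff[OF mp] in \<open>auto simp: P.crd_v\<close>)
      also have "\<dots> = (\<Sum>k\<in>E i j. ?Q k x)"
        using sub by (simp add: sum.inter_restrict[symmetric] Int_absorb1)
      also have "\<dots> = \<pi> (A\<^sub>s_gen i j) x"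
        unfolding \<pi>(2) X using Y.orth_proj_sum_subspaces[OF sub] by simp
      finally show "(\<psi> \<circ> \<phi>) (A\<^sub>s_gen i j) x = \<pi> (A\<^sub>s_gen i j) x" .
    qed
    have "(\<psi> \<circ> \<phi>) z = \<pi> z" if "z \<in> carrier A\<^sub>s" for z
    proof (rule A\<^sub>s_hom_agree[OF bounded_operators_star_algebra _ _ star_hom_comp[OF \<phi> \<psi>] \<pi>(1) gen that])
      show "cstar_seminorm bounded_operators (cnorm bounded_operators)"
        using bounded_operators_cstar_seminorm by simp
      show "T = \<zero>\<^bsub>bounded_operators\<^esub>" if "T \<in> carrier bounded_operators" "cnorm bounded_operators T = 0"
        for T :: "'h \<Rightarrow> 'h"
        using that onorm_eq_0[of T] by (auto simp: carrier_bounded_operators fun_eq_iff)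
    qed
    then show ?thesis
      unfolding realizes_factorization_def using \<phi> \<phi>_gen \<psi> by auto
  qed
  then obtain \<rho> where \<rho>: "\<rho> \<in> star_hom P.B A" "\<rho> ` carrier P.B = carrier A" "\<And>i j. \<rho> (P.v i j) = u i j"
    using hopf P.quantum_permutation_algebra_B unfolding hopf_image_def by blast
  obtain \<tau> where \<tau>: "\<tau> \<in> star_hom (tensor A A) (tensor A A)"
    "\<And>x y. x \<in> carrier A \<Longrightarrow> y \<in> carrier A \<Longrightarrow> \<tau> (elem_tensor A A x y) = elem_tensor A A y x"
    using A.tensor_flip_ex by blast
  interpret T: cstar_tensor A A ..
  have u: "u i j \<in> carrier A" for i j
    using star_homD(1)[OF \<rho>(1) P.v_closed] by (simp add: \<rho>(3))
  have \<tau>u: "\<tau> (\<Delta> (u i j)) = \<Delta> (u i j)" for i j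
  proof -
    have "\<tau> (\<Delta> (u i j)) = (\<Oplus>\<^bsub>tensor A A\<^esub>k\<in>UNIV. \<tau> (elem_tensor A A (u i k) (u k j)))"
      unfolding \<Delta>u
      by (rule star_hom_finsum[OF T.T.star_algebra_axioms T.T.star_algebra_axioms \<tau>(1)]) (auto simp: u)
    also have "\<dots> = (\<Oplus>\<^bsub>tensor A A\<^esub>k\<in>UNIV. elem_tensor A A (u k j) (u i k))"
      by (simp add: \<tau>(2) u)
    also have "\<dots> = (\<Oplus>\<^bsub>tensor A A\<^esub>k\<in>UNIV. elem_tensor A A (u i k) (u k j))"
    proof -
      \<comment> \<open>Commutativity of the group enters here: the two expansions in
        \<open>P.coproduct_eq\<close> have the same coefficients.\<close>
      have \<rho>\<delta>: "\<rho> (P.\<delta> g) \<in> carrier A" if "g \<in> S" for g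
        by (rule star_homD(1)[OF \<rho>(1) P.\<delta>_closed[OF that]])
      have "snd z (fst z j) = fst z (snd z j)" if "z \<in> S \<times> S" for z
        using fun_cong[OF comm, of "snd z" "fst z" j] that by auto
      then have "T.T.combination (S \<times> S) (\<lambda>z. elem_tensor A A (\<rho> (P.\<delta> (fst z))) (\<rho> (P.\<delta> (snd z))))
            (\<lambda>z. if snd z (fst z j) = i then 1 else 0)
          = T.T.combination (S \<times> S) (\<lambda>z. elem_tensor A A (\<rho> (P.\<delta> (fst z))) (\<rho> (P.\<delta> (snd z))))
            (\<lambda>z. if fst z (snd z j) = i then 1 else 0)"
        by (intro T.T.combination_cong T.elem_tensor_closed \<rho>\<delta>) auto
      then show ?thesis
        using P.coproduct_eq[OF A.cstar_algebra_axioms \<rho>(1), where i = i and j = j]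
        unfolding \<rho>(3) by (simp only:)
    qed
    finally show ?thesis unfolding \<Delta>u .
  qed
  have invariant: "\<tau> (\<Delta> a) = \<Delta> a" if "a \<in> carrier A" for a
  proof -
    \<comment> \<open>Invariance is known on the \<open>u i j\<close>. It is lifted along the
      surjection \<rho> to \<open>P.B\<close>, which the \<open>P.v i j\<close> generate purely
      algebraically, so agreement on generators suffices.\<close>
    have "a \<in> \<rho> ` carrier P.B" using that by (simp only: \<rho>(2))
    then obtain b where b: "a = \<rho> b" "b \<in> carrier P.B" by (rule imageE)
    note h = star_hom_comp[OF \<rho>(1) \<Delta>]
    have "(\<tau> \<circ> (\<Delta> \<circ> \<rho>)) x = (\<Delta> \<circ> \<rho>) x" if x: "x \<in> P.V" for x
    proof -
      obtain i j where "x = P.v i j" using x by blast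
      then show ?thesis using \<tau>u[of i j] by (simp only: o_apply \<rho>(3))
    qed
    from P.B.star_hom_agree[OF star_hom_comp[OF h \<tau>(1)] h P.V_subset this]
    have "(\<tau> \<circ> (\<Delta> \<circ> \<rho>)) b = (\<Delta> \<circ> \<rho>) b"
      using b(2) by (simp only: P.generate_eq)
    then show ?thesis by (simp only: b(1) o_apply)
  qed
  show ?thesis
    unfolding cocommutative_def comultiplication_def tensor_flip_def
  proof (intro exI[of _ \<Delta>] exI[of _ \<tau>] conjI allI ballI)
    show "\<Delta> \<in> star_hom A (tensor A A)" "\<tau> \<in> star_hom (tensor A A) (tensor A A)"
      by (rule \<Delta> \<tau>(1))+
    show "\<Delta> (u i j) = (\<Oplus>\<^bsub>tensor A A\<^esub>k\<in>UNIV. elem_tensor A A (u i k) (u k j))" for i j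
      by (rule \<Delta>u)
    show "\<tau> (elem_tensor A A x y) = elem_tensor A A y x" if "x \<in> carrier A" "y \<in> carrier A" for x y
      using that by (rule \<tau>(2))
    show "\<tau> (\<Delta> a) = \<Delta> a" if "a \<in> carrier A" for a
      using that by (rule invariant)
  qed
qed

section \<open>Cocommutative algebras give abelian magic partitions\<close>

text \<open>
  Multiplying \<open>\<Sum>\<^sub>k u\<^sub>i\<^sub>k \<otimes> u\<^sub>k\<^sub>j = \<Sum>\<^sub>k u\<^sub>k\<^sub>j \<otimes> u\<^sub>i\<^sub>k\<close> by \<open>u\<^sub>i\<^sub>l \<otimes> 1\<close> from the left and by
  \<open>u\<^sub>a\<^sub>j \<otimes> 1\<close> from the right leaves one term on each side.
\<close>

lemma cocommutative_relation:
  fixes A :: "'a cstar" and u :: "'n::finite \<Rightarrow> 'n \<Rightarrow> 'a"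
  assumes A: "cstar_algebra A" and u: "magic_unitary A u" and coc: "cocommutative A u"
  shows "elem_tensor A A (u i l \<otimes>\<^bsub>A\<^esub> u a j) (u l j \<ominus>\<^bsub>A\<^esub> u i a) = \<zero>\<^bsub>tensor A A\<^esub>"
proof -
  interpret A: cstar_algebra A by fact
  interpret T: cstar_tensor A A ..
  have ucl: "u i j \<in> carrier A" and idem: "u i j \<otimes>\<^bsub>A\<^esub> u i j = u i j"
    and row: "j \<noteq> k \<Longrightarrow> u i j \<otimes>\<^bsub>A\<^esub> u i k = \<zero>\<^bsub>A\<^esub>"
    and col: "i \<noteq> k \<Longrightarrow> u i j \<otimes>\<^bsub>A\<^esub> u k j = \<zero>\<^bsub>A\<^esub>" for i j k
    using u by (auto simp: magic_unitary_def projection_def)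
  obtain \<Delta> \<tau> where \<Delta>: "\<And>i j. \<Delta> (u i j) = (\<Oplus>\<^bsub>tensor A A\<^esub>k\<in>UNIV. elem_tensor A A (u i k) (u k j))"
    and \<tau>: "\<tau> \<in> star_hom (tensor A A) (tensor A A)"
    and \<tau>e: "\<And>x y. x \<in> carrier A \<Longrightarrow> y \<in> carrier A \<Longrightarrow> \<tau> (elem_tensor A A x y) = elem_tensor A A y x"
    and inv: "\<And>a. a \<in> carrier A \<Longrightarrow> \<tau> (\<Delta> a) = \<Delta> a"
    using coc unfolding cocommutative_def comultiplication_def tensor_flip_def by blast
  have flip: "(\<Oplus>\<^bsub>tensor A A\<^esub>k\<in>UNIV. elem_tensor A A (u i k) (u k j))
      = (\<Oplus>\<^bsub>tensor A A\<^esub>k\<in>UNIV. elem_tensor A A (u k j) (u i k))"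
  proof -
    have "(\<Oplus>\<^bsub>tensor A A\<^esub>k\<in>UNIV. elem_tensor A A (u i k) (u k j)) = \<tau> (\<Delta> (u i j))"
      using inv[OF ucl] \<Delta> by simp
    also have "\<dots> = (\<Oplus>\<^bsub>tensor A A\<^esub>k\<in>UNIV. \<tau> (elem_tensor A A (u i k) (u k j)))"
      unfolding \<Delta>
      by (rule star_hom_finsum[OF T.T.star_algebra_axioms T.T.star_algebra_axioms \<tau>]) (auto simp: ucl)
    finally show ?thesis by (simp add: \<tau>e ucl)
  qed
  \<comment> \<open>One computation for both sides of the flipped equation: \<open>m\<close> is the
    index of the surviving term, \<open>l\<close> on one side and \<open>a\<close> on the
    other.\<close>
  have sandwich: "elem_tensor A A (u i l) \<one>\<^bsub>A\<^esub> \<otimes>\<^bsub>tensor A A\<^esub> (\<Oplus>\<^bsub>tensor A A\<^esub>k\<in>UNIV. elem_tensor A A (f k) (g k))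
        \<otimes>\<^bsub>tensor A A\<^esub> elem_tensor A A (u a j) \<one>\<^bsub>A\<^esub>
      = elem_tensor A A (u i l \<otimes>\<^bsub>A\<^esub> u a j) (g m)"
    if f: "\<And>k. f k \<in> carrier A" and g: "\<And>k. g k \<in> carrier A"
      and m: "u i l \<otimes>\<^bsub>A\<^esub> f m \<otimes>\<^bsub>A\<^esub> u a j = u i l \<otimes>\<^bsub>A\<^esub> u a j"
      and other: "\<And>k. k \<noteq> m \<Longrightarrow> u i l \<otimes>\<^bsub>A\<^esub> f k \<otimes>\<^bsub>A\<^esub> u a j = \<zero>\<^bsub>A\<^esub>"
    for f g :: "'n \<Rightarrow> 'a" and m
  proof -
    let ?x = "elem_tensor A A (u i l) \<one>\<^bsub>A\<^esub>" and ?y = "elem_tensor A A (u a j) \<one>\<^bsub>A\<^esub>"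
    have xy: "?x \<in> carrier (tensor A A)" "?y \<in> carrier (tensor A A)" by (simp_all add: ucl)
    have fg: "(\<lambda>k. elem_tensor A A (f k) (g k)) \<in> UNIV \<rightarrow> carrier (tensor A A)"
      using f g by simp
    have distr: "?x \<otimes>\<^bsub>tensor A A\<^esub> (\<Oplus>\<^bsub>tensor A A\<^esub>k\<in>UNIV. elem_tensor A A (f k) (g k))
        = (\<Oplus>\<^bsub>tensor A A\<^esub>k\<in>UNIV. ?x \<otimes>\<^bsub>tensor A A\<^esub> elem_tensor A A (f k) (g k))"
      by (rule T.T.finsum_rdistr[OF _ xy(1) fg]) simp
    have "?x \<otimes>\<^bsub>tensor A A\<^esub> (\<Oplus>\<^bsub>tensor A A\<^esub>k\<in>UNIV. elem_tensor A A (f k) (g k)) \<otimes>\<^bsub>tensor A A\<^esub> ?y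
        = (\<Oplus>\<^bsub>tensor A A\<^esub>k\<in>UNIV. ?x \<otimes>\<^bsub>tensor A A\<^esub> elem_tensor A A (f k) (g k) \<otimes>\<^bsub>tensor A A\<^esub> ?y)"
      unfolding distr by (rule T.T.finsum_ldistr[OF _ xy(2)]) (simp_all add: Pi_iff ucl f g)
    also have "\<dots> = (\<Oplus>\<^bsub>tensor A A\<^esub>k\<in>UNIV.
        if m = k then elem_tensor A A (u i l \<otimes>\<^bsub>A\<^esub> u a j) (g k) else \<zero>\<^bsub>tensor A A\<^esub>)"
    proof (rule T.T.finsum_cong')
      fix k
      have 1: "?x \<otimes>\<^bsub>tensor A A\<^esub> elem_tensor A A (f k) (g k) = elem_tensor A A (u i l \<otimes>\<^bsub>A\<^esub> f k) (g k)"
        using T.elem_tensor_simps(5)[OF ucl A.one_closed f g] by (simp only: A.l_one[OF g])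
      have 2: "elem_tensor A A (u i l \<otimes>\<^bsub>A\<^esub> f k) (g k) \<otimes>\<^bsub>tensor A A\<^esub> ?y
          = elem_tensor A A (u i l \<otimes>\<^bsub>A\<^esub> f k \<otimes>\<^bsub>A\<^esub> u a j) (g k)"
        using T.elem_tensor_simps(5)[OF A.m_closed[OF ucl f] g ucl A.one_closed] by (simp only: A.r_one[OF g])
      note expand = trans[OF arg_cong[OF 1, of "\<lambda>z. z \<otimes>\<^bsub>tensor A A\<^esub> ?y"] 2]
      show "?x \<otimes>\<^bsub>tensor A A\<^esub> elem_tensor A A (f k) (g k) \<otimes>\<^bsub>tensor A A\<^esub> ?y
          = (if m = k then elem_tensor A A (u i l \<otimes>\<^bsub>A\<^esub> u a j) (g k) else \<zero>\<^bsub>tensor A A\<^esub>)"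
      proof (cases "m = k")
        case True
        then show ?thesis unfolding expand using m by (simp only: simp_thms if_True)
      next
        case False
        then have "u i l \<otimes>\<^bsub>A\<^esub> f k \<otimes>\<^bsub>A\<^esub> u a j = \<zero>\<^bsub>A\<^esub>" by (intro other) simp
        then show ?thesis
          unfolding expand using False T.elem_tensor_zero_left[OF g] by (simp only: if_False)
      qed
    qed (simp_all add: ucl g)
    also have "\<dots> = elem_tensor A A (u i l \<otimes>\<^bsub>A\<^esub> u a j) (g m)"
      by (rule T.T.finsum_singleton) (simp_all add: ucl g)
    finally show ?thesis .
  qed
  have "elem_tensor A A (u i l \<otimes>\<^bsub>A\<^esub> u a j) (u l j) = elem_tensor A A (u i l \<otimes>\<^bsub>A\<^esub> u a j) (u i a)"
  proof -
    have "u i l \<otimes>\<^bsub>A\<^esub> u a j \<otimes>\<^bsub>A\<^esub> u a j = u i l \<otimes>\<^bsub>A\<^esub> u a j"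
      by (simp add: A.m_assoc ucl idem)
    \<comment> \<open>For the flipped sum, orthogonality in column \<open>j\<close> against the
      right factor leaves only \<open>k = a\<close>; for the other sum, orthogonality in row
      \<open>i\<close> against the left factor leaves only \<open>k = l\<close>.\<close>
    moreover have "u i l \<otimes>\<^bsub>A\<^esub> u k j \<otimes>\<^bsub>A\<^esub> u a j = \<zero>\<^bsub>A\<^esub>" if "k \<noteq> a" for k
      using that by (simp add: A.m_assoc ucl col)
    ultimately have right: "elem_tensor A A (u i l) \<one>\<^bsub>A\<^esub> \<otimes>\<^bsub>tensor A A\<^esub>
        (\<Oplus>\<^bsub>tensor A A\<^esub>k\<in>UNIV. elem_tensor A A (u k j) (u i k)) \<otimes>\<^bsub>tensor A A\<^esub> elem_tensor A A (u a j) \<one>\<^bsub>A\<^esub>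
      = elem_tensor A A (u i l \<otimes>\<^bsub>A\<^esub> u a j) (u i a)"
      by (intro sandwich ucl)
    have "u i l \<otimes>\<^bsub>A\<^esub> u i l \<otimes>\<^bsub>A\<^esub> u a j = u i l \<otimes>\<^bsub>A\<^esub> u a j"
      by (simp add: idem)
    moreover have "u i l \<otimes>\<^bsub>A\<^esub> u i k \<otimes>\<^bsub>A\<^esub> u a j = \<zero>\<^bsub>A\<^esub>" if "k \<noteq> l" for k
      using that by (simp add: ucl row)
    ultimately have left: "elem_tensor A A (u i l) \<one>\<^bsub>A\<^esub> \<otimes>\<^bsub>tensor A A\<^esub>
        (\<Oplus>\<^bsub>tensor A A\<^esub>k\<in>UNIV. elem_tensor A A (u i k) (u k j)) \<otimes>\<^bsub>tensor A A\<^esub> elem_tensor A A (u a j) \<one>\<^bsub>A\<^esub>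
      = elem_tensor A A (u i l \<otimes>\<^bsub>A\<^esub> u a j) (u l j)"
      by (intro sandwich ucl)
    show ?thesis by (rule trans[OF left[unfolded flip, symmetric] right])
  qed
  then have eq: "elem_tensor A A (u i l \<otimes>\<^bsub>A\<^esub> u a j) (u l j) \<ominus>\<^bsub>tensor A A\<^esub> elem_tensor A A (u i l \<otimes>\<^bsub>A\<^esub> u a j) (u i a)
      = \<zero>\<^bsub>tensor A A\<^esub>"
    by (simp add: T.T.minus_eq_zero_iff ucl)
  have cl: "u i l \<otimes>\<^bsub>A\<^esub> u a j \<in> carrier A" by (simp add: ucl)
  have "elem_tensor A A (u i l \<otimes>\<^bsub>A\<^esub> u a j) (u l j \<ominus>\<^bsub>A\<^esub> u i a)
      = elem_tensor A A (u i l \<otimes>\<^bsub>A\<^esub> u a j) (u l j \<oplus>\<^bsub>A\<^esub> (-1) \<odot>\<^bsub>A\<^esub> u i a)"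
    by (simp only: A.minus_eq A.smult_minus_one[OF ucl])
  also have "\<dots> = elem_tensor A A (u i l \<otimes>\<^bsub>A\<^esub> u a j) (u l j)
      \<oplus>\<^bsub>tensor A A\<^esub> (-1) \<odot>\<^bsub>tensor A A\<^esub> elem_tensor A A (u i l \<otimes>\<^bsub>A\<^esub> u a j) (u i a)"
    by (simp only: T.elem_tensor_simps(2)[OF cl ucl A.smult_closed[OF ucl]] T.elem_tensor_simps(4)[OF cl ucl])
  also have "\<dots> = \<zero>\<^bsub>tensor A A\<^esub>"
    unfolding T.T.smult_minus_one[OF T.elem_tensor_closed[OF cl ucl]] using eq by (simp only: T.T.minus_eq)
  finally show ?thesis .
qed

lemma cocommutative_abelian_magic_partition:
  fixes X :: "'n::finite \<Rightarrow> 'n \<Rightarrow> 'h::chilbert_space set" and A :: "'a cstar" and u :: "'n \<Rightarrow> 'n \<Rightarrow> 'a"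
  assumes X: "magic_decomposition X" and nz: "\<And>i j. X i j \<noteq> {0}"
    and assoc: "associated_algebra X A u" and coc: "cocommutative A u"
  shows "\<exists>(N :: nat) (Y :: nat \<Rightarrow> 'h set) (E :: 'n \<Rightarrow> 'n \<Rightarrow> nat set).
    orthogonal_decomposition {1..N} Y \<and> abelian_magic_partition N E \<and>
    (\<forall>i j. X i j = sum_subspaces (E i j) Y)"
proof -
  interpret R: decomposition UNIV "X i" for i by (rule magic_decompositionD(1)[OF X])
  interpret C: decomposition UNIV "\<lambda>i. X i j" for j by (rule magic_decompositionD(2)[OF X])
  define P where "P i j = orth_proj (X i j)" for i j
  obtain \<pi> where \<pi>: "\<And>i j. \<pi> (A\<^sub>s_gen i j) = P i j" and hopf: "hopf_image \<pi> A u"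
    using assoc unfolding associated_algebra_def P_def by blast
  have Aq: "quantum_permutation_algebra A u" using hopf by (simp add: hopf_image_def)
  interpret A: cstar_algebra A using Aq by (simp add: quantum_permutation_algebra_def)
  have magic: "magic_unitary A u" using Aq by (simp add: quantum_permutation_algebra_def)
  then have ucl: "u i j \<in> carrier A" for i j by (auto simp: magic_unitary_def projection_def)
  obtain \<phi> \<psi> where "\<And>i j. \<phi> (A\<^sub>s_gen i j) = u i j" and \<psi>: "\<psi> \<in> star_hom A bounded_operators"
    and "\<And>x. x \<in> carrier A\<^sub>s \<Longrightarrow> \<psi> (\<phi> x) = \<pi> x"
    using hopf unfolding hopf_image_def realizes_factorization_def by blast
  moreover have "A\<^sub>s_gen i j \<in> carrier A\<^sub>s" for i j :: 'n
    unfolding A\<^sub>s_eq A\<^sub>s_gen_eq by (rule M.universal_gen_closed) simp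
  ultimately have \<psi>u: "\<psi> (u i j) = P i j" for i j using \<pi> by metis
  interpret T: cstar_tensor A A ..
  \<comment> \<open>The tensor relation in operator form: \<psi> is used on both legs, so an
    elementary tensor can vanish only if one of its two images does.\<close>
  have key: "P i l \<circ> P a j = (\<lambda>_. 0) \<or> P l j = P i a" for i j l a
  proof -
    have "\<psi> (u i l \<otimes>\<^bsub>A\<^esub> u a j) = (\<lambda>_. 0) \<or> \<psi> (u l j \<ominus>\<^bsub>A\<^esub> u i a) = (\<lambda>_. 0)"
      by (rule T.elem_tensor_eq_zero[OF \<psi> \<psi> _ _ cocommutative_relation[OF A.cstar_algebra_axioms magic coc]])
         (simp_all add: ucl)
    moreover have "\<psi> (u i l \<otimes>\<^bsub>A\<^esub> u a j) = P i l \<circ> P a j"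
      using star_homD(2)[OF \<psi> ucl ucl] by (simp add: \<psi>u)
    moreover have "P l j = P i a" if "\<psi> (u l j \<ominus>\<^bsub>A\<^esub> u i a) = (\<lambda>_. 0)"
    proof -
      interpret BO: star_algebra "bounded_operators :: ('h \<Rightarrow> 'h) cstar"
        by (rule bounded_operators_star_algebra)
      have "\<psi> (u l j) \<ominus>\<^bsub>bounded_operators\<^esub> \<psi> (u i a) = \<zero>\<^bsub>bounded_operators\<^esub>"
        using star_hom_diff[OF A.star_algebra_axioms BO.star_algebra_axioms \<psi> ucl ucl] that by simp
      then show ?thesis
        using BO.minus_eq_zero_iff star_homD(1)[OF \<psi> ucl] by (simp only: \<psi>u)
    qed
    ultimately show ?thesis by auto
  qed
  have P_mem: "P i j x \<in> X i j" and P_fix: "x \<in> X i j \<Longrightarrow> P i j x = x"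
    and row_sum: "(\<Sum>j\<in>UNIV. P i j x) = x" and col_sum: "(\<Sum>i\<in>UNIV. P i j x) = x"
    and row: "j \<noteq> k \<Longrightarrow> P i j (P i k x) = 0" and col: "i \<noteq> k \<Longrightarrow> P i j (P k j x) = 0" for i j k x
    unfolding P_def
    using R.orth_proj_mem R.orth_proj_fix R.sum_orth_proj C.sum_orth_proj R.orth_proj_other C.orth_proj_other
      C.orth_proj_mem by auto
  have P_zero: "P i j 0 = 0" for i j
    using P_fix[of 0 i j] R.subspace by (simp add: closed_csubspace_def)
  have P_sum: "P i j (\<Sum>k\<in>K. f k) = (\<Sum>k\<in>K. P i j (f k))" for i j K and f :: "'n \<Rightarrow> 'h"
    using R.orth_proj_operator[of j i] linear_sum[of "P i j" f K]
    by (simp add: carrier_bounded_operators P_def bounded_linear.linear)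
  have nonzero: "\<exists>x. P i j x \<noteq> 0" for i j
  proof -
    have "0 \<in> X i j" using R.subspace by (simp add: closed_csubspace_def)
    then obtain x where "x \<in> X i j" "x \<noteq> 0" using nz[of i j] by blast
    then show ?thesis using P_fix by metis
  qed
  \<comment> \<open>Two entries of one row are orthogonal; equal ones would be orthogonal to
    themselves and thus zero, which non-degeneracy excludes.\<close>
  have P_eq_row: "j = k" if "P i j = P i k" for i j k
    using nonzero[of i j] row[of j k i] P_fix[OF P_mem, of i j] that by (metis (no_types))
  have P_eq_col: "i = k" if "P i j = P k j" for i j k
    using nonzero[of i j] col[of i k j] P_fix[OF P_mem, of i j] that by (metis (no_types))
  have equal: "P i l = P a j" if "P i l \<circ> P a j \<noteq> (\<lambda>_. 0)" for i l a j
  proof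
    fix x
    have eq: "P l j = P i a" using key that by blast
    \<comment> \<open>Otherwise \<open>key\<close> gives \<open>P l j = P i b\<close>, and with
      \<open>eq\<close> row \<open>i\<close> would contain the same projection twice. So in the sum
      over column \<open>j\<close> only \<open>a\<close> contributes to
      \<open>P i l x\<close>.\<close>
    have "P i l (P b j y) = 0" if "b \<noteq> a" for b y
      using key[of i l b j] P_eq_row[of i a b] eq that by (metis comp_apply)
    then have "P i l x = P i l (P a j x)"
      using P_sum[of i l "\<lambda>b. P b j x" UNIV] col_sum[of j x] sum.remove[of UNIV a "\<lambda>b. P i l (P b j x)"] by simp
    \<comment> \<open>The same argument in the other factor: a nonzero product would give
      \<open>P k j = P l j\<close>, a repetition in column \<open>j\<close>. Hence
      \<open>P i l\<close> fixes the range of \<open>P a j\<close>.\<close>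
    also have "P i k (P a j y) = 0" if "k \<noteq> l" for k y
      using key[of i k a j] P_eq_col[of k j l] eq that by (metis comp_apply)
    then have "P i l (P a j x) = P a j x"
      using row_sum[of i "P a j x"] sum.remove[of UNIV l "\<lambda>k. P i k (P a j x)"] by simp
    finally show "P i l x = P a j x" .
  qed
  \<comment> \<open>The projections of one column sum to the identity, so some product with
    \<open>P i l\<close> is nonzero, and \<open>equal\<close> applies. With the analogue for rows
    this makes the matrix a Latin square.\<close>
  have exists_col: "\<exists>a. P i l = P a j" for i l j
  proof -
    obtain x where x: "P i l x \<noteq> 0" using nonzero by blast
    have "(\<Sum>a\<in>UNIV. P i l (P a j x)) = P i l x" by (simp add: col_sum flip: P_sum)
    then obtain a where "P i l (P a j x) \<noteq> 0" using x by (metis sum.neutral)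
    then show ?thesis using equal[of i l a j] by (metis comp_apply)
  qed
  have exists_row: "\<exists>j. P i l = P a j" for i l a
  proof -
    obtain x where x: "P i l x \<noteq> 0" using nonzero by blast
    have "(\<Sum>j\<in>UNIV. P i l (P a j x)) = P i l x" by (simp add: row_sum flip: P_sum)
    then obtain j where "P i l (P a j x) \<noteq> 0" using x by (metis sum.neutral)
    then show ?thesis using equal[of i l a j] by (metis comp_apply)
  qed
  \<comment> \<open>If the two projections coincide, their product is that same nonzero projection,
    so \<open>key\<close> leaves its second alternative.\<close>
  have swap: "P l j = P i a" if "P i l = P a j" for i j l a
  proof -
    obtain x where "P i l x \<noteq> 0" using nonzero by blast
    moreover have "(P i l \<circ> P a j) x = P i l x"
      unfolding comp_apply that[symmetric] by (rule P_fix[OF P_mem])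
    ultimately have "(P i l \<circ> P a j) x \<noteq> 0" by (simp only: not_False_eq_True)
    then have "P i l \<circ> P a j \<noteq> (\<lambda>_. 0)" by (metis (no_types))
    then show ?thesis using key by blast
  qed
  \<comment> \<open>Any row can serve as the list of symbols, since each projection of the matrix
    occurs in it exactly once.\<close>
  define r :: 'n where "r = undefined"
  define N where "N = CARD('n)"
  obtain f where f: "bij_betw f {1..N} (UNIV :: 'n set)"
    using ex_bij_betw_nat_finite_1[of "UNIV :: 'n set"] unfolding N_def by auto
  define Y where "Y k = X r (f k)" for k
  define E where "E i j = {k \<in> {1..N}. P r (f k) = P i j}" for i j
  have Y: "orthogonal_decomposition {1..N} Y"
    unfolding orthogonal_decomposition_def orthogonal_family_def
  proof (intro conjI ballI impI)
    fix k l x y assume kl: "k \<in> {1..N}" "l \<in> {1..N}" "k \<noteq> l" "x \<in> Y k" "y \<in> Y l"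
    then have "f k \<noteq> f l" using inj_onD[OF bij_betw_imp_inj_on[OF f], of k l] by blast
    then show "cinner x y = 0" using R.orthogonal[of "f k" "f l" x r y] kl by (simp add: Y_def)
  next
    show "closed_csubspace (Y k)" for k unfolding Y_def by (rule R.subspace) simp
    have "h \<in> sum_subspaces {1..N} Y" for h
    proof -
      have "h = (\<Sum>k\<in>{1..N}. P r (f k) h)"
        using sum.reindex_bij_betw[OF f, of "\<lambda>j. P r j h"] row_sum[of r h] by simp
      then show ?thesis
        unfolding sum_subspaces_def using P_mem by (auto simp: Y_def)
    qed
    then show "sum_subspaces {1..N} Y = UNIV" by blast
  qed
  have f_ex: "\<exists>k\<in>{1..N}. P r (f k) = P i j" for i j
  proof -
    obtain m where "P i j = P r m" using exists_row by blast
    moreover obtain k where "k \<in> {1..N}" "f k = m" using f by (metis UNIV_I bij_betw_def image_iff)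
    ultimately show ?thesis by metis
  qed
  have mp: "magic_partition N E"
    unfolding magic_partition_def set_partition_def disjoint_family_on_def
  proof (intro conjI allI ballI impI)
    fix i j k :: 'n assume "j \<noteq> k"
    then show "E i j \<inter> E i k = {}" using P_eq_row[of i j k] by (auto simp: E_def)
  next
    fix i :: 'n show "(\<Union>j. E i j) = {1..N}" unfolding E_def using exists_row by blast
  next
    fix j i k :: 'n assume "i \<noteq> k"
    then show "E i j \<inter> E k j = {}" using P_eq_col[of i j k] by (auto simp: E_def)
  next
    fix j :: 'n show "(\<Union>i. E i j) = {1..N}" unfolding E_def using exists_col by blast
  qed
  let ?\<sigma> = "partition_perm E"
  have \<sigma>: "?\<sigma> k j = i \<longleftrightarrow> P r (f k) = P i j" if "k \<in> {1..N}" for k i j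
    using partition_perm_eq_iff[OF mp that] that by (simp add: E_def)
  have \<sigma>_comm: "?\<sigma> k \<circ> ?\<sigma> m = ?\<sigma> m \<circ> ?\<sigma> k" if k: "k \<in> {1..N}" and m: "m \<in> {1..N}" for k m
  proof
    fix j
    \<comment> \<open>The permutation of \<open>m\<close> sends j to l, that of \<open>k\<close>
      sends l to i and j to a. So \<open>P i l\<close> and \<open>P a j\<close> are both the symbol
      of \<open>k\<close>, and \<open>swap\<close> makes \<open>P i a\<close> equal to
      \<open>P l j\<close>, the symbol of \<open>m\<close>: the permutation of \<open>m\<close>
      sends a to i.\<close>
    define l where "l = ?\<sigma> m j"
    define i where "i = ?\<sigma> k l"
    define a where "a = ?\<sigma> k j"
    have "P r (f m) = P l j" "P r (f k) = P i l" "P r (f k) = P a j"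
      using \<sigma>[OF m, of j l] \<sigma>[OF k, of l i] \<sigma>[OF k, of j a] by (simp_all add: l_def i_def a_def)
    then have "P r (f m) = P i a" using swap[of i l a j] by simp
    then have "?\<sigma> m a = i" using \<sigma>[OF m] by simp
    then show "(?\<sigma> k \<circ> ?\<sigma> m) j = (?\<sigma> m \<circ> ?\<sigma> k) j" by (simp add: a_def i_def l_def)
  qed
  have "abelian_magic_partition N E"
    unfolding abelian_magic_partition_def
  proof
    interpret Sym: group "BijGroup (UNIV :: 'n set)" by (rule group_BijGroup)
    let ?H = "carrier (BijGroup UNIV) \<inter> ?\<sigma> ` {1..N}"
    have PG: "partition_group N E = subgroup_generated (BijGroup UNIV) (?\<sigma> ` {1..N})"
      by (simp add: partition_group_def)
    show "comm_group (partition_group N E)"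
      unfolding PG
    proof (rule group.group_comm_groupI)
      show "group (subgroup_generated (BijGroup UNIV) (?\<sigma> ` {1..N}))" by simp
      fix x y assume "x \<in> carrier (subgroup_generated (BijGroup UNIV) (?\<sigma> ` {1..N}))"
        "y \<in> carrier (subgroup_generated (BijGroup UNIV) (?\<sigma> ` {1..N}))"
      then have "x \<in> generate (BijGroup UNIV) ?H" "y \<in> generate (BijGroup UNIV) ?H"
        by (simp_all add: carrier_subgroup_generated)
      then have "x \<otimes>\<^bsub>BijGroup UNIV\<^esub> y = y \<otimes>\<^bsub>BijGroup UNIV\<^esub> x"
      proof (rule Sym.generate_commute[rotated 2])
        fix g h assume "g \<in> ?H" "h \<in> ?H"
        then obtain k m where "g = ?\<sigma> k" "h = ?\<sigma> m" "k \<in> {1..N}" "m \<in> {1..N}" by blast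
        then show "g \<otimes>\<^bsub>BijGroup UNIV\<^esub> h = h \<otimes>\<^bsub>BijGroup UNIV\<^esub> g"
          using \<sigma>_comm[of k m] bij_partition_perm[OF mp] by (simp only: mult_BijGroup_UNIV)
      qed simp
      then show "x \<otimes>\<^bsub>subgroup_generated (BijGroup UNIV) (?\<sigma> ` {1..N})\<^esub> y
          = y \<otimes>\<^bsub>subgroup_generated (BijGroup UNIV) (?\<sigma> ` {1..N})\<^esub> x" by simp
    qed
  qed (rule mp)
  moreover have "X i j = sum_subspaces (E i j) Y" for i j
  proof -
    obtain k where k: "k \<in> {1..N}" "P r (f k) = P i j" using f_ex by blast
    have unique: "l = k" if "l \<in> {1..N}" "P r (f l) = P i j" for l
    proof -
      have "f l = f k" using P_eq_row[of r "f l" "f k"] that k by simp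
      then show ?thesis by (rule inj_onD[OF bij_betw_imp_inj_on[OF f] _ that(1) k(1)])
    qed
    have "E i j = {k}" unfolding E_def using k unique by blast
    moreover have "X i j = Y k"
    proof -
      \<comment> \<open>A subspace is the fixed point set of its projection, so equal projections
        belong to equal subspaces.\<close>
      have range: "X i' j' = {x. P i' j' x = x}" for i' j'
      proof (intro equalityI subsetI CollectI)
        show "x \<in> X i' j'" if "x \<in> {x. P i' j' x = x}" for x
          using P_mem[of i' j' x] that by simp
      qed (rule P_fix)
      show ?thesis unfolding Y_def range k(2) ..
    qed
    ultimately show ?thesis by simp
  qed
  ultimately show ?thesis using Y by (intro exI[of _ N] exI[of _ Y] exI[of _ E]) simp
qed

theorem theorem3p4:
  fixes X :: "'n::finite \<Rightarrow> 'n \<Rightarrow> 'h::chilbert_space set"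
    and A :: "'a cstar" and u :: "'n \<Rightarrow> 'n \<Rightarrow> 'a"
  assumes "magic_decomposition X"
    and "\<forall>i j. X i j \<noteq> {0}"
    and "associated_algebra X A u"
  shows "cocommutative A u \<longleftrightarrow>
    (\<exists>(N :: nat) (Y :: nat \<Rightarrow> 'h set) (E :: 'n \<Rightarrow> 'n \<Rightarrow> nat set).
       orthogonal_decomposition {1..N} Y \<and> abelian_magic_partition N E \<and>
       (\<forall>i j. X i j = sum_subspaces (E i j) Y))"
proof
  assume "cocommutative A u"
  with assms show "\<exists>(N :: nat) (Y :: nat \<Rightarrow> 'h set) (E :: 'n \<Rightarrow> 'n \<Rightarrow> nat set).
       orthogonal_decomposition {1..N} Y \<and> abelian_magic_partition N E \<and>
       (\<forall>i j. X i j = sum_subspaces (E i j) Y)"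
    by (intro cocommutative_abelian_magic_partition) auto
next
  assume "\<exists>(N :: nat) (Y :: nat \<Rightarrow> 'h set) (E :: 'n \<Rightarrow> 'n \<Rightarrow> nat set).
       orthogonal_decomposition {1..N} Y \<and> abelian_magic_partition N E \<and>
       (\<forall>i j. X i j = sum_subspaces (E i j) Y)"
  with assms(3) show "cocommutative A u"
    using abelian_magic_partition_cocommutative by blast
qed

end
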